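(* If $\mathcal{K}$ is a quasiminimal class, then $\mathcal{K}$ is a FUR-class.
   Context: QUASIMINIMAL CLASSES. Let $L$ be a countable language; $\mathrm{tp}$ denotes quantifier-free type. An $L$-structure $M$ with a pregeometry $\mathrm{cl}$ is a quasiminimal pregeometry structure if: (QM1) if $a,a'$ are singletons and $\mathrm{tp}(a,b)=\mathrm{tp}(a',b')$, then $a\in\mathrm{cl}(b)$ iff $a'\in\mathrm{cl}(b')$; (QM2) $M$ is infinite-dimensional with respect to $\mathrm{cl}$; (QM3) $\mathrm{cl}(A)$ is countable for finite $A\subseteq M$; (QM4) if $H,H'\subseteq M$ are countable closed sets enumerated so that $\mathrm{tp}(H)=\mathrm{tp}(H')$ and $a\in M\setminus H$, $a'\in M\setminus H'$ are singletons, then $\mathrm{tp}(H,a)=\mathrm{tp}(H',a')$ (same enumerations); (QM5) if $H,H'\subseteq M$ are countable closed sets or empty, enumerated so that $\mathrm{tp}(H)=\mathrm{tp}(H')$, $b,b'$ are finite tuples from $M$ with $\mathrm{tp}(H,b)=\mathrm{tp}(H',b')$ and $a\in\mathrm{cl}(H,b)$ is a singleton, then there is a singleton $a'\in M$ with $\mathrm{tp}(H,b,a)=\mathrm{tp}(H',b',a')$. Weakly quasiminimal: all of these except possibly (QM2). A closed embedding $\theta:M_1\to M_2$ of weakly quasiminimal pregeometry structures is an isomorphism onto a substructure that is $\mathrm{cl}_{M_2}$-closed, with $\mathrm{cl}_{M_1}$ the restriction of $\mathrm{cl}_{M_2}$. For a quasiminimal pregeometry structure $M$, $\mathcal{K}^-(M)$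 is the smallest class of $L$-structures containing $M$ and all its closed substructures and closed under isomorphisms; $\mathcal{K}(M)$ is the smallest class containing $\mathcal{K}^-(M)$ and closed also under unions of chains of closed embeddings. A quasiminimal class is $\mathcal{K}=\mathcal{K}(M)$ for some quasiminimal pregeometry structure $M$, with all finite-dimensional structures discarded, and $\mathcal{A}\preccurlyeq\mathcal{B}$ iff $\mathcal{A}$ is a closed submodel of $\mathcal{B}$. It is known that $(\mathcal{K},\preccurlyeq)$ is an abstract elementary class (AEC) with $LS(\mathcal{K})=\omega$. SETTING FOR FUR-CLASSES. $(\mathcal{K},\preccurlyeq)$ is an AEC with monster model $\mathbb{M}$: a $\delta$-model homogeneous and $\delta$-universal member of $\mathcal{K}$, $\delta$ a large cardinal. "Model" means $\mathcal{A}\in\mathcal{K}$, $\mathcal{A}\preccurlyeq\mathbb{M}$; models and parameter sets have size $<\delta$. $a\in X$ may be a finite tuple; juxtaposition denotes union or concatenation. TYPES. $\mathrm{Aut}(\mathbb{M}/A)$ is the group of automorphisms of $\mathbb{M}$ fixing $A$ pointwise. $a,b$ have the same Galois type over $A$, $t^g(a/A)=t^g(b/A)$, if $f(a)=b$ for some $f\in\mathrm{Aut}(\mathbb{M}/A)$; they have the same weak type, $t(a/A)=t(b/A)$, if $t^g(a/B)=t^g(b/B)$ for all finite $B\subseteq A$ (types of models are types of enumerations). For $A\subseteq B$ with $A$ finite, $t(a/B)$ splits over $A$ if there are $b,c\in B$ with $t(b/A)=t(c/A)$ but $t(ab/A)\ne t(ac/A)$. $a\downarrow^{ns}_B C$ means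 that $t(a/B\cup C)$ does not split over some finite $A\subseteq B$; $A\downarrow^{ns}_B C$ means $a\downarrow^{ns}_BC$ for each $a\in A$. FUR-CLASS. $\mathcal{K}$ is a FUR-class if it has AP and JEP, $LS(\mathcal{K})=\omega$, has arbitrarily large structures, contains no finite models, and satisfies: (AI) Every countable model $\mathcal{A}$ is s-saturated: for any $b\in\mathbb{M}$ and finite $A\subseteq\mathcal{A}$ there is $a\in\mathcal{A}$ with $t(a/A)=t(b/A)$. (AII) For all $a$ and countable $\mathcal{A}$ there is an s-primary model $\mathcal{B}=\mathcal{A}a\cup\bigcup_{i<\omega}a_i$ over $\mathcal{A}a$. [s-primary: the $a_i$ are singletons and for all $n<\omega$ there is a finite $A_n\subset\mathcal{A}$ such that for all $(a',a_0',\dots,a_n')$ with $t(a'/\mathcal{A})=t(a/\mathcal{A})$: $t(a',a_0',\dots,a_n'/A_n)=t(a,a_0,\dots,a_n/A_n)$ implies $t(a',a_0',\dots,a_n'/\mathcal{A})=t(a,a_0,\dots,a_n/\mathcal{A})$.] (AIII) Let $\mathcal{A},\mathcal{B},\mathcal{C}$ be models with $\mathcal{A}\downarrow^{ns}_{\mathcal{B}}\mathcal{C}$ and $\mathcal{B}=\mathcal{A}\cap\mathcal{C}$. Then there is a unique (not only up to isomorphism) s-prime model $\mathcal{D}$ over $\mathcal{A}\cup\mathcal{C}$; furthermore, if $\mathcal{C}\subseteq\mathcal{C}'$ and $\mathcal{A}\downarrow^{ns}_{\mathcal{B}}\mathcal{C}'$, then $\mathcal{D}\downarrow^{ns}_{\mathcal{C}}\mathcal{C}'$.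 [For models $\mathcal{A}_i$, $i<\alpha$, and $A=\bigcup_{i<\alpha}\mathcal{A}_i$, a map $f:A\to\mathbb{M}$ is weakly elementary w.r.t. $(\mathcal{A}_i)_{i<\alpha}$ if $t(a/\emptyset)=t(f(a)/\emptyset)$ for all $a\in A$ and $f(\mathcal{A}_i)\preccurlyeq\mathbb{M}$ for all $i$. A model $\mathcal{D}$ is s-prime over $A$ if for every model $\mathcal{B}$ and every $f:A\to\mathcal{B}$ weakly elementary w.r.t. $(\mathcal{A}_i)_{i<\alpha}$ there is an elementary embedding $g:\mathcal{D}\to\mathcal{B}$ with $f\subseteq g$.] (AIV) For each $a\in\mathbb{M}$ there is $n<\omega$ such that for every countable model $\mathcal{A}$ and finite $A\subset\mathcal{A}$, player II has a winning strategy in $GI(a,A,\mathcal{A})$ in $n$ moves. [$GI(a,A,\mathcal{A})$: start with $a_0=a$, $A_0=A$. At move $n$, player I chooses $a_{n+1}\in\mathbb{M}$ and a finite $A_{n+1}'\subseteq\mathcal{A}$ with $t(a_{n+1}/A_n)=t(a_n/A_n)$, $A_n\subseteq A'_{n+1}$ and $t(a_{n+1}/A'_{n+1})\ne t(a_n/A'_{n+1})$; then player II chooses a finite $A_{n+1}\subseteq\mathcal{A}$ with $A'_{n+1}\subseteq A_{n+1}$. Player II wins if player I can no longer move.] (AV) If $\mathcal{A}\subseteq\mathcal{B}$ are countable models, $a\in\mathbb{M}$ and $\mathcal{B}\downarrow^{ns}_{\mathcal{A}}a$, then $a\downarrow^{ns}_{\mathcal{A}}\mathcal{B}$. (AVI)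 For all models $\mathcal{A},\mathcal{B},\mathcal{D}$ with $\mathcal{A}\subseteq\mathcal{B}\cap\mathcal{D}$ there is a model $\mathcal{C}$ with $t(\mathcal{C}/\mathcal{A})=t(\mathcal{B}/\mathcal{A})$ and $\mathcal{C}\downarrow^{ns}_{\mathcal{A}}\mathcal{D}$. *)

theory Defs
  imports Main "HOL-Library.Countable_Set"
begin

unbundle cardinal_syntax

section \<open>Languages and structures\<close>

text \<open>Constants are function symbols of arity 0.\<close>

record ('f, 'r) lang =
  funs :: "'f set"
  rels :: "'r set"
  far :: "'f \<Rightarrow> nat"
  rar :: "'r \<Rightarrow> nat"

definition countable_lang :: "('f, 'r) lang \<Rightarrow> bool" where
  "countable_lang L \<longleftrightarrow> countable (funs L) \<and> countable (rels L)"

record ('f, 'r, 'a) struct =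
  univ :: "'a set"
  fn :: "'f \<Rightarrow> 'a list \<Rightarrow> 'a"
  rel :: "'r \<Rightarrow> 'a list \<Rightarrow> bool"

text \<open>Interpretations take a fixed dummy value on ill-formed arguments, so that two
  structures are equal in HOL iff they are equal as \<open>L\<close>-structures. The empty structure is
  allowed (it can occur as the closure of the empty set).\<close>

definition is_struct :: "('f, 'r) lang \<Rightarrow> ('f, 'r, 'a) struct \<Rightarrow> bool" where
  "is_struct L M \<longleftrightarrow>
     (\<forall>f xs. if f \<in> funs L \<and> length xs = far L f \<and> set xs \<subseteq> univ M
             then fn M f xs \<in> univ M else fn M f xs = undefined) \<and>
     (\<forall>r xs. rel M r xs \<longrightarrow> r \<in> rels L \<and> length xs = rar L r \<and> set xs \<subseteq> univ M)"

definition restr :: "('f, 'r, 'a) struct \<Rightarrow> 'a set \<Rightarrow> ('f, 'r, 'a) struct" where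
  "restr M A =
     \<lparr>univ = A,
      fn = (\<lambda>f xs. if set xs \<subseteq> A then fn M f xs else undefined),
      rel = (\<lambda>r xs. set xs \<subseteq> A \<and> rel M r xs)\<rparr>"

definition substr :: "('f, 'r) lang \<Rightarrow> ('f, 'r, 'a) struct \<Rightarrow> ('f, 'r, 'a) struct \<Rightarrow> bool" where
  "substr L A B \<longleftrightarrow>
     is_struct L A \<and> is_struct L B \<and> univ A \<subseteq> univ B \<and> A = restr B (univ A)"

definition iso ::
  "('f, 'r) lang \<Rightarrow> ('f, 'r, 'a) struct \<Rightarrow> ('f, 'r, 'b) struct \<Rightarrow> ('a \<Rightarrow> 'b) \<Rightarrow> bool" where
  "iso L A B g \<longleftrightarrow>
     is_struct L A \<and> is_struct L B \<and> bij_betw g (univ A) (univ B) \<and>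
     (\<forall>f\<in>funs L. \<forall>xs. length xs = far L f \<and> set xs \<subseteq> univ A \<longrightarrow>
        g (fn A f xs) = fn B f (map g xs)) \<and>
     (\<forall>r\<in>rels L. \<forall>xs. length xs = rar L r \<and> set xs \<subseteq> univ A \<longrightarrow>
        (rel A r xs \<longleftrightarrow> rel B r (map g xs)))"

text \<open>The union of a nonempty set of structures that is totally ordered by \<open>substr\<close>; any member
  containing the arguments may be used to evaluate a function.\<close>

definition chain_union :: "('f, 'r, 'a) struct set \<Rightarrow> ('f, 'r, 'a) struct" where
  "chain_union C =
     \<lparr>univ = (\<Union>A\<in>C. univ A),
      fn = (\<lambda>f xs. if \<exists>A\<in>C. set xs \<subseteq> univ A
                   then fn (SOME A. A \<in> C \<and> set xs \<subseteq> univ A) f xs else undefined),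
      rel = (\<lambda>r xs. \<exists>A\<in>C. rel A r xs)\<rparr>"


section \<open>Quantifier-free types\<close>

datatype ('f, 'v) trm = Var 'v | App 'f "('f, 'v) trm list"

datatype ('f, 'r, 'v) qf =
    Eq "('f, 'v) trm" "('f, 'v) trm"
  | Rel 'r "('f, 'v) trm list"
  | Neg "('f, 'r, 'v) qf"
  | Conj "('f, 'r, 'v) qf" "('f, 'r, 'v) qf"

text \<open>Here \<open>I\<close> is the set of variables that may occur.\<close>

fun wf_trm :: "('f, 'r) lang \<Rightarrow> 'v set \<Rightarrow> ('f, 'v) trm \<Rightarrow> bool" where
  "wf_trm L I (Var x) \<longleftrightarrow> x \<in> I"
| "wf_trm L I (App f ts) \<longleftrightarrow>
     f \<in> funs L \<and> length ts = far L f \<and> (\<forall>t\<in>set ts. wf_trm L I t)"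

fun wf_qf :: "('f, 'r) lang \<Rightarrow> 'v set \<Rightarrow> ('f, 'r, 'v) qf \<Rightarrow> bool" where
  "wf_qf L I (Eq s t) \<longleftrightarrow> wf_trm L I s \<and> wf_trm L I t"
| "wf_qf L I (Rel r ts) \<longleftrightarrow>
     r \<in> rels L \<and> length ts = rar L r \<and> (\<forall>t\<in>set ts. wf_trm L I t)"
| "wf_qf L I (Neg p) \<longleftrightarrow> wf_qf L I p"
| "wf_qf L I (Conj p q) \<longleftrightarrow> wf_qf L I p \<and> wf_qf L I q"

fun val :: "('f, 'r, 'a) struct \<Rightarrow> ('v \<Rightarrow> 'a) \<Rightarrow> ('f, 'v) trm \<Rightarrow> 'a" where
  "val M v (Var x) = v x"
| "val M v (App f ts) = fn M f (map (val M v) ts)"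

fun sat :: "('f, 'r, 'a) struct \<Rightarrow> ('v \<Rightarrow> 'a) \<Rightarrow> ('f, 'r, 'v) qf \<Rightarrow> bool" where
  "sat M v (Eq s t) \<longleftrightarrow> val M v s = val M v t"
| "sat M v (Rel r ts) \<longleftrightarrow> rel M r (map (val M v) ts)"
| "sat M v (Neg p) \<longleftrightarrow> \<not> sat M v p"
| "sat M v (Conj p q) \<longleftrightarrow> sat M v p \<and> sat M v q"

definition qftp ::
  "('f, 'r) lang \<Rightarrow> ('f, 'r, 'a) struct \<Rightarrow> 'v set \<Rightarrow> ('v \<Rightarrow> 'a) \<Rightarrow> ('f, 'r, 'v) qf set" where
  "qftp L M I v = {p. wf_qf L I p \<and> sat M v p}"

definition tp ::
  "('f, 'r) lang \<Rightarrow> ('f, 'r, 'a) struct \<Rightarrow> 'a list \<Rightarrow> ('f, 'r, nat) qf set" where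
  "tp L M a = qftp L M {..<length a} (\<lambda>i. a ! i)"

text \<open>\<open>tp_over L M I h b\<close> is the type tp(H, b) of a countable set H enumerated as
  \<open>(h i)\<close> with \<open>i \<in> I\<close>, followed by a finite tuple b.\<close>

definition tp_over ::
  "('f, 'r) lang \<Rightarrow> ('f, 'r, 'a) struct \<Rightarrow> nat set \<Rightarrow> (nat \<Rightarrow> 'a) \<Rightarrow> 'a list \<Rightarrow>
   ('f, 'r, nat + nat) qf set" where
  "tp_over L M I h b =
     qftp L M (Inl ` I \<union> Inr ` {..<length b}) (case_sum h (\<lambda>i. b ! i))"


section \<open>Quasiminimal pregeometry structures\<close>

text \<open>A closure operator is only meaningful on subsets of the carrier.\<close>

definition pregeometry :: "'a set \<Rightarrow> ('a set \<Rightarrow> 'a set) \<Rightarrow> bool" where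
  "pregeometry X cl \<longleftrightarrow>
     (\<forall>A\<subseteq>X. A \<subseteq> cl A \<and> cl A \<subseteq> X) \<and>
     (\<forall>A B. A \<subseteq> B \<and> B \<subseteq> X \<longrightarrow> cl A \<subseteq> cl B) \<and>
     (\<forall>A\<subseteq>X. cl (cl A) = cl A) \<and>
     (\<forall>A\<subseteq>X. \<forall>a\<in>X. \<forall>b\<in>X. a \<in> cl (insert b A) \<and> a \<notin> cl A \<longrightarrow> b \<in> cl (insert a A)) \<and>
     (\<forall>A\<subseteq>X. \<forall>a\<in>cl A. \<exists>F\<subseteq>A. finite F \<and> a \<in> cl F)"

definition cl_basis :: "'a set \<Rightarrow> ('a set \<Rightarrow> 'a set) \<Rightarrow> 'a set \<Rightarrow> bool" where
  "cl_basis X cl B \<longleftrightarrow> B \<subseteq> X \<and> (\<forall>b\<in>B. b \<notin> cl (B - {b})) \<and> cl B = X"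

definition finite_dim :: "'a set \<Rightarrow> ('a set \<Rightarrow> 'a set) \<Rightarrow> bool" where
  "finite_dim X cl \<longleftrightarrow> (\<exists>B. finite B \<and> cl_basis X cl B)"

definition closed_set :: "'a set \<Rightarrow> ('a set \<Rightarrow> 'a set) \<Rightarrow> 'a set \<Rightarrow> bool" where
  "closed_set X cl H \<longleftrightarrow> H \<subseteq> X \<and> cl H = H"

text \<open>In the following conditions two enumerated sets always share the index set \<open>I\<close>; this is
  part of what it means that their types are equal.\<close>

definition QM1 :: "('f, 'r) lang \<Rightarrow> ('f, 'r, 'a) struct \<Rightarrow> ('a set \<Rightarrow> 'a set) \<Rightarrow> bool" where
  "QM1 L M cl \<longleftrightarrow>
     (\<forall>a a' b b'. a \<in> univ M \<and> a' \<in> univ M \<and> set b \<subseteq> univ M \<and> set b' \<subseteq> univ M \<and>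
        tp L M (a # b) = tp L M (a' # b') \<longrightarrow>
        (a \<in> cl (set b) \<longleftrightarrow> a' \<in> cl (set b')))"

definition QM2 :: "('f, 'r, 'a) struct \<Rightarrow> ('a set \<Rightarrow> 'a set) \<Rightarrow> bool" where
  "QM2 M cl \<longleftrightarrow> \<not> finite_dim (univ M) cl"

definition QM3 :: "('f, 'r, 'a) struct \<Rightarrow> ('a set \<Rightarrow> 'a set) \<Rightarrow> bool" where
  "QM3 M cl \<longleftrightarrow> (\<forall>A\<subseteq>univ M. finite A \<longrightarrow> countable (cl A))"

definition QM4 :: "('f, 'r) lang \<Rightarrow> ('f, 'r, 'a) struct \<Rightarrow> ('a set \<Rightarrow> 'a set) \<Rightarrow> bool" where
  "QM4 L M cl \<longleftrightarrow>
     (\<forall>I h h' a a'.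
        closed_set (univ M) cl (h ` I) \<and> closed_set (univ M) cl (h' ` I) \<and>
        tp_over L M I h [] = tp_over L M I h' [] \<and>
        a \<in> univ M - h ` I \<and> a' \<in> univ M - h' ` I \<longrightarrow>
        tp_over L M I h [a] = tp_over L M I h' [a'])"

definition QM5 :: "('f, 'r) lang \<Rightarrow> ('f, 'r, 'a) struct \<Rightarrow> ('a set \<Rightarrow> 'a set) \<Rightarrow> bool" where
  "QM5 L M cl \<longleftrightarrow>
     (\<forall>I h h' b b' a.
        (closed_set (univ M) cl (h ` I) \<or> h ` I = {}) \<and>
        (closed_set (univ M) cl (h' ` I) \<or> h' ` I = {}) \<and>
        tp_over L M I h [] = tp_over L M I h' [] \<and>
        set b \<subseteq> univ M \<and> set b' \<subseteq> univ M \<and>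
        tp_over L M I h b = tp_over L M I h' b' \<and>
        a \<in> cl (h ` I \<union> set b) \<longrightarrow>
        (\<exists>a'\<in>univ M. tp_over L M I h (b @ [a]) = tp_over L M I h' (b' @ [a'])))"

definition weakly_qm_structure ::
  "('f, 'r) lang \<Rightarrow> ('f, 'r, 'a) struct \<Rightarrow> ('a set \<Rightarrow> 'a set) \<Rightarrow> bool" where
  "weakly_qm_structure L M cl \<longleftrightarrow>
     is_struct L M \<and> pregeometry (univ M) cl \<and> QM1 L M cl \<and> QM3 M cl \<and> QM4 L M cl \<and> QM5 L M cl"

definition qm_structure ::
  "('f, 'r) lang \<Rightarrow> ('f, 'r, 'a) struct \<Rightarrow> ('a set \<Rightarrow> 'a set) \<Rightarrow> bool" where
  "qm_structure L M cl \<longleftrightarrow> weakly_qm_structure L M cl \<and> QM2 M cl"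


section \<open>Quasiminimal classes\<close>

text \<open>A structure together with its closure operator.\<close>

type_synonym ('f, 'r, 'a) pstruct = "('f, 'r, 'a) struct \<times> ('a set \<Rightarrow> 'a set)"

definition closed_sub ::
  "('f, 'r) lang \<Rightarrow> ('f, 'r, 'a) pstruct \<Rightarrow> ('f, 'r, 'a) pstruct \<Rightarrow> bool" where
  "closed_sub L p q \<longleftrightarrow>
     substr L (fst p) (fst q) \<and>
     closed_set (univ (fst q)) (snd q) (univ (fst p)) \<and>
     (\<forall>X\<subseteq>univ (fst p). snd p X = snd q X)"

definition piso ::
  "('f, 'r) lang \<Rightarrow> ('f, 'r, 'a) pstruct \<Rightarrow> ('f, 'r, 'b) pstruct \<Rightarrow> ('a \<Rightarrow> 'b) \<Rightarrow> bool" where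
  "piso L p q g \<longleftrightarrow>
     iso L (fst p) (fst q) g \<and> (\<forall>X\<subseteq>univ (fst p). snd q (g ` X) = g ` snd p X)"

text \<open>In the union of a chain of closed substructures, finite character forces the closure of
  \<open>X\<close> to be the union of the closures of its traces on the members of the chain.\<close>

definition pchain_union :: "('f, 'r, 'a) pstruct set \<Rightarrow> ('f, 'r, 'a) pstruct" where
  "pchain_union C =
     (chain_union (fst ` C), \<lambda>X. \<Union>p\<in>C. snd p (X \<inter> univ (fst p)))"

text \<open>A class of structures is represented by its members with carrier in the type \<open>'a\<close>. The
  generating structure \<open>M\<close> lives in its own type \<open>'m\<close>, and isomorphic copies in \<open>'a\<close> of its
  closed substructures (\<open>M\<close> is one of them) are taken. No member is lost by staying inside
  \<open>'a\<close>: the members of a chain of closed embeddings embed in its union, and so may be replaced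
  by substructures of it. For the same reason only chains of inclusions are needed. Chains are
  indexed by themselves and merely totally ordered; a cofinal well-ordered subchain has the
  same union.\<close>

definition K_minus ::
  "('f, 'r) lang \<Rightarrow> ('f, 'r, 'm) struct \<Rightarrow> ('m set \<Rightarrow> 'm set) \<Rightarrow> ('f, 'r, 'a) pstruct set" where
  "K_minus L M cl = {q. \<exists>p g. closed_sub L p (M, cl) \<and> piso L p q g}"

inductive_set K_gen ::
  "('f, 'r) lang \<Rightarrow> ('f, 'r, 'm) struct \<Rightarrow> ('m set \<Rightarrow> 'm set) \<Rightarrow> ('f, 'r, 'a) pstruct set"
  for L :: "('f, 'r) lang" and M :: "('f, 'r, 'm) struct" and cl :: "'m set \<Rightarrow> 'm set" where
  base: "p \<in> K_minus L M cl \<Longrightarrow> p \<in> K_gen L M cl"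
| iso: "p \<in> K_gen L M cl \<Longrightarrow> piso L p q g \<Longrightarrow> q \<in> K_gen L M cl"
| union: "C \<noteq> {} \<Longrightarrow> \<forall>p\<in>C. p \<in> K_gen L M cl \<Longrightarrow>
    \<forall>p\<in>C. \<forall>q\<in>C. closed_sub L p q \<or> closed_sub L q p \<Longrightarrow>
    pchain_union C \<in> K_gen L M cl"

definition qm_class ::
  "('f, 'r) lang \<Rightarrow> ('f, 'r, 'm) struct \<Rightarrow> ('m set \<Rightarrow> 'm set) \<Rightarrow> ('f, 'r, 'a) struct set" where
  "qm_class L M cl = {N. \<exists>c. (N, c) \<in> K_gen L M cl \<and> \<not> finite_dim (univ N) c}"

definition qm_le ::
  "('f, 'r) lang \<Rightarrow> ('f, 'r, 'm) struct \<Rightarrow> ('m set \<Rightarrow> 'm set) \<Rightarrow>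
   ('f, 'r, 'a) struct \<Rightarrow> ('f, 'r, 'a) struct \<Rightarrow> bool" where
  "qm_le L M cl A B \<longleftrightarrow>
     (\<exists>c d. (A, c) \<in> K_gen L M cl \<and> \<not> finite_dim (univ A) c \<and>
            (B, d) \<in> K_gen L M cl \<and> \<not> finite_dim (univ B) d \<and>
            closed_sub L (A, c) (B, d))"


section \<open>Abstract elementary classes\<close>

text \<open>The Loewenheim-Skolem axiom is stated separately in \<open>LS_omega\<close>: as \<open>\<omega>\<close> is the least
  possible Loewenheim-Skolem number, its being \<open>\<omega>\<close> says that the language is countable and that
  the axiom holds with \<open>\<omega>\<close>.\<close>

definition aec_axioms ::
  "('f, 'r) lang \<Rightarrow> ('f, 'r, 'a) struct set \<Rightarrow>
   (('f, 'r, 'a) struct \<Rightarrow> ('f, 'r, 'a) struct \<Rightarrow> bool) \<Rightarrow> bool" where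
  "aec_axioms L K le \<longleftrightarrow>
     (\<forall>A\<in>K. is_struct L A) \<and>
     (\<forall>A B g. A \<in> K \<and> iso L A B g \<longrightarrow> B \<in> K) \<and>
     (\<forall>A B B' g. le A B \<and> iso L B B' g \<longrightarrow> le (restr B' (g ` univ A)) B') \<and>
     (\<forall>A B. le A B \<longrightarrow> A \<in> K \<and> B \<in> K \<and> substr L A B) \<and>
     (\<forall>A\<in>K. le A A) \<and>
     (\<forall>A B C. le A B \<and> le B C \<longrightarrow> le A C) \<and>
     (\<forall>A B. le A B \<and> le B A \<longrightarrow> A = B) \<and>
     (\<forall>C. C \<noteq> {} \<and> C \<subseteq> K \<and> (\<forall>A\<in>C. \<forall>B\<in>C. le A B \<or> le B A) \<longrightarrow>
        chain_union C \<in> K \<and> (\<forall>A\<in>C. le A (chain_union C)) \<and>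
        (\<forall>B\<in>K. (\<forall>A\<in>C. le A B) \<longrightarrow> le (chain_union C) B)) \<and>
     (\<forall>A B C. le A C \<and> le B C \<and> substr L A B \<longrightarrow> le A B)"

definition LS_omega ::
  "('f, 'r) lang \<Rightarrow> ('f, 'r, 'a) struct set \<Rightarrow>
   (('f, 'r, 'a) struct \<Rightarrow> ('f, 'r, 'a) struct \<Rightarrow> bool) \<Rightarrow> bool" where
  "LS_omega L K le \<longleftrightarrow> countable_lang L \<and>
     (\<forall>A\<in>K. \<forall>X\<subseteq>univ A. \<exists>B. le B A \<and> X \<subseteq> univ B \<and> |univ B| \<le>o |X| +c natLeq)"

definition emb ::
  "('f, 'r) lang \<Rightarrow> (('f, 'r, 'a) struct \<Rightarrow> ('f, 'r, 'a) struct \<Rightarrow> bool) \<Rightarrow>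
   ('f, 'r, 'a) struct \<Rightarrow> ('f, 'r, 'a) struct \<Rightarrow> ('a \<Rightarrow> 'a) \<Rightarrow> bool" where
  "emb L le A B g \<longleftrightarrow> iso L A (restr B (g ` univ A)) g \<and> le (restr B (g ` univ A)) B"

definition AP ::
  "('f, 'r) lang \<Rightarrow> ('f, 'r, 'a) struct set \<Rightarrow>
   (('f, 'r, 'a) struct \<Rightarrow> ('f, 'r, 'a) struct \<Rightarrow> bool) \<Rightarrow> bool" where
  "AP L K le \<longleftrightarrow>
     (\<forall>A\<in>K. \<forall>B\<in>K. \<forall>C\<in>K. \<forall>f g. emb L le A B f \<and> emb L le A C g \<longrightarrow>
        (\<exists>D\<in>K. \<exists>f' g'. emb L le B D f' \<and> emb L le C D g' \<and>
           (\<forall>x\<in>univ A. f' (f x) = g' (g x))))"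

definition JEP ::
  "('f, 'r) lang \<Rightarrow> ('f, 'r, 'a) struct set \<Rightarrow>
   (('f, 'r, 'a) struct \<Rightarrow> ('f, 'r, 'a) struct \<Rightarrow> bool) \<Rightarrow> bool" where
  "JEP L K le \<longleftrightarrow> (\<forall>A\<in>K. \<forall>B\<in>K. \<exists>C\<in>K. \<exists>f g. emb L le A C f \<and> emb L le B C g)"

text \<open>Every cardinality that fits into the type \<open>'a\<close> is reached; in applications \<open>'a\<close> is an
  arbitrary large type.\<close>

definition arbitrarily_large :: "('f, 'r, 'a) struct set \<Rightarrow> bool" where
  "arbitrarily_large K \<longleftrightarrow> (\<forall>X :: 'a set. \<exists>A\<in>K. |X| \<le>o |univ A| )"

text \<open>A cardinal is a relation satisfying \<open>Card_order\<close>.\<close>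

definition monster ::
  "('f, 'r) lang \<Rightarrow> ('f, 'r, 'a) struct set \<Rightarrow>
   (('f, 'r, 'a) struct \<Rightarrow> ('f, 'r, 'a) struct \<Rightarrow> bool) \<Rightarrow> 'a rel \<Rightarrow> ('f, 'r, 'a) struct \<Rightarrow> bool" where
  "monster L K le \<delta> MM \<longleftrightarrow>
     MM \<in> K \<and>
     (\<forall>A\<in>K. |univ A| <o \<delta> \<longrightarrow> (\<exists>f. emb L le A MM f)) \<and>
     (\<forall>A B g. le A MM \<and> le B MM \<and> |univ A| <o \<delta> \<and> |univ B| <o \<delta> \<and> iso L A B g \<longrightarrow>
        (\<exists>h. iso L MM MM h \<and> (\<forall>x\<in>univ A. h x = g x)))"

definition model ::
  "(('f, 'r, 'a) struct \<Rightarrow> ('f, 'r, 'a) struct \<Rightarrow> bool) \<Rightarrow> 'a rel \<Rightarrow> ('f, 'r, 'a) struct \<Rightarrow>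
   'a set \<Rightarrow> bool" where
  "model le \<delta> MM A \<longleftrightarrow> A \<subseteq> univ MM \<and> le (restr MM A) MM \<and> |A| <o \<delta>"


section \<open>Galois types, weak types and splitting\<close>

definition Aut :: "('f, 'r) lang \<Rightarrow> ('f, 'r, 'a) struct \<Rightarrow> 'a set \<Rightarrow> ('a \<Rightarrow> 'a) set" where
  "Aut L MM A = {f. iso L MM MM f \<and> (\<forall>x\<in>A. f x = x)}"

text \<open>Equality of Galois types and of weak types of finite tuples.\<close>

definition gtp_eq ::
  "('f, 'r) lang \<Rightarrow> ('f, 'r, 'a) struct \<Rightarrow> 'a list \<Rightarrow> 'a list \<Rightarrow> 'a set \<Rightarrow> bool" where
  "gtp_eq L MM a b A \<longleftrightarrow> (\<exists>f\<in>Aut L MM A. map f a = b)"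

definition wtp_eq ::
  "('f, 'r) lang \<Rightarrow> ('f, 'r, 'a) struct \<Rightarrow> 'a list \<Rightarrow> 'a list \<Rightarrow> 'a set \<Rightarrow> bool" where
  "wtp_eq L MM a b A \<longleftrightarrow> (\<forall>B\<subseteq>A. finite B \<longrightarrow> gtp_eq L MM a b B)"

text \<open>The weak type of some enumeration of \<open>C\<close> equals that of an enumeration of \<open>B\<close>. Without
  loss of generality \<open>B\<close> is enumerated by itself, and \<open>C\<close> by \<open>e\<close>.\<close>

definition set_wtp_eq ::
  "('f, 'r) lang \<Rightarrow> ('f, 'r, 'a) struct \<Rightarrow> 'a set \<Rightarrow> 'a set \<Rightarrow> 'a set \<Rightarrow> bool" where
  "set_wtp_eq L MM B C A \<longleftrightarrow>
     (\<exists>e. e ` B = C \<and> (\<forall>A0\<subseteq>A. finite A0 \<longrightarrow> (\<exists>f\<in>Aut L MM A0. \<forall>x\<in>B. f x = e x)))"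

definition splits ::
  "('f, 'r) lang \<Rightarrow> ('f, 'r, 'a) struct \<Rightarrow> 'a list \<Rightarrow> 'a set \<Rightarrow> 'a set \<Rightarrow> bool" where
  "splits L MM a B A \<longleftrightarrow>
     (\<exists>b c. set b \<subseteq> B \<and> set c \<subseteq> B \<and> wtp_eq L MM b c A \<and> \<not> wtp_eq L MM (a @ b) (a @ c) A)"

definition indep ::
  "('f, 'r) lang \<Rightarrow> ('f, 'r, 'a) struct \<Rightarrow> 'a list \<Rightarrow> 'a set \<Rightarrow> 'a set \<Rightarrow> bool" where
  "indep L MM a B C \<longleftrightarrow> (\<exists>A\<subseteq>B. finite A \<and> \<not> splits L MM a (B \<union> C) A)"

definition set_indep ::
  "('f, 'r) lang \<Rightarrow> ('f, 'r, 'a) struct \<Rightarrow> 'a set \<Rightarrow> 'a set \<Rightarrow> 'a set \<Rightarrow> bool" where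
  "set_indep L MM A B C \<longleftrightarrow> (\<forall>a. set a \<subseteq> A \<longrightarrow> indep L MM a B C)"


section \<open>FUR-classes\<close>

definition AI ::
  "('f, 'r) lang \<Rightarrow> (('f, 'r, 'a) struct \<Rightarrow> ('f, 'r, 'a) struct \<Rightarrow> bool) \<Rightarrow> 'a rel \<Rightarrow>
   ('f, 'r, 'a) struct \<Rightarrow> bool" where
  "AI L le \<delta> MM \<longleftrightarrow>
     (\<forall>\<A>. model le \<delta> MM \<A> \<and> countable \<A> \<longrightarrow>
        (\<forall>b A. set b \<subseteq> univ MM \<and> A \<subseteq> \<A> \<and> finite A \<longrightarrow>
           (\<exists>a. set a \<subseteq> \<A> \<and> wtp_eq L MM a b A)))"

text \<open>\<open>s\<close> is the sequence of singletons \<open>a_0, a_1, ...\<close>\<close>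

definition s_primary ::
  "('f, 'r) lang \<Rightarrow> (('f, 'r, 'a) struct \<Rightarrow> ('f, 'r, 'a) struct \<Rightarrow> bool) \<Rightarrow> 'a rel \<Rightarrow>
   ('f, 'r, 'a) struct \<Rightarrow> 'a set \<Rightarrow> 'a set \<Rightarrow> 'a list \<Rightarrow> bool" where
  "s_primary L le \<delta> MM \<B> \<A> a \<longleftrightarrow>
     model le \<delta> MM \<B> \<and>
     (\<exists>s :: nat \<Rightarrow> 'a. \<B> = \<A> \<union> set a \<union> range s \<and>
        (\<forall>n. \<exists>A\<subseteq>\<A>. finite A \<and>
           (\<forall>a' s'. set a' \<subseteq> univ MM \<and> set s' \<subseteq> univ MM \<and> length s' = Suc n \<and>
              wtp_eq L MM a' a \<A> \<and>
              wtp_eq L MM (a' @ s') (a @ map s [0..<Suc n]) A \<longrightarrow>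
              wtp_eq L MM (a' @ s') (a @ map s [0..<Suc n]) \<A>)))"

definition AII ::
  "('f, 'r) lang \<Rightarrow> (('f, 'r, 'a) struct \<Rightarrow> ('f, 'r, 'a) struct \<Rightarrow> bool) \<Rightarrow> 'a rel \<Rightarrow>
   ('f, 'r, 'a) struct \<Rightarrow> bool" where
  "AII L le \<delta> MM \<longleftrightarrow>
     (\<forall>a \<A>. set a \<subseteq> univ MM \<and> model le \<delta> MM \<A> \<and> countable \<A> \<longrightarrow>
        (\<exists>\<B>. s_primary L le \<delta> MM \<B> \<A> a))"

text \<open>The family \<open>\<A>_i\<close>, \<open>i < \<alpha>\<close>, of models enters only through the set \<open>F\<close> of its members.\<close>

definition weakly_elementary ::
  "('f, 'r) lang \<Rightarrow> (('f, 'r, 'a) struct \<Rightarrow> ('f, 'r, 'a) struct \<Rightarrow> bool) \<Rightarrow>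
   ('f, 'r, 'a) struct \<Rightarrow> 'a set set \<Rightarrow> ('a \<Rightarrow> 'a) \<Rightarrow> bool" where
  "weakly_elementary L le MM F f \<longleftrightarrow>
     f ` \<Union>F \<subseteq> univ MM \<and>
     (\<forall>a. set a \<subseteq> \<Union>F \<longrightarrow> wtp_eq L MM a (map f a) {}) \<and>
     (\<forall>A\<in>F. le (restr MM (f ` A)) MM)"

definition s_prime ::
  "('f, 'r) lang \<Rightarrow> (('f, 'r, 'a) struct \<Rightarrow> ('f, 'r, 'a) struct \<Rightarrow> bool) \<Rightarrow> 'a rel \<Rightarrow>
   ('f, 'r, 'a) struct \<Rightarrow> 'a set set \<Rightarrow> 'a set \<Rightarrow> bool" where
  "s_prime L le \<delta> MM F D \<longleftrightarrow>
     model le \<delta> MM D \<and> \<Union>F \<subseteq> D \<and>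
     (\<forall>B f. model le \<delta> MM B \<and> f ` \<Union>F \<subseteq> B \<and> weakly_elementary L le MM F f \<longrightarrow>
        (\<exists>g. emb L le (restr MM D) (restr MM B) g \<and> (\<forall>x\<in>\<Union>F. g x = f x)))"

definition AIII ::
  "('f, 'r) lang \<Rightarrow> (('f, 'r, 'a) struct \<Rightarrow> ('f, 'r, 'a) struct \<Rightarrow> bool) \<Rightarrow> 'a rel \<Rightarrow>
   ('f, 'r, 'a) struct \<Rightarrow> bool" where
  "AIII L le \<delta> MM \<longleftrightarrow>
     (\<forall>\<A> \<B> \<C>. model le \<delta> MM \<A> \<and> model le \<delta> MM \<B> \<and> model le \<delta> MM \<C> \<and>
        set_indep L MM \<A> \<B> \<C> \<and> \<B> = \<A> \<inter> \<C> \<longrightarrow>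
        (\<exists>\<D>. s_prime L le \<delta> MM {\<A>, \<C>} \<D> \<and>
           (\<forall>\<D>'. s_prime L le \<delta> MM {\<A>, \<C>} \<D>' \<longrightarrow> \<D>' = \<D>) \<and>
           (\<forall>\<C>'. model le \<delta> MM \<C>' \<and> \<C> \<subseteq> \<C>' \<and> set_indep L MM \<A> \<B> \<C>' \<longrightarrow>
              set_indep L MM \<D> \<C> \<C>')))"

text \<open>The game \<open>GI(a, A, \<A>)\<close>. A strategy \<open>\<sigma>\<close> of player II maps the list of moves made so far
  by player I to II's answer. \<open>gi_play L MM \<A> \<sigma> a A ms b B\<close> says that \<open>ms\<close> is a list of legal
  moves of I against \<open>\<sigma>\<close>, leading to the position \<open>(b, B)\<close>.\<close>

definition gi_legal ::
  "('f, 'r) lang \<Rightarrow> ('f, 'r, 'a) struct \<Rightarrow> 'a set \<Rightarrow> 'a list \<Rightarrow> 'a set \<Rightarrow> 'a list \<Rightarrow> 'a set \<Rightarrow> bool"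
  where
  "gi_legal L MM \<A> b B b' B' \<longleftrightarrow>
     set b' \<subseteq> univ MM \<and> finite B' \<and> B' \<subseteq> \<A> \<and> B \<subseteq> B' \<and>
     wtp_eq L MM b' b B \<and> \<not> wtp_eq L MM b' b B'"

inductive gi_play ::
  "('f, 'r) lang \<Rightarrow> ('f, 'r, 'a) struct \<Rightarrow> 'a set \<Rightarrow> (('a list \<times> 'a set) list \<Rightarrow> 'a set) \<Rightarrow>
   'a list \<Rightarrow> 'a set \<Rightarrow> ('a list \<times> 'a set) list \<Rightarrow> 'a list \<Rightarrow> 'a set \<Rightarrow> bool"
  for L :: "('f, 'r) lang" and MM :: "('f, 'r, 'a) struct" and \<A> \<sigma> a A where
  start: "gi_play L MM \<A> \<sigma> a A [] a A"
| move: "gi_play L MM \<A> \<sigma> a A ms b B \<Longrightarrow> gi_legal L MM \<A> b B b' B' \<Longrightarrow>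
    gi_play L MM \<A> \<sigma> a A (ms @ [(b', B')]) b' (\<sigma> (ms @ [(b', B')]))"

definition gi_winning ::
  "('f, 'r) lang \<Rightarrow> ('f, 'r, 'a) struct \<Rightarrow> 'a set \<Rightarrow> 'a list \<Rightarrow> 'a set \<Rightarrow> nat \<Rightarrow>
   (('a list \<times> 'a set) list \<Rightarrow> 'a set) \<Rightarrow> bool" where
  "gi_winning L MM \<A> a A n \<sigma> \<longleftrightarrow>
     (\<forall>ms b B. gi_play L MM \<A> \<sigma> a A ms b B \<longrightarrow>
        length ms \<le> n \<and>
        (ms \<noteq> [] \<longrightarrow> finite B \<and> B \<subseteq> \<A> \<and> snd (last ms) \<subseteq> B))"

definition AIV ::
  "('f, 'r) lang \<Rightarrow> (('f, 'r, 'a) struct \<Rightarrow> ('f, 'r, 'a) struct \<Rightarrow> bool) \<Rightarrow> 'a rel \<Rightarrow>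
   ('f, 'r, 'a) struct \<Rightarrow> bool" where
  "AIV L le \<delta> MM \<longleftrightarrow>
     (\<forall>a. set a \<subseteq> univ MM \<longrightarrow>
        (\<exists>n. \<forall>\<A> A. model le \<delta> MM \<A> \<and> countable \<A> \<and> A \<subseteq> \<A> \<and> finite A \<longrightarrow>
           (\<exists>\<sigma>. gi_winning L MM \<A> a A n \<sigma>)))"

definition AV ::
  "('f, 'r) lang \<Rightarrow> (('f, 'r, 'a) struct \<Rightarrow> ('f, 'r, 'a) struct \<Rightarrow> bool) \<Rightarrow> 'a rel \<Rightarrow>
   ('f, 'r, 'a) struct \<Rightarrow> bool" where
  "AV L le \<delta> MM \<longleftrightarrow>
     (\<forall>\<A> \<B> a. model le \<delta> MM \<A> \<and> countable \<A> \<and> model le \<delta> MM \<B> \<and> countable \<B> \<and> \<A> \<subseteq> \<B> \<and>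
        set a \<subseteq> univ MM \<and> set_indep L MM \<B> \<A> (set a) \<longrightarrow> indep L MM a \<A> \<B>)"

definition AVI ::
  "('f, 'r) lang \<Rightarrow> (('f, 'r, 'a) struct \<Rightarrow> ('f, 'r, 'a) struct \<Rightarrow> bool) \<Rightarrow> 'a rel \<Rightarrow>
   ('f, 'r, 'a) struct \<Rightarrow> bool" where
  "AVI L le \<delta> MM \<longleftrightarrow>
     (\<forall>\<A> \<B> \<D>. model le \<delta> MM \<A> \<and> model le \<delta> MM \<B> \<and> model le \<delta> MM \<D> \<and> \<A> \<subseteq> \<B> \<inter> \<D> \<longrightarrow>
        (\<exists>\<C>. model le \<delta> MM \<C> \<and> set_wtp_eq L MM \<B> \<C> \<A> \<and> set_indep L MM \<C> \<A> \<D>))"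

text \<open>No particular large cardinal \<open>\<delta>\<close> is singled out: monster models are required to exist for
  every uncountable \<open>\<delta>\<close> that fits into \<open>'a\<close>, and the axioms are required in each of them.\<close>

definition FUR_class ::
  "('f, 'r) lang \<Rightarrow> ('f, 'r, 'a) struct set \<Rightarrow>
   (('f, 'r, 'a) struct \<Rightarrow> ('f, 'r, 'a) struct \<Rightarrow> bool) \<Rightarrow> bool" where
  "FUR_class L K le \<longleftrightarrow>
     aec_axioms L K le \<and> LS_omega L K le \<and> AP L K le \<and> JEP L K le \<and>
     arbitrarily_large K \<and> (\<forall>A\<in>K. infinite (univ A)) \<and>
     (\<forall>\<delta> :: 'a rel. Card_order \<delta> \<and> natLeq <o \<delta> \<longrightarrow>
        (\<exists>MM. monster L K le \<delta> MM) \<and>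
        (\<forall>MM. monster L K le \<delta> MM \<longrightarrow>
           AI L le \<delta> MM \<and> AII L le \<delta> MM \<and> AIII L le \<delta> MM \<and>
           AIV L le \<delta> MM \<and> AV L le \<delta> MM \<and> AVI L le \<delta> MM))"

end

theory Submission
 imports Defs "HOL-Library.Countable_Set_Type"
begin

text \<open>
 By QM1, QM4 and QM5 the finite partial maps that preserve quantifier-free types form a back-and-forth
 system, so isomorphisms between countable closed sets extend along independent sets. To go beyond
 countable sets one shows that a tuple in \<open>cl (E \<union> F)\<close>, with \<open>F\<close> finite and independent over \<open>E\<close>, is
 isolated by finitely many elements of the faces \<open>cl (E \<union> (F - {x}))\<close>. This rests on a Baire category
 argument for automorphisms of countable closed sets, and it allows an isomorphism to be built along
 all finite parts of an uncountable basis at once. Hence closed sets are classified by dimension, the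
 closure operator is determined by the structure, automorphisms of a monster model exist in abundance,
 and weak types are quantifier-free types. A type \<open>t(a/BC)\<close> does not split over a finite part of the
 model \<open>B\<close> iff every \<open>cl\<close>-dependence among \<open>a\<close> over \<open>BC\<close> already holds over \<open>B\<close>, and the axioms
 become exchange arguments and isolation statements in the pregeometry.
\<close>

text \<open>QM4 and QM5 speak only of countable closed sets: they give no value that fits
  uncountably many parameters at once, so a map with uncountable domain cannot be prolonged point by
  point. The obstacle is removed by replacing infinite parameter sets by finite ones. The device is
  nearly always the same: a map with the desired effect on a finite tuple is composed with the
  inverse of a map that keeps the tuple and agrees with the first on the parameters; the product
  fixes the parameters. This is why maps are relations, closed under converse and composition, and
  why many steps end with an inclusion into a composite.

  Infinite dimension supplies room. Finite independent sets can be exchanged for fresh points of a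
  countable closed set \<open>E\<close>, so isolation over countable sets spreads to sets of every
  size, and spare points of \<open>E\<close> make copies of faces possible.

  The axioms are formulated for a family of structures (\<open>qmc\<close>) and used twice: for
  \<open>M\<close> alone, and for all structures whose finitely generated closures embed in
  \<open>M\<close>.\<close>

section \<open>Quantifier-free types: change of variables and locality\<close>

lemma val_rename: "val M v (map_trm id \<rho> t) = val M (v \<circ> \<rho>) t"
 by (induction t) (auto simp: comp_def cong: map_cong)

lemma sat_rename: "sat M v (map_qf id id \<rho> \<phi>) = sat M (v \<circ> \<rho>) \<phi>"
 by (induction \<phi>) (auto simp: val_rename val_rename[unfolded id_def] comp_def cong: map_cong)

lemma wf_trm_rename: "wf_trm L J (map_trm id \<rho> t) = wf_trm L (\<rho> -` J) t"
 by (induction t) auto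

lemma wf_qf_rename: "wf_qf L J (map_qf id id \<rho> \<phi>) = wf_qf L (\<rho> -` J) \<phi>"
 by (induction \<phi>) (auto simp: wf_trm_rename wf_trm_rename[unfolded id_def])

lemma wf_trm_mono: "wf_trm L I t ==> I \<subseteq> J ==> wf_trm L J t"
 by (induction t) auto

lemma wf_qf_mono: "wf_qf L I \<phi> ==> I \<subseteq> J ==> wf_qf L J \<phi>"
 by (induction \<phi>) (auto intro: wf_trm_mono[of L I])

lemma wf_trm_vars: "wf_trm L I t ==> I Int set2_trm t \<subseteq> J ==> wf_trm L J t"
proof (induction t)
 case (App f ts)
 have "wf_trm L J t" if "t \<in> set ts" for t
  by (rule App.IH) (use App.prems that in auto)
 then show ?case using App.prems by auto
qed auto

lemma wf_qf_vars: "wf_qf L I \<phi> ==> I Int set3_qf \<phi> \<subseteq> J ==> wf_qf L J \<phi>"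
proof (induction \<phi>)
 case (Eq s t)
 then show ?case using wf_trm_vars[of L I s J] wf_trm_vars[of L I t J] by auto
next
 case (Rel r ts)
 have "wf_trm L J t" if "t \<in> set ts" for t
  by (rule wf_trm_vars[of L I]) (use Rel that in auto)
 then show ?case using Rel by auto
next
 case (Neg q)
 then show ?case by simp
next
 case (Conj p q)
 have "wf_qf L J p" by (rule Conj.IH) (use Conj.prems in auto)
 moreover have "wf_qf L J q" by (rule Conj.IH) (use Conj.prems in auto)
 ultimately show ?case by simp
qed

lemma finite_vars_qf: "finite (set3_qf \<phi>)"
 by (induction \<phi>) auto

lemma val_cong: "wf_trm L I t ==> (\<And>i. i \<in> I ==> v i = w i) ==> val M v t = val M w t"
 by (induction t) (auto cong: map_cong)

lemma sat_cong: "wf_qf L I \<phi> ==> (\<And>i. i \<in> I ==> v i = w i) ==> sat M v \<phi> = sat M w \<phi>"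
proof (induction \<phi>)
 case (Eq s t)
 then show ?case using val_cong[of L I s v w M] val_cong[of L I t v w M] by auto
next
 case (Rel r ts)
 then have "map (val M v) ts = map (val M w) ts"
  using val_cong[of L I _ v w M] by auto
 then show ?case by (simp del: map_eq_conv)
qed auto

text \<open>A formula contains finitely many variables, so its truth is read off from the type of a
  finite list of them. The substitution \<open>\<rho>\<close> sends each variable to its first
  position in that list, which may contain repetitions.\<close>

lemma qftp_transfer:
 assumes tps: "\<And>is. set is \<subseteq> I ==> tp L A (map v is) = tp L B (map w is)"
  and \<phi>: "\<phi> \<in> qftp L A I v"
 shows "\<phi> \<in> qftp L B I w"
proof -
 from \<phi> have wf: "wf_qf L I \<phi>" and sat: "sat A v \<phi>" by (auto simp: qftp_def)
 obtain "is" where is_def: "set is = I Int set3_qf \<phi>"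
  using finite_list[of "I Int set3_qf \<phi>"] finite_vars_qf by auto
 define \<rho> where "\<rho> i = (LEAST n. n < length is \<and> is ! n = i)" for i
 have \<rho>: "\<rho> i < length is \<and> is ! \<rho> i = i" if "i \<in> set is" for i
  unfolding \<rho>_def by (rule LeastI_ex) (use that in \<open>auto simp: in_set_conv_nth\<close>)
 have w: "wf_qf L (set is) \<phi>" by (rule wf_qf_vars[OF wf]) (simp add: is_def)
 have w': "wf_qf L {..<length is} (map_qf id id \<rho> \<phi>)"
  unfolding wf_qf_rename by (rule wf_qf_mono[OF w]) (use \<rho> in auto)
 have "sat A ((\<lambda>i. map v is ! i) \<circ> \<rho>) \<phi>"
  using sat sat_cong[OF w, of v "(\<lambda>i. map v is ! i) \<circ> \<rho>" A] \<rho> by auto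
 then have "map_qf id id \<rho> \<phi> \<in> tp L A (map v is)"
  using w' by (auto simp: tp_def qftp_def sat_rename)
 then have "map_qf id id \<rho> \<phi> \<in> tp L B (map w is)" using tps[of "is"] is_def by auto
 then have "sat B ((\<lambda>i. map w is ! i) \<circ> \<rho>) \<phi>"
  by (auto simp: tp_def qftp_def sat_rename)
 then have "sat B w \<phi>"
  using sat_cong[OF w, of w "(\<lambda>i. map w is ! i) \<circ> \<rho>" B] \<rho> by auto
 then show ?thesis using wf by (auto simp: qftp_def)
qed

text \<open>Reduces types of infinite enumerations to types of finite tuples, which is the form that
  the definition of \<open>pel\<close> uses.\<close>

lemma qftp_eq_iff:
 fixes A :: "('f, 'r, 'a) struct" and B :: "('f, 'r, 'b) struct"
 shows "qftp L A I v = qftp L B I w \<longleftrightarrow> (\<forall>is. set is \<subseteq> I --> tp L A (map v is) = tp L B (map w is))"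
proof safe
 fix "is" \<phi>
 assume eq: "qftp L A I v = qftp L B I w" and sub: "set is \<subseteq> I"
 define \<rho> where "\<rho> = (!) is"
 have sat: "sat M u (map_qf id id \<rho> \<phi>) = sat M (\<lambda>i. map u is ! i) \<phi>"
  if "wf_qf L {..<length is} \<phi>" for M :: "('f, 'r, 'y) struct" and u and \<phi>
  unfolding sat_rename by (rule sat_cong[OF that]) (auto simp: \<rho>_def)
 have wf: "wf_qf L I (map_qf id id \<rho> \<phi>)" if "wf_qf L {..<length is} \<phi>" for \<phi>
  unfolding wf_qf_rename by (rule wf_qf_mono[OF that]) (use sub nth_mem in \<open>fastforce simp: \<rho>_def\<close>)
 show "\<phi> \<in> tp L B (map w is)" if \<phi>: "\<phi> \<in> tp L A (map v is)"
 proof -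
  from \<phi> have w: "wf_qf L {..<length is} \<phi>" and "sat A (\<lambda>i. map v is ! i) \<phi>"
   by (auto simp: tp_def qftp_def)
  then have "map_qf id id \<rho> \<phi> \<in> qftp L A I v"
   using wf[OF w] sat[OF w, of A v] by (simp add: qftp_def)
  then have "map_qf id id \<rho> \<phi> \<in> qftp L B I w" using eq by simp
  then show ?thesis using w sat[OF w, of B w] by (simp add: qftp_def tp_def)
 qed
 show "\<phi> \<in> tp L A (map v is)" if \<phi>: "\<phi> \<in> tp L B (map w is)"
 proof -
  from \<phi> have w: "wf_qf L {..<length is} \<phi>" and "sat B (\<lambda>i. map w is ! i) \<phi>"
   by (auto simp: tp_def qftp_def)
  then have "map_qf id id \<rho> \<phi> \<in> qftp L B I w"
   using wf[OF w] sat[OF w, of B w] by (simp add: qftp_def)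
  then have "map_qf id id \<rho> \<phi> \<in> qftp L A I v" using eq by simp
  then show ?thesis using w sat[OF w, of A v] by (simp add: qftp_def tp_def)
 qed
next
 fix \<phi>
 assume tps: "\<forall>is. set is \<subseteq> I --> tp L A (map v is) = tp L B (map w is)"
 show "\<phi> \<in> qftp L B I w" if "\<phi> \<in> qftp L A I v" by (rule qftp_transfer[OF _ that]) (use tps in simp)
 show "\<phi> \<in> qftp L A I v" if "\<phi> \<in> qftp L B I w" by (rule qftp_transfer[OF _ that]) (use tps in simp)
qed

text \<open>Partial elementary relations: enumerated sets with equal quantifier-free types are encoded by the
 graph of the enumeration-preserving map, so that no enumeration has to be carried along.\<close>

definition pel :: "('f, 'r) lang \<Rightarrow> ('f, 'r, 'a) struct \<Rightarrow> ('f, 'r, 'b) struct \<Rightarrow> ('a \<times> 'b) set \<Rightarrow> bool"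
 where "pel L A B G \<longleftrightarrow> G \<subseteq> univ A \<times> univ B \<and>
  (\<forall>ps. set ps \<subseteq> G --> tp L A (map fst ps) = tp L B (map snd ps))"

section \<open>Calculus of partial elementary relations\<close>

lemma pel_univ: "pel L A B G ==> Domain G \<subseteq> univ A \<and> Range G \<subseteq> univ B"
 by (auto simp: pel_def)

lemma pel_subset: "pel L A B G ==> H \<subseteq> G ==> pel L A B H"
 by (auto simp: pel_def)

lemma pel_converse_imp: "pel L A B G ==> pel L B A (G\<inverse>)"
proof -
 assume G: "pel L A B G"
 have "tp L B (map fst ps) = tp L A (map snd ps)" if "set ps \<subseteq> G\<inverse>" for ps
 proof -
  have "set (map prod.swap ps) \<subseteq> G" using that by auto
  then have "tp L A (map fst (map prod.swap ps)) = tp L B (map snd (map prod.swap ps))"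
   using G unfolding pel_def by blast
  then show ?thesis by (simp add: comp_def)
 qed
 then show ?thesis using G by (auto simp: pel_def)
qed

lemma pel_converse [simp]: "pel L B A (G\<inverse>) = pel L A B G"
 using pel_converse_imp[of L A B G] pel_converse_imp[of L B A "G\<inverse>"] by auto

lemma pel_comp:
 assumes "pel L A B G" "pel L B C H"
 shows "pel L A C (G O H)"
proof -
 have "tp L A (map fst ps) = tp L C (map snd ps)" if "set ps \<subseteq> G O H" for ps
 proof -
  from that have "\<forall>p\<in>set ps. \<exists>y. (fst p, y) \<in> G \<and> (y, snd p) \<in> H" by fastforce
  then obtain y where y: "\<And>p. p \<in> set ps ==> (fst p, y p) \<in> G \<and> (y p, snd p) \<in> H" by metis
  have "set (map (\<lambda>p. (fst p, y p)) ps) \<subseteq> G" "set (map (\<lambda>p. (y p, snd p)) ps) \<subseteq> H"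
   using y by auto
  then have "tp L A (map fst (map (\<lambda>p. (fst p, y p)) ps)) = tp L B (map snd (map (\<lambda>p. (fst p, y p)) ps))"
   "tp L B (map fst (map (\<lambda>p. (y p, snd p)) ps)) = tp L C (map snd (map (\<lambda>p. (y p, snd p)) ps))"
   using assms unfolding pel_def by blast+
  then show ?thesis by (simp add: comp_def)
 qed
 then show ?thesis using assms by (auto simp: pel_def)
qed

text \<open>Elementarity is tested on finite lists. Limit stages of all constructions are therefore
  free, and claims about large relations are checked below on a finite part, usually called
  \<open>Q\<close>.\<close>

lemma pel_finite: "(\<And>F. F \<subseteq> G ==> finite F ==> pel L A B F) ==> pel L A B G"
proof -
 assume fin: "\<And>F. F \<subseteq> G ==> finite F ==> pel L A B F"
 have "G \<subseteq> univ A \<times> univ B"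
 proof
  fix x assume "x \<in> G"
  then have "pel L A B {x}" using fin by auto
  then show "x \<in> univ A \<times> univ B" by (auto simp: pel_def)
 qed
 moreover have "tp L A (map fst ps) = tp L B (map snd ps)" if "set ps \<subseteq> G" for ps
  using fin[OF that] unfolding pel_def by blast
 ultimately show ?thesis by (auto simp: pel_def)
qed

lemma pel_chain:
 assumes "C \<noteq> {}" "\<And>G. G \<in> C ==> pel L A B G" "\<And>G H. G \<in> C ==> H \<in> C ==> G \<subseteq> H \<or> H \<subseteq> G"
 shows "pel L A B (\<Union>C)"
proof (rule pel_finite)
 fix F assume "F \<subseteq> \<Union>C" "finite F"
 then obtain G where "G \<in> C" "F \<subseteq> G"
  using finite_subset_Union_chain[of F C UNIV] assms(1,3)
  by (metis subset_chain_def subset_UNIV)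
 then show "pel L A B F" using assms(2) pel_subset by blast
qed

text \<open>The formula \<open>Eq (Var 0) (Var 1)\<close> is part of the type, so an elementary
  relation is single-valued in both directions.\<close>

lemma pel_inj:
 assumes "pel L A B G" and ab: "(a, b) \<in> G" "(a', b') \<in> G"
 shows "a = a' \<longleftrightarrow> b = b'"
proof -
 have "tp L A (map fst [(a, b), (a', b')]) = tp L B (map snd [(a, b), (a', b')])"
  using ab assms unfolding pel_def by (metis empty_set empty_subsetI insert_subset list.simps(15))
 then have "Eq (Var 0) (Var 1) \<in> tp L A [a, a'] \<longleftrightarrow> Eq (Var 0) (Var 1) \<in> tp L B [b, b']" by simp
 then show ?thesis by (simp add: tp_def qftp_def)
qed

lemma pel_Id_on:
 assumes S: "S \<subseteq> univ A"
 shows "pel L A A (Id_on S)"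
proof -
 have "map fst ps = map snd ps" if "set ps \<subseteq> Id_on S" for ps
  using that by auto
 then have "tp L A (map fst ps) = tp L A (map snd ps)" if "set ps \<subseteq> Id_on S" for ps
  using that by (metis (no_types))
 then show ?thesis using S by (auto simp: pel_def)
qed

text \<open>The bridge from relations to the enumerated form of the axioms. The enumerations
  \<open>v\<close> and \<open>w\<close> may repeat elements, in the same places.\<close>

lemma pel_qftp:
 "pel L A B ((\<lambda>i. (v i, w i)) ` I) \<longleftrightarrow>
   v ` I \<subseteq> univ A \<and> w ` I \<subseteq> univ B \<and> qftp L A I v = qftp L B I w"
proof -
 let ?G = "(\<lambda>i. (v i, w i)) ` I"
 have "(\<forall>ps. set ps \<subseteq> ?G --> tp L A (map fst ps) = tp L B (map snd ps)) \<longleftrightarrow>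
  (\<forall>is. set is \<subseteq> I --> tp L A (map v is) = tp L B (map w is))" (is "?l = ?r")
 proof (intro iffI allI impI)
  fix "is" assume l: ?l and "set is \<subseteq> I"
  then have "set (map (\<lambda>i. (v i, w i)) is) \<subseteq> ?G" by auto
  then have "tp L A (map fst (map (\<lambda>i. (v i, w i)) is)) = tp L B (map snd (map (\<lambda>i. (v i, w i)) is))"
   using l by blast
  then show "tp L A (map v is) = tp L B (map w is)" by (simp add: comp_def)
 next
  fix ps assume r: ?r and "set ps \<subseteq> ?G"
  then have "\<forall>p\<in>set ps. \<exists>i\<in>I. p = (v i, w i)" by auto
  then obtain k where k: "\<And>p. p \<in> set ps ==> k p \<in> I \<and> p = (v (k p), w (k p))" by metis
  have "set (map k ps) \<subseteq> I" using k by auto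
  then have "tp L A (map v (map k ps)) = tp L B (map w (map k ps))" using r by blast
  moreover have "map v (map k ps) = map fst ps" "map w (map k ps) = map snd ps"
   using k by (simp_all, metis fst_conv, metis snd_conv)
  ultimately show "tp L A (map fst ps) = tp L B (map snd ps)" by metis
 qed
 then show ?thesis unfolding qftp_eq_iff pel_def by auto
qed

lemma set_zip_nth: "length a = length b ==> set (zip a b) = (\<lambda>i. (a ! i, b ! i)) ` {..<length a}"
 by (auto simp: set_zip)

lemma pel_tp_over:
 assumes "length b = length b'" "h ` I Un set b \<subseteq> univ A" "h' ` I Un set b' \<subseteq> univ B"
 shows "pel L A B ((\<lambda>i. (h i, h' i)) ` I Un set (zip b b')) \<longleftrightarrow> tp_over L A I h b = tp_over L B I h' b'"
proof -
 let ?I = "Inl ` I Un Inr ` {..<length b}"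
 have eq: "(\<lambda>i. (h i, h' i)) ` I Un set (zip b b') =
  (\<lambda>i. (case_sum h ((!) b) i, case_sum h' ((!) b') i)) ` ?I"
  using assms(1) by (simp add: set_zip_nth image_Un image_image)
 show ?thesis unfolding eq pel_qftp using assms
  by (auto simp: tp_over_def image_Un image_image image_subset_iff subset_iff)
qed

section \<open>Pregeometries: relative independence and exchange\<close>

definition indp :: "('a set \<Rightarrow> 'a set) \<Rightarrow> 'a set \<Rightarrow> 'a set \<Rightarrow> bool" where
 "indp cl A B \<longleftrightarrow> (\<forall>b\<in>B. b \<notin> cl (A Un (B - {b})))"

text \<open>For closed sets this is infinite dimension (\<open>finite_dim_iff\<close>), phrased
  without a basis so that it passes easily to images, chains and larger closed sets.\<close>

definition infd :: "('a set \<Rightarrow> 'a set) \<Rightarrow> 'a set \<Rightarrow> bool" where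
 "infd cl H \<longleftrightarrow> (\<forall>F\<subseteq>H. finite F --> \<not> H \<subseteq> cl F)"

locale pregeo =
 fixes X :: "'a set" and cl :: "'a set \<Rightarrow> 'a set"
 assumes pregeometry: "pregeometry X cl"
begin

lemma pg:
 shows pg1: "\<forall>A\<subseteq>X. A \<subseteq> cl A \<and> cl A \<subseteq> X"
  and pg2: "\<forall>A B. A \<subseteq> B \<and> B \<subseteq> X --> cl A \<subseteq> cl B"
  and pg3: "\<forall>A\<subseteq>X. cl (cl A) = cl A"
  and pg4: "\<forall>A\<subseteq>X. \<forall>a\<in>X. \<forall>b\<in>X. a \<in> cl (insert b A) \<and> a \<notin> cl A --> b \<in> cl (insert a A)"
  and pg5: "\<forall>A\<subseteq>X. \<forall>a\<in>cl A. \<exists>F\<subseteq>A. finite F \<and> a \<in> cl F"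
 using pregeometry unfolding pregeometry_def by argo+

lemma cl_ext: "A \<subseteq> X ==> A \<subseteq> cl A"
 and cl_in: "A \<subseteq> X ==> cl A \<subseteq> X"
 using pg1 by blast+

lemma cl_mono: "A \<subseteq> B ==> B \<subseteq> X ==> cl A \<subseteq> cl B"
 using pg2 by blast

lemma cl_idem: "A \<subseteq> X ==> cl (cl A) = cl A"
 using pg3 by blast

lemma cl_exch: "A \<subseteq> X ==> b \<in> X ==> a \<in> cl (insert b A) ==> a \<notin> cl A ==> b \<in> cl (insert a A)"
 using pg4 cl_in[of "insert b A"] by blast

lemma cl_fin: "A \<subseteq> X ==> a \<in> cl A ==> \<exists>F\<subseteq>A. finite F \<and> a \<in> cl F"
 using pg5 by blast

lemma cl_least: "B \<subseteq> X ==> A \<subseteq> cl B ==> cl A \<subseteq> cl B"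
 using cl_mono[of A "cl B"] cl_in cl_idem by blast

lemma cl_least': "closed_set X cl H ==> A \<subseteq> H ==> cl A \<subseteq> H"
 using cl_mono unfolding closed_set_def by metis

lemma closed_cl: "A \<subseteq> X ==> closed_set X cl (cl A)"
 unfolding closed_set_def using cl_in cl_idem by blast

lemma cl_Un_cl: "A \<subseteq> X ==> B \<subseteq> X ==> cl (cl A Un B) = cl (A Un B)"
proof (rule subset_antisym)
 assume A: "A \<subseteq> X" and B: "B \<subseteq> X"
 show "cl (cl A Un B) \<subseteq> cl (A Un B)"
  by (rule cl_least) (use A B cl_mono[of A "A Un B"] cl_ext[of "A Un B"] in auto)
 show "cl (A Un B) \<subseteq> cl (cl A Un B)"
  by (rule cl_mono) (use A B cl_ext[of A] cl_in[of A] in auto)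
qed

lemma cl_fin_set:
 assumes "A \<subseteq> X" "finite F" "F \<subseteq> cl A"
 shows "\<exists>G\<subseteq>A. finite G \<and> F \<subseteq> cl G"
 using assms(2,3)
proof (induction rule: finite_induct)
 case (insert x F)
 then obtain G where G: "G \<subseteq> A" "finite G" "F \<subseteq> cl G" by auto
 obtain G' where G': "G' \<subseteq> A" "finite G'" "x \<in> cl G'"
  using cl_fin[of A x] insert.prems assms(1) by auto
 have "cl G \<subseteq> cl (G Un G')" "cl G' \<subseteq> cl (G Un G')"
  by (rule cl_mono; use G G' assms(1) in auto)+
 then show ?case using G G' by (intro exI[of _ "G Un G'"]) auto
qed auto

lemma cl_fin_Un:
 assumes "A \<subseteq> X" "B \<subseteq> X" "finite F" "F \<subseteq> cl (A Un B)"
 shows "\<exists>G\<subseteq>A. finite G \<and> F \<subseteq> cl (G Un B)"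
proof -
 obtain G where G: "G \<subseteq> A Un B" "finite G" "F \<subseteq> cl G"
  using cl_fin_set[OF _ assms(3,4)] assms(1,2) by auto
 have "cl G \<subseteq> cl ((G Int A) Un B)" by (rule cl_mono) (use G assms in auto)
 then show ?thesis using G by (intro exI[of _ "G Int A"]) auto
qed

lemma indp_antimono:
 assumes "indp cl A B" "A' \<subseteq> A" "B' \<subseteq> B" "A \<subseteq> X" "B \<subseteq> X"
 shows "indp cl A' B'"
 unfolding indp_def
proof
 fix b assume b: "b \<in> B'"
 have "cl (A' Un (B' - {b})) \<subseteq> cl (A Un (B - {b}))"
  by (rule cl_mono) (use assms in auto)
 then show "b \<notin> cl (A' Un (B' - {b}))" using assms(1,3) b unfolding indp_def by blast
qed

lemma indp_subset: "indp cl A B ==> C \<subseteq> B ==> A \<subseteq> X ==> B \<subseteq> X ==> indp cl A C"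
 by (rule indp_antimono[of A B A C]) auto

lemma indp_mono: "indp cl A B ==> A' \<subseteq> A ==> A \<subseteq> X ==> B \<subseteq> X ==> indp cl A' B"
 by (rule indp_antimono[of A B A' B]) auto

lemma indp_cl:
 assumes "A \<subseteq> X" "B \<subseteq> X"
 shows "indp cl (cl A) B = indp cl A B"
proof -
 have "cl (cl A Un (B - {b})) = cl (A Un (B - {b}))" for b
  by (rule cl_Un_cl) (use assms in auto)
 then show ?thesis by (simp add: indp_def)
qed

lemma indp_notin':
 assumes "indp cl A B" "A \<subseteq> X" "B \<subseteq> X" "b \<in> B" "C \<subseteq> B - {b}"
 shows "b \<notin> cl (A Un C)"
proof -
 have "cl (A Un C) \<subseteq> cl (A Un (B - {b}))" by (rule cl_mono) (use assms in auto)
 then show ?thesis using assms(1,4) unfolding indp_def by blast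
qed

lemma indp_notin: "indp cl A B ==> A \<subseteq> X ==> B \<subseteq> X ==> b \<in> B ==> b \<notin> cl A"
 using indp_notin'[of A B b "{}"] by simp

lemma indp_insert:
 assumes "indp cl A B" "A \<subseteq> X" "B \<subseteq> X" "b \<in> X" "b \<notin> cl (A Un B)"
 shows "indp cl A (insert b B)"
 unfolding indp_def
proof
 fix x assume x: "x \<in> insert b B"
 show "x \<notin> cl (A Un (insert b B - {x}))"
 proof (cases "x = b")
  case True
  then show ?thesis using assms cl_mono[of "A Un (B - {b})" "A Un B"] by auto
 next
  case False
  then have xB: "x \<in> B" using x by auto
  show ?thesis
  proof
   assume "x \<in> cl (A Un (insert b B - {x}))"
   moreover have "A Un (insert b B - {x}) = insert b (A Un (B - {x}))" using False by auto
   ultimately have "b \<in> cl (insert x (A Un (B - {x})))"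
    using cl_exch[of "A Un (B - {x})" b x] assms xB unfolding indp_def by auto
   moreover have "insert x (A Un (B - {x})) = A Un B" using xB by auto
   ultimately show False using assms by simp
  qed
 qed
qed

lemma indp_finite:
 assumes "\<And>F. F \<subseteq> B ==> finite F ==> indp cl A F" "A \<subseteq> X" "B \<subseteq> X"
 shows "indp cl A B"
 unfolding indp_def
proof (intro ballI notI)
 fix b assume b: "b \<in> B" "b \<in> cl (A Un (B - {b}))"
 then obtain G where G: "G \<subseteq> B - {b}" "finite G" "{b} \<subseteq> cl (G Un A)"
  using cl_fin_Un[of "B - {b}" A "{b}"] assms by (auto simp: Un_commute)
 have "indp cl A (insert b G)" by (rule assms(1)) (use G b in auto)
 moreover have "insert b G - {b} = G" using G by auto
 ultimately show False using G unfolding indp_def by (auto simp: Un_commute)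
qed

lemma exch_min:
 assumes "A \<subseteq> X" "T \<subseteq> X" "y \<in> cl (A Un T)"
 obtains F where "F \<subseteq> T" "finite F" "y \<in> cl (A Un F)"
  "\<And>f. f \<in> F ==> y \<notin> cl (A Un (F - {f}))" "\<And>f. f \<in> F ==> f \<in> cl (insert y (A Un (F - {f})))"
proof -
 define P where "P F \<longleftrightarrow> F \<subseteq> T \<and> finite F \<and> y \<in> cl (A Un F)" for F
 have "\<exists>F. P F" using cl_fin_Un[of T A "{y}"] assms by (auto simp: P_def Un_commute)
 then obtain F where F: "P F" "\<And>G. P G ==> card F \<le> card G"
  using ex_has_least_nat[of P _ card] by metis
 have min: "y \<notin> cl (A Un (F - {f}))" if "f \<in> F" for f
 proof
  assume "y \<in> cl (A Un (F - {f}))"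
  then have "P (F - {f})" using F(1) by (auto simp: P_def)
  then have "card F \<le> card (F - {f})" using F(2) by blast
  then show False using that F(1) by (metis P_def card_Diff1_less not_less)
 qed
 have "f \<in> cl (insert y (A Un (F - {f})))" if "f \<in> F" for f
 proof (rule cl_exch[OF _ _ _ min[OF that]])
  have "insert f (A Un (F - {f})) = A Un F" using that by auto
  then show "y \<in> cl (insert f (A Un (F - {f})))" using F(1) by (simp add: P_def)
 qed (use F(1) assms that in \<open>auto simp: P_def\<close>)
 then show thesis using that F(1) min by (auto simp: P_def)
qed

lemma indp_Un:
 assumes "indp cl A (B Un C)" "B Int C = {}" "A \<subseteq> X" "B \<subseteq> X" "C \<subseteq> X"
 shows "indp cl (A Un B) C"
 unfolding indp_def
proof
 fix c assume c: "c \<in> C"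
 have "A Un (B Un C - {c}) = A Un B Un (C - {c})" using assms(2) c by auto
 then show "c \<notin> cl (A Un B Un (C - {c}))" using assms(1) c unfolding indp_def by (metis UnI2)
qed

text \<open>For a dependent \<open>b\<close> in \<open>B\<close>, a minimal \<open>F\<close> in
  \<open>C\<close> supporting the dependence must be empty: by exchange a member of \<open>F\<close>
  would depend on \<open>A\<close>, \<open>B\<close> and the rest of \<open>C\<close>. So
  \<open>b\<close> already depends on \<open>A\<close> and the rest of \<open>B\<close>.\<close>

lemma indp_UnI:
 assumes B: "indp cl A B" and C: "indp cl (A Un B) C" and X: "A \<subseteq> X" "B \<subseteq> X" "C \<subseteq> X"
 shows "indp cl A (B Un C)"
 unfolding indp_def
proof (intro ballI notI)
 fix b assume b: "b \<in> B Un C" "b \<in> cl (A Un (B Un C - {b}))"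
 show False
 proof (cases "b \<in> C")
  case True
  then have "b \<notin> cl (A Un B Un (C - {b}))" using C unfolding indp_def by blast
  moreover have "cl (A Un (B Un C - {b})) \<subseteq> cl (A Un B Un (C - {b}))"
   by (rule cl_mono) (use X in auto)
  ultimately show False using b by auto
 next
  case False
  then have bB: "b \<in> B" using b by auto
  have "cl (A Un (B Un C - {b})) \<subseteq> cl ((A Un (B - {b})) Un C)"
   by (rule cl_mono) (use X in auto)
  then have bC: "b \<in> cl ((A Un (B - {b})) Un C)" using b by auto
  obtain F where F: "F \<subseteq> C" "finite F" "b \<in> cl (A Un (B - {b}) Un F)"
   "\<And>f. f \<in> F ==> f \<in> cl (insert b (A Un (B - {b}) Un (F - {f})))"
   by (rule exch_min[OF _ _ bC]) (use X in auto)
  have "F = {}"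
  proof (rule ccontr)
   assume "F \<noteq> {}"
   then obtain f where f: "f \<in> F" by auto
   have "cl (insert b (A Un (B - {b}) Un (F - {f}))) \<subseteq> cl (A Un B Un (C - {f}))"
    by (rule cl_mono) (use X F(1) bB in auto)
   then show False using F(1,4) f C unfolding indp_def by blast
  qed
  then show False using F(3) B bB unfolding indp_def by auto
 qed
qed

lemma max_indp:
 assumes "indp cl A B" "B \<subseteq> S" "S \<subseteq> X" "A \<subseteq> X"
 obtains B' where "B \<subseteq> B'" "B' \<subseteq> S" "indp cl A B'" "S \<subseteq> cl (A Un B')"
proof -
 define \<S> where "\<S> = {B'. B \<subseteq> B' \<and> B' \<subseteq> S \<and> indp cl A B'}"
 have "\<exists>M\<in>\<S>. \<forall>Z\<in>\<S>. M \<subseteq> Z --> Z = M"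
 proof (rule subset_Zorn_nonempty)
  show "\<S> \<noteq> {}" using assms by (auto simp: \<S>_def)
  fix \<C> assume "\<C> \<noteq> {}" and ch: "subset.chain \<S> \<C>"
  then have sub: "\<C> \<subseteq> \<S>" by (auto simp: subset_chain_def)
  have "indp cl A (\<Union>\<C>)"
  proof (rule indp_finite)
   fix F assume "F \<subseteq> \<Union>\<C>" "finite F"
   then obtain G where "G \<in> \<C>" "F \<subseteq> G"
    using finite_subset_Union_chain[OF _ _ \<open>\<C> \<noteq> {}\<close> ch] by metis
   then show "indp cl A F" using sub indp_subset[of A G F] assms(3,4) by (auto simp: \<S>_def)
  next
   have "G \<subseteq> X" if "G \<in> \<C>" for G using that sub assms(3) by (auto simp: \<S>_def)
   then show "\<Union>\<C> \<subseteq> X" by blast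
  qed (rule assms)
  then show "\<Union>\<C> \<in> \<S>" using sub \<open>\<C> \<noteq> {}\<close> by (auto simp: \<S>_def)
 qed
 then obtain B' where B': "B \<subseteq> B'" "B' \<subseteq> S" "indp cl A B'"
  and max: "\<And>Z. Z \<in> \<S> ==> B' \<subseteq> Z ==> Z = B'" by (auto simp: \<S>_def)
 have "S \<subseteq> cl (A Un B')"
 proof
  fix s assume s: "s \<in> S"
  show "s \<in> cl (A Un B')"
  proof (rule ccontr)
   assume ns: "s \<notin> cl (A Un B')"
   then have "indp cl A (insert s B')"
    using indp_insert[of A B' s] B' assms s by auto
   then have "insert s B' = B'" using max[of "insert s B'"] B' s by (auto simp: \<S>_def)
   then have "s \<in> A Un B'" by auto
   moreover have "A Un B' \<subseteq> X" using B' assms by auto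
   ultimately show False using ns cl_ext[of "A Un B'"] by blast
  qed
 qed
 then show thesis using that B' by auto
qed

lemma indp_empty [simp]: "indp cl A {}"
 by (simp add: indp_def)

lemma basis_of:
 assumes "S \<subseteq> X" "A \<subseteq> X"
 obtains B where "B \<subseteq> S" "indp cl A B" "S \<subseteq> cl (A Un B)"
 by (rule max_indp[of A "{}" S]) (simp_all add: assms that)

lemma infd_infinite_basis:
 assumes "infd cl H" "finite A" "A \<subseteq> H" "B \<subseteq> H" "H \<subseteq> cl (A Un B)"
 shows "infinite B"
proof
 assume "finite B"
 then have "A Un B \<subseteq> H" "finite (A Un B)" using assms by auto
 then have "\<not> H \<subseteq> cl (A Un B)" using assms(1) unfolding infd_def by blast
 then show False using assms(5) by blast
qed

text \<open>A finite generating set would be supported by \<open>A\<close> and finitely many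
  elements of \<open>B\<close>, and some other element of \<open>B\<close> would then depend on
  these.\<close>

lemma infd_cl:
 assumes "infinite B" "indp cl A B" "A \<subseteq> X" "B \<subseteq> X"
 shows "infd cl (cl (A Un B))"
 unfolding infd_def
proof (intro allI impI notI)
 fix F assume F: "F \<subseteq> cl (A Un B)" "finite F" "cl (A Un B) \<subseteq> cl F"
 obtain G where G: "G \<subseteq> B" "finite G" "F \<subseteq> cl (G Un A)"
  using cl_fin_Un[of B A F] F assms by (auto simp: Un_commute)
 obtain b where b: "b \<in> B" "b \<notin> G" using assms(1) G(1,2) by (metis finite_subset subsetI)
 have "b \<in> cl F" using F(3) b cl_ext[of "A Un B"] assms by auto
 moreover have "cl F \<subseteq> cl (G Un A)" by (rule cl_least) (use G assms in auto)
 ultimately show False using indp_notin'[of A B b G] b G assms by (auto simp: Un_commute)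
qed

lemma finite_dim_iff:
 assumes "closed_set X cl H"
 shows "finite_dim H cl \<longleftrightarrow> \<not> infd cl H"
proof
 assume "finite_dim H cl"
 then obtain B where "finite B" "B \<subseteq> H" "cl B = H" by (auto simp: finite_dim_def cl_basis_def)
 then show "\<not> infd cl H" unfolding infd_def by blast
next
 assume "\<not> infd cl H"
 then obtain F where F: "F \<subseteq> H" "finite F" "H \<subseteq> cl F" unfolding infd_def by auto
 have HX: "H \<subseteq> X" using assms by (simp add: closed_set_def)
 obtain B where B: "B \<subseteq> F" "indp cl {} B" "F \<subseteq> cl ({} Un B)"
  using basis_of[of F "{}"] F(1) HX by auto
 have "cl B = H"
 proof (rule subset_antisym)
  show "cl B \<subseteq> H" using cl_least'[OF assms, of B] B F by auto
  have "cl F \<subseteq> cl B" by (rule cl_least) (use B F HX in auto)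
  then show "H \<subseteq> cl B" using F by auto
 qed
 moreover have "finite B" using B(1) F(2) by (rule finite_subset)
 moreover have "B \<subseteq> H" using B(1) F(1) by (rule subset_trans)
 moreover have "\<forall>b\<in>B. b \<notin> cl (B - {b})" using B(2) by (simp add: indp_def)
 ultimately show "finite_dim H cl" unfolding finite_dim_def cl_basis_def by blast
qed

lemma indp_disjoint: "indp cl A B ==> A \<subseteq> X ==> B \<subseteq> X ==> B Int A = {}"
 using indp_notin[of A B] cl_ext[of A] by fastforce

lemma countable_cl:
 assumes fin: "\<And>F. finite F ==> F \<subseteq> X ==> countable (cl F)" and "countable A" "A \<subseteq> X"
 shows "countable (cl A)"
proof -
 have "cl A \<subseteq> (\<Union>F\<in>{F. finite F \<and> F \<subseteq> A}. cl F)"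
  using cl_fin[OF assms(3)] by blast
 moreover have "countable (\<Union>F\<in>{F. finite F \<and> F \<subseteq> A}. cl F)"
 proof (rule countable_UN)
  show "countable {F. finite F \<and> F \<subseteq> A}" using assms(2) by (rule countable_Collect_finite_subset)
  show "countable (cl F)" if "F \<in> {F. finite F \<and> F \<subseteq> A}" for F
   using that assms(3) by (intro fin) auto
 qed
 ultimately show ?thesis by (rule countable_subset)
qed

end

section \<open>Back-and-forth and extension along countable independent sets\<close>

text \<open>The property \<open>P\<close> is known only at the stages of the construction, so a
  finite part of \<open>G\<close> is placed inside a stage. In the applications \<open>P F\<close>
  says that \<open>F\<close> together with a fixed, possibly uncountable, relation is
  elementary.\<close>

lemma back_forth:
 assumes cA: "countable A" and cB: "countable B" and P0: "P {}"
  and forth: "\<And>F a. finite F ==> F \<subseteq> A \<times> B ==> P F ==> a \<in> A ==> \<exists>b\<in>B. P (insert (a, b) F)"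
  and bk: "\<And>F b. finite F ==> F \<subseteq> A \<times> B ==> P F ==> b \<in> B ==> \<exists>a\<in>A. P (insert (a, b) F)"
 obtains G where "G \<subseteq> A \<times> B" "Domain G = A" "Range G = B"
  "\<And>F. finite F ==> F \<subseteq> G ==> \<exists>F'. F \<subseteq> F' \<and> P F'"
proof -
 define Q where "Q F \<longleftrightarrow> finite F \<and> F \<subseteq> A \<times> B \<and> P F" for F
 define R where "R n F F' \<longleftrightarrow> F \<subseteq> F' \<and> (A \<noteq> {} --> from_nat_into A n \<in> Domain F') \<and>
  (B \<noteq> {} --> from_nat_into B n \<in> Range F')" for n F F'
 have "\<exists>F'. Q F' \<and> R n F F'" if F: "Q F" for n F
 proof -
  have "\<exists>F1. Q F1 \<and> F \<subseteq> F1 \<and> (A \<noteq> {} --> from_nat_into A n \<in> Domain F1)"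
  proof (cases "A = {}")
   case True
   then show ?thesis using F by auto
  next
   case False
   then have a: "from_nat_into A n \<in> A" by (rule from_nat_into)
   then obtain b where "b \<in> B" "P (insert (from_nat_into A n, b) F)" using forth[of F] F unfolding Q_def by blast
   then show ?thesis using F a by (intro exI[of _ "insert (from_nat_into A n, b) F"]) (auto simp: Q_def)
  qed
  then obtain F1 where F1: "Q F1" "F \<subseteq> F1" "A \<noteq> {} --> from_nat_into A n \<in> Domain F1" by blast
  show ?thesis
  proof (cases "B = {}")
   case True
   then show ?thesis using F1 by (auto simp: R_def)
  next
   case False
   then have b: "from_nat_into B n \<in> B" by (rule from_nat_into)
   then obtain a where "a \<in> A" "P (insert (a, from_nat_into B n) F1)" using bk[of F1] F1 unfolding Q_def by blast
   then show ?thesis using F1 b by (intro exI[of _ "insert (a, from_nat_into B n) F1"]) (auto simp: Q_def R_def)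
  qed
 qed
 moreover have "Q {}" using P0 by (simp add: Q_def)
 ultimately have "\<exists>f. \<forall>n. Q (f n) \<and> R n (f n) (f (Suc n))"
  using dependent_nat_choice[of "\<lambda>_. Q" R] by blast
 then obtain f where f: "\<And>n. Q (f n)" "\<And>n. R n (f n) (f (Suc n))" by blast
 have mono: "f m \<subseteq> f n" if "m \<le> n" for m n
 proof (rule lift_Suc_mono_le[OF _ that])
  show "f n \<subseteq> f (Suc n)" for n using f(2)[of n] by (simp add: R_def)
 qed
 show thesis
 proof (rule that[of "\<Union>(range f)"])
  show G: "\<Union>(range f) \<subseteq> A \<times> B" using f(1) by (auto simp: Q_def)
  have "a \<in> Domain (\<Union>(range f))" if aA: "a \<in> A" for a
  proof -
   obtain n where "from_nat_into A n = a" using from_nat_into_surj[OF cA aA] by blast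
   then have "a \<in> Domain (f (Suc n))" using f(2)[of n] aA by (auto simp: R_def)
   then show ?thesis by blast
  qed
  then show "Domain (\<Union>(range f)) = A" using G by blast
  have "b \<in> Range (\<Union>(range f))" if bB: "b \<in> B" for b
  proof -
   obtain n where "from_nat_into B n = b" using from_nat_into_surj[OF cB bB] by blast
   then have "b \<in> Range (f (Suc n))" using f(2)[of n] bB by (auto simp: R_def)
   then show ?thesis by blast
  qed
  then show "Range (\<Union>(range f)) = B" using G by blast
  fix F assume F: "finite F" "F \<subseteq> \<Union>(range f)"
  have "f m \<subseteq> f n \<or> f n \<subseteq> f m" for m n using mono nat_le_linear by blast
  then have "subset.chain UNIV (range f)" unfolding subset_chain_def by blast
  then obtain n where "F \<subseteq> f n"
   using finite_subset_Union_chain[OF F, of UNIV] by blast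
  then show "\<exists>F'. F \<subseteq> F' \<and> P F'" using f(1) by (auto simp: Q_def)
 qed
qed

lemma pel_Image_singleton: "pel L A B G ==> (a, b) \<in> G ==> G `` {a} = {b}"
 using pel_inj by fastforce

lemma pel_Image_Id: "pel L A B G ==> Id_on S \<subseteq> G ==> G `` S = S"
 using pel_inj by fastforce

lemma pel_Range_eq: "pel L A B G ==> Range G = (\<lambda>a. SOME b. (a, b) \<in> G) ` Domain G"
proof -
 assume G: "pel L A B G"
 have "(SOME b. (a, b) \<in> G) = b" if "(a, b) \<in> G" for a b
  using pel_inj[OF G that] that by (metis (mono_tags, lifting) G pel_inj someI_ex)
 then show "Range G = (\<lambda>a. SOME b. (a, b) \<in> G) ` Domain G" by force
qed

lemma pel_countable_Range: "pel L A B G ==> countable (Domain G) ==> countable (Range G)"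
 by (simp add: pel_Range_eq)

lemma pel_finite_dom: "pel L A B G ==> finite (Domain G) ==> finite G"
proof -
 assume G: "pel L A B G" "finite (Domain G)"
 then have "finite (Range G)" by (simp add: pel_Range_eq)
 then have "finite (Domain G \<times> Range G)" using G by simp
 then show "finite G" by (rule rev_finite_subset) auto
qed

abbreviation U :: "('f, 'r, 'a) pstruct \<Rightarrow> 'a set" where "U p \<equiv> univ (fst p)"

definition gr :: "('a \<Rightarrow> 'b) \<Rightarrow> 'a set \<Rightarrow> ('a \<times> 'b) set" where "gr f S = (\<lambda>x. (x, f x)) ` S"

lemma gr_simps [simp]: "Domain (gr f S) = S" "Range (gr f S) = f ` S" "(x, y) \<in> gr f S \<longleftrightarrow> x \<in> S \<and> y = f x"
 by (auto simp: gr_def)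

text \<open>The axioms for maps between two members of a family, with relations in place of
  enumerations. The family may be \<open>M\<close> alone or all \<open>fgood\<close> structures, so
  one proof serves both for automorphisms and for isomorphisms between different members.
  \<open>qm0\<close> (agreement on sentences) starts a back-and-forth between different structures;
  \<open>qm1\<close> is one implication, its converse comes from the converse relation. Infinite
  dimension is assumed of individual sets, as \<open>infd\<close>, where room is needed.\<close>

locale qmc =
 fixes L :: "('f, 'r) lang" and GG :: "('f, 'r, 'a) pstruct set"
 assumes pgi: "p \<in> GG ==> pregeo (U p) (snd p)"
  and qm0: "p \<in> GG ==> q \<in> GG ==> pel L (fst p) (fst q) {}"
  and qm1: "p \<in> GG ==> q \<in> GG ==> pel L (fst p) (fst q) G ==> (a, a') \<in> G ==> B \<subseteq> G ==> finite B ==>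
   a \<in> snd p (Domain B) ==> a' \<in> snd q (Range B)"
  and qm3: "p \<in> GG ==> finite F ==> F \<subseteq> U p ==> countable (snd p F)"
  and qm4: "p \<in> GG ==> q \<in> GG ==> pel L (fst p) (fst q) G ==> closed_set (U p) (snd p) (Domain G) ==>
   closed_set (U q) (snd q) (Range G) ==> countable (Domain G) ==> a \<in> U p - Domain G ==> a' \<in> U q - Range G ==>
   pel L (fst p) (fst q) (insert (a, a') G)"
  and qm5: "p \<in> GG ==> q \<in> GG ==> pel L (fst p) (fst q) (G Un B) ==> finite B ==>
   G = {} \<or> closed_set (U p) (snd p) (Domain G) \<and> closed_set (U q) (snd q) (Range G) \<and> countable (Domain G) ==>
   a \<in> snd p (Domain (G Un B)) ==> \<exists>a'. pel L (fst p) (fst q) (insert (a, a') (G Un B))"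
begin

abbreviation el :: "('f, 'r, 'a) pstruct \<Rightarrow> ('f, 'r, 'a) pstruct \<Rightarrow> ('a \<times> 'a) set \<Rightarrow> bool" where
 "el p q G \<equiv> pel L (fst p) (fst q) G"

abbreviation clo :: "('f, 'r, 'a) pstruct \<Rightarrow> 'a set \<Rightarrow> bool" where
 "clo p H \<equiv> closed_set (U p) (snd p) H"

text \<open>An isomorphism between closed sets, kept as a relation. That it respects closures inside
  its domain is a consequence of \<open>qm1\<close> (\<open>ciso_image\<close>).\<close>

definition ciso :: "('f, 'r, 'a) pstruct \<Rightarrow> ('f, 'r, 'a) pstruct \<Rightarrow> ('a \<times> 'a) set \<Rightarrow> bool" where
 "ciso p q G \<longleftrightarrow> el p q G \<and> clo p (Domain G) \<and> clo q (Range G)"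

lemma ciso_el: "ciso p q G ==> el p q G" and ciso_Domain: "ciso p q G ==> clo p (Domain G)"
 and ciso_Range: "ciso p q G ==> clo q (Range G)"
 by (auto simp: ciso_def)

lemma ciso_converse: "ciso p q G ==> ciso q p (G\<inverse>)"
 by (simp add: ciso_def)

lemma ciso_Id_on: "clo p H ==> ciso p p (Id_on H)"
 by (auto simp: ciso_def closed_set_def intro!: pel_Id_on)

lemma el_U: "el p q G ==> Domain G \<subseteq> U p" "el p q G ==> Range G \<subseteq> U q"
 using pel_univ by blast+

lemma cl_imp:
 assumes p: "p \<in> GG" "q \<in> GG" and G: "el p q G" "(a, a') \<in> G" "B \<subseteq> G" and a: "a \<in> snd p (Domain B)"
 shows "a' \<in> snd q (Range B)"
proof -
 interpret P: pregeo "U p" "snd p" by (rule pgi) fact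
 interpret Q: pregeo "U q" "snd q" by (rule pgi) fact
 have BU: "Domain B \<subseteq> U p" "Range B \<subseteq> U q"
  using el_U[OF G(1)] Domain_mono[OF G(3)] Range_mono[OF G(3)] by simp_all
 obtain F where F: "F \<subseteq> Domain B" "finite F" "a \<in> snd p F"
  using P.cl_fin[OF BU(1) a] by blast
 have "F \<subseteq> fst ` B" using F(1) by force
 then obtain B0 where B0: "B0 \<subseteq> B" "finite B0" "F = fst ` B0"
  using finite_subset_image[OF F(2)] by metis
 then have "a \<in> snd p (Domain B0)" using F(3) by (simp add: Domain_fst)
 then have "a' \<in> snd q (Range B0)" using qm1[OF p G(1,2) _ B0(2)] B0(1) G(3) by blast
 moreover have "snd q (Range B0) \<subseteq> snd q (Range B)"
  by (rule Q.cl_mono) (use B0 BU in auto)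
 ultimately show ?thesis by blast
qed

lemma cl_iff:
 assumes "p \<in> GG" "q \<in> GG" "el p q G" "(a, a') \<in> G" "B \<subseteq> G"
 shows "a \<in> snd p (Domain B) \<longleftrightarrow> a' \<in> snd q (Range B)"
 using cl_imp[OF assms] cl_imp[OF assms(2,1), of "G\<inverse>" a' a "B\<inverse>"] assms(3-5) by auto

lemma cl_iff_Image:
 assumes "p \<in> GG" "q \<in> GG" "el p q G" "(a, a') \<in> G" "S \<subseteq> Domain G"
 shows "a \<in> snd p S \<longleftrightarrow> a' \<in> snd q (G `` S)"
proof -
 have "Domain (G Int S \<times> UNIV) = S" "Range (G Int S \<times> UNIV) = G `` S" using assms(5) by auto
 then show ?thesis using cl_iff[OF assms(1-4), of "G Int S \<times> UNIV"] by simp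
qed

lemma cl_iff_Id:
 assumes "p \<in> GG" "el p p G" "(a, a') \<in> G" "Id_on S \<subseteq> G"
 shows "a \<in> snd p S \<longleftrightarrow> a' \<in> snd p S"
 using cl_iff[OF assms(1,1,2,3,4)] by simp

lemma ciso_image:
 assumes p: "p \<in> GG" "q \<in> GG" and G: "ciso p q G" and S: "S \<subseteq> Domain G"
 shows "G `` snd p S = snd q (G `` S)"
proof -
 interpret P: pregeo "U p" "snd p" by (rule pgi) fact
 interpret Q: pregeo "U q" "snd q" by (rule pgi) fact
 have "snd p S \<subseteq> Domain G" using P.cl_least'[OF ciso_Domain[OF G] S] .
 moreover have "snd q (G `` S) \<subseteq> Range G" 
  by (rule Q.cl_least'[OF ciso_Range[OF G]]) auto
 ultimately show ?thesis using cl_iff_Image[OF p ciso_el[OF G] _ S] by blast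
qed

lemma ciso_restrict:
 assumes p: "p \<in> GG" "q \<in> GG" and G: "ciso p q G" and S: "S \<subseteq> Domain G"
 shows "ciso p q (G Int snd p S \<times> UNIV)" "Domain (G Int snd p S \<times> UNIV) = snd p S"
  "Range (G Int snd p S \<times> UNIV) = snd q (G `` S)"
proof -
 interpret P: pregeo "U p" "snd p" by (rule pgi) fact
 interpret Q: pregeo "U q" "snd q" by (rule pgi) fact
 have sub: "snd p S \<subseteq> Domain G" using P.cl_least'[OF ciso_Domain[OF G] S] .
 then show D: "Domain (G Int snd p S \<times> UNIV) = snd p S" by auto
 show R: "Range (G Int snd p S \<times> UNIV) = snd q (G `` S)"
  using ciso_image[OF assms] by auto
 have "S \<subseteq> U p" "G `` S \<subseteq> U q" using el_U[OF ciso_el[OF G]] S by auto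
 then show "ciso p q (G Int snd p S \<times> UNIV)"
  unfolding ciso_def D R using P.closed_cl Q.closed_cl pel_subset[OF ciso_el[OF G], of "G Int snd p S \<times> UNIV"] by auto
qed

lemma ciso_comp:
 assumes "ciso p q G" "ciso q r H" "Range G = Domain H"
 shows "ciso p r (G O H)" "Domain (G O H) = Domain G" "Range (G O H) = Range H"
proof -
 show D: "Domain (G O H) = Domain G" and R: "Range (G O H) = Range H" using assms(3) by blast+
 show "ciso p r (G O H)" unfolding ciso_def D R
  using assms(1,2) pel_comp unfolding ciso_def by blast
qed

text \<open>During the back-and-forth only finitely many pairs are added to the fixed countable
  isomorphism \<open>G\<close>, so \<open>qm5\<close> applies at every stage; \<open>qm1\<close>
  shows that the values it supplies lie in the right closure.\<close>

lemma bf: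
 assumes p: "p \<in> GG" "q \<in> GG" and el: "el p q (G Un B)" and fin: "finite B"
  and G: "G = {} \<or> ciso p q G \<and> countable (Domain G)"
 obtains G' where "ciso p q G'" "G Un B \<subseteq> G'" "Domain G' = snd p (Domain (G Un B))"
  "Range G' = snd q (Range (G Un B))"
proof -
 interpret P: pregeo "U p" "snd p" by (rule pgi) fact
 interpret Q: pregeo "U q" "snd q" by (rule pgi) fact
 note U = el_U[OF el]
 have cd: "countable (Domain (G Un B))"
  using G fin by (auto simp: Domain_Un_eq finite_Domain countable_finite)
 have cr: "countable (Range (G Un B))" by (rule pel_countable_Range[OF el cd])
 have G': "G = {} \<or> clo p (Domain G) \<and> clo q (Range G) \<and> countable (Domain G)"
  "G\<inverse> = {} \<or> clo q (Domain (G\<inverse>)) \<and> clo p (Range (G\<inverse>)) \<and> countable (Domain (G\<inverse>))"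
  using G pel_countable_Range by (auto simp: ciso_def)
 let ?A = "snd p (Domain (G Un B))" and ?B = "snd q (Range (G Un B))"
 obtain K where K: "K \<subseteq> ?A \<times> ?B" "Domain K = ?A" "Range K = ?B"
  "\<And>F. finite F ==> F \<subseteq> K ==> \<exists>F'. F \<subseteq> F' \<and> el p q (G Un B Un F')"
 proof (rule back_forth[of ?A ?B "\<lambda>F. el p q (G Un B Un F)"])
  show "countable ?A" by (rule P.countable_cl[OF qm3[OF p(1)] cd U(1)])
  show "countable ?B" by (rule Q.countable_cl[OF qm3[OF p(2)] cr U(2)])
  show "el p q (G Un B Un {})" using el by simp
 next
  fix F a assume F: "finite F" "F \<subseteq> ?A \<times> ?B" "el p q (G Un B Un F)" and a: "a \<in> ?A"
  have "?A \<subseteq> snd p (Domain (G Un (B Un F)))"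
   by (rule P.cl_mono) (use el_U[OF F(3)] in auto)
  moreover have "el p q (G Un (B Un F))" using F(3) by (simp add: Un_assoc)
  ultimately obtain b where b: "el p q (insert (a, b) (G Un (B Un F)))"
   using qm5[OF p, of G "B Un F" a] a F(1) fin G' by auto
  then have "b \<in> ?B" using cl_imp[OF p b, of a b "G Un B"] a by auto
  then show "\<exists>b\<in>?B. el p q (G Un B Un insert (a, b) F)" using b by (auto simp: Un_assoc)
 next
  fix F b assume F: "finite F" "F \<subseteq> ?A \<times> ?B" "el p q (G Un B Un F)" and b: "b \<in> ?B"
  have "?B \<subseteq> snd q (Domain (G\<inverse> Un (B Un F)\<inverse>))"
   by (rule Q.cl_mono) (use el_U[OF F(3)] in auto)
  moreover have "el q p (G\<inverse> Un (B Un F)\<inverse>)"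
   using F(3) pel_converse[of L "fst q" "fst p" "G Un B Un F"] by (simp add: converse_Un Un_assoc)
  ultimately obtain a where a: "el q p (insert (b, a) (G\<inverse> Un (B Un F)\<inverse>))"
   using qm5[OF p(2,1), of "G\<inverse>" "(B Un F)\<inverse>" b] b F(1) fin G' by auto
  then have "a \<in> ?A" 
   using cl_imp[OF p(2,1) a, of b a "(G Un B)\<inverse>"] b unfolding Domain_converse Range_converse by auto
  moreover have "el p q ((insert (b, a) (G\<inverse> Un (B Un F)\<inverse>))\<inverse>)" using a by simp
  moreover have "(insert (b, a) (G\<inverse> Un (B Un F)\<inverse>))\<inverse> = G Un B Un insert (a, b) F" by auto
  ultimately show "\<exists>a\<in>?A. el p q (G Un B Un insert (a, b) F)" by auto
 qed blast
 have elK: "el p q (G Un B Un K)"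
 proof (rule pel_finite)
  fix F assume F: "F \<subseteq> G Un B Un K" "finite F"
  then obtain F' where "F Int K \<subseteq> F'" "el p q (G Un B Un F')" using K(4)[of "F Int K"] by auto
  then show "el p q F" using pel_subset[of L _ _ "G Un B Un F'" F] F by blast
 qed
 have "Domain (G Un B) \<subseteq> ?A" "Range (G Un B) \<subseteq> ?B" using P.cl_ext[OF U(1)] Q.cl_ext[OF U(2)] by blast+
 then have D: "Domain (G Un B Un K) = ?A" and R: "Range (G Un B Un K) = ?B" using K by blast+
 have "ciso p q (G Un B Un K)"
  unfolding ciso_def D R using elK P.closed_cl[OF U(1)] Q.closed_cl[OF U(2)] by simp
 then show thesis using that[of "G Un B Un K"] D R by blast
qed

text \<open>\<open>qm4\<close> adjoins one pair of generic points, and \<open>bf\<close> closes off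
  the result.\<close>

lemma step:
 assumes p: "p \<in> GG" "q \<in> GG" and G: "ciso p q G" "countable (Domain G)"
  and a: "a \<in> U p" "a \<notin> Domain G" "a' \<in> U q" "a' \<notin> Range G"
 obtains G' where "ciso p q G'" "insert (a, a') G \<subseteq> G'" "Domain G' = snd p (insert a (Domain G))"
  "Range G' = snd q (insert a' (Range G))"
proof -
 have "el p q (G Un {(a, a')})" using qm4[OF p, of G a a'] G a by (auto simp: ciso_def)
 then obtain G' where "ciso p q G'" "G Un {(a, a')} \<subseteq> G'" "Domain G' = snd p (Domain (G Un {(a, a')}))"
  "Range G' = snd q (Range (G Un {(a, a')}))"
  using bf[OF p, of G "{(a, a')}"] G by blast
 then show thesis using that[of G'] by (simp add: Un_commute)
qed

lemma cl_fin_el: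
 assumes p: "p \<in> GG" "q \<in> GG" and el: "el p q B" "finite B"
 obtains G where "ciso p q G" "B \<subseteq> G" "Domain G = snd p (Domain B)" "Range G = snd q (Range B)"
 using bf[OF p, of "{}" B] assms by auto

end

lemma nat_choice:
 assumes "P 0 x" "\<And>n x. P n x ==> \<exists>y. P (Suc n) y \<and> Q n x y"
 shows "\<exists>f. (\<forall>n. P n (f n)) \<and> (\<forall>n::nat. Q n (f n) (f (Suc n)))"
proof -
 have "\<exists>f. \<forall>n. P n (f n) \<and> Q n (f n) (f (Suc n))"
  by (rule dependent_nat_choice) (use assms in blast)+
 then show ?thesis by blast
qed

lemma pel_UN_nat:
 assumes "\<And>n. pel L A B (f n)" "\<And>n::nat. f n \<subseteq> f (Suc n)"
 shows "pel L A B (\<Union>(range f))"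
proof (rule pel_chain)
 have "f m \<subseteq> f n" if "m \<le> n" for m n by (rule lift_Suc_mono_le[of f, OF assms(2) that])
 then have "f m \<subseteq> f n \<or> f n \<subseteq> f m" for m n using nat_le_linear by blast
 then show "G \<subseteq> H \<or> H \<subseteq> G" if "G \<in> range f" "H \<in> range f" for G H
  using that by blast
qed (use assms(1) in auto)

context qmc begin

text \<open>\<open>step\<close> is iterated along an enumeration of \<open>X\<close>. Independence
  on both sides keeps each new point outside the closed set reached so far, as \<open>qm4\<close>
  demands.\<close>

lemma cext:
 assumes p: "p \<in> GG" "q \<in> GG" and G: "ciso p q G" "countable (Domain G)"
  and X: "X \<subseteq> U p" "countable X" "indp (snd p) (Domain G) X"
  and j: "inj_on j X" "j ` X \<subseteq> U q" "indp (snd q) (Range G) (j ` X)"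
 obtains G' where "ciso p q G'" "G \<subseteq> G'" "gr j X \<subseteq> G'" "Domain G' = snd p (Domain G Un X)"
  "Range G' = snd q (Range G Un j ` X)"
proof (cases "X = {}")
 case True
 then show ?thesis using that[of G] G(1) by (auto simp: ciso_def closed_set_def gr_def)
next
 case False
 interpret P: pregeo "U p" "snd p" by (rule pgi) fact
 interpret Q: pregeo "U q" "snd q" by (rule pgi) fact
 note DR = el_U[OF ciso_el[OF G(1)]]
 define Y where "Y n = from_nat_into X ` {..<n}" for n
 have YX: "Y n \<subseteq> X" for n using from_nat_into[OF False] by (auto simp: Y_def)
 have jY: "j ` Y n \<subseteq> U q" for n using YX[of n] j(2) by blast
 have YS: "Y (Suc n) = insert (from_nat_into X n) (Y n)" for n
  by (auto simp: Y_def lessThan_Suc)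
 have Ymono: "Y m \<subseteq> Y n" if "m \<le> n" for m n using that by (auto simp: Y_def)
 define I where "I n K \<longleftrightarrow> ciso p q K \<and> G \<subseteq> K \<and> gr j (Y n) \<subseteq> K \<and> Domain K = snd p (Domain G Un Y n) \<and>
  Range K = snd q (Range G Un j ` Y n)" for n K
 have I0: "I 0 G" using G(1) by (auto simp: I_def Y_def gr_def ciso_def closed_set_def)
 have IS: "\<exists>K'. I (Suc n) K' \<and> K \<subseteq> K'" if K: "I n K" for n K
 proof (cases "from_nat_into X n \<in> Y n")
  case True
  then have "Y (Suc n) = Y n" using YS[of n] by (simp add: insert_absorb)
  then have "I (Suc n) K" using K by (simp add: I_def)
  then show ?thesis by blast
 next
  case new: False
  let ?x = "from_nat_into X n"
  have x: "?x \<in> X" by (rule from_nat_into[OF False])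
  have cisoK: "ciso p q K" using K by (simp add: I_def)
  have cK: "countable (Domain K)"
   using K YX[of n] X(1,2) G DR P.countable_cl[OF qm3[OF p(1)], of "Domain G Un Y n"]
   by (auto simp: I_def intro: countable_subset)
  have 1: "?x \<notin> Domain K"
   using P.indp_notin'[OF X(3) DR(1) X(1) x, of "Y n"] YX new K by (auto simp: I_def)
  have "j ?x \<notin> j ` Y n" using new x YX[of n] j(1) by (auto dest: inj_onD)
  then have 2: "j ?x \<notin> Range K"
   using Q.indp_notin'[OF j(3) DR(2) j(2), of "j ?x" "j ` Y n"] x YX[of n] K by (auto simp: I_def)
  obtain K' where K': "ciso p q K'" "insert (?x, j ?x) K \<subseteq> K'" "Domain K' = snd p (insert ?x (Domain K))"
   "Range K' = snd q (insert (j ?x) (Range K))"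
   using step[OF p cisoK cK _ 1 _ 2] x X(1) j(2) by blast
  have "Domain K' = snd p (snd p (Domain G Un Y n) Un {?x})" using K' K by (simp add: I_def)
  also have "\<dots> = snd p (Domain G Un Y n Un {?x})"
   by (rule P.cl_Un_cl) (use DR YX[of n] X x in auto)
  finally have D: "Domain K' = snd p (Domain G Un Y (Suc n))" by (simp add: YS)
  have "Range K' = snd q (snd q (Range G Un j ` Y n) Un {j ?x})" using K' K by (simp add: I_def)
  also have "\<dots> = snd q (Range G Un j ` Y n Un {j ?x})"
   by (rule Q.cl_Un_cl) (use DR jY[of n] j x in auto)
  finally have R: "Range K' = snd q (Range G Un j ` Y (Suc n))" by (simp add: YS)
  have "gr j (Y (Suc n)) = insert (?x, j ?x) (gr j (Y n))" by (simp add: YS gr_def)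
  then have "gr j (Y (Suc n)) \<subseteq> K'" "G \<subseteq> K'" "K \<subseteq> K'" using K K'(2) unfolding I_def by blast+
  then have "I (Suc n) K'" unfolding I_def using K'(1) D R by blast
  then show ?thesis using \<open>K \<subseteq> K'\<close> by blast
 qed
 obtain f where f: "\<And>n. I n (f n)" "\<And>n. f n \<subseteq> f (Suc n)"
  using nat_choice[of I G "\<lambda>_ K K'. K \<subseteq> K'", OF I0 IS] by blast
 have mono: "f m \<subseteq> f n" if "m \<le> n" for m n
  by (rule lift_Suc_mono_le[of f, OF f(2) that])
 have Xc: "\<exists>n. F \<subseteq> Y n" if "finite F" "F \<subseteq> X" for F
  using that
 proof (induction rule: finite_induct)
  case (insert x F)
  then obtain n where n: "F \<subseteq> Y n" by auto
  obtain m where m: "from_nat_into X m = x" using from_nat_into_surj[OF X(2)] insert by blast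
  have "insert x F \<subseteq> Y (Suc (max n m))"
   using n m Ymono[of n "Suc (max n m)"] by (auto simp: Y_def)
  then show ?case by blast
 qed auto
 let ?K = "\<Union>(range f)"
 have el: "el p q ?K"
  by (rule pel_UN_nat) (use f in \<open>simp_all add: I_def ciso_def\<close>)
 have D: "Domain ?K = snd p (Domain G Un X)"
 proof
  show "Domain ?K \<subseteq> snd p (Domain G Un X)"
  proof
   fix a assume "a \<in> Domain ?K"
   then obtain n where "a \<in> Domain (f n)" by blast
   then have "a \<in> snd p (Domain G Un Y n)" using f(1)[of n] by (simp add: I_def)
   moreover have "snd p (Domain G Un Y n) \<subseteq> snd p (Domain G Un X)"
    by (rule P.cl_mono) (use YX[of n] DR X in auto)
   ultimately show "a \<in> snd p (Domain G Un X)" by blast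
  qed
  show "snd p (Domain G Un X) \<subseteq> Domain ?K"
  proof
   fix a assume "a \<in> snd p (Domain G Un X)"
   then obtain F where F: "F \<subseteq> X" "finite F" "{a} \<subseteq> snd p (F Un Domain G)"
    using P.cl_fin_Un[of X "Domain G" "{a}"] X(1) DR(1) by (auto simp: Un_commute)
   obtain n where n: "F \<subseteq> Y n" using Xc[OF F(2,1)] by blast
   have "snd p (F Un Domain G) \<subseteq> snd p (Domain G Un Y n)"
    by (rule P.cl_mono) (use YX[of n] n DR X in auto)
   then have "a \<in> Domain (f n)" using F f(1)[of n] by (auto simp: I_def)
   then show "a \<in> Domain ?K" by blast
  qed
 qed
 have R: "Range ?K = snd q (Range G Un j ` X)"
 proof
  show "Range ?K \<subseteq> snd q (Range G Un j ` X)"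
  proof
   fix a assume "a \<in> Range ?K"
   then obtain n where "a \<in> Range (f n)" by blast
   then have "a \<in> snd q (Range G Un j ` Y n)" using f(1)[of n] by (simp add: I_def)
   moreover have "snd q (Range G Un j ` Y n) \<subseteq> snd q (Range G Un j ` X)"
    by (rule Q.cl_mono) (use YX[of n] jY[of n] DR j in auto)
   ultimately show "a \<in> snd q (Range G Un j ` X)" by blast
  qed
  show "snd q (Range G Un j ` X) \<subseteq> Range ?K"
  proof
   fix a assume "a \<in> snd q (Range G Un j ` X)"
   then obtain F where F: "F \<subseteq> j ` X" "finite F" "{a} \<subseteq> snd q (F Un Range G)"
    using Q.cl_fin_Un[of "j ` X" "Range G" "{a}"] j(2) DR(2) by (auto simp: Un_commute)
   then obtain F0 where F0: "F0 \<subseteq> X" "finite F0" "F = j ` F0"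
    using finite_subset_image[OF F(2,1)] by blast
   obtain n where "F0 \<subseteq> Y n" using Xc[OF F0(2,1)] by blast
   then have n: "F \<subseteq> j ` Y n" using F0(3) by blast
   have "snd q (F Un Range G) \<subseteq> snd q (Range G Un j ` Y n)"
    by (rule Q.cl_mono) (use jY[of n] n DR j in auto)
   then have "a \<in> Range (f n)" using F f(1)[of n] by (auto simp: I_def)
   then show "a \<in> Range ?K" by blast
  qed
 qed
 have "Domain G Un X \<subseteq> U p" "Range G Un j ` X \<subseteq> U q" using DR X(1) j(2) by simp_all
 then have cK: "ciso p q ?K" unfolding ciso_def D R
  using el P.closed_cl[of "Domain G Un X"] Q.closed_cl[of "Range G Un j ` X"] by blast
 have "G \<subseteq> f 0" using f(1)[of 0] by (simp add: I_def)
 then have GK: "G \<subseteq> ?K" by blast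
 have jK: "gr j X \<subseteq> ?K"
 proof
  fix z assume "z \<in> gr j X"
  then obtain x where x: "z = (x, j x)" "x \<in> X" by (auto simp: gr_def)
  obtain n where "{x} \<subseteq> Y n" using Xc[of "{x}"] x(2) by blast
  then have "z \<in> gr j (Y n)" using x by (auto simp: gr_def)
  then have "z \<in> f n" using f(1)[of n] unfolding I_def by blast
  then show "z \<in> ?K" by blast
 qed
 show thesis by (rule that[OF cK GK jK D R])
qed

end

section \<open>Isolation of types over countable closed sets\<close>

lemma not_pel_finite: "\<not> pel L A B G ==> \<exists>F\<subseteq>G. finite F \<and> \<not> pel L A B F"
 by (rule ccontr) (use pel_finite in \<open>metis (no_types)\<close>)

lemma gr_id: "gr id S = Id_on S"
 by (auto simp: gr_def)

lemma Id_on_subset_mono: "A \<subseteq> B ==> Id_on A \<subseteq> Id_on B"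
 by auto

lemma Domain_restrict: "A \<subseteq> Domain G ==> Domain (G Int A \<times> UNIV) = A"
 by auto

context qmc begin

lemma cext_id:
 assumes p: "p \<in> GG" and G: "ciso p p G" "countable (Domain G)"
  and X: "X \<subseteq> U p" "countable X" "indp (snd p) (Domain G) X" "indp (snd p) (Range G) X"
 shows "\<exists>G'. ciso p p G' \<and> G \<subseteq> G' \<and> Id_on X \<subseteq> G' \<and> Domain G' = snd p (Domain G Un X) \<and>
  Range G' = snd p (Range G Un X)"
proof -
 have X': "id ` X \<subseteq> U p" "indp (snd p) (Range G) (id ` X)" using X by simp_all
 obtain G' where "ciso p p G'" "G \<subseteq> G'" "gr id X \<subseteq> G'" "Domain G' = snd p (Domain G Un X)"
  "Range G' = snd p (Range G Un id ` X)"
  by (rule cext[OF p p G X(1-3) inj_on_id X'])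
 then show ?thesis by (intro exI[of _ G']) (simp add: gr_id)
qed

text \<open>A diagonal argument: an automorphism of \<open>H\<close> that extends to the closure of \<open>H \<union> e\<close> sends
 \<open>e\<close> to one of only countably many tuples, while the automorphisms constructed below would
 produce a type over \<open>H\<close> that none of these tuples realizes.\<close>

lemma type_stabilizer_open:
 assumes p: "p \<in> GG" and H: "clo p H" "countable H" and e: "finite e" "e \<subseteq> U p"
 shows "\<exists>h\<subseteq>H. finite h \<and> (\<forall>\<alpha>. ciso p p \<alpha> --> Domain \<alpha> = H --> Range \<alpha> = H --> Id_on h \<subseteq> \<alpha> -->
  el p p (Id_on e Un \<alpha>))"
proof (rule ccontr)
 interpret P: pregeo "U p" "snd p" by (rule pgi) fact
 define aut where "aut \<alpha> \<longleftrightarrow> ciso p p \<alpha> \<and> Domain \<alpha> = H \<and> Range \<alpha> = H" for \<alpha>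
 assume neg: "\<not> ?thesis"
 have bad: "\<exists>\<gamma>. aut \<gamma> \<and> Id_on h \<subseteq> \<gamma> \<and> \<not> el p p (Id_on e Un \<gamma>)" if h: "finite h" "h \<subseteq> H" for h
 proof (rule ccontr)
  assume "\<not> ?thesis"
  then have "\<forall>\<alpha>. ciso p p \<alpha> --> Domain \<alpha> = H --> Range \<alpha> = H --> Id_on h \<subseteq> \<alpha> --> el p p (Id_on e Un \<alpha>)"
   unfolding aut_def by simp
  with h neg show False by blast
 qed
 have HU: "H \<subseteq> U p" using H by (simp add: closed_set_def)
 let ?D = "snd p (H Un e)"
 have cD: "countable ?D"
  by (rule P.countable_cl[OF qm3[OF p]]) (use H HU e in \<open>auto simp: countable_finite\<close>)
 define RR where "RR = {R. finite R \<and> R \<subseteq> e \<times> ?D \<and> Domain R = e}"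
 have cRR: "countable RR"
  by (rule countable_subset[OF _ countable_Collect_finite_subset[of "e \<times> ?D"]])
   (use cD e in \<open>auto simp: RR_def countable_finite\<close>)
 have eD: "e \<subseteq> ?D" using P.cl_ext[of "H Un e"] HU e by auto
 have "Id_on e \<in> RR" using e eD by (auto simp: RR_def Id_on_def)
 then have RRne: "RR \<noteq> {}" by auto
 \<comment> \<open>A state consists of an automorphism of \<open>H\<close> and a finite set on which
   it is committed. Stage \<open>n\<close> makes the committed part incompatible with the
   \<open>n\<close>-th candidate for the image of \<open>e\<close>, and puts the \<open>n\<close>-th
   element of \<open>H\<close> into domain and range, so that the limit is again an automorphism of
   \<open>H\<close>.\<close>
 define Q where "Q n s s' \<longleftrightarrow> snd s \<subseteq> snd s' \<and> fst s Int snd s \<times> UNIV \<subseteq> fst s' \<and>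
  (\<exists>\<beta>\<subseteq>fst s' Int snd s' \<times> UNIV. \<not> el p p (from_nat_into RR n Un \<beta>)) \<and>
  (H \<noteq> {} --> from_nat_into H n \<in> snd s' \<and> (\<exists>u\<in>snd s'. (u, from_nat_into H n) \<in> fst s'))"
  for n :: nat and s s' :: "('a \<times> 'a) set \<times> 'a set"
 define S where "S s \<longleftrightarrow> aut (fst s) \<and> finite (snd s) \<and> snd s \<subseteq> H" for s :: "('a \<times> 'a) set \<times> 'a set"
 have S0: "S (Id_on H, {})" using H HU by (auto simp: S_def aut_def ciso_Id_on)
 have SS: "\<exists>s'. S s' \<and> Q n s s'" if s: "S s" for n s
 proof -
  obtain \<alpha> h where s_eq: "s = (\<alpha>, h)" by force
  have \<alpha>: "aut \<alpha>" and h: "finite h" "h \<subseteq> H" using s by (auto simp: S_def s_eq)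
  have el\<alpha>: "el p p \<alpha>" using \<alpha> by (auto simp: aut_def ciso_def)
  let ?R = "from_nat_into RR n"
  have "?R \<in> RR" by (rule from_nat_into[OF RRne])
  then have DR: "Domain ?R = e" by (simp add: RR_def)
  obtain \<gamma> where \<gamma>: "aut \<gamma>" "Id_on h \<subseteq> \<gamma>" "\<not> el p p (Id_on e Un \<gamma>)" using bad[OF h] by blast
  have el\<gamma>: "el p p \<gamma>" using \<gamma> by (auto simp: aut_def ciso_def)
  obtain F where F: "F \<subseteq> Id_on e Un \<gamma>" "finite F" "\<not> el p p F" 
   using not_pel_finite[OF \<gamma>(3)] by blast
  define \<gamma>0 where "\<gamma>0 = F Int \<gamma>"
  have \<gamma>0: "\<gamma>0 \<subseteq> \<gamma>" "finite \<gamma>0" "\<not> el p p (Id_on e Un \<gamma>0)"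
   using F pel_subset[of L _ _ "Id_on e Un \<gamma>0" F] by (auto simp: \<gamma>0_def)
  define \<beta> where "\<beta> = \<alpha> Int Range \<gamma>0 \<times> UNIV"
  have "\<exists>\<alpha>' \<beta>'. aut \<alpha>' \<and> \<alpha> Int h \<times> UNIV \<subseteq> \<alpha>' \<and> \<beta>' \<subseteq> \<alpha>' \<and> finite (Domain \<beta>') \<and> \<not> el p p (?R Un \<beta>')"
  proof (cases "el p p (?R Un \<beta>)")
   case False
   then show ?thesis using \<alpha> \<gamma>0 by (intro exI[of _ \<alpha>] exI[of _ \<beta>])
    (auto simp: \<beta>_def intro: finite_subset[OF _ finite_Range])
  next
   case True
   \<comment> \<open>Both \<open>\<alpha>\<close> and \<open>\<gamma> O \<alpha>\<close> respect the
     commitment on \<open>h\<close>. A candidate that fits \<open>\<alpha>\<close> cannot fit the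
     other one: composing the two compatible maps, the second reversed, would make
     \<open>Id_on e\<close> together with \<open>\<gamma>0\<close> elementary.\<close>
   have "\<not> el p p (?R Un \<gamma>0 O \<beta>)"
   proof
    assume "el p p (?R Un \<gamma>0 O \<beta>)"
    then have "el p p ((?R Un \<gamma>0 O \<beta>) O (?R Un \<beta>)\<inverse>)"
     by (rule pel_comp) (simp only: pel_converse True)
    moreover have "Id_on e Un \<gamma>0 \<subseteq> (?R Un \<gamma>0 O \<beta>) O (?R Un \<beta>)\<inverse>"
    proof (rule Un_least)
     show "Id_on e \<subseteq> (?R Un \<gamma>0 O \<beta>) O (?R Un \<beta>)\<inverse>" using DR by blast
     have "Range \<gamma>0 \<subseteq> Domain \<alpha>" using \<gamma>0(1) \<gamma>(1) \<alpha> by (auto simp: aut_def)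
     have "(u, v) \<in> (?R Un \<gamma>0 O \<beta>) O (?R Un \<beta>)\<inverse>" if uv: "(u, v) \<in> \<gamma>0" for u v
     proof -
      obtain w where "(v, w) \<in> \<alpha>" using uv \<open>Range \<gamma>0 \<subseteq> Domain \<alpha>\<close> by blast
      then have "(v, w) \<in> \<beta>" using uv by (auto simp: \<beta>_def)
      then show ?thesis using uv by blast
     qed
     then show "\<gamma>0 \<subseteq> (?R Un \<gamma>0 O \<beta>) O (?R Un \<beta>)\<inverse>" by auto
    qed
    ultimately show False using \<gamma>0(3) pel_subset by blast
   qed
   moreover have "aut (\<gamma> O \<alpha>)" using ciso_comp[of p p \<gamma> p \<alpha>] \<gamma>(1) \<alpha> by (auto simp: aut_def)
   moreover have "\<alpha> Int h \<times> UNIV \<subseteq> \<gamma> O \<alpha>" using \<gamma>(2) by blast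
   moreover have "\<gamma>0 O \<beta> \<subseteq> \<gamma> O \<alpha>" using \<gamma>0 by (auto simp: \<beta>_def)
   moreover have "finite (Domain (\<gamma>0 O \<beta>))"
    by (rule finite_subset[OF _ finite_Domain[OF \<gamma>0(2)]]) auto
   ultimately show ?thesis by blast
  qed
  then obtain \<alpha>' \<beta>' where A: "aut \<alpha>'" "\<alpha> Int h \<times> UNIV \<subseteq> \<alpha>'" "\<beta>' \<subseteq> \<alpha>'" "finite (Domain \<beta>')" "\<not> el p p (?R Un \<beta>')"
   by blast
  have D: "Domain \<alpha>' = H" "Range \<alpha>' = H" using A by (auto simp: aut_def)
  obtain T where T: "T \<subseteq> H" "finite T" "H \<noteq> {} --> from_nat_into H n \<in> T \<and> (\<exists>u\<in>T. (u, from_nat_into H n) \<in> \<alpha>')"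
  proof (cases "H = {}")
   case True
   then show thesis using that[of "{}"] by auto
  next
   case False
   then have t: "from_nat_into H n \<in> H" by (rule from_nat_into)
   then obtain u where "(u, from_nat_into H n) \<in> \<alpha>'" using D by blast
   then show thesis using that[of "{u, from_nat_into H n}"] t D by auto
  qed
  have "Q n s (\<alpha>', h Un Domain \<beta>' Un T)"
   unfolding Q_def s_eq using A T by (auto intro!: exI[of _ \<beta>'])
  moreover have "S (\<alpha>', h Un Domain \<beta>' Un T)"
   using A h T D Domain_mono[OF A(3)] by (auto simp: S_def)
  ultimately show ?thesis by blast
 qed
 obtain f where f: "\<And>n. S (f n)" "\<And>n. Q n (f n) (f (Suc n))"
  using nat_choice[of "\<lambda>_. S" _ Q, OF S0 SS] by blast
 define g where "g n = fst (f n) Int snd (f n) \<times> UNIV" for n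
 let ?A = "\<Union>(range g)"
 have elA: "el p p ?A"
 proof (rule pel_UN_nat)
  have e: "el p p (fst (f n))" for n using f(1)[of n] by (simp add: S_def aut_def ciso_def)
  show "el p p (g n)" for n using pel_subset[OF e[of n], of "g n"] by (simp add: g_def)
  show "g n \<subseteq> g (Suc n)" for n using f(2)[of n] unfolding Q_def g_def by blast
 qed
 have fH: "Domain (fst (f n)) = H" "Range (fst (f n)) = H" "snd (f n) \<subseteq> H" for n
  using f(1)[of n] by (auto simp: S_def aut_def)
 have A_DR: "Domain ?A = H" "Range ?A = H"
 proof -
  have "x \<in> Domain ?A \<and> x \<in> Range ?A" if xH: "x \<in> H" for x
  proof -
   obtain n where n: "from_nat_into H n = x" using from_nat_into_surj[OF H(2) xH] by blast
   have "x \<in> snd (f (Suc n))" "\<exists>u\<in>snd (f (Suc n)). (u, x) \<in> fst (f (Suc n))"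
    using f(2)[of n] n xH by (auto simp: Q_def)
   then have "x \<in> Domain (g (Suc n))" "x \<in> Range (g (Suc n))"
    using fH[of "Suc n"] xH by (auto simp: g_def)
   then show ?thesis by blast
  qed
  moreover have "g n \<subseteq> H \<times> H" for n using fH[of n] unfolding g_def by blast
  then have "?A \<subseteq> H \<times> H" by blast
  ultimately show "Domain ?A = H" "Range ?A = H" by blast+
 qed
 have cA: "ciso p p ?A" using elA H A_DR by (simp add: ciso_def)
 obtain Y where Y: "Y \<subseteq> e" "indp (snd p) H Y" "e \<subseteq> snd p (H Un Y)" using P.basis_of[OF e(2) HU] .
 have fY: "finite Y" using Y e finite_subset by blast
 have YU: "Y \<subseteq> U p" using Y(1) e(2) by blast
 \<comment> \<open>The limit does extend to the closure of \<open>H\<close> and \<open>e\<close>, by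
   the identity on a basis \<open>Y\<close> of \<open>e\<close> over \<open>H\<close>. The
   restriction of this extension to \<open>e\<close> is a candidate that was excluded at some
   stage.\<close>
 obtain B where B: "ciso p p B" "?A \<subseteq> B" "Domain B = snd p (H Un Y)" "Range B = snd p (H Un Y)"
  using cext_id[OF p cA _ YU countable_finite[OF fY]] Y(2) H(2) unfolding A_DR by blast
 have YD: "snd p (H Un Y) \<subseteq> ?D" by (rule P.cl_mono) (use Y HU e in auto)
 define R where "R = B Int e \<times> UNIV"
 have elR: "el p p R" using pel_subset[OF ciso_el[OF B(1)]] by (auto simp: R_def)
 have DR: "Domain R = e" unfolding R_def by (rule Domain_restrict) (use Y(3) B(3) in simp)
 have "B \<subseteq> Domain B \<times> Range B" by auto
 then have "R \<subseteq> e \<times> ?D" using B(4) YD unfolding R_def by blast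
 then have "R \<in> RR" unfolding RR_def using DR pel_finite_dom[OF elR] e(1) by simp
 then obtain n where n: "from_nat_into RR n = R" using from_nat_into_surj[OF cRR] by blast
 obtain \<beta> where \<beta>: "\<beta> \<subseteq> g (Suc n)" "\<not> el p p (R Un \<beta>)"
  using f(2)[of n] n by (auto simp: Q_def g_def)
 have "R Un \<beta> \<subseteq> B" using \<beta> B by (auto simp: R_def)
 then show False using \<beta> pel_subset[OF ciso_el[OF B(1)]] by blast
qed

text \<open>Every realization of the type of \<open>e\<close> over \<open>k\<close> realizes the
  type of \<open>e\<close> over \<open>S\<close>. The realization is encoded as a map
  \<open>G\<close> that is the identity on \<open>k\<close>.\<close>

definition isol :: "('f, 'r, 'a) pstruct \<Rightarrow> 'a set \<Rightarrow> 'a set \<Rightarrow> 'a set \<Rightarrow> bool" where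
 "isol p k e S \<longleftrightarrow>
  (\<forall>G. el p p G --> Domain G = k Un e --> Id_on k \<subseteq> G --> el p p (G Un Id_on S))"

lemma isolD: "isol p k e S ==> el p p G ==> Domain G = k Un e ==> Id_on k \<subseteq> G ==> el p p (G Un Id_on S)"
 unfolding isol_def by blast

text \<open>Let \<open>k\<close> contain a stabilizing set from \<open>type_stabilizer_open\<close>
  and a support of \<open>e\<close>. A map \<open>G\<close> fixing \<open>k\<close> and
  \<open>Y\<close> extends to a map \<open>\<pi>\<close> that also fixes a basis \<open>W\<close> of
  \<open>H\<close> over \<open>k\<close>. Then \<open>\<pi>\<close> maps \<open>H\<close> onto
  itself, and its restriction \<open>\<alpha>\<close> to \<open>H\<close> can be extended by the
  identity on \<open>e\<close> and \<open>Y\<close>. Undoing this extension and then applying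
  \<open>\<pi>\<close> moves \<open>e\<close> as \<open>G\<close> does and fixes \<open>H\<close>
  pointwise.\<close>

lemma isol_closed:
 assumes p: "p \<in> GG" and H: "clo p H" "countable H" and Y: "finite Y" "Y \<subseteq> U p" "indp (snd p) H Y"
  and e: "finite e" "e \<subseteq> snd p (H Un Y)"
 obtains k where "k \<subseteq> H" "finite k" "e \<subseteq> snd p (k Un Y)" "isol p (k Un Y) e (H Un Y)"
proof -
 interpret P: pregeo "U p" "snd p" by (rule pgi) fact
 have HU: "H \<subseteq> U p" and clH: "snd p H = H" using H by (simp_all add: closed_set_def)
 have HYU: "H Un Y \<subseteq> U p" using HU Y by simp
 have eU: "e Un Y \<subseteq> U p" using e P.cl_in[OF HYU] Y by blast
 obtain h where h: "h \<subseteq> H" "finite h"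
  "\<And>\<alpha>. ciso p p \<alpha> ==> Domain \<alpha> = H ==> Range \<alpha> = H ==> Id_on h \<subseteq> \<alpha> ==> el p p (Id_on (e Un Y) Un \<alpha>)"
  using type_stabilizer_open[OF p H, of "e Un Y"] e(1) Y(1) eU by blast
 obtain k1 where k1: "k1 \<subseteq> H" "finite k1" "e \<subseteq> snd p (k1 Un Y)"
  using P.cl_fin_Un[OF HU Y(2) e] by blast
 define k where "k = h Un k1"
 have k: "k \<subseteq> H" "finite k" and kU: "k \<subseteq> U p" "k Un Y \<subseteq> U p" using h k1 HU Y by (auto simp: k_def)
 have "snd p (k1 Un Y) \<subseteq> snd p (k Un Y)" by (rule P.cl_mono) (use kU in \<open>auto simp: k_def\<close>)
 then have ek: "e \<subseteq> snd p (k Un Y)" using k1(3) by blast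
 \<comment> \<open>Since \<open>Y\<close> is independent over \<open>H\<close>, the basis
   \<open>W\<close> stays independent over \<open>k\<close> and \<open>Y\<close>; maps that live on
   the closure of these can therefore be extended by the identity on \<open>W\<close>.\<close>
 obtain W where W: "W \<subseteq> H" "indp (snd p) k W" "H \<subseteq> snd p (k Un W)" using P.basis_of[OF HU kU(1)] .
 have WU: "W \<subseteq> U p" using W HU by blast
 have HW: "snd p (k Un W) = H" using P.cl_least'[OF H(1), of "k Un W"] W k by auto
 have YW: "Y Int W = {}" using P.indp_disjoint[OF Y(3) HU Y(2)] W by blast
 have "indp (snd p) (k Un W) Y" using P.indp_cl[of "k Un W" Y] HW Y kU WU by simp
 then have "indp (snd p) k (W Un Y)" by (rule P.indp_UnI[OF W(2) _ kU(1) WU Y(2)])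
 then have "indp (snd p) k (Y Un W)" by (simp add: Un_commute)
 then have "indp (snd p) (k Un Y) W" by (rule P.indp_Un[OF _ YW kU(1) Y(2) WU])
 then have indW: "indp (snd p) (snd p (k Un Y)) W" using P.indp_cl[OF kU(2) WU] by simp
 have "isol p (k Un Y) e (H Un Y)"
  unfolding isol_def
 proof (intro allI impI)
  fix G assume G: "el p p G" "Domain G = k Un Y Un e" "Id_on (k Un Y) \<subseteq> G"
  have DG: "snd p (Domain G) = snd p (k Un Y)"
   unfolding G(2) using P.cl_least[of "k Un Y" "k Un Y Un e"] P.cl_mono[of "k Un Y" "k Un Y Un e"]
    kU eU P.cl_ext[of "k Un Y"] ek by blast
  have R1: "Range G \<subseteq> snd p (k Un Y)"
  proof
   fix v assume "v \<in> Range G"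
   then obtain u where "(u, v) \<in> G" by blast
   moreover have "u \<in> snd p (k Un Y)" using calculation G(2) ek P.cl_ext[OF kU(2)] by blast
   ultimately show "v \<in> snd p (k Un Y)" using cl_iff_Id[OF p G(1) _ G(3)] by blast
  qed
  have RG: "snd p (Range G) = snd p (k Un Y)"
  proof
   show "snd p (Range G) \<subseteq> snd p (k Un Y)" by (rule P.cl_least[OF kU(2) R1])
   show "snd p (k Un Y) \<subseteq> snd p (Range G)" by (rule P.cl_mono) (use G(3) el_U[OF G(1)] in auto)
  qed
  have "finite G" by (rule pel_finite_dom[OF G(1)]) (use G(2) k Y e in simp)
  then obtain G1 where G1: "ciso p p G1" "G \<subseteq> G1" "Domain G1 = snd p (k Un Y)" "Range G1 = snd p (k Un Y)"
   using cl_fin_el[OF p p G(1)] DG RG by metis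
  have c1: "countable (Domain G1)" unfolding G1(3)
   by (rule P.countable_cl[OF qm3[OF p]]) (use k Y kU in \<open>auto simp: countable_finite\<close>)
  have cW: "countable W" using W(1) H(2) countable_subset by blast
  obtain \<pi> where \<pi>: "ciso p p \<pi>" "G1 \<subseteq> \<pi>" "Id_on W \<subseteq> \<pi>"
   using cext_id[OF p G1(1) c1 WU cW] indW unfolding G1(3,4) by blast
  note \<pi>(3)
  moreover have "Id_on k \<subseteq> \<pi>" using \<pi>(2) G1(2) G(3) Id_on_subset_mono[of k "k Un Y"] by blast
  ultimately have idW: "Id_on (k Un W) \<subseteq> \<pi>" by auto
  have kD: "k Un W \<subseteq> Domain \<pi>" using idW by auto
  have im: "\<pi> `` (k Un W) = k Un W" by (rule pel_Image_Id[OF ciso_el[OF \<pi>(1)] idW])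
  define \<alpha> where "\<alpha> = \<pi> Int H \<times> UNIV"
  have \<alpha>: "ciso p p \<alpha>" "Domain \<alpha> = H" "Range \<alpha> = H"
   using ciso_restrict[OF p p \<pi>(1) kD] unfolding im HW \<alpha>_def by auto
  have "Id_on h \<subseteq> \<alpha>" using idW h k by (auto simp: \<alpha>_def k_def)
  then have "el p p (Id_on (e Un Y) Un \<alpha>)" by (rule h(3)[OF \<alpha>])
  then have "el p p ((Id_on (e Un Y) Un \<alpha>)\<inverse>)" by simp
  then have el: "el p p ((Id_on (e Un Y) Un \<alpha>)\<inverse> O \<pi>)" by (rule pel_comp[OF _ ciso_el[OF \<pi>(1)]])
  have "G Un Id_on (H Un Y) \<subseteq> (Id_on (e Un Y) Un \<alpha>)\<inverse> O \<pi>"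
  proof -
   let ?R = "(Id_on (e Un Y) Un \<alpha>)\<inverse> O \<pi>"
   have H1: "(u, u) \<in> ?R" if u: "u \<in> H" for u
   proof -
    obtain x where "(x, u) \<in> \<alpha>" using u \<alpha>(3) by blast
    then show ?thesis by (auto simp: \<alpha>_def)
   qed
   have G\<pi>: "G \<subseteq> \<pi>" using \<pi>(2) G1(2) by blast
   have Y1: "(u, v) \<in> ?R" if "(u, v) \<in> G" "u \<in> e Un Y" for u v
    using that G\<pi> by blast
   have k1: "(u, v) \<in> ?R" if "(u, v) \<in> G" "u \<in> k" for u v
   proof -
    have "(u, u) \<in> G" using G(3) that by auto
    then have "v = u" using pel_inj[OF G(1)] that by blast
    then show ?thesis using H1 that k by blast
   qed
   have G1: "(u, v) \<in> ?R" if "(u, v) \<in> G" for u v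
   proof -
    have "u \<in> k \<or> u \<in> e Un Y" using DomainI[OF that] G(2) by blast
    then show ?thesis using k1 Y1 that by blast
   qed
   have "(u, u) \<in> ?R" if "u \<in> H Un Y" for u
   proof (cases "u \<in> H")
    case False
    then have "(u, u) \<in> G" using that G(3) by auto
    then show ?thesis by (rule G1)
   qed (rule H1)
   then show ?thesis using G1 by auto
  qed
  then show "el p p (G Un Id_on (H Un Y))" by (rule pel_subset[OF el])
 qed
 then show thesis using that[OF k ek] by blast
qed

end

section \<open>Isolation over the faces of a finite independent set\<close>

lemma pel_finite_Image: "pel L A B G ==> finite S ==> finite (G `` S)"
proof -
 assume G: "pel L A B G" "finite S"
 have "finite (Domain (G Int S \<times> UNIV))" by (rule finite_subset[OF _ G(2)]) auto
 then have "finite (G Int S \<times> UNIV)" by (rule pel_finite_dom[OF pel_subset[OF G(1)], rotated]) auto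
 then have "finite (Range (G Int S \<times> UNIV))" by (rule finite_Range)
 moreover have "Range (G Int S \<times> UNIV) = G `` S" by auto
 ultimately show "finite (G `` S)" by simp
qed

context qmc begin

text \<open>For \<open>W = F\<close> these are the faces of the simplex with vertex set
  \<open>F\<close> over \<open>E\<close>, one opposite to each vertex; for larger \<open>W\<close>,
  everything generated while avoiding some vertex of \<open>F\<close>. The vertices are added
  separately because the face opposite to a single vertex does not contain it.\<close>

definition faces :: "('f, 'r, 'a) pstruct \<Rightarrow> 'a set \<Rightarrow> 'a set \<Rightarrow> 'a set \<Rightarrow> 'a set" where
 "faces p E W F = F Un (\<Union>x\<in>F. snd p (E Un (W - {x})))"

lemma restrict_fixing:
 assumes p: "p \<in> GG" and G: "ciso p p G" and S: "Id_on S \<subseteq> G"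
 shows "ciso p p (G Int snd p S \<times> UNIV)" "Domain (G Int snd p S \<times> UNIV) = snd p S"
  "Range (G Int snd p S \<times> UNIV) = snd p S"
proof -
 have "S \<subseteq> Domain G" using S by auto
 note r = ciso_restrict[OF p p G this]
 show "ciso p p (G Int snd p S \<times> UNIV)" "Domain (G Int snd p S \<times> UNIV) = snd p S" by (rule r)+
 show "Range (G Int snd p S \<times> UNIV) = snd p S"
  using r(3) pel_Image_Id[OF ciso_el[OF G] S] by simp
qed

text \<open>Induction on the set \<open>T\<close> of vertices whose opposite faces
  \<open>\<pi>\<close> may move; if \<open>T\<close> is empty, all faces are fixed and the claim is
  trivial. For a further vertex \<open>x\<close>, a spare generic point \<open>z\<close> of
  \<open>Z\<close> takes the place of \<open>x\<close>: the map \<open>\<tau>\<close> copies the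
  face opposite \<open>x\<close>, which contains \<open>z\<close>, onto a closed set containing
  \<open>e\<close>. The copy \<open>\<sigma>\<close> of \<open>\<pi>\<close> under
  \<open>\<tau>\<close> fixes \<open>e\<close> and agrees with \<open>\<pi>\<close> on
  \<open>snd p A\<close>, so \<open>\<pi>\<close> followed by the inverse of \<open>\<sigma>\<close>
  fixes \<open>snd p A\<close>. The induction hypothesis applies to this map, and composing with
  \<open>\<sigma>\<close> recovers \<open>\<pi>\<close>. Each vertex of \<open>T\<close> costs one
  element of \<open>Z\<close>. The face opposite \<open>y\<close> is never released; it is what
  makes \<open>\<pi>\<close> fix \<open>E\<close> and \<open>Z\<close>.\<close>

lemma fixing_faces:
 assumes p: "p \<in> GG" and E: "E \<subseteq> U p" "countable E" and F: "finite F" "F \<subseteq> U p" and y: "y \<in> F"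
  and e: "finite e" "e \<subseteq> snd p (E Un F)"
  and T: "T \<subseteq> F - {y}" and Z: "finite Z" "Z \<subseteq> U p" "card Z = card T" "F Int Z = {}"
  and ind: "indp (snd p) E (F Un Z)"
 shows "\<exists>k. finite k \<and> k \<subseteq> (\<Union>x\<in>T. snd p (E Un Z Un (F - {x}))) \<and>
  (\<forall>\<pi>. el p p \<pi> --> Domain \<pi> = snd p (E Un Z Un F) --> Range \<pi> = snd p (E Un Z Un F) -->
   Id_on (k Un F) \<subseteq> \<pi> --> (\<forall>x\<in>F - T. Id_on (snd p (E Un Z Un (F - {x}))) \<subseteq> \<pi>) -->
   el p p (Id_on e Un \<pi> Int faces p E F F \<times> UNIV))"
proof -
 interpret P: pregeo "U p" "snd p" by (rule pgi) fact
 have EF: "E Un F \<subseteq> U p" using E F by simp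
 have facesU: "faces p E F F \<subseteq> snd p (E Un F)"
  unfolding faces_def
 proof (intro Un_least UN_least)
  show "F \<subseteq> snd p (E Un F)" using P.cl_ext[OF EF] by simp
  show "snd p (E Un (F - {x})) \<subseteq> snd p (E Un F)" for x by (rule P.cl_mono[OF _ EF]) auto
 qed
 have finT: "finite T" using T F finite_subset by blast
 show ?thesis using finT T Z ind
 proof (induction T arbitrary: Z rule: finite_induct)
  case empty
  then have Z: "Z = {}" by simp
  show ?case
  proof (intro exI[of _ "{}"] conjI allI impI)
   fix \<pi> assume \<pi>: "el p p \<pi>" "Id_on ({} Un F) \<subseteq> \<pi>" "\<forall>x\<in>F - {}. Id_on (snd p (E Un Z Un (F - {x}))) \<subseteq> \<pi>"
   have "(u, u) \<in> \<pi>" if "u \<in> faces p E F F" for u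
    using that \<pi>(2,3) Z unfolding faces_def by auto
   then have "(u, v) \<in> \<pi> ==> u \<in> faces p E F F ==> v = u" for u v
    using pel_inj[OF \<pi>(1)] by blast
   then have "Id_on e Un \<pi> Int faces p E F F \<times> UNIV \<subseteq> Id_on (snd p (E Un F))"
    using e(2) facesU by fastforce
   then show "el p p (Id_on e Un \<pi> Int faces p E F F \<times> UNIV)"
    using pel_subset[OF pel_Id_on[OF P.cl_in[OF EF]]] by blast
  qed auto
 next
  case (insert x T)
  have xF: "x \<in> F" "x \<noteq> y" using insert.prems by auto
  have "card Z = Suc (card T)" using insert by simp
  then obtain z where z: "z \<in> Z" by (metis card.empty ex_in_conv nat.distinct(1))
  define Z' where "Z' = Z - {z}"
  have Z'x: "Z = insert z Z'" "z \<notin> Z'" using z by (auto simp: Z'_def)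
  have ZU: "Z \<subseteq> U p" "Z' \<subseteq> U p" using insert.prems by (auto simp: Z'_def)
  have FZ: "F Int Z = {}" using insert.prems by simp
  have card': "card Z' = card T" using \<open>card Z = Suc (card T)\<close> z insert.prems by (simp add: Z'_def)
  have ind: "indp (snd p) E (F Un Z)" using insert.prems by simp
  have FZU: "F Un Z \<subseteq> U p" using F ZU by simp
  have ind': "indp (snd p) E (F Un Z')" by (rule P.indp_subset[OF ind _ E(1) FZU]) (auto simp: Z'_def)
  have pre: "T \<subseteq> F - {y}" "finite Z'" "F Int Z' = {}" using insert.prems by (auto simp: Z'_def)
  obtain k2 where k2: "finite k2" "k2 \<subseteq> (\<Union>x\<in>T. snd p (E Un Z' Un (F - {x})))"
   and IH0: "\<forall>\<pi>. el p p \<pi> --> Domain \<pi> = snd p (E Un Z' Un F) --> Range \<pi> = snd p (E Un Z' Un F) -->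
   Id_on (k2 Un F) \<subseteq> \<pi> --> (\<forall>x\<in>F - T. Id_on (snd p (E Un Z' Un (F - {x}))) \<subseteq> \<pi>) -->
   el p p (Id_on e Un \<pi> Int faces p E F F \<times> UNIV)"
   using insert.IH[OF pre(1,2) ZU(2) card' pre(3) ind'] by blast
  have IH: "\<And>\<pi>. el p p \<pi> ==> Domain \<pi> = snd p (E Un Z' Un F) ==> Range \<pi> = snd p (E Un Z' Un F) ==>
   Id_on (k2 Un F) \<subseteq> \<pi> ==> (\<forall>x\<in>F - T. Id_on (snd p (E Un Z' Un (F - {x}))) \<subseteq> \<pi>) ==>
   el p p (Id_on e Un \<pi> Int faces p E F F \<times> UNIV)"
   using IH0 by simp
  define A where "A = E Un Z' Un (F - {x})"
  have AU: "A \<subseteq> U p" using E F ZU by (auto simp: A_def)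
  have zx: "z \<in> U p" "x \<in> U p" using z ZU xF F by auto
  have zA: "z \<notin> snd p A" using P.indp_notin'[OF ind E(1) FZU, of z "Z' Un (F - {x})"] z FZ
   by (auto simp: A_def Z'_def Un_assoc)
  have xA: "x \<notin> snd p A" using P.indp_notin'[OF ind E(1) FZU, of x "Z' Un (F - {x})"] xF FZ
   by (auto simp: A_def Z'_def Un_assoc)
  have cA: "countable A" using E insert.prems F by (auto simp: A_def Z'_def countable_finite)
  have cclA: "countable (snd p A)" by (rule P.countable_cl[OF qm3[OF p] cA AU])
  define D1 where "D1 = snd p (E Un Z Un (F - {x}))"
  define D2 where "D2 = snd p (E Un Z' Un F)"
  have s1: "insert z A = E Un Z Un (F - {x})" and s2: "insert x A = E Un Z' Un F"
   using Z'x xF by (auto simp: A_def)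
  \<comment> \<open>Both \<open>z\<close> and \<open>x\<close> are generic over the closure of
    \<open>A\<close>, so the identity of that closure extends to a map sending \<open>z\<close> to
    \<open>x\<close>.\<close>
  obtain \<tau> where \<tau>: "ciso p p \<tau>" "insert (z, x) (Id_on (snd p A)) \<subseteq> \<tau>"
   "Domain \<tau> = snd p (insert z (snd p A))" "Range \<tau> = snd p (insert x (snd p A))"
   using step[OF p p ciso_Id_on[OF P.closed_cl[OF AU]], of z x] cclA zx zA xA by auto
  have D\<tau>: "Domain \<tau> = D1" using P.cl_Un_cl[OF AU, of "{z}"] zx \<tau>(3) s1 by (simp add: D1_def)
  have R\<tau>: "Range \<tau> = D2" using P.cl_Un_cl[OF AU, of "{x}"] zx \<tau>(4) s2 by (simp add: D2_def)
  have zx\<tau>: "(z, x) \<in> \<tau>" and Id\<tau>: "Id_on (snd p A) \<subseteq> \<tau>" using \<tau>(2) by auto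
  have EZF: "E Un Z Un F \<subseteq> U p" and EZF': "E Un Z' Un F \<subseteq> U p" using E ZU F by auto
  have clEF: "snd p (E Un F) \<subseteq> D2" unfolding D2_def by (rule P.cl_mono[OF _ EZF']) auto
  have eD: "e \<subseteq> D2" using e(2) clEF by blast
  have "snd p (E Un Z' Un (F - {w})) \<subseteq> D2" for w unfolding D2_def by (rule P.cl_mono[OF _ EZF']) auto
  then have k2D: "k2 \<subseteq> D2" using k2(2) by blast
  \<comment> \<open>The preimage under \<open>\<tau>\<close> of \<open>e\<close> and
    \<open>k2\<close>. If \<open>\<pi>\<close> fixes \<open>k3\<close>, its conjugate
    \<open>\<sigma>\<close> fixes \<open>e\<close> and \<open>k2\<close>.\<close>
  define k3 where "k3 = \<tau>\<inverse> `` (e Un k2)"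
  have k3: "finite k3" unfolding k3_def
   by (rule pel_finite_Image[OF ciso_el[OF ciso_converse[OF \<tau>(1)]]]) (use e k2 in simp)
  have k3D: "k3 \<subseteq> D1" using D\<tau> by (auto simp: k3_def)
  have mono: "snd p (E Un Z' Un (F - {w})) \<subseteq> snd p (E Un Z Un (F - {w}))" for w
   by (rule P.cl_mono) (use Z'x EZF in auto)
  have "k2 \<subseteq> (\<Union>w\<in>T. snd p (E Un Z Un (F - {w})))"
   by (rule order_trans[OF k2(2)]) (rule UN_mono[OF subset_refl mono])
  then have ksub: "k2 Un k3 \<subseteq> (\<Union>w\<in>insert x T. snd p (E Un Z Un (F - {w})))"
   using k3D unfolding D1_def by auto
  show ?case
  proof (intro exI[of _ "k2 Un k3"] conjI allI impI)
   show "finite (k2 Un k3)" using k2 k3 by simp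
   show "k2 Un k3 \<subseteq> (\<Union>w\<in>insert x T. snd p (E Un Z Un (F - {w})))" by (rule ksub)
   fix \<pi> assume \<pi>: "el p p \<pi>" "Domain \<pi> = snd p (E Un Z Un F)" "Range \<pi> = snd p (E Un Z Un F)"
    "Id_on (k2 Un k3 Un F) \<subseteq> \<pi>" "\<forall>w\<in>F - insert x T. Id_on (snd p (E Un Z Un (F - {w}))) \<subseteq> \<pi>"
   have c\<pi>: "ciso p p \<pi>" unfolding ciso_def \<pi>(2,3) using \<pi>(1) P.closed_cl[OF EZF] by simp
   have "Id_on (snd p (E Un Z Un (F - {y}))) \<subseteq> \<pi>" using \<pi>(5) y insert.prems by blast
   moreover have "E Un Z \<subseteq> snd p (E Un Z Un (F - {y}))" using P.cl_ext[of "E Un Z Un (F - {y})"] EZF by auto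
   ultimately have fx: "(u, u) \<in> \<pi>" if "u \<in> E Un Z Un F" for u
    using that \<pi>(4) by blast
   have IdS: "Id_on S \<subseteq> \<pi>" if "S \<subseteq> E Un Z Un F" for S using fx that by auto
   have E1: "E Un Z Un (F - {x}) \<subseteq> E Un Z Un F" by auto
   define \<pi>x where "\<pi>x = \<pi> Int D1 \<times> UNIV"
   have \<pi>x: "ciso p p \<pi>x" "Domain \<pi>x = D1" "Range \<pi>x = D1"
    unfolding \<pi>x_def D1_def by (rule restrict_fixing[OF p c\<pi> IdS[OF E1]])+
   define \<sigma> where "\<sigma> = \<tau>\<inverse> O (\<pi>x O \<tau>)"
   have \<pi>x\<tau>: "ciso p p (\<pi>x O \<tau>)" "Domain (\<pi>x O \<tau>) = D1" "Range (\<pi>x O \<tau>) = D2"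
    using ciso_comp[OF \<pi>x(1) \<tau>(1)] \<pi>x D\<tau> R\<tau> by auto
   have \<sigma>: "ciso p p \<sigma>" "Domain \<sigma> = D2" "Range \<sigma> = D2"
    using ciso_comp[OF ciso_converse[OF \<tau>(1)] \<pi>x\<tau>(1)] \<pi>x\<tau> D\<tau> R\<tau> unfolding \<sigma>_def by auto
   have \<sigma>I: "(a', b') \<in> \<sigma>" if "(a, b) \<in> \<pi>" "(a, a') \<in> \<tau>" "(b, b') \<in> \<tau>" for a b a' b'
   proof -
    have "a \<in> D1" using that(2) D\<tau> by blast
    then show ?thesis using that unfolding \<sigma>_def \<pi>x_def by blast
   qed
   have \<sigma>ek: "(w, w) \<in> \<sigma>" if w: "w \<in> e Un k2" for w
   proof -
    have "w \<in> Range \<tau>" using w eD k2D R\<tau> by blast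
    then obtain u where u: "(u, w) \<in> \<tau>" by blast
    then have "u \<in> k3" using w by (auto simp: k3_def)
    then have "(u, u) \<in> \<pi>" using \<pi>(4) by auto
    then show ?thesis using \<sigma>I u by blast
   qed
   have \<sigma>face: "(w, w) \<in> \<sigma>" if w: "w \<in> snd p (E Un Z' Un (F - {x'}))" and x': "x' \<in> F - insert x T" for w x'
   proof -
    define S where "S = E Un Z' Un (F - {x} - {x'})"
    have SA: "S \<subseteq> snd p A" using P.cl_ext[OF AU] by (auto simp: S_def A_def)
    have "Id_on S \<subseteq> \<tau>" using Id_on_subset_mono[OF SA] Id\<tau> by (rule subset_trans)
    then have "\<tau> `` S = S" by (rule pel_Image_Id[OF ciso_el[OF \<tau>(1)]])
    moreover have "\<tau> `` {z} = {x}" by (rule pel_Image_singleton[OF ciso_el[OF \<tau>(1)] zx\<tau>])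
    moreover have "\<tau> `` insert z S = \<tau> `` {z} Un \<tau> `` S" by blast
    ultimately have "\<tau> `` insert z S = insert x S" by simp
    moreover have "insert x S = E Un Z' Un (F - {x'})" using xF x' by (auto simp: S_def)
    moreover have "insert z S \<subseteq> Domain \<tau>" using SA Id\<tau> zx\<tau> by blast
    ultimately have "w \<in> \<tau> `` snd p (insert z S)"
     using ciso_image[OF p p \<tau>(1), of "insert z S"] w by simp
    then obtain u where u: "u \<in> snd p (insert z S)" "(u, w) \<in> \<tau>" by blast
    have "snd p (insert z S) \<subseteq> snd p (E Un Z Un (F - {x'}))"
     by (rule P.cl_mono) (use EZF Z'x in \<open>auto simp: S_def\<close>)
    then have "(u, u) \<in> \<pi>" using u(1) \<pi>(5) x' by blast
    then show ?thesis using \<sigma>I u(2) by blast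
   qed
   have AE: "A \<subseteq> E Un Z Un F" using Z'x by (auto simp: A_def)
   have \<sigma>A: "(u, v) \<in> \<sigma>" if uv: "(u, v) \<in> \<pi>" "u \<in> snd p A" for u v
   proof -
    have "v \<in> snd p A" using cl_iff_Id[OF p \<pi>(1) uv(1) IdS[OF AE]] uv(2) by simp
    then have "(u, u) \<in> \<tau>" "(v, v) \<in> \<tau>" using uv(2) Id\<tau> by auto
    then show ?thesis using \<sigma>I[OF uv(1)] by blast
   qed
   have \<sigma>F: "(w, w) \<in> \<sigma>" if w: "w \<in> F" for w
   proof (cases "w = x")
    case True
    then show ?thesis using \<sigma>I[OF fx zx\<tau> zx\<tau>] z by simp
   next
    case False
    then have "w \<in> snd p A" using P.cl_ext[OF AU] w by (auto simp: A_def)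
    then show ?thesis using \<sigma>A fx w by blast
   qed
   define \<pi>2 where "\<pi>2 = \<pi> Int D2 \<times> UNIV"
   have E2: "E Un Z' Un F \<subseteq> E Un Z Un F" using Z'x by auto
   have \<pi>2: "ciso p p \<pi>2" "Domain \<pi>2 = D2" "Range \<pi>2 = D2"
    unfolding \<pi>2_def D2_def by (rule restrict_fixing[OF p c\<pi> IdS[OF E2]])+
   \<comment> \<open>On \<open>snd p A\<close>, the face opposite \<open>x\<close> of the smaller
     configuration, \<open>\<pi>\<close> and \<open>\<sigma>\<close> coincide; so this map has one
     more fixed face than \<open>\<pi>\<close> and falls under the induction hypothesis for
     \<open>T\<close>.\<close>
   define \<pi>1 where "\<pi>1 = \<pi>2 O \<sigma>\<inverse>"
   have \<pi>1: "ciso p p \<pi>1" "Domain \<pi>1 = D2" "Range \<pi>1 = D2"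
    using ciso_comp[OF \<pi>2(1) ciso_converse[OF \<sigma>(1)]] \<pi>2 \<sigma> unfolding \<pi>1_def by auto
   have \<pi>1I: "(u, w) \<in> \<pi>1" if "(u, v) \<in> \<pi>" "(w, v) \<in> \<sigma>" "u \<in> D2" for u v w
    using that unfolding \<pi>1_def \<pi>2_def by blast
   have "el p p (Id_on e Un \<pi>1 Int faces p E F F \<times> UNIV)"
   proof (rule IH)
    show "el p p \<pi>1" by (rule ciso_el[OF \<pi>1(1)])
    show "Domain \<pi>1 = snd p (E Un Z' Un F)" "Range \<pi>1 = snd p (E Un Z' Un F)" using \<pi>1 D2_def by simp_all
    have "F \<subseteq> D2" using P.cl_ext[OF EZF'] by (auto simp: D2_def)
    then have "(w, w) \<in> \<pi>1" if "w \<in> k2 Un F" for w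
     using \<pi>1I[of w w w] \<pi>(4) \<sigma>ek[of w] \<sigma>F[of w] k2D that by blast
    then show "Id_on (k2 Un F) \<subseteq> \<pi>1" by auto
    show "\<forall>x\<in>F - T. Id_on (snd p (E Un Z' Un (F - {x}))) \<subseteq> \<pi>1"
    proof
     fix x' assume x': "x' \<in> F - T"
     have "(u, u) \<in> \<pi>1" if u: "u \<in> snd p (E Un Z' Un (F - {x'}))" for u
     proof -
      have uD: "u \<in> D2" using u P.cl_mono[OF _ EZF', of "E Un Z' Un (F - {x'})"] by (auto simp: D2_def)
      show ?thesis
      proof (cases "x' = x")
       case True
       then have uA: "u \<in> snd p A" using u by (simp add: A_def)
       have "u \<in> Domain \<pi>" using uD \<pi>2(2) unfolding \<pi>2_def by blast
       then obtain v where "(u, v) \<in> \<pi>" by blast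
       then show ?thesis using \<pi>1I[OF _ \<sigma>A uD] uA by blast
      next
       case False
       then have x'': "x' \<in> F - insert x T" using x' by simp
       then have "(u, u) \<in> \<pi>" using \<pi>(5) u mono by blast
       then show ?thesis using \<pi>1I[OF _ \<sigma>face[OF u x''] uD] by blast
      qed
     qed
     then show "Id_on (snd p (E Un Z' Un (F - {x'}))) \<subseteq> \<pi>1" by auto
    qed
   qed
   then have el: "el p p ((Id_on e Un \<pi>1 Int faces p E F F \<times> UNIV) O \<sigma>)"
    by (rule pel_comp[OF _ ciso_el[OF \<sigma>(1)]])
   have "(u, v) \<in> (Id_on e Un \<pi>1 Int faces p E F F \<times> UNIV) O \<sigma>"
    if uv: "(u, v) \<in> \<pi>" "u \<in> faces p E F F" for u v
   proof -
    have uD: "u \<in> D2" using uv(2) facesU clEF by blast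
    then have "(u, v) \<in> \<pi>2" using uv by (simp add: \<pi>2_def)
    then have "v \<in> Range \<sigma>" using \<pi>2(3) \<sigma>(3) by blast
    then obtain s where s: "(s, v) \<in> \<sigma>" by blast
    then have "(u, s) \<in> \<pi>1" using \<pi>1I uv uD by blast
    then show ?thesis using s uv by blast
   qed
   moreover have "(u, u) \<in> (Id_on e Un \<pi>1 Int faces p E F F \<times> UNIV) O \<sigma>" if "u \<in> e" for u
    using \<sigma>ek that by blast
   ultimately have "Id_on e Un \<pi> Int faces p E F F \<times> UNIV \<subseteq> (Id_on e Un \<pi>1 Int faces p E F F \<times> UNIV) O \<sigma>"
    by auto
   then show "el p p (Id_on e Un \<pi> Int faces p E F F \<times> UNIV)" by (rule pel_subset[OF el])
  qed
 qed
qed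

end

context qmc begin

lemma countable_closure: "p \<in> GG ==> countable A ==> A \<subseteq> U p ==> countable (snd p A)"
 by (rule pregeo.countable_cl[OF pgi qm3])

lemma cext_ex:
 assumes "p \<in> GG" "q \<in> GG" "ciso p q G" "Domain G = A" "Range G = B" "countable A"
  and "X \<subseteq> U p" "countable X" "indp (snd p) A X"
  and "bij_betw j X Y" "Y \<subseteq> U q" "indp (snd q) B Y"
 shows "\<exists>G'. ciso p q G' \<and> G \<subseteq> G' \<and> gr j X \<subseteq> G' \<and> Domain G' = snd p (A Un X) \<and> Range G' = snd q (B Un Y)"
proof -
 have Y: "inj_on j X" "j ` X = Y" using assms(10) by (simp_all add: bij_betw_def)
 obtain G' where "ciso p q G'" "G \<subseteq> G'" "gr j X \<subseteq> G'" "Domain G' = snd p (A Un X)" "Range G' = snd q (B Un Y)"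
  by (rule cext[OF assms(1-3), of X j]) (use assms Y in simp_all)
 then show ?thesis by blast
qed

lemma faces_mono:
 assumes "p \<in> GG" "E \<subseteq> U p" "W \<subseteq> U p" "F \<subseteq> W"
 shows "faces p E F F \<subseteq> faces p E W F"
proof -
 interpret P: pregeo "U p" "snd p" by (rule pgi) fact
 have "snd p (E Un (F - {x})) \<subseteq> snd p (E Un (W - {x}))" for x
  by (rule P.cl_mono) (use assms in auto)
 then show ?thesis unfolding faces_def by blast
qed

text \<open>Each point of a face has a finite support that avoids the opposite vertex, also within
  \<open>B\<close>, because \<open>B\<close> and \<open>W\<close> are disjoint. Hence one finite set
  \<open>N\<close>, with the vertex removed, serves for all points at once.\<close>

lemma faces_support:
 assumes p: "p \<in> GG" and U: "e \<subseteq> U p" "B \<subseteq> U p" "W \<subseteq> U p" and BW: "B Int W = {}"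
  and q: "finite q" "q \<subseteq> F Un (\<Union>x\<in>F. snd p (e Un (B Un (W - {x}))))" and F: "F \<subseteq> W"
 shows "\<exists>N. finite N \<and> N \<subseteq> B Un W \<and> (\<forall>a\<in>q. a \<in> F \<or> (\<exists>x\<in>F. a \<in> snd p (e Un (N - {x}))))"
 using q
proof (induction rule: finite_induct)
 case empty
 then show ?case by auto
next
 interpret P: pregeo "U p" "snd p" by (rule pgi) fact
 case (insert a q)
 then obtain N where N: "finite N" "N \<subseteq> B Un W" "\<forall>a\<in>q. a \<in> F \<or> (\<exists>x\<in>F. a \<in> snd p (e Un (N - {x})))" by auto
 obtain M where M: "finite M" "M \<subseteq> B Un W" "a \<in> F \<or> (\<exists>x\<in>F. a \<in> snd p (e Un (M - {x})))"
 proof (cases "a \<in> F")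
  case True
  then show thesis using that[of "{}"] by auto
 next
  case False
  then obtain x where x: "x \<in> F" "a \<in> snd p (e Un (B Un (W - {x})))" using insert.prems by auto
  have "B Un (W - {x}) \<subseteq> U p" using U by auto
  from P.cl_fin_Un[OF this U(1), of "{a}"] x(2)
  obtain M where M: "M \<subseteq> B Un (W - {x})" "finite M" "a \<in> snd p (M Un e)" by (auto simp: Un_commute)
  have "M - {x} = M" using M(1) BW F x(1) by auto
  then have "a \<in> snd p (e Un (M - {x}))" using M(3) by (simp add: Un_commute)
  moreover have "M \<subseteq> B Un W" using M(1) by auto
  ultimately show thesis using that[of M] M(2) x(1) by blast
 qed
 have mono: "snd p (e Un (N - {x})) \<subseteq> snd p (e Un (N Un M - {x}))" "snd p (e Un (M - {x})) \<subseteq> snd p (e Un (N Un M - {x}))" for x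
  by (rule P.cl_mono; use U N(2) M(2) in auto)+
 have "\<forall>b\<in>insert a q. b \<in> F \<or> (\<exists>x\<in>F. b \<in> snd p (e Un (N Un M - {x})))"
  using N(3) M(3) mono by blast
 then show ?case using N(1,2) M(1,2) by (intro exI[of _ "N Un M"]) simp
qed

text \<open>A basis of \<open>E\<close> over a support \<open>e1\<close> of \<open>e\<close> is
  divided into spare points \<open>Z\<close> and the rest, which with \<open>e1\<close> forms
  \<open>E0\<close>; this is the configuration of \<open>fixing_faces\<close>. The set
  \<open>k\<close> joins its \<open>k2\<close> with a set isolating over the face opposite
  \<open>y\<close>. A map \<open>G\<close> fixing \<open>k\<close> then extends to a
  \<open>\<pi>\<close> that fixes that face, and \<open>fixing_faces\<close> turns
  \<open>\<pi>\<close> into a map \<open>R0\<close> that acts on \<open>e\<close> like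
  \<open>G\<close> and fixes the faces over \<open>E0\<close>. Finitely many points on the faces
  over \<open>E\<close> and \<open>W\<close> are carried to faces over \<open>E0\<close> by
  exchanging their supports for fresh points of \<open>E0\<close>; conjugating \<open>R0\<close>
  with this exchange gives the claim for the finite part considered.\<close>

lemma isol_faces:
 assumes p: "p \<in> GG" and E: "clo p E" "countable E" "infd (snd p) E"
  and W: "W \<subseteq> U p" "indp (snd p) E W" and F: "F \<subseteq> W" "finite F" "F \<noteq> {}"
  and e: "finite e" "e \<subseteq> snd p (E Un F)"
 obtains k where "finite k" "k \<subseteq> faces p E F F" "e \<subseteq> snd p k" "isol p k e (faces p E W F)"
proof -
 interpret P: pregeo "U p" "snd p" by (rule pgi) fact
 have EU: "E \<subseteq> U p" and clE: "snd p E = E" using E by (simp_all add: closed_set_def)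
 have FU: "F \<subseteq> U p" using F W by blast
 obtain y where y: "y \<in> F" using F by blast
 obtain e1 where e1: "e1 \<subseteq> E" "finite e1" "e \<subseteq> snd p (e1 Un F)"
  using P.cl_fin_Un[OF EU FU e] by blast
 have e1U: "e1 \<subseteq> U p" using e1 EU by blast
 obtain B where B: "B \<subseteq> E" "indp (snd p) e1 B" "E \<subseteq> snd p (e1 Un B)" using P.basis_of[OF EU e1U] .
 have BU: "B \<subseteq> U p" using B EU by blast
 have clB: "snd p (e1 Un B) = E" using P.cl_least'[OF E(1), of "e1 Un B"] B e1 by auto
 have "infinite B" by (rule P.infd_infinite_basis[OF E(3) e1(2,1) B(1,3)])
 then obtain Z where Z: "Z \<subseteq> B" "finite Z" "card Z = card (F - {y})"
  using infinite_arbitrarily_large by blast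
 have ZU: "Z \<subseteq> U p" using Z BU by blast
 define E0 where "E0 = e1 Un (B - Z)"
 have E0: "E0 \<subseteq> U p" "countable E0" "E0 \<subseteq> E"
  using e1 e1U BU B(1) E(2) by (auto simp: E0_def intro: countable_subset)
 have "e1 Un B = E0 Un Z" using Z by (auto simp: E0_def)
 then have clE0: "snd p (E0 Un Z) = E" using clB by simp
 have WB: "B Int W = {}" using P.indp_disjoint[OF W(2) EU W(1)] B by blast
 have FZ: "F Int Z = {}" using WB F Z by blast
 have indBW: "indp (snd p) e1 (B Un W)"
  by (rule P.indp_UnI[OF B(2) _ e1U BU W(1)]) (use P.indp_cl[of "e1 Un B" W] clB W e1U BU in simp)
 have BWU: "B Un W \<subseteq> U p" using BU W by simp
 have indsub: "indp (snd p) (e1 Un C) D" if "C \<subseteq> B Un W" "D \<subseteq> B Un W" "C Int D = {}" for C D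
 proof (rule P.indp_Un)
  show "indp (snd p) e1 (C Un D)" by (rule P.indp_subset[OF indBW _ e1U BWU]) (use that in simp)
 qed (use that BWU e1U in auto)
 have ind0: "indp (snd p) E0 (F Un Z)"
  unfolding E0_def by (rule indsub) (use F Z WB in auto)
 have clEX: "snd p (E0 Un Z Un X) = snd p (E Un X)" if "X \<subseteq> U p" for X
  using P.cl_Un_cl[of "E0 Un Z" X] E0(1) ZU that clE0 by simp
 have e0: "e \<subseteq> snd p (E0 Un F)"
 proof -
  have "snd p (e1 Un F) \<subseteq> snd p (E0 Un F)" by (rule P.cl_mono) (use E0 FU in \<open>auto simp: E0_def\<close>)
  then show ?thesis using e1(3) by blast
 qed
 obtain k2 where k2: "finite k2" "k2 \<subseteq> (\<Union>x\<in>F - {y}. snd p (E0 Un Z Un (F - {x})))"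
  and k2P: "\<forall>\<pi>. el p p \<pi> --> Domain \<pi> = snd p (E0 Un Z Un F) --> Range \<pi> = snd p (E0 Un Z Un F) -->
   Id_on (k2 Un F) \<subseteq> \<pi> --> (\<forall>x\<in>F - (F - {y}). Id_on (snd p (E0 Un Z Un (F - {x}))) \<subseteq> \<pi>) -->
   el p p (Id_on e Un \<pi> Int faces p E0 F F \<times> UNIV)"
  using fixing_faces[OF p E0(1,2) F(2) FU y e(1) e0 subset_refl Z(2) ZU Z(3) FZ ind0] by blast
 have k2F: "k2 \<subseteq> (\<Union>x\<in>F - {y}. snd p (E Un (F - {x})))"
 proof -
  have "snd p (E0 Un Z Un (F - {x})) = snd p (E Un (F - {x}))" for x by (rule clEX) (use FU in auto)
  then show ?thesis using k2(2) by simp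
 qed
 define A where "A = snd p (E Un (F - {y}))"
 have EFy: "E Un (F - {y}) \<subseteq> U p" and EF: "E Un F \<subseteq> U p" using EU FU by auto
 have cloA: "clo p A" unfolding A_def by (rule P.closed_cl[OF EFy])
 have AU: "A \<subseteq> U p" using P.cl_in[OF EFy] by (simp add: A_def)
 have "countable (E Un (F - {y}))" using E(2) F(2) by (simp add: countable_finite)
 then have cA: "countable A" unfolding A_def by (rule countable_closure[OF p _ EFy])
 have yU: "{y} \<subseteq> U p" using y FU by blast
 have "indp (snd p) E F" by (rule P.indp_subset[OF W(2) F(1) EU W(1)])
 then have "indp (snd p) E ((F - {y}) Un {y})" using y by (simp add: insert_absorb)
 then have "indp (snd p) (E Un (F - {y})) {y}" by (rule P.indp_Un) (use EU FU yU in auto)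
 then have indy: "indp (snd p) A {y}" unfolding A_def using P.indp_cl[OF EFy yU] by simp
 have clAy: "snd p (A Un {y}) = snd p (E Un F)"
 proof -
  have "snd p (A Un {y}) = snd p (E Un (F - {y}) Un {y})" unfolding A_def by (rule P.cl_Un_cl[OF EFy yU])
  also have "E Un (F - {y}) Un {y} = E Un F" using y by auto
  finally show ?thesis .
 qed
 have k2EF: "k2 \<subseteq> snd p (E Un F)"
 proof -
  have "snd p (E Un (F - {x})) \<subseteq> snd p (E Un F)" for x by (rule P.cl_mono[OF _ EF]) auto
  then show ?thesis using k2F by blast
 qed
 have ek2: "finite (e Un k2)" "e Un k2 \<subseteq> snd p (A Un {y})" using e k2(1) k2EF clAy by auto
 \<comment> \<open>The points of \<open>k2\<close> lie on faces other than \<open>A\<close>. They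
   are isolated jointly with \<open>e\<close>, so that one extension of \<open>G\<close> fixes
   \<open>A\<close>, \<open>y\<close> and \<open>k2\<close> at the same time.\<close>
 obtain h where h: "h \<subseteq> A" "finite h" "isol p (h Un {y}) (e Un k2) (A Un {y})"
  by (rule isol_closed[OF p cloA cA _ yU indy ek2]) auto
 define k where "k = h Un {y} Un k2 Un F Un e1"
 have fk: "finite k" using h k2 F e1 by (simp add: k_def)
 have Ayf: "A \<subseteq> faces p E F F" unfolding faces_def A_def using y by blast
 have EA: "E Un (F - {y}) \<subseteq> A" unfolding A_def by (rule P.cl_ext[OF EFy])
 have kf: "k \<subseteq> faces p E F F"
 proof -
  have "k2 \<subseteq> faces p E F F" using k2F unfolding faces_def by blast
  moreover have "F \<subseteq> faces p E F F" unfolding faces_def by blast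
  ultimately show ?thesis using h(1) y Ayf EA e1(1) unfolding k_def by blast
 qed
 have fW: "faces p E F F \<subseteq> faces p E W F" by (rule faces_mono[OF p EU W(1) F(1)])
 have EWU: "faces p E W F \<subseteq> U p"
 proof -
  have "snd p (E Un (W - {x})) \<subseteq> U p" for x by (rule P.cl_in) (use EU W in auto)
  then show ?thesis using FU unfolding faces_def by blast
 qed
 have kU: "k \<subseteq> U p" using kf fW EWU by blast
 have e1F: "e1 Un F \<subseteq> k" by (auto simp: k_def)
 have ek: "e \<subseteq> snd p k" using e1(3) P.cl_mono[OF e1F kU] by blast
 have "isol p k e (faces p E W F)"
  unfolding isol_def
 proof (intro allI impI)
  fix G assume G: "el p p G" "Domain G = k Un e" "Id_on k \<subseteq> G"
  define G' where "G' = G Int (h Un {y} Un (e Un k2)) \<times> UNIV"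
  have G'D: "Domain G' = h Un {y} Un (e Un k2)"
   unfolding G'_def by (rule Domain_restrict) (use G(2) in \<open>auto simp: k_def\<close>)
  have elG': "el p p (G' Un Id_on (A Un {y}))"
  proof (rule isolD[OF h(3) _ G'D])
   show "el p p G'" by (rule pel_subset[OF G(1)]) (auto simp: G'_def)
   show "Id_on (h Un {y}) \<subseteq> G'" using G(3) by (auto simp: G'_def k_def)
  qed
  have fG': "finite (G' Un Id_on {y})"
  proof -
   have "finite G'" by (rule pel_finite_dom[OF pel_subset[OF G(1)]]) (use G'D h ek2 in \<open>auto simp: G'_def\<close>)
   moreover have "Id_on {y} = {(y, y)}" by auto
   ultimately show ?thesis by simp
  qed
  have eqI: "Id_on A Un (G' Un Id_on {y}) = G' Un Id_on (A Un {y})" by auto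
  obtain \<pi> where \<pi>: "ciso p p \<pi>" "Id_on A Un (G' Un Id_on {y}) \<subseteq> \<pi>"
   "Domain \<pi> = snd p (Domain (Id_on A Un (G' Un Id_on {y})))" "Range \<pi> = snd p (Range (Id_on A Un (G' Un Id_on {y})))"
   using bf[OF p p, of "Id_on A" "G' Un Id_on {y}"] elG' eqI fG' ciso_Id_on[OF cloA] cA by auto
  have AyU: "A Un {y} \<subseteq> U p" using AU yU by simp
  have IdAy: "Id_on (A Un {y}) \<subseteq> \<pi>" using \<pi>(2) by auto
  have dom: "Domain (Id_on A Un (G' Un Id_on {y})) \<subseteq> snd p (A Un {y})"
  proof -
   have "Domain G' \<subseteq> snd p (A Un {y})" unfolding G'D using h(1) ek2(2) P.cl_ext[OF AyU] by blast
   then show ?thesis using P.cl_ext[OF AyU] by auto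
  qed
  have ran: "Range (Id_on A Un (G' Un Id_on {y})) \<subseteq> snd p (A Un {y})"
  proof
   fix v assume "v \<in> Range (Id_on A Un (G' Un Id_on {y}))"
   then obtain u where u: "(u, v) \<in> Id_on A Un (G' Un Id_on {y})" by blast
   then have "u \<in> snd p (A Un {y})" using dom by blast
   then show "v \<in> snd p (A Un {y})" using cl_iff_Id[OF p ciso_el[OF \<pi>(1)] _ IdAy] u \<pi>(2) by blast
  qed
  have D\<pi>: "Domain \<pi> = snd p (E Un F)"
  proof
   show "Domain \<pi> \<subseteq> snd p (E Un F)" unfolding \<pi>(3) clAy[symmetric] by (rule P.cl_least[OF AyU dom])
   show "snd p (E Un F) \<subseteq> Domain \<pi>" unfolding clAy[symmetric]
    by (rule P.cl_least'[OF ciso_Domain[OF \<pi>(1)]]) (use IdAy in auto)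
  qed
  have R\<pi>: "Range \<pi> = snd p (E Un F)"
  proof
   show "Range \<pi> \<subseteq> snd p (E Un F)" unfolding \<pi>(4) clAy[symmetric] by (rule P.cl_least[OF AyU ran])
   show "snd p (E Un F) \<subseteq> Range \<pi>" unfolding clAy[symmetric]
    by (rule P.cl_least'[OF ciso_Range[OF \<pi>(1)]]) (use IdAy in auto)
  qed
  have el\<pi>: "el p p \<pi>" by (rule ciso_el[OF \<pi>(1)])
  have G\<pi>: "(u, v) \<in> \<pi>" if "(u, v) \<in> G" "u \<in> e Un k2" for u v
   using that \<pi>(2) unfolding G'_def by blast
  have IdF: "(u, u) \<in> \<pi>" if "u \<in> E Un F" for u using that EA IdAy by blast
  have Idk2: "(u, u) \<in> \<pi>" if "u \<in> k2" for u
   using G\<pi>[of u u] that G(3) by (auto simp: k_def)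
  have e01: "el p p (Id_on e Un \<pi> Int faces p E0 F F \<times> UNIV)"
  proof -
   have "Domain \<pi> = snd p (E0 Un Z Un F)" "Range \<pi> = snd p (E0 Un Z Un F)" using D\<pi> R\<pi> clEX[OF FU] by simp_all
   moreover have "Id_on (k2 Un F) \<subseteq> \<pi>" using Idk2 IdF by auto
   moreover have "\<forall>x\<in>F - (F - {y}). Id_on (snd p (E0 Un Z Un (F - {x}))) \<subseteq> \<pi>"
   proof
    fix x assume "x \<in> F - (F - {y})"
    then have "x = y" by blast
    moreover have "snd p (E0 Un Z Un (F - {y})) = A" unfolding A_def by (rule clEX) (use FU in auto)
    ultimately show "Id_on (snd p (E0 Un Z Un (F - {x}))) \<subseteq> \<pi>" using IdAy by auto
   qed
   ultimately show ?thesis using k2P el\<pi> by blast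
  qed
  have inv: "u \<in> faces p E0 F F" if uv: "(u, v) \<in> \<pi>" "v \<in> faces p E0 F F" for u v
  proof (cases "v \<in> F")
   case True
   then have "(v, v) \<in> \<pi>" using IdF by blast
   then have "u = v" using pel_inj[OF el\<pi>] uv(1) by blast
   then show ?thesis using uv by simp
  next
   case False
   then obtain x where x: "x \<in> F" "v \<in> snd p (E0 Un (F - {x}))" using uv(2) by (auto simp: faces_def)
   have "Id_on (E0 Un (F - {x})) \<subseteq> \<pi>" using IdF E0(3) by auto
   then have "u \<in> snd p (E0 Un (F - {x}))" using cl_iff_Id[OF p el\<pi> uv(1)] x(2) by blast
   then show ?thesis using x(1) by (auto simp: faces_def)
  qed
  have f0: "faces p E0 F F \<subseteq> Range \<pi>"
  proof -
   have "snd p (E0 Un (F - {x})) \<subseteq> snd p (E Un F)" for x by (rule P.cl_mono) (use E0 EF in auto)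
   moreover have "F \<subseteq> snd p (E Un F)" using P.cl_ext[OF EF] by blast
   ultimately show ?thesis unfolding R\<pi> faces_def by blast
  qed
  \<comment> \<open>\<open>\<pi>\<close> is undone on the faces over \<open>E0\<close> while
    \<open>e\<close> stays in place, and then applied: the faces return to themselves and
    \<open>e\<close> goes where \<open>G\<close> sends it.\<close>
  define R0 where "R0 = (Id_on e Un \<pi> Int faces p E0 F F \<times> UNIV)\<inverse> O \<pi>"
  have elR0: "el p p R0"
   unfolding R0_def by (rule pel_comp[OF _ el\<pi>]) (simp only: pel_converse e01)
  have R0I: "(v, v) \<in> R0" if v: "v \<in> faces p E0 F F" for v
  proof -
   obtain u where u: "(u, v) \<in> \<pi>" using f0 v by blast
   then have "(v, u) \<in> (Id_on e Un \<pi> Int faces p E0 F F \<times> UNIV)\<inverse>" using inv[OF u v] by simp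
   then show ?thesis using u unfolding R0_def by blast
  qed
  have R0G: "(u, v) \<in> R0" if "(u, v) \<in> G" "u \<in> e" for u v
   using that G\<pi>[of u v] unfolding R0_def by blast
  show "el p p (G Un Id_on (faces p E W F))"
  proof (rule pel_finite)
   fix Q assume Q: "Q \<subseteq> G Un Id_on (faces p E W F)" "finite Q"
   define q where "q = Domain (Q Int Id_on (faces p E W F)) Un k"
   have qf: "finite q" "q \<subseteq> faces p E W F" using Q fk kf fW by (auto simp: q_def intro: finite_Domain)
   have clW: "snd p (E Un (W - {x})) = snd p (e1 Un (B Un (W - {x})))" for x
    using P.cl_Un_cl[of "e1 Un B" "W - {x}"] clB e1U BU W(1) by (auto simp: Un_assoc)
   have "q \<subseteq> F Un (\<Union>x\<in>F. snd p (e1 Un (B Un (W - {x}))))" using qf(2) unfolding faces_def clW .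
   then obtain N where N: "finite N" "N \<subseteq> B Un W"
    "\<forall>a\<in>q. a \<in> F \<or> (\<exists>x\<in>F. a \<in> snd p (e1 Un (N - {x})))"
    using faces_support[OF p e1U BU W(1) WB qf(1) _ F(1)] by blast
   \<comment> \<open>The support points outside \<open>E0\<close> and \<open>F\<close>: elements of
     \<open>Z\<close> and further elements of \<open>W\<close>. They are exchanged for fresh points
     \<open>Z1\<close> of \<open>B - Z\<close>, hence of \<open>E0\<close>.\<close>
   define V where "V = N - (F Un (B - Z))"
   define B1 where "B1 = N Int (B - Z)"
   have V: "finite V" "V \<subseteq> B Un W" "V Int F = {}" "V Int B1 = {}" using N by (auto simp: V_def B1_def)
   have B1: "finite B1" "B1 \<subseteq> B - Z" using N by (auto simp: B1_def)
   have "infinite (B - Z - B1)" using \<open>infinite B\<close> Z(2) B1(1) by simp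
   then obtain Z1 where Z1: "Z1 \<subseteq> B - Z - B1" "finite Z1" "card Z1 = card V"
    using infinite_arbitrarily_large by metis
   obtain r0 where r0: "bij_betw r0 V Z1" using finite_same_card_bij[OF V(1) Z1(2)] Z1(3) by metis
   define S0 where "S0 = e1 Un (B1 Un F)"
   have S0U: "S0 \<subseteq> U p" using e1U B1 BU FU by (auto simp: S0_def)
   have VU: "V \<subseteq> U p" "Z1 \<subseteq> U p" using V(2) BWU Z1(1) BU by auto
   have S0V: "indp (snd p) (snd p S0) V" "indp (snd p) (snd p S0) Z1"
   proof -
    have "indp (snd p) S0 V" unfolding S0_def by (rule indsub) (use B1 F V in auto)
    then show "indp (snd p) (snd p S0) V" using P.indp_cl[OF S0U VU(1)] by simp
    have "indp (snd p) S0 Z1" unfolding S0_def by (rule indsub) (use B1 F Z1 WB in auto)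
    then show "indp (snd p) (snd p S0) Z1" using P.indp_cl[OF S0U VU(2)] by simp
   qed
   have cS0: "countable (snd p S0)"
    by (rule qm3[OF p _ S0U]) (use e1 B1 F in \<open>simp add: S0_def\<close>)
   obtain r where r: "ciso p p r" "Id_on (snd p S0) \<subseteq> r" "gr r0 V \<subseteq> r"
    using cext_ex[OF p p ciso_Id_on[OF P.closed_cl[OF S0U]] Domain_Id_on Range_Id_on cS0 VU(1)
     countable_finite[OF V(1)] S0V(1) r0 VU(2) S0V(2)] by blast
   have elr: "el p p r" by (rule ciso_el[OF r(1)])
   have S0c: "S0 \<subseteq> snd p S0" by (rule P.cl_ext[OF S0U])
   define R1 where "R1 = r O (R0 O r\<inverse>)"
   have elR1: "el p p R1"
    unfolding R1_def by (intro pel_comp[OF elr] pel_comp[OF elR0]) (simp add: elr)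
   have qR: "(a, a) \<in> R1" if a: "a \<in> q" for a
   proof -
    have "\<exists>b. (a, b) \<in> r \<and> b \<in> faces p E0 F F"
    proof (cases "a \<in> F")
     case True
     then have "(a, a) \<in> r" using r(2) S0c by (auto simp: S0_def)
     then show ?thesis using True by (auto simp: faces_def)
    next
     case False
     then obtain x where x: "x \<in> F" "a \<in> snd p (e1 Un (N - {x}))" using N(3) a by blast
     define S where "S = (e1 Un B1 Un (F - {x})) Un V"
     have "e1 Un B1 Un (F - {x}) \<subseteq> snd p S0" using S0c by (auto simp: S0_def)
     then have Sr: "Id_on (e1 Un B1 Un (F - {x})) \<subseteq> r" using Id_on_subset_mono r(2) by blast
     have SD: "S \<subseteq> Domain r"
      unfolding S_def using Domain_mono[OF Sr] Domain_mono[OF r(3)] by simp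
     have SU: "S \<subseteq> U p" using SD el_U[OF elr] by blast
     have "e1 Un (N - {x}) \<subseteq> S" by (auto simp: S_def V_def B1_def)
     then have aS: "a \<in> snd p S" using x(2) P.cl_mono[OF _ SU] by blast
     then have "a \<in> Domain r" using P.cl_least'[OF ciso_Domain[OF r(1)] SD] by blast
     then obtain b where b: "(a, b) \<in> r" by blast
     have "b \<in> snd p (r `` S)" using cl_iff_Image[OF p p elr b SD] aS by simp
     moreover have "snd p (r `` S) \<subseteq> snd p (E0 Un (F - {x}))"
     proof (rule P.cl_mono)
      have "r `` V \<subseteq> Z1"
      proof
       fix w assume "w \<in> r `` V"
       then obtain v where v: "v \<in> V" "(v, w) \<in> r" by blast
       then have "(v, r0 v) \<in> r" using r(3) by (auto simp: gr_def)
       then have "w = r0 v" using pel_inj[OF elr] v(2) by blast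
       then show "w \<in> Z1" using r0 v(1) by (auto simp: bij_betw_def)
      qed
      moreover have "r `` (e1 Un B1 Un (F - {x})) = e1 Un B1 Un (F - {x})" by (rule pel_Image_Id[OF elr Sr])
      ultimately show "r `` S \<subseteq> E0 Un (F - {x})" using B1 Z1(1) by (auto simp: S_def E0_def Image_Un)
     qed (use E0 FU in auto)
     ultimately show ?thesis using b x(1) by (auto simp: faces_def)
    qed
    then obtain b where b: "(a, b) \<in> r" "b \<in> faces p E0 F F" by blast
    then show ?thesis using R0I[OF b(2)] unfolding R1_def by blast
   qed
   have GR: "(u, v) \<in> R1" if uv: "(u, v) \<in> G" "u \<in> e" for u v
   proof -
    have sub: "snd p (e1 Un F) \<subseteq> snd p S0" by (rule P.cl_mono[OF _ S0U]) (auto simp: S0_def)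
    have u: "u \<in> snd p (e1 Un F)" using uv(2) e1(3) by blast
    moreover have "Id_on (e1 Un F) \<subseteq> G" using G(3) e1F by auto
    ultimately have "v \<in> snd p (e1 Un F)" using cl_iff_Id[OF p G(1) uv(1)] by blast
    then have "(u, u) \<in> r" "(v, v) \<in> r" using u sub r(2) by auto
    then show ?thesis using R0G[OF uv] unfolding R1_def by blast
   qed
   have "Q \<subseteq> R1"
   proof
    fix t assume t: "t \<in> Q"
    obtain u v where uv: "t = (u, v)" by force
    show "t \<in> R1"
    proof (cases "t \<in> Id_on (faces p E W F)")
     case True
     then have "u = v" "u \<in> q" using t uv by (auto simp: q_def)
     then show ?thesis using qR uv by simp
    next
     case False
     then have tG: "(u, v) \<in> G" using t Q(1) uv by blast
     show ?thesis
     proof (cases "u \<in> e")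
      case True
      then show ?thesis using GR[OF tG] uv by simp
     next
      case False
      then have uk: "u \<in> k" using tG G(2) by blast
      then have "(u, u) \<in> G" using G(3) by auto
      then have "v = u" using pel_inj[OF G(1)] tG by blast
      then show ?thesis using qR[of u] uk uv by (simp add: q_def)
     qed
    qed
   qed
   then show "el p p Q" by (rule pel_subset[OF elR1])
  qed
 qed
 then show thesis using that[OF fk kf ek] by blast
qed

end

section \<open>Extension along independent sets of arbitrary size\<close>

context qmc begin

text \<open>Isolation inside \<open>p\<close> is used for maps into \<open>q\<close>. A finite part
  of \<open>f\<close> extends to an isomorphism \<open>\<rho>\<close> of closed sets, through which
  \<open>B\<close> is pulled back to \<open>p\<close>, isolated there and pushed forward again.
  Compatibility of \<open>B\<close> with all of \<open>f\<close>, however large, is thus reduced to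
  the finite part of \<open>f\<close> over \<open>k\<close>.\<close>

lemma lift_isol:
 assumes p: "p \<in> GG" "q \<in> GG" and f: "el p q f" "Domain f \<subseteq> S" and k: "k \<subseteq> Domain f" "finite k"
  and B: "finite B" "el p q (f Int k \<times> UNIV Un B)" "Domain B \<subseteq> snd p k" and iso: "isol p k (Domain B) S"
 shows "el p q (f Un B)"
proof (rule pel_finite)
 interpret Q: pregeo "U q" "snd q" by (rule pgi) fact
 fix Q assume Q: "Q \<subseteq> f Un B" "finite Q"
 define fk where "fk = f Int k \<times> UNIV"
 have Dfk: "Domain fk = k" unfolding fk_def by (rule Domain_restrict) (rule k)
 have elfk: "el p q fk" by (rule pel_subset[OF f(1)]) (auto simp: fk_def)
 have ffk: "finite fk" by (rule pel_finite_dom[OF elfk]) (simp add: Dfk k)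
 define f2 where "f2 = (Q Int f) Un fk"
 have f2: "el p q f2" "finite f2"
  using Q(2) ffk pel_subset[OF f(1), of f2] by (auto simp: f2_def fk_def)
 obtain \<rho> where \<rho>: "ciso p q \<rho>" "f2 \<subseteq> \<rho>" "Domain \<rho> = snd p (Domain f2)" "Range \<rho> = snd q (Range f2)"
  by (rule cl_fin_el[OF p f2])
 have el\<rho>: "el p q \<rho>" by (rule ciso_el[OF \<rho>(1)])
 have BR: "b \<in> Range \<rho>" if ab: "(a, b) \<in> B" for a b
 proof -
  have "a \<in> snd p (Domain fk)" using ab B(3) Dfk by blast
  then have "b \<in> snd q (Range fk)"
   using cl_imp[OF p B(2), of a b fk] ab by (simp add: fk_def)
  moreover have "snd q (Range fk) \<subseteq> snd q (Range f2)"
   by (rule Q.cl_mono) (use el_U[OF f2(1)] in \<open>auto simp: f2_def\<close>)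
  ultimately show ?thesis using \<rho>(4) by blast
 qed
 define G where "G = (fk Un B) O \<rho>\<inverse>"
 have "el p p G" unfolding G_def by (rule pel_comp[OF B(2)[folded fk_def]]) (simp add: el\<rho>)
 moreover have IdG: "Id_on k \<subseteq> G"
 proof -
  have "(u, u) \<in> G" if u: "u \<in> k" for u
  proof -
   obtain v where "(u, v) \<in> fk" using u Dfk by blast
   then show ?thesis using \<rho>(2) unfolding G_def f2_def by blast
  qed
  then show ?thesis by auto
 qed
 moreover have "Domain G = k Un Domain B"
 proof
  show "Domain G \<subseteq> k Un Domain B" using Dfk unfolding G_def by blast
  have "Domain B \<subseteq> Domain G" using BR unfolding G_def by blast
  then show "k Un Domain B \<subseteq> Domain G" using IdG by auto
 qed
 ultimately have "el p p (G Un Id_on S)" by (intro isolD[OF iso])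
 then have el: "el p q ((G Un Id_on S) O \<rho>)" by (rule pel_comp[OF _ el\<rho>])
 have "Q \<subseteq> (G Un Id_on S) O \<rho>"
 proof
  fix t assume t: "t \<in> Q"
  obtain a b where ab: "t = (a, b)" by force
  show "t \<in> (G Un Id_on S) O \<rho>"
  proof (cases "t \<in> f")
   case True
   then have "(a, b) \<in> \<rho>" "a \<in> S" using t ab \<rho>(2) f(2) by (auto simp: f2_def)
   then show ?thesis using ab by blast
  next
   case False
   then have tB: "(a, b) \<in> B" using Q(1) t ab by blast
   then obtain u where "(u, b) \<in> \<rho>" using BR by blast
   then show ?thesis using tB ab unfolding G_def by blast
  qed
 qed
 then show "el p q Q" by (rule pel_subset[OF el])
qed

text \<open>With the faces in the domain of \<open>f\<close>, a finite set \<open>k\<close> on them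
  isolates the new element together with the previous ones. \<open>qm5\<close> finds a value that is
  right over \<open>k\<close>, and by \<open>lift_isol\<close> it is right over all of
  \<open>f\<close>.\<close>

lemma gext_forth:
 assumes p: "p \<in> GG" "q \<in> GG" and E: "clo p E" "countable E" "infd (snd p) E"
  and W: "W \<subseteq> U p" "indp (snd p) E W" and F: "F \<subseteq> W" "finite F" "F \<noteq> {}"
  and f: "el p q (f Un B)" "finite B" "faces p E F F \<subseteq> Domain f" "Domain f \<subseteq> faces p E W F"
  and B: "Domain B \<subseteq> snd p (E Un F)" and a: "a \<in> snd p (E Un F)"
 shows "\<exists>a'. el p q (f Un insert (a, a') B)"
proof -
 interpret P: pregeo "U p" "snd p" by (rule pgi) fact
 have elf: "el p q f" by (rule pel_subset[OF f(1)]) simp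
 have e: "finite (insert a (Domain B))" "insert a (Domain B) \<subseteq> snd p (E Un F)"
  using f(2) B a by (auto simp: finite_Domain)
 obtain k where k: "finite k" "k \<subseteq> faces p E F F" "insert a (Domain B) \<subseteq> snd p k"
  "isol p k (insert a (Domain B)) (faces p E W F)"
  by (rule isol_faces[OF p(1) E W F e])
 have kf: "k \<subseteq> Domain f" using k(2) f(3) by blast
 define fk where "fk = f Int k \<times> UNIV"
 have Dfk: "Domain fk = k" unfolding fk_def by (rule Domain_restrict[OF kf])
 have elB: "el p q ({} Un (fk Un B))" by (rule pel_subset[OF f(1)]) (auto simp: fk_def)
 have "finite fk"
  by (rule pel_finite_dom[OF pel_subset[OF elf, of fk]]) (use Dfk k in \<open>auto simp: fk_def\<close>)
 then have fin: "finite (fk Un B)" using f(2) by simp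
 have "snd p k \<subseteq> snd p (Domain ({} Un (fk Un B)))"
  by (rule P.cl_mono) (use Dfk el_U[OF elB] in auto)
 then have "a \<in> snd p (Domain ({} Un (fk Un B)))" using k(3) by blast
 then obtain a' where a': "el p q (insert (a, a') ({} Un (fk Un B)))"
  using qm5[OF p elB fin] by blast
 have "el p q (f Un insert (a, a') B)"
 proof (rule lift_isol[OF p elf f(4) kf k(1)])
  show "el p q (f Int k \<times> UNIV Un insert (a, a') B)" using a' by (simp add: fk_def)
 qed (use f(2) k in auto)
 then show ?thesis by blast
qed

text \<open>Only the countable closure of \<open>E\<close> and \<open>F\<close> is enumerated; the
  map \<open>f\<close>, which may be uncountable, stays a fixed part of the condition that is
  maintained.\<close>

lemma gext_step:
 assumes p: "p \<in> GG" "q \<in> GG"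
  and E: "clo p E" "countable E" "infd (snd p) E" and E': "clo q E'" "countable E'" "infd (snd q) E'"
  and W: "W \<subseteq> U p" "indp (snd p) E W" and W': "W' \<subseteq> U q" "indp (snd q) E' W'"
  and F: "F \<subseteq> W" "finite F" "F \<noteq> {}" and F': "F' \<subseteq> W'" "finite F'" "F' \<noteq> {}"
  and f: "el p q f" "faces p E F F \<subseteq> Domain f" "Domain f \<subseteq> faces p E W F"
   "faces q E' F' F' \<subseteq> Range f" "Range f \<subseteq> faces q E' W' F'"
  and EF: "f `` (E Un F) = E' Un F'" "E Un F \<subseteq> Domain f"
 shows "\<exists>f'. el p q f' \<and> f \<subseteq> f' \<and> Domain f' = Domain f Un snd p (E Un F) \<and>
  f' `` snd p (E Un F) = snd q (E' Un F')"
proof -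
 interpret P: pregeo "U p" "snd p" by (rule pgi) fact
 interpret Q: pregeo "U q" "snd q" by (rule pgi) fact
 have U: "E Un F \<subseteq> U p" "E' Un F' \<subseteq> U q" using E E' W W' F F' by (auto simp: closed_set_def)
 \<comment> \<open>As \<open>f\<close> already matches \<open>E\<close> and \<open>F\<close> with
   \<open>E'\<close> and \<open>F'\<close>, \<open>qm1\<close> forces every value found by an
   elementary extension into the corresponding closure.\<close>
 have cl: "a \<in> snd p (E Un F) \<longleftrightarrow> a' \<in> snd q (E' Un F')" if "el p q (f Un insert (a, a') B)" for a a' B
 proof -
  define g where "g = f Int (E Un F) \<times> UNIV"
  have "Domain g = E Un F" unfolding g_def by (rule Domain_restrict[OF EF(2)])
  moreover have "Range g = E' Un F'" using EF(1) by (auto simp: g_def)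
  moreover have "g \<subseteq> f Un insert (a, a') B" by (auto simp: g_def)
  ultimately show ?thesis using cl_iff[OF p that, of a a' g] by simp
 qed
 let ?A = "snd p (E Un F)" and ?B = "snd q (E' Un F')"
 obtain K where K: "K \<subseteq> ?A \<times> ?B" "Domain K = ?A" "Range K = ?B"
  "\<And>X. finite X ==> X \<subseteq> K ==> \<exists>X'. X \<subseteq> X' \<and> el p q (f Un X')"
 proof (rule back_forth[of ?A ?B "\<lambda>X. el p q (f Un X)"])
  show "countable ?A" by (rule countable_closure[OF p(1) _ U(1)]) (use E F in \<open>simp add: countable_finite\<close>)
  show "countable ?B" by (rule countable_closure[OF p(2) _ U(2)]) (use E' F' in \<open>simp add: countable_finite\<close>)
  show "el p q (f Un {})" using f by simp
 next
  fix X a assume X: "finite X" "X \<subseteq> ?A \<times> ?B" "el p q (f Un X)" and a: "a \<in> ?A"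
  have "Domain X \<subseteq> ?A" using X(2) by auto
  then obtain a' where "el p q (f Un insert (a, a') X)"
   using gext_forth[OF p E W F X(3,1) f(2,3) _ a] by blast
  then show "\<exists>b\<in>?B. el p q (f Un insert (a, b) X)" using cl a by blast
 next
  fix X b assume X: "finite X" "X \<subseteq> ?A \<times> ?B" "el p q (f Un X)" and b: "b \<in> ?B"
  have D: "Domain (X\<inverse>) \<subseteq> ?B" using X(2) by auto
  have elc: "el q p (f\<inverse> Un X\<inverse>)" using X(3) by (simp only: converse_Un[symmetric] pel_converse)
  obtain a where "el q p (f\<inverse> Un insert (b, a) (X\<inverse>))"
   using gext_forth[OF p(2,1) E' W' F' elc _ _ _ D b] X(1) f(4,5) by auto
  moreover have "f\<inverse> Un insert (b, a) (X\<inverse>) = (f Un insert (a, b) X)\<inverse>" by auto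
  ultimately have "el p q (f Un insert (a, b) X)" by (simp only: pel_converse)
  then show "\<exists>a\<in>?A. el p q (f Un insert (a, b) X)" using cl b by blast
 qed blast
 have el: "el p q (f Un K)"
 proof (rule pel_finite)
  fix X assume X: "X \<subseteq> f Un K" "finite X"
  then obtain X' where "X Int K \<subseteq> X'" "el p q (f Un X')" using K(4)[of "X Int K"] by auto
  then show "el p q X" using pel_subset[of L _ _ "f Un X'" X] X by blast
 qed
 have "(f Un K) `` ?A = ?B"
 proof
  show "?B \<subseteq> (f Un K) `` ?A" using K(1,3) by blast
  show "(f Un K) `` ?A \<subseteq> ?B"
  proof
   fix v assume "v \<in> (f Un K) `` ?A"
   then obtain u where u: "u \<in> ?A" "(u, v) \<in> f Un K" by blast
   then obtain w where w: "(u, w) \<in> K" using K(2) by blast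
   then have "v = w" using pel_inj[OF el u(2), of u w] by blast
   then show "v \<in> ?B" using w K(1) by blast
  qed
 qed
 moreover have "Domain (f Un K) = Domain f Un ?A" using K(2) by auto
 ultimately show ?thesis using el by blast
qed

definition good_sets :: "('f, 'r, 'a) pstruct \<Rightarrow> ('f, 'r, 'a) pstruct \<Rightarrow> 'a set \<Rightarrow> 'a set \<Rightarrow> 'a set \<Rightarrow> ('a \<Rightarrow> 'a) \<Rightarrow>
  ('a \<times> 'a) set \<Rightarrow> 'a set set" where
 "good_sets p q E E' W j f = {G. finite G \<and> G \<subseteq> W \<and> snd p (E Un G) \<subseteq> Domain f \<and>
   f `` snd p (E Un G) = snd q (E' Un j ` G) \<and> gr j G \<subseteq> f}"

text \<open>Zorn's lemma for the partial elementary maps whose domain is a union of closures of finite parts of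
 \<open>W\<close>, each mapped onto the closure of the corresponding part of \<open>W'\<close>. A maximal one is total, since
 a minimal missing finite set \<open>F\<close> has all its faces in the domain.\<close>

lemma gext:
 assumes p: "p \<in> GG" "q \<in> GG"
  and E: "clo p E" "countable E" "infd (snd p) E" and E': "clo q E'" "countable E'" "infd (snd q) E'"
  and W: "W \<subseteq> U p" "indp (snd p) E W" and W': "W' \<subseteq> U q" "indp (snd q) E' W'" and j: "bij_betw j W W'"
  and f0: "el p q f0" "{} \<in> good_sets p q E E' W j f0"
   "Domain f0 = (\<Union>G\<in>good_sets p q E E' W j f0. snd p (E Un G))"
 shows "\<exists>f. ciso p q f \<and> f0 \<subseteq> f \<and> gr j W \<subseteq> f \<and> Domain f = snd p (E Un W) \<and> Range f = snd q (E' Un W')"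
proof -
 interpret P: pregeo "U p" "snd p" by (rule pgi) fact
 interpret Q: pregeo "U q" "snd q" by (rule pgi) fact
 have EU: "E \<subseteq> U p" "E' \<subseteq> U q" using E E' by (auto simp: closed_set_def)
 have clE: "snd p E = E" "snd q E' = E'" using E E' by (auto simp: closed_set_def)
 have jW: "j ` W = W'" "inj_on j W" using j by (auto simp: bij_betw_def)
 let ?g = "good_sets p q E E' W j"
 have E0: "E \<subseteq> Domain f0" "f0 `` E = E'" using f0(2) clE by (auto simp: good_sets_def)
 have Im: "h `` A = g `` A" if h: "el p q h" "g \<subseteq> h" "A \<subseteq> Domain g" for g h A
 proof
  show "g `` A \<subseteq> h `` A" using h(2) by blast
  show "h `` A \<subseteq> g `` A"
  proof
   fix v assume "v \<in> h `` A"
   then obtain u where u: "u \<in> A" "(u, v) \<in> h" by blast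
   then obtain w where w: "(u, w) \<in> g" using h(3) by blast
   then have "v = w" using pel_inj[OF h(1) u(2), of u w] h(2) by blast
   then show "v \<in> g `` A" using u w by blast
  qed
 qed
 have gmono: "?g g \<subseteq> ?g h" if "el p q h" "g \<subseteq> h" for g h
 proof
  fix G assume G: "G \<in> ?g g"
  then have "snd p (E Un G) \<subseteq> Domain g" by (simp add: good_sets_def)
  then show "G \<in> ?g h" using G Im[OF that, of "snd p (E Un G)"] that(2) unfolding good_sets_def by blast
 qed
 define \<S> where "\<S> = {f. el p q f \<and> f0 \<subseteq> f \<and> Domain f = (\<Union>G\<in>?g f. snd p (E Un G))}"
 have "\<exists>f\<in>\<S>. \<forall>h\<in>\<S>. f \<subseteq> h --> h = f"
 proof (rule subset_Zorn_nonempty)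
  show "\<S> \<noteq> {}" using f0 by (auto simp: \<S>_def)
  fix C assume C: "C \<noteq> {}" "subset.chain \<S> C"
  then have CS: "C \<subseteq> \<S>" and ch: "\<And>g h. g \<in> C ==> h \<in> C ==> g \<subseteq> h \<or> h \<subseteq> g"
   by (auto simp: subset_chain_def)
  have el: "el p q (\<Union>C)"
  proof (rule pel_chain[OF C(1)])
   show "el p q g" if "g \<in> C" for g using that CS by (auto simp: \<S>_def)
  qed (rule ch)
  have "Domain (\<Union>C) \<subseteq> (\<Union>G\<in>?g (\<Union>C). snd p (E Un G))"
  proof
   fix a assume "a \<in> Domain (\<Union>C)"
   then obtain g where g: "g \<in> C" "a \<in> Domain g" by blast
   have "Domain g = (\<Union>G\<in>?g g. snd p (E Un G))" using g(1) CS unfolding \<S>_def by blast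
   then have "a \<in> (\<Union>G\<in>?g g. snd p (E Un G))" using g(2) by blast
   moreover have "?g g \<subseteq> ?g (\<Union>C)" by (rule gmono[OF el]) (use g in blast)
   ultimately show "a \<in> (\<Union>G\<in>?g (\<Union>C). snd p (E Un G))" by blast
  qed
  moreover have "(\<Union>G\<in>?g (\<Union>C). snd p (E Un G)) \<subseteq> Domain (\<Union>C)" unfolding good_sets_def by blast
  moreover have "f0 \<subseteq> \<Union>C" using C(1) CS by (auto simp: \<S>_def)
  ultimately show "\<Union>C \<in> \<S>" using el by (auto simp: \<S>_def)
 qed
 then obtain f where fS: "f \<in> \<S>" and max: "\<And>h. h \<in> \<S> ==> f \<subseteq> h ==> h = f" by blast
 have f: "el p q f" "f0 \<subseteq> f" "Domain f = (\<Union>G\<in>?g f. snd p (E Un G))" using fS by (auto simp: \<S>_def)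
 have fE: "E \<subseteq> Domain f" using E0(1) f(2) by blast
 have fE': "f `` E = E'" using E0(2) Im[OF f(1,2) E0(1)] by simp
 have down: "H \<in> ?g f" if G: "G \<in> ?g f" and H: "H \<subseteq> G" for G H
 proof -
  have G': "finite G" "G \<subseteq> W" "snd p (E Un G) \<subseteq> Domain f" "f `` snd p (E Un G) = snd q (E' Un j ` G)" "gr j G \<subseteq> f"
   using G by (auto simp: good_sets_def)
  define g where "g = f Int snd p (E Un G) \<times> UNIV"
  have "j ` G \<subseteq> W'" using G'(2) jW(1) by blast
  then have EGU: "E Un G \<subseteq> U p" "E' Un j ` G \<subseteq> U q" using EU G'(2) W(1) W'(1) by auto
  have Dg: "Domain g = snd p (E Un G)" unfolding g_def by (rule Domain_restrict[OF G'(3)])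
  have Rg: "Range g = snd q (E' Un j ` G)" using G'(4) by (auto simp: g_def)
  have g: "ciso p q g"
   unfolding ciso_def Dg Rg using P.closed_cl[OF EGU(1)] Q.closed_cl[OF EGU(2)]
    pel_subset[OF f(1), of g] by (auto simp: g_def)
  have EHD: "E Un H \<subseteq> Domain g" using Dg P.cl_ext[OF EGU(1)] H by blast
  have sub: "snd p (E Un H) \<subseteq> Domain g" by (rule P.cl_least'[OF ciso_Domain[OF g] EHD])
  have gf: "g \<subseteq> f" by (auto simp: g_def)
  have "g `` E = E'" using Im[OF f(1) gf, of E] EHD fE' by simp
  moreover have "g `` H = j ` H"
  proof -
   have "f `` H = j ` H"
   proof
    show "j ` H \<subseteq> f `` H" using G'(5) H by (auto simp: gr_def)
    show "f `` H \<subseteq> j ` H"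
    proof
     fix v assume "v \<in> f `` H"
     then obtain u where u: "u \<in> H" "(u, v) \<in> f" by blast
     then have "(u, j u) \<in> f" using G'(5) H by (auto simp: gr_def)
     then have "v = j u" using pel_inj[OF f(1) u(2)] by blast
     then show "v \<in> j ` H" using u by blast
    qed
   qed
   then show ?thesis using Im[OF f(1) gf, of H] EHD by simp
  qed
  ultimately have "g `` snd p (E Un H) = snd q (E' Un j ` H)"
   using ciso_image[OF p g EHD] by (simp add: Image_Un)
  then have "f `` snd p (E Un H) = snd q (E' Un j ` H)" using Im[OF f(1) gf sub] by simp
  moreover have "gr j H \<subseteq> f" using G'(5) H by (auto simp: gr_def)
  moreover have "snd p (E Un H) \<subseteq> Domain f" using sub gf by blast
  moreover have "finite H" "H \<subseteq> W" using G' H finite_subset by auto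
  ultimately show ?thesis by (simp add: good_sets_def)
 qed
 have all: "F \<in> ?g f" if F: "finite F" "F \<subseteq> W" for F
 proof (rule ccontr)
  assume "F \<notin> ?g f"
  then have "\<exists>F. F \<notin> ?g f \<and> finite F \<and> F \<subseteq> W" using F by blast
  then obtain F where F: "F \<notin> ?g f" "finite F" "F \<subseteq> W"
   and least: "\<And>H. H \<notin> ?g f \<and> finite H \<and> H \<subseteq> W ==> card F \<le> card H"
   using ex_has_least_nat[of "\<lambda>F. F \<notin> ?g f \<and> finite F \<and> F \<subseteq> W" _ card] by metis
  have F0: "F \<noteq> {}" using F(1) gmono[OF f(1,2)] f0(2) by blast
  have Fx: "F - {x} \<in> ?g f" if "x \<in> F" for x
  proof (rule ccontr)
   assume "F - {x} \<notin> ?g f"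
   then have "card F \<le> card (F - {x})" using least[of "F - {x}"] F by auto
   then show False using that F(2) by (metis card_Diff1_less not_less)
  qed
  \<comment> \<open>Good sets are closed under subsets, so none of them contains \<open>F\<close>,
    and the whole domain of \<open>f\<close> avoids some vertex of \<open>F\<close> at each point.
    This is the upper bound on the domain that \<open>gext_step\<close> demands.\<close>
  have nF: "\<exists>x\<in>F. G \<subseteq> W - {x}" if "G \<in> ?g f" for G
  proof -
   have "\<not> F \<subseteq> G" using down[OF that] F(1) by blast
   then show ?thesis using that by (auto simp: good_sets_def)
  qed
  define F' where "F' = j ` F"
  have F': "F' \<subseteq> W'" "finite F'" "F' \<noteq> {}" using F F0 jW by (auto simp: F'_def)
  have jd: "j ` (W - {x}) = W' - {j x}" "j ` (F - {x}) = F' - {j x}" if "x \<in> F" for x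
   using that jW F(3) inj_on_image_set_diff[OF jW(2), of W "{x}"] inj_on_image_set_diff[OF jW(2), of F "{x}"]
   by (auto simp: F'_def)
  have WU: "E Un (W - {x}) \<subseteq> U p" "E' Un (W' - {x'}) \<subseteq> U q" for x x' using EU W W' by auto
  have Rf: "v \<in> snd q (E' Un j ` G)" if "(u, v) \<in> f" "u \<in> snd p (E Un G)" "G \<in> ?g f" for u v G
   using that by (auto simp: good_sets_def)
  have Df: "\<exists>x\<in>F. u \<in> snd p (E Un (W - {x})) \<and> v \<in> snd q (E' Un (W' - {j x}))" if uv: "(u, v) \<in> f" for u v
  proof -
   obtain G where G: "G \<in> ?g f" "u \<in> snd p (E Un G)" using f(3) uv by blast
   obtain x where x: "x \<in> F" "G \<subseteq> W - {x}" using nF[OF G(1)] by blast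
   have 1: "snd p (E Un G) \<subseteq> snd p (E Un (W - {x}))" by (rule P.cl_mono[OF _ WU(1)]) (use x in auto)
   have "j ` G \<subseteq> W' - {j x}" using x jd(1) by blast
   then have 2: "snd q (E' Un j ` G) \<subseteq> snd q (E' Un (W' - {j x}))" by (intro Q.cl_mono[OF _ WU(2)]) auto
   show ?thesis using x(1) G 1 2 Rf[OF uv G(2,1)] by blast
  qed
  \<comment> \<open>If \<open>F\<close> has two elements, each vertex lies on the face opposite to
    another one and \<open>f\<close> already follows \<open>j\<close> there. Only a single vertex
    may be new; it is generic over the domain, and \<open>qm4\<close> is applied to the closure of
    each finite part of \<open>f\<close>.\<close>
  define f1 where "f1 = f Un gr j F"
  have el1: "el p q f1"
  proof (cases "\<exists>x. F = {x}")
   case True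
   then obtain x where x: "F = {x}" by blast
   have xW: "x \<in> W" "j x \<in> W'" using F(3) x jW by auto
   show ?thesis
   proof (rule pel_finite)
    fix Q assume Q: "Q \<subseteq> f1" "finite Q"
    have fQ: "el p q (Q Int f)" "finite (Q Int f)" using pel_subset[OF f(1)] Q(2) by auto
    obtain \<rho> where \<rho>: "ciso p q \<rho>" "Q Int f \<subseteq> \<rho>" "Domain \<rho> = snd p (Domain (Q Int f))" "Range \<rho> = snd q (Range (Q Int f))"
     by (rule cl_fin_el[OF p fQ])
    have "Domain (Q Int f) \<subseteq> snd p (E Un (W - {x}))" "Range (Q Int f) \<subseteq> snd q (E' Un (W' - {j x}))"
     using Df x by blast+
    then have sub: "Domain \<rho> \<subseteq> snd p (E Un (W - {x}))" "Range \<rho> \<subseteq> snd q (E' Un (W' - {j x}))"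
     unfolding \<rho>(3,4) using P.cl_least[OF WU(1)] Q.cl_least[OF WU(2)] by blast+
    have "x \<notin> snd p (E Un (W - {x}))" "j x \<notin> snd q (E' Un (W' - {j x}))"
     using W(2) W'(2) xW by (auto simp: indp_def)
    then have n: "x \<in> U p - Domain \<rho>" "j x \<in> U q - Range \<rho>" using sub xW W(1) W'(1) by auto
    have cD: "countable (Domain \<rho>)" unfolding \<rho>(3)
     by (rule countable_closure[OF p(1)]) (use fQ el_U[OF fQ(1)] in \<open>auto simp: countable_finite finite_Domain\<close>)
    have "el p q (insert (x, j x) \<rho>)"
     by (rule qm4[OF p ciso_el[OF \<rho>(1)] ciso_Domain[OF \<rho>(1)] ciso_Range[OF \<rho>(1)] cD n])
    moreover have "Q \<subseteq> insert (x, j x) \<rho>" using Q(1) \<rho>(2) x by (auto simp: f1_def gr_def)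
    ultimately show "el p q Q" by (rule pel_subset)
   qed
  next
   case False
   have "gr j F \<subseteq> f"
   proof
    fix t assume "t \<in> gr j F"
    then obtain x where x: "x \<in> F" "t = (x, j x)" by (auto simp: gr_def)
    then obtain y where "y \<in> F" "y \<noteq> x" using False by blast
    then show "t \<in> f" using Fx[of y] x by (auto simp: good_sets_def gr_def)
   qed
   then have "f1 = f" by (auto simp: f1_def)
   then show ?thesis using f by simp
  qed
  have ff1: "f \<subseteq> f1" and grF: "gr j F \<subseteq> f1" by (auto simp: f1_def)
  have D1: "Domain f1 = Domain f Un F" and R1: "Range f1 = Range f Un F'"
   by (simp_all add: f1_def F'_def Domain_Un_eq Range_Un_eq)
  have c1: "faces p E F F \<subseteq> Domain f1"
   using Fx unfolding faces_def D1 good_sets_def by blast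
  have c2: "Domain f1 \<subseteq> faces p E W F"
   using Df unfolding faces_def D1 by blast
  have c3: "faces q E' F' F' \<subseteq> Range f1"
  proof -
   have "snd q (E' Un (F' - {x'})) \<subseteq> Range f" if "x' \<in> F'" for x'
   proof -
    obtain x where x: "x \<in> F" "x' = j x" using \<open>x' \<in> F'\<close> by (auto simp: F'_def)
    then have "f `` snd p (E Un (F - {x})) = snd q (E' Un (F' - {x'}))"
     using Fx[OF x(1)] jd(2)[OF x(1)] by (simp add: good_sets_def)
    then show ?thesis by blast
   qed
   then show ?thesis unfolding faces_def R1 by blast
  qed
  have c4: "Range f1 \<subseteq> faces q E' W' F'"
  proof
   fix v assume "v \<in> Range f1"
   then consider "v \<in> F'" | u where "(u, v) \<in> f" unfolding R1 by blast
   then show "v \<in> faces q E' W' F'"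
   proof cases
    case 1
    then show ?thesis by (simp add: faces_def)
   next
    case 2
    then obtain x where "x \<in> F" "v \<in> snd q (E' Un (W' - {j x}))" using Df by blast
    then show ?thesis by (auto simp: faces_def F'_def)
   qed
  qed
  have c5: "f1 `` (E Un F) = E' Un F'" "E Un F \<subseteq> Domain f1"
  proof -
   have "f1 `` E = E'" using Im[OF el1 ff1 fE] fE' by simp
   moreover have "f1 `` F = F'" using Im[OF el1 grF, of F] by (auto simp: F'_def)
   ultimately show "f1 `` (E Un F) = E' Un F'" by (simp add: Image_Un)
   show "E Un F \<subseteq> Domain f1" using D1 fE by blast
  qed
  obtain f' where f': "el p q f'" "f1 \<subseteq> f'" "Domain f' = Domain f1 Un snd p (E Un F)"
   "f' `` snd p (E Un F) = snd q (E' Un F')"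
   using gext_step[OF p E E' W W' F(3,2) F0 F' el1 c1 c2 c3 c4 c5] by blast
  have ff': "f \<subseteq> f'" using ff1 f'(2) by blast
  have Fg: "F \<in> ?g f'" using F f' grF by (auto simp: good_sets_def F'_def)
  have FE: "F \<subseteq> snd p (E Un F)" using P.cl_ext[of "E Un F"] EU W F by blast
  have "Domain f' \<subseteq> (\<Union>G\<in>?g f'. snd p (E Un G))"
  proof -
   have "Domain f \<subseteq> (\<Union>G\<in>?g f'. snd p (E Un G))" using f(3) gmono[OF f'(1) ff'] by blast
   then show ?thesis unfolding f'(3) D1 using FE Fg by blast
  qed
  moreover have "(\<Union>G\<in>?g f'. snd p (E Un G)) \<subseteq> Domain f'" unfolding good_sets_def by blast
  ultimately have "f' \<in> \<S>" using f'(1) ff' f(2) by (auto simp: \<S>_def)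
  then have "f' = f" using max ff' by blast
  then show False using Fg F(1) by simp
 qed
 have EWU: "W Un E \<subseteq> U p" "W' Un E' \<subseteq> U q" using EU W W' by auto
 have D: "Domain f = snd p (E Un W)"
 proof
  have "snd p (E Un G) \<subseteq> snd p (E Un W)" if "G \<in> ?g f" for G
   by (rule P.cl_mono) (use that EWU in \<open>auto simp: good_sets_def\<close>)
  then show "Domain f \<subseteq> snd p (E Un W)" unfolding f(3) by blast
  show "snd p (E Un W) \<subseteq> Domain f"
  proof
   fix a assume "a \<in> snd p (E Un W)"
   then obtain F where F: "F \<subseteq> W" "finite F" "a \<in> snd p (F Un E)"
    using P.cl_fin_Un[OF W(1) EU(1), of "{a}"] by (auto simp: Un_commute)
   then show "a \<in> Domain f" using all[OF F(2,1)] by (auto simp: good_sets_def Un_commute)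
  qed
 qed
 have R: "Range f = snd q (E' Un W')"
 proof
  show "Range f \<subseteq> snd q (E' Un W')"
  proof
   fix v assume "v \<in> Range f"
   then obtain u where u: "(u, v) \<in> f" by blast
   then obtain G where G: "G \<in> ?g f" "u \<in> snd p (E Un G)" using f(3) by blast
   then have "v \<in> snd q (E' Un j ` G)" using u by (auto simp: good_sets_def)
   moreover have "snd q (E' Un j ` G) \<subseteq> snd q (E' Un W')"
   proof (rule Q.cl_mono)
    have "j ` G \<subseteq> W'" using G(1) jW(1) by (auto simp: good_sets_def)
    then show "E' Un j ` G \<subseteq> E' Un W'" by blast
   qed (use EWU in auto)
   ultimately show "v \<in> snd q (E' Un W')" by blast
  qed
  show "snd q (E' Un W') \<subseteq> Range f"
  proof
   fix a assume "a \<in> snd q (E' Un W')"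
   then obtain F' where F': "F' \<subseteq> W'" "finite F'" "a \<in> snd q (F' Un E')"
    using Q.cl_fin_Un[OF W'(1) EU(2), of "{a}"] by (auto simp: Un_commute)
   obtain F where F: "F \<subseteq> W" "finite F" "F' = j ` F"
    using finite_subset_image[OF F'(2), of j W] F'(1) jW(1) by blast
   then have "f `` snd p (E Un F) = snd q (E' Un F')" using all[OF F(2,1)] by (auto simp: good_sets_def)
   then show "a \<in> Range f" using F'(3) by (auto simp: Un_commute)
  qed
 qed
 have "ciso p q f" unfolding ciso_def D R
  using f(1) P.closed_cl[of "E Un W"] Q.closed_cl[of "E' Un W'"] EWU by (simp add: Un_commute)
 moreover have "gr j W \<subseteq> f"
 proof
  fix t assume "t \<in> gr j W"
  then obtain x where "x \<in> W" "t = (x, j x)" by (auto simp: gr_def)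
  then show "t \<in> f" using all[of "{x}"] by (auto simp: good_sets_def)
 qed
 ultimately show ?thesis using f(2) D R by blast
qed

end

lemma pel_gr:
 assumes "pel L A B G"
 obtains g where "G = gr g (Domain G)" "inj_on g (Domain G)"
proof -
 have "\<forall>x\<in>Domain G. \<exists>y. (x, y) \<in> G" by auto
 then obtain g where g: "\<And>x. x \<in> Domain G ==> (x, g x) \<in> G" by metis
 have "y = g x" if "(x, y) \<in> G" for x y
  using pel_inj[OF assms that g] that by blast
 then have 1: "G = gr g (Domain G)" using g by (auto simp: gr_def)
 have "inj_on g (Domain G)"
 proof (rule inj_onI)
  fix x y assume "x \<in> Domain G" "y \<in> Domain G" "g x = g y"
  then show "x = y" using pel_inj[OF assms g g, of x y] by simp
 qed
 then show thesis using that 1 by blast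
qed

lemma gr_Image: "A \<subseteq> S ==> gr g S `` A = g ` A"
 unfolding gr_def by blast

context qmc begin

lemma indp_image:
 assumes p: "p \<in> GG" "q \<in> GG" and G: "el p q G" and AB: "A \<subseteq> Domain G" "B \<subseteq> Domain G" and ind: "indp (snd p) A B"
 shows "indp (snd q) (G `` A) (G `` B)"
 unfolding indp_def
proof
 fix b' assume "b' \<in> G `` B"
 then obtain b where b: "b \<in> B" "(b, b') \<in> G" by blast
 have "G `` (A Un (B - {b})) = G `` A Un (G `` B - {b'})"
  using pel_inj[OF G b(2)] by blast
 moreover have "b \<notin> snd p (A Un (B - {b}))" using ind b(1) unfolding indp_def by blast
 moreover have "A Un (B - {b}) \<subseteq> Domain G" using AB by blast
 ultimately show "b' \<notin> snd q (G `` A Un (G `` B - {b'}))"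
  using cl_iff_Image[OF p G b(2), of "A Un (B - {b})"] by simp
qed

text \<open>Serves to start \<open>gext\<close> from a nonempty map: where the map is an isomorphism
  between closed sets it preserves closures, so every finite set on which it follows
  \<open>j\<close> is good.\<close>

lemma good_sets_mem:
 assumes p: "p \<in> GG" "q \<in> GG" and f: "el p q f" and A: "clo p A" "A \<subseteq> Domain f" "clo q (f `` A)"
  and E: "E \<subseteq> A" "f `` E = E'" and F: "finite F" "F \<subseteq> W" "F \<subseteq> A" "gr j F \<subseteq> f"
 shows "F \<in> good_sets p q E E' W j f"
proof -
 interpret P: pregeo "U p" "snd p" by (rule pgi) fact
 define g where "g = f Int A \<times> UNIV"
 have Dg: "Domain g = A" unfolding g_def by (rule Domain_restrict[OF A(2)])
 have Rg: "Range g = f `` A" by (auto simp: g_def)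
 have g: "ciso p q g" unfolding ciso_def Dg Rg using A pel_subset[OF f, of g] by (auto simp: g_def)
 have gI: "g `` X = f `` X" if "X \<subseteq> A" for X using that by (auto simp: g_def)
 have sub: "snd p (E Un F) \<subseteq> A" by (rule P.cl_least'[OF A(1)]) (use E F in auto)
 have "f `` F = j ` F"
 proof
  show "j ` F \<subseteq> f `` F" using F(4) by (auto simp: gr_def)
  show "f `` F \<subseteq> j ` F"
  proof
   fix v assume "v \<in> f `` F"
   then obtain u where u: "u \<in> F" "(u, v) \<in> f" by blast
   then have "(u, j u) \<in> f" using F(4) by (auto simp: gr_def)
   then have "v = j u" using pel_inj[OF f u(2)] by blast
   then show "v \<in> j ` F" using u by blast
  qed
 qed
 then have "g `` (E Un F) = E' Un j ` F" using gI[of "E Un F"] E F by (simp add: Image_Un)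
 moreover have "g `` snd p (E Un F) = snd q (g `` (E Un F))"
  by (rule ciso_image[OF p g]) (use Dg E F in auto)
 ultimately have "f `` snd p (E Un F) = snd q (E' Un j ` F)" using gI[OF sub] by simp
 then show ?thesis using F sub A(2) by (auto simp: good_sets_def)
qed

text \<open>\<open>gext\<close> works over a countable infinite-dimensional base. A countably
  infinite part of a basis of \<open>H\<close> generates such a base \<open>E\<close>, and the rest
  of the basis remains independent over it.\<close>

lemma countable_infd_subset:
 assumes p: "p \<in> GG" and H: "clo p H" "infd (snd p) H"
 obtains B0 E Z where "B0 \<subseteq> H" "countable B0" "infinite B0" "indp (snd p) {} B0" "E = snd p B0" "clo p E" "countable E"
  "infd (snd p) E" "E \<subseteq> H" "Z \<subseteq> H" "indp (snd p) E Z" "H = snd p (E Un Z)"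
proof -
 interpret P: pregeo "U p" "snd p" by (rule pgi) fact
 have HU: "H \<subseteq> U p" using H by (simp add: closed_set_def)
 obtain B where B: "B \<subseteq> H" "indp (snd p) {} B" "H \<subseteq> snd p ({} Un B)" using P.basis_of[OF HU, of "{}"] by auto
 have "infinite B" using P.infd_infinite_basis[OF H(2), of "{}" B] B by auto
 then obtain B0 where B0: "B0 \<subseteq> B" "infinite B0" "countable B0" using infinite_countable_subset' by metis
 have BU: "B \<subseteq> U p" "B0 \<subseteq> U p" using B B0 HU by auto
 have i0: "indp (snd p) {} B0" by (rule P.indp_subset[OF B(2) B0(1)]) (use BU in auto)
 have Z: "indp (snd p) ({} Un B0) (B - B0)"
  by (rule P.indp_Un) (use B B0 BU in \<open>auto simp: Un_absorb1\<close>)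
 have Z': "indp (snd p) (snd p B0) (B - B0)" using Z P.indp_cl[OF BU(2), of "B - B0"] BU by auto
 have E: "snd p B0 \<subseteq> H" by (rule P.cl_least'[OF H(1)]) (use B B0 in blast)
 have inf: "infd (snd p) (snd p B0)" using P.infd_cl[OF B0(2) i0] BU by simp
 have "H = snd p (snd p B0 Un (B - B0))"
 proof -
  have "snd p (snd p B0 Un (B - B0)) = snd p (B0 Un (B - B0))" by (rule P.cl_Un_cl) (use BU in auto)
  also have "B0 Un (B - B0) = B" using B0 by auto
  also have "snd p B = H" using B P.cl_least'[OF H(1) B(1)] by auto
  finally show ?thesis by simp
 qed
 then show thesis
  using that[of B0 "snd p B0" "B - B0"] B B0 i0 P.closed_cl[OF BU(2)] countable_closure[OF p B0(3) BU(2)] inf E Z' by blast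
qed

lemma infd_image:
 assumes p: "p \<in> GG" "q \<in> GG" and G: "ciso p q G" and inf: "infd (snd p) (Domain G)"
 shows "infd (snd q) (Range G)"
 unfolding infd_def
proof (intro allI impI notI)
 fix F assume F: "F \<subseteq> Range G" "finite F" "Range G \<subseteq> snd q F"
 have elc: "el q p (G\<inverse>)" using ciso_el[OF G] by simp
 have fin: "finite (G\<inverse> `` F)" by (rule pel_finite_Image[OF elc F(2)])
 have "Domain G \<subseteq> snd p (G\<inverse> `` F)"
 proof
  fix a assume "a \<in> Domain G"
  then obtain b where b: "(b, a) \<in> G\<inverse>" by blast
  then have "b \<in> snd q F" using F(3) by blast
  then show "a \<in> snd p (G\<inverse> `` F)" using cl_iff_Image[OF p(2,1) elc b] F(1) by auto
 qed
 moreover have "G\<inverse> `` F \<subseteq> Domain G" by blast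
 ultimately show False using inf fin unfolding infd_def by blast
qed

text \<open>\<open>gext\<close> over a countable base \<open>E\<close> inside the domain of
  \<open>G\<close>, started at \<open>G\<close> itself: the finite subsets of \<open>Z\<close> are
  good because \<open>G\<close> is an isomorphism on the closure of \<open>E\<close> and
  \<open>Z\<close>.\<close>

lemma gext1_infd:
 assumes p: "p \<in> GG" "q \<in> GG" and G: "ciso p q G" "infd (snd p) (Domain G)"
  and X: "X \<subseteq> U p" "indp (snd p) (Domain G) X" and Y: "Y \<subseteq> U q" "indp (snd q) (Range G) Y"
  and j: "bij_betw j X Y"
 shows "\<exists>f. ciso p q f \<and> G \<subseteq> f \<and> gr j X \<subseteq> f \<and> Domain f = snd p (Domain G Un X) \<and> Range f = snd q (Range G Un Y)"
proof -
 interpret P: pregeo "U p" "snd p" by (rule pgi) fact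
 interpret Q: pregeo "U q" "snd q" by (rule pgi) fact
 let ?H = "Domain G"
 have elG: "el p q G" by (rule ciso_el[OF G(1)])
 obtain B0 E Z where E: "E = snd p B0" "B0 \<subseteq> ?H" "clo p E" "countable E" "infd (snd p) E" "E \<subseteq> ?H"
  and Z: "Z \<subseteq> ?H" "indp (snd p) E Z" "?H = snd p (E Un Z)"
  by (rule countable_infd_subset[OF p(1) ciso_Domain[OF G(1)] G(2)])
 note HU = el_U[OF elG]
 have EU: "E \<subseteq> U p" "Z \<subseteq> U p" "E Un Z \<subseteq> U p" using E Z HU by auto
 obtain g where g: "G = gr g ?H" "inj_on g ?H" by (rule pel_gr[OF elG])
 define E' where "E' = G `` E"
 have rE: "ciso p q (G Int E \<times> UNIV)" "Domain (G Int E \<times> UNIV) = E" "Range (G Int E \<times> UNIV) = E'"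
 proof -
  have "snd p E = E" using E(3) by (simp add: closed_set_def)
  then show "ciso p q (G Int E \<times> UNIV)" "Domain (G Int E \<times> UNIV) = E"
   using ciso_restrict[OF p G(1) E(6)] by simp_all
  show "Range (G Int E \<times> UNIV) = E'" by (auto simp: E'_def)
 qed
 have E': "clo q E'" "countable E'" "infd (snd q) E'"
  using ciso_Range[OF rE(1)] infd_image[OF p rE(1)] pel_countable_Range[OF ciso_el[OF rE(1)]] E rE by simp_all
 have disj: "X Int ?H = {}" "Y Int Range G = {}"
  using P.indp_disjoint[OF X(2) HU(1) X(1)] Q.indp_disjoint[OF Y(2) HU(2) Y(1)] by auto
 \<comment> \<open>On \<open>Z\<close> the bijection has to follow \<open>G\<close>, on
   \<open>X\<close> it is the prescribed one.\<close>
 define j' where "j' x = (if x \<in> X then j x else g x)" for x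
 have j'Z: "j' ` Z = G `` Z" "gr j' Z \<subseteq> G" if "True"
 proof -
  have "gr g ?H \<subseteq> G" using g(1) by (rule equalityD2)
  then have "(z, g z) \<in> G" if "z \<in> Z" for z using that Z(1) unfolding gr_def by blast
  moreover have "j' z = g z" if "z \<in> Z" for z using that Z(1) disj(1) unfolding j'_def by auto
  ultimately have "(z, j' z) \<in> G" if "z \<in> Z" for z using that by simp
  then show "gr j' Z \<subseteq> G" by (auto simp: gr_def)
  then show "j' ` Z = G `` Z" using pel_inj[OF elG] by (fastforce simp: gr_def)
 qed
 have j'X: "gr j' X = gr j X" by (auto simp: gr_def j'_def)
 have GZ: "G `` Z \<subseteq> Range G" by blast
 have bij: "bij_betw j' (Z Un X) (G `` Z Un Y)"
 proof (rule bij_betw_combine)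
  have "inj_on j' Z"
  proof (rule inj_onI)
   fix x y assume xy: "x \<in> Z" "y \<in> Z" "j' x = j' y"
   have "(x, j' x) \<in> G" "(y, j' y) \<in> G" using j'Z(2) xy by (auto simp: gr_def)
   then show "x = y" using pel_inj[OF elG, of x "j' x" y "j' y"] xy(3) by simp
  qed
  then show "bij_betw j' Z (G `` Z)" using j'Z(1) by (simp add: bij_betw_def)
  show "bij_betw j' X Y" using j by (auto simp: j'_def cong: bij_betw_cong)
  show "G `` Z Int Y = {}" using disj GZ by blast
 qed
 have indW: "indp (snd p) E (Z Un X)"
 proof (rule P.indp_UnI[OF Z(2) _ EU(1,2) X(1)])
  show "indp (snd p) (E Un Z) X" using X(2) Z(3) P.indp_cl[OF EU(3) X(1)] by simp
 qed
 have EZ': "Range G = snd q (E' Un G `` Z)"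
 proof -
  have "G `` snd p (E Un Z) = snd q (G `` (E Un Z))" by (rule ciso_image[OF p G(1)]) (use E Z in auto)
  moreover have "G `` snd p (E Un Z) = Range G" using Z(3) by auto
  ultimately show ?thesis by (simp add: E'_def Image_Un)
 qed
 have EU': "E' \<subseteq> U q" "G `` Z \<subseteq> U q" "E' Un G `` Z \<subseteq> U q" using HU by (auto simp: E'_def)
 have indW': "indp (snd q) E' (G `` Z Un Y)"
 proof (rule Q.indp_UnI[OF _ _ EU'(1,2) Y(1)])
  show "indp (snd q) E' (G `` Z)" unfolding E'_def by (rule indp_image[OF p elG E(6) Z(1,2)])
  show "indp (snd q) (E' Un G `` Z) Y" using Y(2) EZ' Q.indp_cl[OF EU'(3) Y(1)] by simp
 qed
 have mem: "F \<in> good_sets p q E E' (Z Un X) j' G" if F: "finite F" "F \<subseteq> Z" for F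
 proof (rule good_sets_mem[OF p elG ciso_Domain[OF G(1)] subset_refl _ E(6) _ F(1)])
  have "G `` ?H = Range G" by auto
  then show "clo q (G `` ?H)" using ciso_Range[OF G(1)] by simp
  show "G `` E = E'" by (simp add: E'_def)
  show "gr j' F \<subseteq> G" using j'Z(2) F(2) by (auto simp: gr_def)
 qed (use F Z in auto)
 have D: "?H = (\<Union>F\<in>good_sets p q E E' (Z Un X) j' G. snd p (E Un F))"
 proof
  show "?H \<subseteq> (\<Union>F\<in>good_sets p q E E' (Z Un X) j' G. snd p (E Un F))"
  proof
   fix a assume "a \<in> ?H"
   then have "{a} \<subseteq> snd p (Z Un E)" using Z(3) by (simp add: Un_commute)
   then obtain F where F: "F \<subseteq> Z" "finite F" "a \<in> snd p (F Un E)"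
    using P.cl_fin_Un[OF EU(2,1), of "{a}"] by auto
   then show "a \<in> (\<Union>F\<in>good_sets p q E E' (Z Un X) j' G. snd p (E Un F))"
    using mem[OF F(2,1)] by (auto simp: Un_commute)
  qed
 qed (auto simp: good_sets_def)
 have WU: "Z Un X \<subseteq> U p" "G `` Z Un Y \<subseteq> U q" using EU X EU' Y by auto
 obtain f where f: "ciso p q f" "G \<subseteq> f" "gr j' (Z Un X) \<subseteq> f" "Domain f = snd p (E Un (Z Un X))"
  "Range f = snd q (E' Un (G `` Z Un Y))"
  using gext[OF p E(3-5) E' WU(1) indW WU(2) indW' bij elG mem D] by auto
 have "gr j X \<subseteq> f" using f(3) j'X by (auto simp: gr_def)
 moreover have "Domain f = snd p (?H Un X)"
  using f(4) Z(3) P.cl_Un_cl[OF EU(3) X(1)] by (simp add: Un_assoc)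
 moreover have "Range f = snd q (Range G Un Y)"
  using f(5) EZ' Q.cl_Un_cl[OF EU'(3) Y(1)] by (simp add: Un_assoc)
 ultimately show ?thesis using f(1,2) by blast
qed

lemma not_infd_countable:
 assumes p: "p \<in> GG" and H: "clo p H" "\<not> infd (snd p) H"
 shows "countable H"
proof -
 obtain F where F: "F \<subseteq> H" "finite F" "H \<subseteq> snd p F" using H unfolding infd_def by blast
 then have "countable (snd p F)" using qm3[OF p F(2)] H by (auto simp: closed_set_def)
 then show ?thesis using F(3) countable_subset by blast
qed

text \<open>A domain of finite dimension is countable. Then \<open>cext\<close> suffices for finite
  \<open>X\<close>; for infinite \<open>X\<close>, countably many of its elements are adjoined by
  \<open>cext\<close>, which makes the domain infinite-dimensional.\<close>

lemma gext1:
 assumes p: "p \<in> GG" "q \<in> GG" and G: "ciso p q G"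
  and X: "X \<subseteq> U p" "indp (snd p) (Domain G) X" and Y: "Y \<subseteq> U q" "indp (snd q) (Range G) Y"
  and j: "bij_betw j X Y"
 shows "\<exists>f. ciso p q f \<and> G \<subseteq> f \<and> gr j X \<subseteq> f \<and> Domain f = snd p (Domain G Un X) \<and> Range f = snd q (Range G Un Y)"
proof (cases "infd (snd p) (Domain G)")
 case True
 then show ?thesis by (rule gext1_infd[OF p G _ X Y j])
next
 interpret P: pregeo "U p" "snd p" by (rule pgi) fact
 interpret Q: pregeo "U q" "snd q" by (rule pgi) fact
 case False
 then have cD: "countable (Domain G)" by (rule not_infd_countable[OF p(1) ciso_Domain[OF G]])
 note U = el_U[OF ciso_el[OF G]]
 show ?thesis
 proof (cases "finite X")
  case True
  show ?thesis
   by (rule cext_ex[OF p G refl refl cD X(1) countable_finite[OF True] X(2) j Y])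
 next
  case False
  then obtain X0 where X0: "X0 \<subseteq> X" "infinite X0" "countable X0" using infinite_countable_subset' by metis
  define Y0 where "Y0 = j ` X0"
  have Y0: "Y0 \<subseteq> Y" using j X0 by (auto simp: Y0_def bij_betw_def)
  have j0: "bij_betw j X0 Y0" unfolding Y0_def by (rule bij_betw_subset[OF j X0(1)]) simp
  have j1: "bij_betw j (X - X0) (Y - Y0)"
  proof -
   have "inj_on j X" "j ` X = Y" using j by (auto simp: bij_betw_def)
   then have "j ` (X - X0) = Y - Y0" using inj_on_image_set_diff[of j X X X0] X0 by (simp add: Y0_def)
   then show ?thesis using \<open>inj_on j X\<close> by (auto simp: bij_betw_def intro: inj_on_subset)
  qed
  have XU: "X0 \<subseteq> U p" "Y0 \<subseteq> U q" "X - X0 \<subseteq> U p" "Y - Y0 \<subseteq> U q" using X0 Y0 X Y by auto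
  have i0: "indp (snd p) (Domain G) X0" "indp (snd q) (Range G) Y0"
   by (rule P.indp_subset[OF X(2) X0(1) U(1) X(1)], rule Q.indp_subset[OF Y(2) Y0 U(2) Y(1)])
  obtain G' where G': "ciso p q G'" "G \<subseteq> G'" "gr j X0 \<subseteq> G'" "Domain G' = snd p (Domain G Un X0)"
   "Range G' = snd q (Range G Un Y0)"
   using cext_ex[OF p G refl refl cD XU(1) X0(3) i0(1) j0 XU(2) i0(2)] by blast
  have inf: "infd (snd p) (Domain G')" unfolding G'(4) by (rule P.infd_cl[OF X0(2) i0(1) U(1) XU(1)])
  have "indp (snd p) (Domain G Un X0) (X - X0)" "indp (snd q) (Range G Un Y0) (Y - Y0)"
   by (rule P.indp_Un, use X X0 U in \<open>auto simp: Un_absorb1\<close>) (rule Q.indp_Un, use Y Y0 U in \<open>auto simp: Un_absorb1\<close>)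
  moreover have U0: "Domain G Un X0 \<subseteq> U p" "Range G Un Y0 \<subseteq> U q" using U XU by auto
  ultimately have i1: "indp (snd p) (Domain G') (X - X0)" "indp (snd q) (Range G') (Y - Y0)"
   unfolding G'(4,5) using P.indp_cl[OF U0(1) XU(3)] Q.indp_cl[OF U0(2) XU(4)] by simp_all
  obtain f where f: "ciso p q f" "G' \<subseteq> f" "gr j (X - X0) \<subseteq> f" "Domain f = snd p (Domain G' Un (X - X0))"
   "Range f = snd q (Range G' Un (Y - Y0))"
   using gext1_infd[OF p G'(1) inf XU(3) i1(1) XU(4) i1(2) j1] by blast
  have "Domain G Un X0 Un (X - X0) = Domain G Un X" "Range G Un Y0 Un (Y - Y0) = Range G Un Y" using X0 Y0 by auto
  then have "Domain f = snd p (Domain G Un X)" "Range f = snd q (Range G Un Y)"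
   using f(4,5) P.cl_Un_cl[OF U0(1) XU(3)] Q.cl_Un_cl[OF U0(2) XU(4)] G'(4,5) by simp_all
  moreover have "gr j X \<subseteq> f"
  proof -
   have "gr j X = gr j X0 Un gr j (X - X0)" using X0(1) by (auto simp: gr_def)
   then show ?thesis using G'(3) f(2,3) by blast
  qed
  ultimately show ?thesis using f(1,2) G'(2) by blast
 qed
qed

end

context qmc begin

text \<open>The domain of \<open>f\<close> is not closed, but it is the union of the closures over
  \<open>E\<close> of finite parts of \<open>Z \<union> X\<close> and of
  \<open>Z \<union> Y\<close>, which is all that \<open>gext\<close> asks of its starting map. The
  independence of \<open>X\<close> over \<open>C\<close> makes \<open>Z\<close>, \<open>Y\<close>
  and \<open>X\<close> together independent over \<open>E\<close>. This is the extension property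
  behind the s-prime models of (AIII).\<close>

lemma gext2:
 assumes p: "p \<in> GG" "q \<in> GG" and f: "el p q f" "Domain f = A Un C"
  and A: "clo p A" "clo q (f `` A)" and C: "clo p C" "clo q (f `` C)"
  and B: "B = A Int C" "clo p B" "infd (snd p) B"
  and X: "X \<subseteq> A" "indp (snd p) C X" "A = snd p (B Un X)"
 shows "\<exists>f'. ciso p q f' \<and> f \<subseteq> f' \<and> Domain f' = snd p (A Un C) \<and> Range f' = snd q (f `` (A Un C))"
proof -
 interpret P: pregeo "U p" "snd p" by (rule pgi) fact
 interpret Q: pregeo "U q" "snd q" by (rule pgi) fact
 have U: "A \<subseteq> U p" "C \<subseteq> U p" "B \<subseteq> U p" "X \<subseteq> U p"
  using A(1) C(1) B(2) X(1) unfolding closed_set_def by blast+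
 obtain B0 E Z where E: "E = snd p B0" "B0 \<subseteq> B" "clo p E" "countable E" "infd (snd p) E" "E \<subseteq> B"
  and Z: "Z \<subseteq> B" "indp (snd p) E Z" "B = snd p (E Un Z)"
  by (rule countable_infd_subset[OF p(1) B(2,3)])
 obtain Y where Y: "Y \<subseteq> C" "indp (snd p) B Y" "C \<subseteq> snd p (B Un Y)" using P.basis_of[OF U(2,3)] .
 have YU: "Y \<subseteq> U p" and EU: "E \<subseteq> U p" "Z \<subseteq> U p" "E Un Z \<subseteq> U p" using Y(1) U E(6) Z(1) by blast+
 have clBV: "snd p (B Un V) = snd p (E Un (Z Un V))" if "V \<subseteq> U p" for V
  using P.cl_Un_cl[OF EU(3) that] Z(3) by (simp add: Un_assoc)
 have CY: "C = snd p (E Un (Z Un Y))"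
 proof -
  have "snd p (B Un Y) \<subseteq> C" by (rule P.cl_least'[OF C(1)]) (use B(1) Y(1) in blast)
  then show ?thesis using Y(3) clBV[OF YU] by blast
 qed
 have AX: "A = snd p (E Un (Z Un X))" using X(3) clBV[OF U(4)] by simp
 have ZY: "indp (snd p) E (Z Un Y)"
 proof (rule P.indp_UnI[OF Z(2) _ EU(1,2) YU])
  show "indp (snd p) (E Un Z) Y" using Y(2) Z(3) P.indp_cl[OF EU(3) YU] by simp
 qed
 define W where "W = (Z Un Y) Un X"
 have ZYU: "Z Un Y \<subseteq> U p" "E Un (Z Un Y) \<subseteq> U p" and WU: "W \<subseteq> U p" using EU YU U by (auto simp: W_def)
 have indW: "indp (snd p) E W"
  unfolding W_def
 proof (rule P.indp_UnI[OF ZY _ EU(1) ZYU(1) U(4)])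
  show "indp (snd p) (E Un (Z Un Y)) X" using X(2) CY P.indp_cl[OF ZYU(2) U(4)] by simp
 qed
 obtain g where g: "f = gr g (Domain f)" "inj_on g (Domain f)" by (rule pel_gr[OF f(1)])
 have gf: "gr g (Domain f) \<subseteq> f" using g(1) by (rule equalityD2)
 have WD: "W \<subseteq> Domain f" and ED: "E \<subseteq> Domain f" 
  using f(2) Z(1) Y(1) X(1) B(1) E(6) unfolding W_def by blast+
 define E' where "E' = f `` E"
 define W' where "W' = f `` W"
 have j: "bij_betw g W W'"
 proof -
  have "f `` W = g ` W" using g(1) gr_Image[OF WD] by metis
  then show ?thesis using inj_on_subset[OF g(2) WD] by (simp add: bij_betw_def W'_def)
 qed
 define fA where "fA = f Int A \<times> UNIV"
 have DfA: "Domain fA = A" unfolding fA_def by (rule Domain_restrict) (simp add: f)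
 have RfA: "Range fA = f `` A" by (auto simp: fA_def)
 have fA: "ciso p q fA" unfolding ciso_def DfA RfA using A pel_subset[OF f(1), of fA] by (auto simp: fA_def)
 have EA: "E \<subseteq> A" "E \<subseteq> C" using E(6) B(1) by auto
 have clE: "snd p E = E" using E(3) by (simp add: closed_set_def)
 have rE: "ciso p q (fA Int E \<times> UNIV)" "Domain (fA Int E \<times> UNIV) = E"
  using ciso_restrict[OF p fA, of E] EA DfA clE by simp_all
 have RE: "Range (fA Int E \<times> UNIV) = E'" using EA by (auto simp: E'_def fA_def)
 have E': "clo q E'" "countable E'" "infd (snd q) E'"
  using ciso_Range[OF rE(1)] infd_image[OF p rE(1)] pel_countable_Range[OF ciso_el[OF rE(1)]] E rE RE by simp_all
 have indW': "indp (snd q) E' W'" unfolding E'_def W'_def by (rule indp_image[OF p f(1) ED WD indW])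
 have W'U: "W' \<subseteq> U q" using el_U[OF f(1)] by (auto simp: W'_def)
 let ?g = "good_sets p q E E' W g f"
 have grF: "gr g F \<subseteq> f" if "F \<subseteq> W" for F
 proof -
  have "gr g F \<subseteq> gr g (Domain f)" unfolding gr_def by (rule image_mono) (rule subset_trans[OF that WD])
  then show ?thesis using gf by (rule subset_trans)
 qed
 have EE': "f `` E = E'" by (simp add: E'_def)
 have DfAC: "A \<subseteq> Domain f" "C \<subseteq> Domain f" unfolding f(2) by blast+
 have ZA: "Z Un X \<subseteq> A" "Z Un Y \<subseteq> C" using Z(1) X(1) Y(1) B(1) by blast+
 have ZW: "Z Un X \<subseteq> W" "Z Un Y \<subseteq> W" unfolding W_def by blast+
 have memA: "F \<in> ?g" if F: "finite F" "F \<subseteq> Z Un X" for F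
  by (rule good_sets_mem[OF p f(1) A(1) DfAC(1) A(2) EA(1) EE' F(1) subset_trans[OF F(2) ZW(1)]
    subset_trans[OF F(2) ZA(1)] grF[OF subset_trans[OF F(2) ZW(1)]]])
 have memC: "F \<in> ?g" if F: "finite F" "F \<subseteq> Z Un Y" for F
  by (rule good_sets_mem[OF p f(1) C(1) DfAC(2) C(2) EA(2) EE' F(1) subset_trans[OF F(2) ZW(2)]
    subset_trans[OF F(2) ZA(2)] grF[OF subset_trans[OF F(2) ZW(2)]]])
 have cover: "\<exists>F. F \<subseteq> V \<and> finite F \<and> a \<in> snd p (E Un F)" if a: "a \<in> snd p (E Un V)" and V: "V \<subseteq> U p" for a V
 proof -
  have "{a} \<subseteq> snd p (V Un E)" using a by (simp add: Un_commute)
  from P.cl_fin_Un[OF V EU(1) _ this] show ?thesis by (simp add: Un_commute)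
 qed
 have D: "Domain f = (\<Union>F\<in>?g. snd p (E Un F))"
 proof
  show "Domain f \<subseteq> (\<Union>F\<in>?g. snd p (E Un F))"
  proof
   fix a assume "a \<in> Domain f"
   then consider "a \<in> A" | "a \<in> C" using f(2) by blast
   then show "a \<in> (\<Union>F\<in>?g. snd p (E Un F))"
   proof cases
    case 1
    then have a1: "a \<in> snd p (E Un (Z Un X))" using AX by (rule subst[rotated])
    have "Z Un X \<subseteq> U p" using EU(2) U(4) by simp
    then obtain F where F: "F \<subseteq> Z Un X" "finite F" "a \<in> snd p (E Un F)" using cover[OF a1] by blast
    then show ?thesis using memA[OF F(2,1)] by blast
   next
    case 2
    then have a1: "a \<in> snd p (E Un (Z Un Y))" using CY by (rule subst[rotated])
    obtain F where F: "F \<subseteq> Z Un Y" "finite F" "a \<in> snd p (E Un F)" using cover[OF a1 ZYU(1)] by blast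
    then show ?thesis using memC[OF F(2,1)] by blast
   qed
  qed
 qed (auto simp: good_sets_def)
 have mem0: "{} \<in> ?g" by (rule memA) simp_all
 obtain f' where f': "ciso p q f'" "f \<subseteq> f'" "gr g W \<subseteq> f'" "Domain f' = snd p (E Un W)" "Range f' = snd q (E' Un W')"
  using gext[OF p E(3-5) E' WU indW W'U indW' j f(1) mem0 D] by blast
 have EWU: "E Un W \<subseteq> U p" "A Un C \<subseteq> U p" using EU WU U by auto
 have sub: "A Un C \<subseteq> Domain f'" using f'(2) f(2) by blast
 have D': "Domain f' = snd p (A Un C)"
 proof
  show "Domain f' \<subseteq> snd p (A Un C)" unfolding f'(4)
   by (rule P.cl_mono) (use WD ED f(2) EWU in auto)
  show "snd p (A Un C) \<subseteq> Domain f'" by (rule P.cl_least'[OF ciso_Domain[OF f'(1)] sub])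
 qed
 have "f' `` snd p (A Un C) = snd q (f' `` (A Un C))" by (rule ciso_image[OF p f'(1) sub])
 moreover have "f' `` snd p (A Un C) = Range f'" using D' by auto
 moreover have "f' `` (A Un C) = f `` (A Un C)"
 proof
  show "f' `` (A Un C) \<subseteq> f `` (A Un C)"
  proof
   fix v assume "v \<in> f' `` (A Un C)"
   then obtain u where u: "u \<in> A Un C" "(u, v) \<in> f'" by blast
   then obtain w where w: "(u, w) \<in> f" using f(2) by blast
   then have "v = w" using pel_inj[OF ciso_el[OF f'(1)] u(2), of u w] f'(2) by blast
   then show "v \<in> f `` (A Un C)" using w u by blast
  qed
 qed (use f'(2) in blast)
 ultimately have "Range f' = snd q (f `` (A Un C))" by simp
 then show ?thesis using f'(1,2) D' by blast
qed

section \<open>Saturation, isolation over large sets, and nonsplitting\<close>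

text \<open>A basis of \<open>b\<close> over \<open>A\<close> is replaced by equally many elements
  of \<open>H\<close> that are independent over \<open>A\<close>; infinite dimension guarantees that
  there are enough.\<close>

lemma saturated:
 assumes p: "p \<in> GG" and H: "clo p H" "infd (snd p) H" and A: "A \<subseteq> H" "finite A" and b: "finite b" "b \<subseteq> U p"
 shows "\<exists>G. el p p G \<and> Id_on A \<subseteq> G \<and> b \<subseteq> Domain G \<and> Range G \<subseteq> H"
proof -
 interpret P: pregeo "U p" "snd p" by (rule pgi) fact
 have HU: "H \<subseteq> U p" and AU: "A \<subseteq> U p" using H A by (auto simp: closed_set_def)
 obtain Y where Y: "Y \<subseteq> b" "indp (snd p) A Y" "b \<subseteq> snd p (A Un Y)" using P.basis_of[OF b(2) AU] .
 obtain B where B: "B \<subseteq> H" "indp (snd p) A B" "H \<subseteq> snd p (A Un B)" using P.basis_of[OF HU AU] .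
 have "infinite B" by (rule P.infd_infinite_basis[OF H(2) A(2,1) B(1,3)])
 then obtain Y' where Y': "Y' \<subseteq> B" "finite Y'" "card Y' = card Y" using infinite_arbitrarily_large by blast
 have fY: "finite Y" using Y b finite_subset by blast
 obtain j where j: "bij_betw j Y Y'" using finite_same_card_bij[OF fY Y'(2)] Y'(3) by metis
 have YU: "Y \<subseteq> U p" "Y' \<subseteq> U p" "B \<subseteq> U p" using Y b Y' B HU by auto
 have i: "indp (snd p) (snd p A) Y" "indp (snd p) (snd p A) Y'"
  using Y(2) P.indp_subset[OF B(2) Y'(1) AU YU(3)] P.indp_cl[OF AU] YU by auto
 obtain G where G: "ciso p p G" "Id_on (snd p A) \<subseteq> G" "Domain G = snd p (snd p A Un Y)" "Range G = snd p (snd p A Un Y')"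
  using cext_ex[OF p p ciso_Id_on[OF P.closed_cl[OF AU]] Domain_Id_on Range_Id_on qm3[OF p A(2) AU]
   YU(1) countable_finite[OF fY] i(1) j YU(2) i(2)] by blast
 have "Id_on A \<subseteq> G" using Id_on_subset_mono[OF P.cl_ext[OF AU]] G(2) by blast
 moreover have "b \<subseteq> Domain G" using G(3) Y(3) P.cl_Un_cl[OF AU YU(1)] by simp
 moreover have "Range G \<subseteq> H"
  unfolding G(4) by (rule P.cl_least'[OF H(1)]) (use P.cl_least'[OF H(1) A(1)] Y' B in auto)
 ultimately show ?thesis using ciso_el[OF G(1)] by blast
qed

text \<open>A finite part of the closure of \<open>E\<close> and \<open>V\<close> has finite
  supports \<open>k1\<close> in \<open>E\<close> and \<open>V1\<close> in \<open>V\<close>.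
  Exchanging \<open>V1\<close> for fresh points of \<open>E\<close> while fixing \<open>k1\<close>,
  \<open>k\<close> and \<open>Y\<close> carries it into \<open>E\<close>, where the type is
  isolated; conjugation brings the conclusion back.\<close>

lemma isol_lift:
 assumes p: "p \<in> GG" and E: "clo p E" "countable E" "infd (snd p) E" and Y: "finite Y" "Y \<subseteq> U p"
  and V: "V \<subseteq> U p" "indp (snd p) E (V Un Y)" "V Int Y = {}"
  and k: "k \<subseteq> E" "finite k" "e \<subseteq> snd p (k Un Y)" and iso: "isol p (k Un Y) e (E Un Y)"
 shows "isol p (k Un Y) e (snd p (E Un V) Un Y)"
 unfolding isol_def
proof (intro allI impI)
 interpret P: pregeo "U p" "snd p" by (rule pgi) fact
 fix G assume G: "el p p G" "Domain G = k Un Y Un e" "Id_on (k Un Y) \<subseteq> G"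
 have EU: "E \<subseteq> U p" and kU: "k \<subseteq> U p" using E k by (auto simp: closed_set_def)
 have elE: "el p p (G Un Id_on (E Un Y))" by (rule isolD[OF iso G])
 have RG: "Range G \<subseteq> snd p (k Un Y)"
 proof
  fix v assume "v \<in> Range G"
  then obtain u where u: "(u, v) \<in> G" by blast
  then have "u \<in> snd p (k Un Y)" using G(2) k(3) P.cl_ext[of "k Un Y"] kU Y(2) by blast
  then show "v \<in> snd p (k Un Y)" using cl_iff_Id[OF p G(1) u G(3)] by blast
 qed
 have DG: "Domain G \<subseteq> snd p (k Un Y)" using G(2) k(3) P.cl_ext[of "k Un Y"] kU Y(2) by auto
 show "el p p (G Un Id_on (snd p (E Un V) Un Y))"
 proof (rule pel_finite)
  fix Q assume Q: "Q \<subseteq> G Un Id_on (snd p (E Un V) Un Y)" "finite Q"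
  define q where "q = Domain (Q Int Id_on (snd p (E Un V)))"
  have q: "finite q" "q \<subseteq> snd p (E Un V)" using Q(2) by (auto simp: q_def finite_Domain)
  obtain V1 where V1: "V1 \<subseteq> V" "finite V1" "q \<subseteq> snd p (V1 Un E)"
   using P.cl_fin_Un[OF V(1) EU q(1)] q(2) by (auto simp: Un_commute)
  have V1U: "V1 \<subseteq> U p" using V1 V by blast
  obtain k1 where k1: "k1 \<subseteq> E" "finite k1" "q \<subseteq> snd p (k1 Un V1)"
   using P.cl_fin_Un[OF EU V1U q(1)] V1(3) by (auto simp: Un_commute)
  define k2 where "k2 = k1 Un k"
  have k2: "k2 \<subseteq> E" "finite k2" "k2 \<subseteq> U p" using k1 k EU by (auto simp: k2_def)
  obtain B where B: "B \<subseteq> E" "indp (snd p) k2 B" "E \<subseteq> snd p (k2 Un B)" using P.basis_of[OF EU k2(3)] .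
  have "infinite B" by (rule P.infd_infinite_basis[OF E(3) k2(2,1) B(1,3)])
  then obtain Z where Z: "Z \<subseteq> B" "finite Z" "card Z = card V1" using infinite_arbitrarily_large by blast
  obtain j where j: "bij_betw j V1 Z" using finite_same_card_bij[OF V1(2) Z(2)] Z(3) by metis
  have ZU: "Z \<subseteq> U p" "Z \<subseteq> E" using Z B EU by auto
  have k2Y: "k2 Un Y \<subseteq> U p" using k2 Y by simp
  have "indp (snd p) E (V1 Un Y)" by (rule P.indp_subset[OF V(2) _ EU]) (use V1 V Y in auto)
  then have iV: "indp (snd p) (k2 Un Y) V1"
  proof -
   assume "indp (snd p) E (V1 Un Y)"
   then have "indp (snd p) k2 (Y Un V1)" using P.indp_mono[OF _ k2(1) EU] V1U Y by (simp add: Un_commute)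
   then show ?thesis by (rule P.indp_Un) (use V1 V k2 Y V1U in auto)
  qed
  have iZ: "indp (snd p) (k2 Un Y) Z"
  proof -
   have "indp (snd p) k2 Z" by (rule P.indp_subset[OF B(2) Z(1) k2(3)]) (use B EU in auto)
   moreover have "indp (snd p) (k2 Un Z) Y"
    by (rule P.indp_antimono[OF V(2), of "k2 Un Z" Y]) (use k2 ZU EU V Y in auto)
   ultimately have "indp (snd p) k2 (Z Un Y)" by (rule P.indp_UnI) (use k2 ZU Y in auto)
   then have "indp (snd p) k2 (Y Un Z)" by (simp add: Un_commute)
   moreover have "Y Int Z = {}" using P.indp_disjoint[OF V(2) EU] V(1) Y(2) ZU by blast
   ultimately show ?thesis by (rule P.indp_Un) (use k2 ZU Y in auto)
  qed
  let ?S = "snd p (k2 Un Y)"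
  have iVZ: "indp (snd p) ?S V1" "indp (snd p) ?S Z" using iV iZ P.indp_cl[OF k2Y] V1U ZU by auto
  have cS: "countable ?S" by (rule qm3[OF p _ k2Y]) (use k2 Y in simp)
  obtain r where r: "ciso p p r" "Id_on ?S \<subseteq> r" "gr j V1 \<subseteq> r" "Domain r = snd p (?S Un V1)" "Range r = snd p (?S Un Z)"
   using cext_ex[OF p p ciso_Id_on[OF P.closed_cl[OF k2Y]] Domain_Id_on Range_Id_on cS V1U
    countable_finite[OF V1(2)] iVZ(1) j ZU(1) iVZ(2)] by blast
  have elr: "el p p r" by (rule ciso_el[OF r(1)])
  define R where "R = r O ((G Un Id_on (E Un Y)) O r\<inverse>)"
  have elR: "el p p R" unfolding R_def by (intro pel_comp[OF elr] pel_comp[OF elE]) (simp add: elr)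
  have kS: "snd p (k Un Y) \<subseteq> ?S" by (rule P.cl_mono[OF _ k2Y]) (auto simp: k2_def)
  have "G \<subseteq> R"
  proof
   fix t assume t: "t \<in> G"
   obtain u v where uv: "t = (u, v)" by force
   have "(u, u) \<in> r" "(v, v) \<in> r" using t uv DG RG kS r(2) by blast+
   then show "t \<in> R" using t uv unfolding R_def by blast
  qed
  moreover have qR: "(a, a) \<in> R" if a: "a \<in> q" for a
  proof -
   have kr: "Id_on k1 \<subseteq> r" using P.cl_ext[OF k2Y] r(2) by (auto simp: k2_def)
   have kV: "k1 Un V1 \<subseteq> Domain r" using Domain_mono[OF kr] Domain_mono[OF r(3)] by simp
   have "a \<in> snd p (k1 Un V1)" using k1(3) a by blast
   then have "a \<in> Domain r" using P.cl_least'[OF ciso_Domain[OF r(1)] kV] by blast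
   then obtain b where b: "(a, b) \<in> r" by blast
   have "b \<in> snd p (r `` (k1 Un V1))" using cl_iff_Image[OF p p elr b kV] \<open>a \<in> snd p (k1 Un V1)\<close> by simp
   moreover have "r `` (k1 Un V1) \<subseteq> E"
   proof -
    have "r `` V1 \<subseteq> Z"
    proof
     fix w assume "w \<in> r `` V1"
     then obtain v where v: "v \<in> V1" "(v, w) \<in> r" by blast
     then have "(v, j v) \<in> r" using r(3) by (auto simp: gr_def)
     then have "w = j v" using pel_inj[OF elr] v(2) by blast
     then show "w \<in> Z" using j v(1) by (auto simp: bij_betw_def)
    qed
    moreover have "r `` k1 = k1" by (rule pel_Image_Id[OF elr kr])
    ultimately show ?thesis using ZU(2) k1(1) by (auto simp: Image_Un)
   qed
   ultimately have "b \<in> E" using P.cl_least'[OF E(1)] by blast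
   then show ?thesis using b unfolding R_def by blast
  qed
  moreover have "Id_on Y \<subseteq> G" using G(3) by auto
  ultimately have "Q \<subseteq> R" using Q(1) unfolding q_def by blast
  then show "el p p Q" by (rule pel_subset[OF elR])
 qed
qed

text \<open>A version of \<open>isol_closed\<close> for maps that move \<open>Y\<close> but keep its
  image independent over \<open>H\<close>. Such an image is returned to \<open>Y\<close> by a map
  \<open>\<phi>\<close> fixing \<open>H\<close>, which reduces the claim to
  \<open>isol_closed\<close>. It is the form needed in (AII) and (AIV), where the tuple itself is
  replaced by other realizations.\<close>

lemma isol_generic:
 assumes p: "p \<in> GG" and H: "clo p H" "countable H" and Y: "finite Y" "Y \<subseteq> U p" "indp (snd p) H Y"
  and e: "finite e" "e \<subseteq> snd p (H Un Y)"
 obtains k where "k \<subseteq> H" "finite k" "e \<subseteq> snd p (k Un Y)"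
  "\<forall>G. el p p G --> Domain G = k Un Y Un e --> Id_on k \<subseteq> G --> indp (snd p) H (G `` Y) --> el p p (G Un Id_on H)"
proof -
 interpret P: pregeo "U p" "snd p" by (rule pgi) fact
 obtain k where k: "k \<subseteq> H" "finite k" "e \<subseteq> snd p (k Un Y)" "isol p (k Un Y) e (H Un Y)"
  by (rule isol_closed[OF p H Y e])
 have HU: "H \<subseteq> U p" and clH: "snd p H = H" using H by (auto simp: closed_set_def)
 have kU: "k \<subseteq> U p" "k Un Y \<subseteq> U p" using k HU Y by auto
 have "el p p (G Un Id_on H)"
  if G: "el p p G" "Domain G = k Un Y Un e" "Id_on k \<subseteq> G" "indp (snd p) H (G `` Y)" for G
 proof -
  obtain g where g: "G = gr g (Domain G)" "inj_on g (Domain G)" by (rule pel_gr[OF G(1)])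
  have YD: "Y \<subseteq> Domain G" using G(2) by blast
  have Yg: "G `` Y = g ` Y" using g(1) gr_Image[OF YD] by metis
  define j where "j = the_inv_into Y g"
  have bg: "bij_betw g Y (G `` Y)" using inj_on_subset[OF g(2) YD] Yg by (simp add: bij_betw_def)
  have j: "bij_betw j (G `` Y) Y" unfolding j_def by (rule bij_betw_the_inv_into[OF bg])
  have Y'U: "G `` Y \<subseteq> U p" using el_U[OF G(1)] by blast
  have fY': "finite (G `` Y)" using Yg Y(1) by simp
  obtain \<phi> where \<phi>: "ciso p p \<phi>" "Id_on H \<subseteq> \<phi>" "gr j (G `` Y) \<subseteq> \<phi>" "Domain \<phi> = snd p (H Un G `` Y)"
   using cext_ex[OF p p ciso_Id_on[OF H(1)] Domain_Id_on Range_Id_on H(2) Y'U countable_finite[OF fY'] G(4) j Y(2,3)]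
   by blast
  have el\<phi>: "el p p \<phi>" by (rule ciso_el[OF \<phi>(1)])
  have kY: "k Un Y \<subseteq> Domain G" using G(2) by blast
  have HY': "H Un G `` Y \<subseteq> U p" using HU Y'U by simp
  have R\<phi>: "Range G \<subseteq> Domain \<phi>"
  proof
   fix v assume "v \<in> Range G"
   then obtain u where u: "(u, v) \<in> G" by blast
   then have "u \<in> snd p (k Un Y)" using G(2) k(3) P.cl_ext[OF kU(2)] by blast
   then have "v \<in> snd p (G `` (k Un Y))" using cl_iff_Image[OF p p G(1) u kY] by simp
   moreover have "G `` (k Un Y) \<subseteq> H Un G `` Y" using pel_Image_Id[OF G(1,3)] k(1) by (simp add: Image_Un) blast
   ultimately show "v \<in> Domain \<phi>" unfolding \<phi>(4) using P.cl_mono[OF _ HY'] by blast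
  qed
  define G2 where "G2 = G O \<phi>"
  have "el p p (G2 Un Id_on (H Un Y))"
  proof (rule isolD[OF k(4)])
   show "el p p G2" unfolding G2_def by (rule pel_comp[OF G(1) el\<phi>])
   show "Domain G2 = k Un Y Un e" using G(2) R\<phi> unfolding G2_def by blast
   have "(y, y) \<in> G2" if y: "y \<in> Y" for y
   proof -
    have "(y, g y) \<in> G" using g(1) YD y by (metis gr_simps(3) subsetD)
    moreover have "j (g y) = y" unfolding j_def by (rule the_inv_into_f_f) (use bg y in \<open>auto simp: bij_betw_def\<close>)
    ultimately have "(g y, y) \<in> gr j (G `` Y)" using y by auto
    then show ?thesis using \<open>(y, g y) \<in> G\<close> \<phi>(3) unfolding G2_def by blast
   qed
   moreover have "(u, u) \<in> G2" if "u \<in> k" for u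
    using that G(3) \<phi>(2) k(1) unfolding G2_def by blast
   ultimately show "Id_on (k Un Y) \<subseteq> G2" by auto
  qed
  then have el: "el p p ((G2 Un Id_on (H Un Y)) O \<phi>\<inverse>)" by (rule pel_comp) (simp add: el\<phi>)
  have "G Un Id_on H \<subseteq> (G2 Un Id_on (H Un Y)) O \<phi>\<inverse>"
  proof
   fix t assume t: "t \<in> G Un Id_on H"
   obtain u v where uv: "t = (u, v)" by force
   show "t \<in> (G2 Un Id_on (H Un Y)) O \<phi>\<inverse>"
   proof (cases "t \<in> G")
    case True
    then obtain w where "(v, w) \<in> \<phi>" using R\<phi> uv by blast
    then show ?thesis using True uv unfolding G2_def by blast
   next
    case False
    then have "u = v" "u \<in> H" using t uv by auto
    then show ?thesis using \<phi>(2) uv by blast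
   qed
  qed
  then show ?thesis by (rule pel_subset[OF el])
 qed
 then show thesis using that[OF k(1-3)] by blast
qed

end

context qmc begin

text \<open>The type of \<open>e\<close> is isolated over a countable closed \<open>E1\<close>
  inside \<open>B\<close> that contains a support of \<open>e\<close>, and by
  \<open>isol_lift\<close> the isolation spreads to a closed set containing \<open>B\<close> and
  \<open>C\<close>. A finite part of \<open>G\<close> extends to a map \<open>\<rho>'\<close> fixing
  \<open>Y\<close>, since \<open>Y\<close> is independent over its domain and its range. What
  \<open>\<rho>'\<close> does to \<open>e\<close> is undone by an elementary map that fixes the
  range of \<open>G\<close>; the composite extends that part of \<open>G\<close> and fixes
  \<open>e\<close>.\<close>

lemma indep_fin:
 assumes p: "p \<in> GG" and B: "clo p B" "infd (snd p) B" and C: "C \<subseteq> U p"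
  and Y: "finite Y" "Y \<subseteq> U p" "indp (snd p) (B Un C) Y" and e: "finite e" "e \<subseteq> snd p (B Un Y)"
 shows "\<exists>b\<subseteq>B. finite b \<and> (\<forall>G. el p p G --> Domain G \<subseteq> B Un C --> Range G \<subseteq> B Un C --> Id_on b \<subseteq> G -->
  el p p (G Un Id_on e))"
proof -
 interpret P: pregeo "U p" "snd p" by (rule pgi) fact
 have BU: "B \<subseteq> U p" and BCU: "B Un C \<subseteq> U p" using B C by (auto simp: closed_set_def)
 obtain B0 E Z where E: "E = snd p B0" "B0 \<subseteq> B" "countable B0" "clo p E" "countable E" "infd (snd p) E" "E \<subseteq> B"
  "infinite B0" "indp (snd p) {} B0"
  by (rule countable_infd_subset[OF p B])
 obtain b1 where b1: "b1 \<subseteq> B" "finite b1" "e \<subseteq> snd p (b1 Un Y)"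
  using P.cl_fin_Un[OF BU Y(2) e] by blast
 have EU: "E \<subseteq> U p" using E BU by blast
 \<comment> \<open>A countable infinite independent set is enlarged by finitely many elements of
   \<open>b1\<close>, so that the closure absorbs \<open>b1\<close> and stays countable and
   infinite-dimensional.\<close>
 obtain E1 where E1: "clo p E1" "countable E1" "infd (snd p) E1" "E1 \<subseteq> B" "b1 \<subseteq> E1"
 proof -
  obtain D where D: "D \<subseteq> b1" "indp (snd p) E D" "b1 \<subseteq> snd p (E Un D)" using P.basis_of[of b1 E] b1 BU EU by blast
  have DU: "D \<subseteq> U p" "finite D" "B0 \<subseteq> U p" using D b1 BU finite_subset E(2) by auto
  have "indp (snd p) ({} Un B0) D" using D(2) P.indp_cl[OF DU(3,1)] E(1) by simp
  then have "indp (snd p) {} (B0 Un D)" using P.indp_UnI[OF E(9), of D] DU by simp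
  then have inf: "infd (snd p) (snd p (B0 Un D))" using P.infd_cl[of "B0 Un D" "{}"] E(8) DU by simp
  have B0D: "B0 Un D \<subseteq> U p" "B0 Un D \<subseteq> B" using DU D b1 E(2) by auto
  have cB: "countable (B0 Un D)" using E(3) DU(2) by (simp add: countable_finite)
  have "snd p (E Un D) = snd p (B0 Un D)" using P.cl_Un_cl[OF DU(3,1)] E(1) by simp
  then have "b1 \<subseteq> snd p (B0 Un D)" using D(3) by simp
  then show thesis using that[of "snd p (B0 Un D)"] P.closed_cl[OF B0D(1)] countable_closure[OF p cB B0D(1)] inf
   P.cl_least'[OF B(1) B0D(2)] by blast
 qed
 have E1U: "E1 \<subseteq> U p" using E1 BU by blast
 obtain V where V: "V \<subseteq> B Un C" "indp (snd p) E1 V" "B Un C \<subseteq> snd p (E1 Un V)" using P.basis_of[OF BCU E1U] .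
 have VU: "V \<subseteq> U p" using V BCU by blast
 have EV: "E1 Un V \<subseteq> B Un C" using E1 V by blast
 have VY: "V Int Y = {}" using P.indp_disjoint[OF Y(3) BCU Y(2)] V by blast
 have "indp (snd p) (E1 Un V) Y" by (rule P.indp_mono[OF Y(3) EV BCU Y(2)])
 then have iVY: "indp (snd p) E1 (V Un Y)" by (rule P.indp_UnI[OF V(2) _ E1U VU Y(2)])
 have iE1Y: "indp (snd p) E1 Y" by (rule P.indp_subset[OF iVY]) (use E1U VU Y in auto)
 have eE: "e \<subseteq> snd p (E1 Un Y)" using b1(3) P.cl_mono[of "b1 Un Y" "E1 Un Y"] E1 E1U Y by blast
 obtain k where k: "k \<subseteq> E1" "finite k" "e \<subseteq> snd p (k Un Y)" "isol p (k Un Y) e (E1 Un Y)"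
  by (rule isol_closed[OF p E1(1,2) Y(1,2) iE1Y e(1) eE])
 have iso: "isol p (k Un Y) e (snd p (E1 Un V) Un Y)"
  by (rule isol_lift[OF p E1(1-3) Y(1,2) VU iVY VY k])
 have "el p p (G Un Id_on e)"
  if G: "el p p G" "Domain G \<subseteq> B Un C" "Range G \<subseteq> B Un C" "Id_on k \<subseteq> G" for G
 proof (rule pel_finite)
  fix Q assume Q: "Q \<subseteq> G Un Id_on e" "finite Q"
  define G0 where "G0 = Q Int G Un Id_on k"
  have G0: "el p p G0" "finite G0" "G0 \<subseteq> G"
  proof -
   show sub: "G0 \<subseteq> G" using G(4) by (auto simp: G0_def)
   show "el p p G0" by (rule pel_subset[OF G(1) sub])
   have "Id_on k = (\<lambda>x. (x, x)) ` k" by auto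
   then show "finite G0" using Q(2) k(2) by (simp add: G0_def)
  qed
  have DR: "Domain G0 \<subseteq> B Un C" "Range G0 \<subseteq> B Un C" using G0(3) G(2,3) by auto
  obtain \<rho> where \<rho>: "ciso p p \<rho>" "G0 \<subseteq> \<rho>" "Domain \<rho> = snd p (Domain G0)" "Range \<rho> = snd p (Range G0)"
   by (rule cl_fin_el[OF p p G0(1,2)])
  have DU: "Domain G0 \<subseteq> U p" "Range G0 \<subseteq> U p" using DR BCU by auto
  have "indp (snd p) (Domain G0) Y" "indp (snd p) (Range G0) Y"
   by (rule P.indp_mono[OF Y(3) DR(1) BCU Y(2)], rule P.indp_mono[OF Y(3) DR(2) BCU Y(2)])
  then have i: "indp (snd p) (Domain \<rho>) Y" "indp (snd p) (Range \<rho>) Y"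
   unfolding \<rho>(3,4) using P.indp_cl[OF DU(1) Y(2)] P.indp_cl[OF DU(2) Y(2)] by simp_all
  have cD: "countable (Domain \<rho>)"
   unfolding \<rho>(3) by (rule qm3[OF p _ DU(1)]) (use G0(2) in \<open>simp add: finite_Domain\<close>)
  obtain \<rho>' where \<rho>': "ciso p p \<rho>'" "\<rho> \<subseteq> \<rho>'" "Id_on Y \<subseteq> \<rho>'"
   using cext_id[OF p \<rho>(1) cD Y(2) countable_finite[OF Y(1)] i] by blast
  have el\<rho>': "el p p \<rho>'" by (rule ciso_el[OF \<rho>'(1)])
  have "Id_on k \<subseteq> \<rho>'" using \<rho>(2) \<rho>'(2) unfolding G0_def by blast
  then have IdkY: "Id_on (k Un Y) \<subseteq> \<rho>'" using \<rho>'(3) by auto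
  have kYD: "k Un Y \<subseteq> Domain \<rho>'" using Domain_mono[OF IdkY] by simp
  have eD: "e \<subseteq> Domain \<rho>'" using P.cl_least'[OF ciso_Domain[OF \<rho>'(1)] kYD] k(3) by blast
  define G1 where "G1 = \<rho>' Int (k Un Y Un e) \<times> UNIV"
  have "el p p (G1 Un Id_on (snd p (E1 Un V) Un Y))"
  proof (rule isolD[OF iso])
   show "el p p G1" by (rule pel_subset[OF el\<rho>']) (auto simp: G1_def)
   show "Domain G1 = k Un Y Un e" unfolding G1_def by (rule Domain_restrict) (use kYD eD in blast)
   show "Id_on (k Un Y) \<subseteq> G1" using IdkY by (auto simp: G1_def)
  qed
  then have elR: "el p p (\<rho>' O (G1 Un Id_on (snd p (E1 Un V) Un Y))\<inverse>)"
   by (intro pel_comp[OF el\<rho>']) (simp only: pel_converse)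
  have "Q \<subseteq> \<rho>' O (G1 Un Id_on (snd p (E1 Un V) Un Y))\<inverse>"
  proof
   fix t assume t: "t \<in> Q"
   obtain u v where uv: "t = (u, v)" by force
   show "t \<in> \<rho>' O (G1 Un Id_on (snd p (E1 Un V) Un Y))\<inverse>"
   proof (cases "t \<in> G")
    case True
    then have "(u, v) \<in> \<rho>'" using t uv \<rho>(2) \<rho>'(2) unfolding G0_def by blast
    moreover have "v \<in> snd p (E1 Un V)" using True uv G(3) V(3) by blast
    ultimately show ?thesis using uv by blast
   next
    case False
    then have "u = v" "u \<in> e" using t Q(1) uv by auto
    moreover obtain w where "(u, w) \<in> \<rho>'" using eD \<open>u \<in> e\<close> by blast
    ultimately show ?thesis using uv unfolding G1_def by blast
   qed
  qed
  then show "el p p Q" by (rule pel_subset[OF elR])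
 qed
 then show ?thesis using k(1,2) E1(4) by blast
qed

text \<open>By saturation the finite support \<open>q\<close> of the dependence is moved into
  \<open>B\<close> over \<open>b\<close>. The hypothesis extends this motion by the identity on
  \<open>a\<close>, and preservation of closures turns the dependence of \<open>y\<close> over
  \<open>q\<close> into one over \<open>B\<close>.\<close>

lemma indep_dep:
 assumes p: "p \<in> GG" and B: "clo p B" "infd (snd p) B" and C: "C \<subseteq> U p" and a: "finite a" "a \<subseteq> U p"
  and b: "b \<subseteq> B" "finite b"
  and ns: "\<forall>G. finite G --> el p p G --> Domain G \<subseteq> B Un C --> Range G \<subseteq> B Un C --> Id_on b \<subseteq> G --> el p p (G Un Id_on a)"
  and y: "y \<in> a" "S \<subseteq> a" "y \<in> snd p (B Un C Un S)"
 shows "y \<in> snd p (B Un S)"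
proof -
 interpret P: pregeo "U p" "snd p" by (rule pgi) fact
 have BU: "B \<subseteq> U p" and BCU: "B Un C \<subseteq> U p" and SU: "S \<subseteq> U p" using B C y a by (auto simp: closed_set_def)
 obtain q where q: "q \<subseteq> B Un C" "finite q" "y \<in> snd p (q Un S)"
  using P.cl_fin_Un[OF BCU SU, of "{y}"] y(3) by auto
 have qU: "q \<subseteq> U p" using q BCU by blast
 obtain G where G: "el p p G" "Id_on b \<subseteq> G" "q \<subseteq> Domain G" "Range G \<subseteq> B"
  using saturated[OF p B b q(2) qU] by blast
 define G0 where "G0 = G Int (b Un q) \<times> UNIV"
 have bqD: "b Un q \<subseteq> Domain G" using G(3) Domain_mono[OF G(2)] by simp
 have D: "Domain G0 = b Un q" unfolding G0_def by (rule Domain_restrict[OF bqD])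
 have G0: "el p p G0" by (rule pel_subset[OF G(1)]) (auto simp: G0_def)
 have fin: "finite G0" by (rule pel_finite_dom[OF G0]) (simp add: D b q)
 have "Range G0 \<subseteq> B Un C" using G(4) by (auto simp: G0_def)
 moreover have "Domain G0 \<subseteq> B Un C" using D b q by auto
 moreover have "Id_on b \<subseteq> G0" using G(2) by (auto simp: G0_def)
 ultimately have el: "el p p (G0 Un Id_on a)" using ns fin G0 by blast
 define K where "K = G0 Int q \<times> UNIV Un Id_on S"
 have DK: "Domain K = q Un S"
 proof -
  have "Domain (G0 Int q \<times> UNIV) = q" by (rule Domain_restrict) (simp add: D)
  then show ?thesis by (simp add: K_def Domain_Un_eq)
 qed
 have "y \<in> snd p (Range K)"
  using cl_imp[OF p p el, of y y K] y(1,2) q(3) DK by (auto simp: K_def)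
 moreover have "snd p (Range K) \<subseteq> snd p (B Un S)"
 proof (rule P.cl_mono)
  show "Range K \<subseteq> B Un S" using G(4) by (auto simp: K_def G0_def)
 qed (use BU SU in simp)
 ultimately show ?thesis by blast
qed

section \<open>Cardinalities and extension to automorphisms\<close>

lemma card_cl:
 assumes p: "p \<in> GG" and A: "A \<subseteq> U p" and r: "Card_order r" "\<not> finite (Field r)" "|A| \<le>o r"
 shows "|snd p A| \<le>o r"
proof -
 interpret P: pregeo "U p" "snd p" by (rule pgi) fact
 have r': "natLeq \<le>o r" using r(1,2) infinite_iff_natLeq_ordLeq[of "Field r"] card_of_Field_ordIso[OF r(1)]
  by (metis ordLeq_ordIso_trans)
 \<comment> \<open>The closure of \<open>A\<close> is a union of countable sets indexed by the
   finite lists over \<open>A\<close>, which are counted by their length.\<close>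
 define I where "I n = {xs. set xs \<subseteq> A \<and> length xs = n}" for n
 have In: "|I n| \<le>o r" for n
 proof (induction n)
  case 0
  have "I 0 = {[]}" by (auto simp: I_def)
  then have "countable (I 0)" by simp
  then show ?case using r' countable_card_le_natLeq ordLeq_transitive by blast
 next
  case (Suc n)
  have "I (Suc n) \<subseteq> (\<lambda>(x, xs). x # xs) ` (A \<times> I n)"
  proof
   fix ys assume "ys \<in> I (Suc n)"
   then obtain x xs where "ys = x # xs" "x \<in> A" "xs \<in> I n" by (cases ys) (auto simp: I_def)
   then show "ys \<in> (\<lambda>(x, xs). x # xs) ` (A \<times> I n)" by force
  qed
  then have "|I (Suc n)| \<le>o |A \<times> I n|" by (rule surj_imp_ordLeq)
  moreover have "|A \<times> I n| \<le>o r" by (rule card_of_Times_ordLeq_infinite_Field[OF r(2,3) Suc.IH r(1)])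
  ultimately show ?case by (rule ordLeq_transitive)
 qed
 have nat: "|UNIV :: nat set| \<le>o r" using card_of_nat r' ordIso_ordLeq_trans by blast
 have J: "|\<Union>n. I n| \<le>o r"
  by (rule card_of_UNION_ordLeq_infinite_Field[OF r(2,1) nat]) (use In in blast)
 have sub: "snd p A \<subseteq> (\<Union>xs\<in>(\<Union>n. I n). snd p (set xs))"
 proof
  fix a assume "a \<in> snd p A"
  then obtain F where F: "F \<subseteq> A" "finite F" "a \<in> snd p F" using P.cl_fin[OF A] by blast
  obtain xs where "set xs = F" using finite_list[OF F(2)] by blast
  then show "a \<in> (\<Union>xs\<in>(\<Union>n. I n). snd p (set xs))" using F unfolding I_def by blast
 qed
 have "\<forall>xs\<in>(\<Union>n. I n). |snd p (set xs)| \<le>o r"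
 proof
  fix xs assume "xs \<in> (\<Union>n. I n)"
  then have "set xs \<subseteq> U p" using A unfolding I_def by blast
  then have "countable (snd p (set xs))" using qm3[OF p, of "set xs"] by simp
  then show "|snd p (set xs)| \<le>o r" using r' countable_card_le_natLeq ordLeq_transitive by blast
 qed
 then have "|\<Union>xs\<in>(\<Union>n. I n). snd p (set xs)| \<le>o r"
  by (rule card_of_UNION_ordLeq_infinite_Field[OF r(2,1) J])
 then show ?thesis using card_of_mono1[OF sub] ordLeq_transitive by blast
qed

lemma card_cl_less:
 assumes p: "p \<in> GG" and A: "A \<subseteq> U p" and r: "Card_order r" "natLeq <o r" "|A| <o r"
 shows "|snd p A| <o r"
proof (cases "finite A")
 case True
 then have "countable (snd p A)" using qm3[OF p _ A] by blast
 then show ?thesis using r(2) countable_card_le_natLeq[THEN iffD1] ordLeq_ordLess_trans by blast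
next
 case False
 then have "\<not> finite (Field |A| )" by (simp add: Field_card_of)
 then have "|snd p A| \<le>o |A|" by (rule card_cl[OF p A card_of_Card_order _ ordLeq_refl[OF card_of_Card_order]])
 then show ?thesis using r(3) ordLeq_ordLess_trans by blast
qed

text \<open>If \<open>X\<close> were smaller than the whole structure, so would be
  \<open>A \<union> X\<close>, and by \<open>card_cl_less\<close> its closure as well.\<close>

lemma basis_card:
 assumes p: "p \<in> GG" and unc: "natLeq <o |U p|" and A: "A \<subseteq> U p" "|A| <o |U p|"
  and X: "X \<subseteq> U p" "U p \<subseteq> snd p (A Un X)"
 shows "|X| =o |U p|"
proof (rule ccontr)
 assume n: "\<not> |X| =o |U p|"
 have "|X| \<le>o |U p|" by (rule card_of_mono1[OF X(1)])
 then have less: "|X| <o |U p|" using n ordLeq_iff_ordLess_or_ordIso by blast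
 have inf: "infinite (U p)" using unc infinite_iff_natLeq_ordLeq ordLess_imp_ordLeq by blast
 have "|A Un X| <o |U p|" by (rule card_of_Un_ordLess_infinite[OF inf A(2) less])
 then have "|snd p (A Un X)| <o |U p|"
  by (intro card_cl_less[OF p _ card_of_Card_order unc]) (use A X in auto)
 then show False using card_of_mono1[OF X(2)] not_ordLess_ordLeq by blast
qed

text \<open>The complements of a small domain and of a small range both have bases of full
  cardinality. A bijection between these bases extends by \<open>gext1\<close>.\<close>

lemma aut_ext:
 assumes p: "p \<in> GG" and unc: "natLeq <o |U p|" and G: "ciso p p G" "|Domain G| <o |U p|"
 shows "\<exists>f. el p p f \<and> G \<subseteq> f \<and> Domain f = U p \<and> Range f = U p"
proof -
 interpret P: pregeo "U p" "snd p" by (rule pgi) fact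
 have elG: "el p p G" by (rule ciso_el[OF G(1)])
 note DU = el_U[OF elG]
 obtain X where X: "X \<subseteq> U p" "indp (snd p) (Domain G) X" "U p \<subseteq> snd p (Domain G Un X)"
  using P.basis_of[OF subset_refl DU(1)] .
 obtain Y where Y: "Y \<subseteq> U p" "indp (snd p) (Range G) Y" "U p \<subseteq> snd p (Range G Un Y)"
  using P.basis_of[OF subset_refl DU(2)] .
 have "|Range G| \<le>o |Domain G|" unfolding pel_Range_eq[OF elG] by (rule card_of_image)
 then have R: "|Range G| <o |U p|" using G(2) ordLeq_ordLess_trans by blast
 have "|X| =o |Y|" using basis_card[OF p unc DU(1) G(2) X(1,3)] basis_card[OF p unc DU(2) R Y(1,3)]
  ordIso_transitive ordIso_symmetric by blast
 then obtain j where j: "bij_betw j X Y" using card_of_ordIso[of X Y] by blast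
 obtain f where f: "ciso p p f" "G \<subseteq> f" "Domain f = snd p (Domain G Un X)" "Range f = snd p (Range G Un Y)"
  using gext1[OF p p G(1) X(1,2) Y(1,2) j] by blast
 have "Domain f = U p" "Range f = U p" using f(3,4) X(3) Y(3) el_U[OF ciso_el[OF f(1)]] by blast+
 then show ?thesis using f(1,2) ciso_el by blast
qed

lemma aut_ext_fin:
 assumes p: "p \<in> GG" and unc: "natLeq <o |U p|" and G: "el p p G" "finite G"
 shows "\<exists>f. el p p f \<and> G \<subseteq> f \<and> Domain f = U p \<and> Range f = U p"
proof -
 obtain G1 where G1: "ciso p p G1" "G \<subseteq> G1" "Domain G1 = snd p (Domain G)" by (rule cl_fin_el[OF p p G])
 have "countable (Domain G1)" unfolding G1(3)
  by (rule qm3[OF p]) (use G el_U[OF G(1)] in \<open>auto simp: finite_Domain\<close>)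
 then have "|Domain G1| <o |U p|" using unc countable_card_le_natLeq[THEN iffD1] ordLeq_ordLess_trans by blast
 then obtain f where "el p p f" "G1 \<subseteq> f" "Domain f = U p" "Range f = U p" using aut_ext[OF p unc G1(1)] by blast
 then show ?thesis using G1(2) by blast
qed

end

section \<open>Isomorphisms, substructures and chain unions in terms of elementary relations\<close>

lemma val_in_univ:
 assumes "is_struct L M" "v ` I \<subseteq> univ M" "wf_trm L I t"
 shows "val M v t \<in> univ M"
 using assms(3)
proof (induction t)
 case (App f ts)
 have "set (map (val M v) ts) \<subseteq> univ M" using App by auto
 then show ?case using App.prems assms(1) unfolding is_struct_def by (auto split: if_splits)
qed (use assms in auto)

lemma iso_val:
 assumes "iso L A B g" "v ` I \<subseteq> univ A" "wf_trm L I t"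
 shows "g (val A v t) = val B (\<lambda>i. g (v i)) t"
 using assms(3)
proof (induction t)
 case (App f ts)
 have A: "is_struct L A" using assms(1) by (simp add: iso_def)
 have "set (map (val A v) ts) \<subseteq> univ A" using App.prems val_in_univ[OF A assms(2)] by auto
 then have "g (fn A f (map (val A v) ts)) = fn B f (map g (map (val A v) ts))"
  using App.prems assms(1) unfolding iso_def by (metis length_map wf_trm.simps(2))
 moreover have "map g (map (val A v) ts) = map (val B (\<lambda>i. g (v i))) ts" using App by auto
 ultimately show ?case by (simp only: val.simps)
qed simp

lemma iso_sat:
 assumes "iso L A B g" "v ` I \<subseteq> univ A" "wf_qf L I \<phi>"
 shows "sat A v \<phi> = sat B (\<lambda>i. g (v i)) \<phi>"
 using assms(3)
proof (induction \<phi>)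
 case (Eq s t)
 have A: "is_struct L A" "inj_on g (univ A)" using assms(1) by (simp_all add: iso_def bij_betw_def)
 have st: "wf_trm L I s" "wf_trm L I t" using Eq by simp_all
 have "val A v s = val A v t \<longleftrightarrow> g (val A v s) = g (val A v t)"
  using inj_on_eq_iff[OF A(2) val_in_univ[OF A(1) assms(2) st(1)] val_in_univ[OF A(1) assms(2) st(2)]] by simp
 then show ?case using iso_val[OF assms(1,2)] st by simp
next
 case (Rel r ts)
 have A: "is_struct L A" using assms(1) by (simp add: iso_def)
 have "set (map (val A v) ts) \<subseteq> univ A" using Rel val_in_univ[OF A assms(2)] by auto
 then have "rel A r (map (val A v) ts) = rel B r (map g (map (val A v) ts))"
  using Rel assms(1) unfolding iso_def by (metis length_map wf_qf.simps(2))
 moreover have "map g (map (val A v) ts) = map (val B (\<lambda>i. g (v i))) ts"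
  using Rel iso_val[OF assms(1,2)] by auto
 ultimately show ?case by (simp only: sat.simps)
qed auto

lemma iso_pel:
 assumes "iso L A B g"
 shows "pel L A B (gr g (univ A))"
proof -
 have "qftp L A (univ A) (\<lambda>x. x) = qftp L B (univ A) g"
  unfolding qftp_def using iso_sat[OF assms, of "\<lambda>x. x" "univ A"] by auto
 then have "pel L A B ((\<lambda>i. (i, g i)) ` univ A)"
  unfolding pel_qftp using assms by (auto simp: iso_def bij_betw_def)
 then show ?thesis by (simp add: gr_def)
qed

lemma pel_gr_tp: "pel L A B (gr g S) ==> set xs \<subseteq> S ==> tp L A xs = tp L B (map g xs)"
proof -
 assume g: "pel L A B (gr g S)" and xs: "set xs \<subseteq> S"
 have "set (map (\<lambda>x. (x, g x)) xs) \<subseteq> gr g S" using xs by (auto simp: gr_def)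
 then have "tp L A (map fst (map (\<lambda>x. (x, g x)) xs)) = tp L B (map snd (map (\<lambda>x. (x, g x)) xs))"
  using g unfolding pel_def by blast
 then show ?thesis by (simp add: comp_def)
qed

lemma map_nth_less: "map (\<lambda>i. (xs @ ys) ! i) [0..<length xs] = xs"
 by (rule nth_equalityI) (auto simp: nth_append)

lemma fn_tp:
 assumes "f \<in> funs L" "length xs = far L f"
 shows "Eq (App f (map Var [0..<length xs])) (Var (length xs)) \<in> tp L A (xs @ [t]) \<longleftrightarrow> fn A f xs = t"
proof -
 have "map (val A (\<lambda>i. (xs @ [t]) ! i)) (map Var [0..<length xs]) = xs"
  using map_nth_less[of xs "[t]"] by (simp add: comp_def)
 moreover have "(xs @ [t]) ! far L f = t" using assms(2) by (metis nth_append_length)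
 ultimately show ?thesis using assms by (auto simp: tp_def qftp_def)
qed

lemma rel_tp:
 assumes "r \<in> rels L" "length xs = rar L r"
 shows "Rel r (map Var [0..<length xs]) \<in> tp L A xs \<longleftrightarrow> rel A r xs"
proof -
 have "map (val A (\<lambda>i. xs ! i)) (map Var [0..<length xs]) = xs"
  using map_nth_less[of xs "[]"] by (simp add: comp_def)
 then show ?thesis using assms by (auto simp: tp_def qftp_def)
qed

lemma pel_fn:
 assumes "pel L A B (gr g S)" "f \<in> funs L" "length xs = far L f" "set xs \<subseteq> S" "fn A f xs \<in> S"
 shows "g (fn A f xs) = fn B f (map g xs)"
proof -
 have "tp L A (xs @ [fn A f xs]) = tp L B (map g (xs @ [fn A f xs]))"
  by (rule pel_gr_tp[OF assms(1)]) (use assms in auto)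
 then show ?thesis using fn_tp[OF assms(2,3), of A "fn A f xs"] fn_tp[OF assms(2), of "map g xs" B "g (fn A f xs)"] assms(3)
  by simp
qed

lemma pel_rel:
 assumes "pel L A B (gr g S)" "r \<in> rels L" "length xs = rar L r" "set xs \<subseteq> S"
 shows "rel A r xs = rel B r (map g xs)"
 using pel_gr_tp[OF assms(1,4)] rel_tp[OF assms(2,3), of A] rel_tp[OF assms(2), of "map g xs" B] assms(3) by simp

lemma is_struct_fn: "is_struct L A ==> f \<in> funs L ==> length xs = far L f ==> set xs \<subseteq> univ A ==> fn A f xs \<in> univ A"
 unfolding is_struct_def by metis

lemma pel_iso:
 assumes "is_struct L A" "is_struct L B" "pel L A B (gr g (univ A))" "g ` univ A = univ B"
 shows "iso L A B g"
proof -
 have "inj_on g (univ A)"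
 proof (rule inj_onI)
  fix x y assume "x \<in> univ A" "y \<in> univ A" "g x = g y"
  then show "x = y" using pel_inj[OF assms(3), of x "g x" y "g y"] by simp
 qed
 moreover have "g (fn A f xs) = fn B f (map g xs)" if "f \<in> funs L" "length xs = far L f \<and> set xs \<subseteq> univ A" for f xs
  using pel_fn[OF assms(3) that(1), of xs] is_struct_fn[OF assms(1) that(1), of xs] that(2) by simp
 moreover have "rel A r xs \<longleftrightarrow> rel B r (map g xs)" if "r \<in> rels L" "length xs = rar L r \<and> set xs \<subseteq> univ A" for r xs
  using pel_rel[OF assms(3) that(1), of xs] that(2) by simp
 ultimately show ?thesis unfolding iso_def bij_betw_def using assms(1,2,4) by simp
qed

lemma univ_restr [simp]: "univ (restr N H) = H"
 by (simp add: restr_def)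

lemma restr_restr: "K \<subseteq> H ==> restr (restr N H) K = restr N K"
 by (auto simp: restr_def fun_eq_iff)

lemma struct_eqI:
 assumes "univ A = univ B" "\<And>f xs. fn A f xs = fn B f xs" "\<And>r xs. rel A r xs = rel B r xs"
 shows "A = (B :: ('f, 'r, 'a) struct)"
 using assms by (cases A, cases B) (auto simp: fun_eq_iff)

lemma is_struct_rel: "is_struct L A ==> rel A r xs ==> set xs \<subseteq> univ A"
 unfolding is_struct_def by blast

lemma is_struct_undefined: "is_struct L A ==> \<not> set xs \<subseteq> univ A ==> fn A f xs = undefined"
 unfolding is_struct_def by metis

lemma restr_fn: "fn (restr N H) f xs = (if set xs \<subseteq> H then fn N f xs else undefined)"
 by (simp add: restr_def)

lemma restr_rel: "rel (restr N H) r xs \<longleftrightarrow> set xs \<subseteq> H \<and> rel N r xs"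
 by (simp add: restr_def)

lemma restr_univ:
 assumes "is_struct L N"
 shows "restr N (univ N) = N"
proof (rule struct_eqI)
 show "fn (restr N (univ N)) f xs = fn N f xs" for f xs
  using is_struct_undefined[OF assms, of xs f] by (simp add: restr_fn)
 show "rel (restr N (univ N)) r xs = rel N r xs" for r xs
  using is_struct_rel[OF assms, of r xs] by (auto simp: restr_rel)
qed simp

lemma is_struct_restr:
 assumes N: "is_struct L N" and H: "H \<subseteq> univ N"
  and cl: "\<And>f xs. f \<in> funs L ==> length xs = far L f ==> set xs \<subseteq> H ==> fn N f xs \<in> H"
 shows "is_struct L (restr N H)"
 unfolding is_struct_def
proof (intro conjI allI)
 fix f xs
 show "if f \<in> funs L \<and> length xs = far L f \<and> set xs \<subseteq> univ (restr N H) then fn (restr N H) f xs \<in> univ (restr N H)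
   else fn (restr N H) f xs = undefined"
 proof (cases "set xs \<subseteq> H")
  case True
  then have "\<not> (f \<in> funs L \<and> length xs = far L f) ==> fn N f xs = undefined"
   using N H unfolding is_struct_def by metis
  then show ?thesis using True cl by (auto simp: restr_def)
 qed (auto simp: restr_def)
 fix r
 show "rel (restr N H) r xs --> r \<in> rels L \<and> length xs = rar L r \<and> set xs \<subseteq> univ (restr N H)"
  using N unfolding is_struct_def by (auto simp: restr_def)
qed

lemma val_restr:
 assumes "is_struct L (restr N H)" "v ` I \<subseteq> H" "wf_trm L I t"
 shows "val (restr N H) v t = val N v t"
 using assms(3)
proof (induction t)
 case (App f ts)
 have 1: "map (val (restr N H) v) ts = map (val N v) ts" using App by auto
 have "set (map (val (restr N H) v) ts) \<subseteq> H"
  using val_in_univ[OF assms(1), of v I] assms(2) App.prems by auto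
 then have "val (restr N H) v (App f ts) = fn N f (map (val (restr N H) v) ts)"
  by (simp only: val.simps restr_fn if_True)
 then show ?case using 1 by (simp only: val.simps)
qed simp

lemma sat_restr:
 assumes "is_struct L (restr N H)" "v ` I \<subseteq> H" "wf_qf L I \<phi>"
 shows "sat (restr N H) v \<phi> = sat N v \<phi>"
 using assms(3)
proof (induction \<phi>)
 case (Rel r ts)
 have 1: "map (val (restr N H) v) ts = map (val N v) ts" using Rel val_restr[OF assms(1,2)] by auto
 have "set (map (val (restr N H) v) ts) \<subseteq> H"
  using val_in_univ[OF assms(1), of v I] assms(2) Rel by auto
 then have "sat (restr N H) v (Rel r ts) = rel N r (map (val (restr N H) v) ts)"
  by (simp only: sat.simps restr_rel simp_thms)
 then show ?case using 1 by (simp only: sat.simps)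
qed (use val_restr[OF assms(1,2)] in auto)

lemma pel_restr:
 assumes "is_struct L (restr N H)" "H \<subseteq> univ N"
 shows "pel L (restr N H) N (Id_on H)"
proof -
 have "qftp L (restr N H) H (\<lambda>x. x) = qftp L N H (\<lambda>x. x)"
  unfolding qftp_def using sat_restr[OF assms(1), of "\<lambda>x. x" H] by auto
 then have "pel L (restr N H) N ((\<lambda>i. (i, i)) ` H)" unfolding pel_qftp using assms(2) by simp
 moreover have "(\<lambda>i. (i, i)) ` H = Id_on H" by auto
 ultimately show ?thesis by simp
qed

text \<open>The identity of a substructure is elementary into the ambient structure, so composing
  with such identities moves between the two.\<close>

lemma pel_restr_iff:
 assumes "is_struct L (restr N H)" "H \<subseteq> univ N" "is_struct L (restr N' H')" "H' \<subseteq> univ N'" "G \<subseteq> H \<times> H'"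
 shows "pel L (restr N H) (restr N' H') G \<longleftrightarrow> pel L N N' G"
proof
 have G: "Id_on H O G O Id_on H' = G" using assms(5) by auto
 have G': "(Id_on H)\<inverse> O G O Id_on H' = G" using assms(5) by auto
 note p = pel_restr[OF assms(1,2)] pel_restr[OF assms(3,4)]
 { assume "pel L (restr N H) (restr N' H') G"
  then have "pel L N N' ((Id_on H)\<inverse> O G O Id_on H')"
   by (intro pel_comp[of L N "restr N H"] pel_comp[of L _ "restr N' H'"] p) (simp_all only: pel_converse p)
  then show "pel L N N' G" using G' by simp }
 { assume "pel L N N' G"
  then have "pel L (restr N H) (restr N' H') (Id_on H O G O (Id_on H')\<inverse>)"
   by (intro pel_comp[of L _ N] pel_comp[of L _ N'] p) (simp_all only: pel_converse p)
  then show "pel L (restr N H) (restr N' H') G" using G by simp }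
qed

lemma substr_eq: "substr L A B ==> A = restr B (univ A)"
 by (simp add: substr_def)

lemma substr_fn: "substr L A B ==> set xs \<subseteq> univ A ==> fn A f xs = fn B f xs"
 using arg_cong[OF substr_eq, of L A B "\<lambda>A. fn A f xs"] by (simp add: restr_fn)

lemma substr_rel: "substr L A B ==> rel A r xs \<longleftrightarrow> set xs \<subseteq> univ A \<and> rel B r xs"
 using arg_cong[OF substr_eq, of L A B "\<lambda>A. rel A r xs"] by (simp add: restr_rel)

lemma substr_restr: "is_struct L N ==> is_struct L (restr N H) ==> H \<subseteq> univ N ==> substr L (restr N H) N"
 by (simp add: substr_def)

lemma substr_trans:
 assumes "substr L A B" "substr L B C"
 shows "substr L A C"
proof -
 have sub: "univ A \<subseteq> univ B" using assms(1) by (simp add: substr_def)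
 have "A = restr C (univ A)"
  using substr_eq[OF assms(1)] substr_eq[OF assms(2)] restr_restr[OF sub, of C] by metis
 then show ?thesis using assms unfolding substr_def by blast
qed

text \<open>The choice made in \<open>chain_union\<close> does not matter: two members that contain
  the arguments are comparable and give the same value.\<close>

lemma chain_union_substr:
 assumes C: "C \<noteq> {}" and st: "\<And>A. A \<in> C ==> is_struct L A"
  and ch: "\<And>A B. A \<in> C ==> B \<in> C ==> substr L A B \<or> substr L B A"
 shows "is_struct L (chain_union C)" "A \<in> C ==> substr L A (chain_union C)"
proof -
 let ?N = "chain_union C"
 have uni: "univ ?N = (\<Union>A\<in>C. univ A)" by (simp add: chain_union_def)
 have fn_eq: "fn ?N f xs = fn A f xs" if A: "A \<in> C" "set xs \<subseteq> univ A" for A f xs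
 proof -
  define B where "B = (SOME B. B \<in> C \<and> set xs \<subseteq> univ B)"
  have B: "B \<in> C \<and> set xs \<subseteq> univ B" unfolding B_def by (rule someI[of _ A]) (use A in simp)
  have "fn ?N f xs = fn B f xs" using A by (auto simp: chain_union_def B_def)
  also have "\<dots> = fn A f xs" using ch[of A B] A B substr_fn[of L A B xs f] substr_fn[of L B A xs f] by auto
  finally show ?thesis .
 qed
 have fn_undef: "fn ?N f xs = undefined" if "\<not> (\<exists>A\<in>C. set xs \<subseteq> univ A)" for f xs
  using that by (simp add: chain_union_def)
 have rel_eq: "rel ?N r xs \<longleftrightarrow> rel A r xs" if A: "A \<in> C" "set xs \<subseteq> univ A" for A r xs
 proof
  assume "rel ?N r xs"
  then obtain B where B: "B \<in> C" "rel B r xs" by (auto simp: chain_union_def)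
  then show "rel A r xs" using ch[of A B] A substr_rel[of L A B r xs] substr_rel[of L B A r xs] by auto
 qed (use A in \<open>auto simp: chain_union_def\<close>)
 have chain: "subset.chain UNIV (univ ` C)"
 proof -
  have "univ A \<subseteq> univ B \<or> univ B \<subseteq> univ A" if "A \<in> C" "B \<in> C" for A B
   using ch[OF that] by (auto simp: substr_def)
  then show ?thesis unfolding subset_chain_def by blast
 qed
 have cover: "\<exists>A\<in>C. set xs \<subseteq> univ A" if xs: "set xs \<subseteq> univ ?N" for xs
 proof -
  have "finite (set xs)" "set xs \<subseteq> \<Union>(univ ` C)" using xs uni by auto
  then obtain Y where "Y \<in> univ ` C" "set xs \<subseteq> Y"
   using finite_subset_Union_chain[of "set xs" "univ ` C" UNIV] C chain by blast
  then show ?thesis by blast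
 qed
 show N: "is_struct L ?N"
  unfolding is_struct_def
 proof (intro conjI allI)
  fix f xs
  show "if f \<in> funs L \<and> length xs = far L f \<and> set xs \<subseteq> univ ?N then fn ?N f xs \<in> univ ?N else fn ?N f xs = undefined"
  proof (cases "\<exists>A\<in>C. set xs \<subseteq> univ A")
   case True
   then obtain A where A: "A \<in> C" "set xs \<subseteq> univ A" by blast
   have "if f \<in> funs L \<and> length xs = far L f \<and> set xs \<subseteq> univ A then fn A f xs \<in> univ A else fn A f xs = undefined"
    using st[OF A(1)] unfolding is_struct_def by blast
   moreover have "set xs \<subseteq> univ ?N" "univ A \<subseteq> univ ?N" using A uni by auto
   ultimately show ?thesis using fn_eq[OF A, of f] A(2) by (auto split: if_splits)
  next
   case False
   then have "\<not> set xs \<subseteq> univ ?N" using cover by blast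
   then show ?thesis using fn_undef[OF False] by simp
  qed
  fix r
  show "rel ?N r xs --> r \<in> rels L \<and> length xs = rar L r \<and> set xs \<subseteq> univ ?N"
  proof
   assume "rel ?N r xs"
   then obtain B where B: "B \<in> C" "rel B r xs" by (auto simp: chain_union_def)
   then have "r \<in> rels L \<and> length xs = rar L r \<and> set xs \<subseteq> univ B" using st[OF B(1)] unfolding is_struct_def by blast
   then show "r \<in> rels L \<and> length xs = rar L r \<and> set xs \<subseteq> univ ?N" using B(1) uni by auto
  qed
 qed
 assume A: "A \<in> C"
 have "A = restr ?N (univ A)"
 proof (rule struct_eqI)
  show "fn A f xs = fn (restr ?N (univ A)) f xs" for f xs
   using fn_eq[OF A, of xs f] is_struct_undefined[OF st[OF A]] by (simp add: restr_fn)
  show "rel A r xs = rel (restr ?N (univ A)) r xs" for r xs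
   using rel_eq[OF A, of xs r] is_struct_rel[OF st[OF A], of r xs] by (auto simp: restr_rel)
 qed simp
 then show "substr L A ?N" using N st[OF A] A uni by (auto simp: substr_def)
qed

text \<open>Enumerating a countable relation as a set of pairs enumerates its domain and range over
  a common index set, as QM4 and QM5 require.\<close>

lemma enum_rel:
 assumes "countable G"
 shows "\<exists>(I :: nat set) h h'. G = (\<lambda>i. (h i, h' i)) ` I"
proof (cases "G = {}")
 case True
 then show ?thesis by (intro exI[of _ "{}"]) auto
next
 case False
 have "G = range (from_nat_into G)" using range_from_nat_into[OF False assms] by simp
 also have "\<dots> = (\<lambda>i. (fst (from_nat_into G i), snd (from_nat_into G i))) ` UNIV" by simp
 finally show ?thesis by (intro exI)
qed

lemma pel_countable_dom: "pel L A B G ==> countable (Domain G) ==> countable G"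
proof -
 assume G: "pel L A B G" "countable (Domain G)"
 then have "countable (Domain G \<times> Range G)" using pel_countable_Range by blast
 then show "countable G" by (rule countable_subset[rotated]) auto
qed

section \<open>From the axioms for \<open>M\<close> to closed embeddings into
  \<open>M\<close>\<close>

lemma weakly_qm_qmc:
 assumes "weakly_qm_structure L M cl"
 shows "qmc L {(M, cl)}"
proof -
 have st: "is_struct L M" "pregeometry (univ M) cl" "QM1 L M cl" "QM3 M cl" "QM4 L M cl" "QM5 L M cl"
  using assms by (simp_all add: weakly_qm_structure_def)
 have pgM: "pregeo (univ M) cl" by (rule pregeo.intro) (rule st)
 show ?thesis
 proof (unfold_locales, goal_cases)
  case (1 p)
  then show ?case using st(2) by simp
 next
  case (2 p q)
  then show ?case by (auto simp: pel_def tp_def)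
 next
  case (3 p q G a a' B)
  then have G: "pel L M M G" by simp
  obtain ps where ps: "set ps = B" using finite_list[OF 3(6)] by blast
  have sub: "set ((a, a') # ps) \<subseteq> G" using 3 ps by simp
  then have "tp L M (map fst ((a, a') # ps)) = tp L M (map snd ((a, a') # ps))" using G unfolding pel_def by blast
  then have "tp L M (a # map fst ps) = tp L M (a' # map snd ps)" by simp
  moreover have "a \<in> univ M" "a' \<in> univ M" "set (map fst ps) \<subseteq> univ M" "set (map snd ps) \<subseteq> univ M"
   using sub G by (auto simp: pel_def)
  ultimately have "a \<in> cl (set (map fst ps)) \<longleftrightarrow> a' \<in> cl (set (map snd ps))" using st(3) unfolding QM1_def by blast
  then show ?case using 3 ps by (simp add: Domain_fst Range_snd)
 next
  case (4 p F)
  then show ?case using st(4) by (auto simp: QM3_def)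
 next
  case (5 p q G a a')
  then have G: "pel L M M G" and c: "closed_set (univ M) cl (Domain G)" "closed_set (univ M) cl (Range G)" "countable (Domain G)"
   and a: "a \<in> univ M - Domain G" "a' \<in> univ M - Range G" by simp_all
  obtain I :: "nat set" and h h' where h: "G = (\<lambda>i. (h i, h' i)) ` I"
   using enum_rel[OF pel_countable_dom[OF G c(3)]] by blast
  have D: "h ` I = Domain G" "h' ` I = Range G" using h by auto
  have U: "h ` I \<subseteq> univ M" "h' ` I \<subseteq> univ M" using pel_univ[OF G] D by auto
  have t0: "tp_over L M I h [] = tp_over L M I h' []"
   using pel_tp_over[of "[]" "[]" h I M h' M L] U G h by simp
  have "tp_over L M I h [a] = tp_over L M I h' [a']"
  proof -
   have "closed_set (univ M) cl (h ` I) \<and> closed_set (univ M) cl (h' ` I) \<and>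
    tp_over L M I h [] = tp_over L M I h' [] \<and> a \<in> univ M - h ` I \<and> a' \<in> univ M - h' ` I"
    using c(1,2) a t0 by (simp add: D)
   then show ?thesis using st(5)[unfolded QM4_def, rule_format, of h I h' a a'] by simp
  qed
  then have "pel L M M ((\<lambda>i. (h i, h' i)) ` I Un set (zip [a] [a']))"
   using pel_tp_over[of "[a]" "[a']" h I M h' M L] U a by simp
  then show ?case using 5 h by simp
 next
  case (6 p q G B a)
  then have G: "pel L M M (G Un B)" and B: "finite B" and c: "G = {} \<or> closed_set (univ M) cl (Domain G) \<and>
   closed_set (univ M) cl (Range G) \<and> countable (Domain G)" and a: "a \<in> cl (Domain (G Un B))" by simp_all
  have G0: "pel L M M G" by (rule pel_subset[OF G]) simp
  have cG: "countable G" using c pel_countable_dom[OF G0] by auto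
  obtain I :: "nat set" and h h' where h: "G = (\<lambda>i. (h i, h' i)) ` I"
   using enum_rel[OF cG] by blast
  obtain ps where ps: "set ps = B" using finite_list[OF B] by blast
  define b b' where "b = map fst ps" and "b' = map snd ps"
  have D: "h ` I = Domain G" "h' ` I = Range G" using h by auto
  have Db: "set b = Domain B" "set b' = Range B" using ps by (simp_all add: b_def b'_def Domain_fst Range_snd)
  have zip: "zip b b' = ps" by (simp add: b_def b'_def zip_map_fst_snd)
  have len: "length b = length b'" by (simp add: b_def b'_def)
  have U: "h ` I \<subseteq> univ M" "h' ` I \<subseteq> univ M" "set b \<subseteq> univ M" "set b' \<subseteq> univ M"
   using pel_univ[OF G] unfolding D Db by auto
  have 1: "tp_over L M I h [] = tp_over L M I h' []"
   using pel_tp_over[of "[]" "[]" h I M h' M L] U G0 h by simp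
  have 2: "tp_over L M I h b = tp_over L M I h' b'"
   using pel_tp_over[OF len, of h I M h' M L] U G h zip ps by simp
  have 3: "closed_set (univ M) cl (h ` I) \<or> h ` I = {}" "closed_set (univ M) cl (h' ` I) \<or> h' ` I = {}"
   using c unfolding D by auto
  have 4: "a \<in> cl (h ` I Un set b)" using a unfolding D Db by (simp add: Domain_Un_eq)
  have "(closed_set (univ M) cl (h ` I) \<or> h ` I = {}) \<and> (closed_set (univ M) cl (h' ` I) \<or> h' ` I = {}) \<and>
    tp_over L M I h [] = tp_over L M I h' [] \<and> set b \<subseteq> univ M \<and> set b' \<subseteq> univ M \<and>
    tp_over L M I h b = tp_over L M I h' b' \<and> a \<in> cl (h ` I Un set b)"
   using 1 2 3 4 U(3,4) by (intro conjI)
  then have "\<exists>a'\<in>univ M. tp_over L M I h (b @ [a]) = tp_over L M I h' (b' @ [a'])"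
   using st(6)[unfolded QM5_def, rule_format, of h I h' b b' a] by simp
  then obtain a' where a': "a' \<in> univ M" "tp_over L M I h (b @ [a]) = tp_over L M I h' (b' @ [a'])" by blast
  have aM: "a \<in> univ M" using 4 pregeo.cl_in[OF pgM, of "h ` I Un set b"] U by blast
  have len': "length (b @ [a]) = length (b' @ [a'])" using len by simp
  have "zip (b @ [a]) (b' @ [a']) = ps @ [(a, a')]" using zip len by simp
  then have "pel L M M ((\<lambda>i. (h i, h' i)) ` I Un set (ps @ [(a, a')]))"
   using pel_tp_over[OF len', of h I M h' M L] U a' aM by simp
  moreover have "(\<lambda>i. (h i, h' i)) ` I Un set (ps @ [(a, a')]) = insert (a, a') (G Un B)" using h ps by auto
  ultimately have "pel L M M (insert (a, a') (G Un B))" by simp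
  then show ?case using 6 by auto
 qed
qed

text \<open>Inside a \<open>qmc\<close> family elementary maps preserve closures by
  \<open>qm1\<close>. For maps into \<open>M\<close> from a structure whose axioms are still to be
  established, and whose carrier type may differ, this has to be part of the notion of embedding. It
  is tested on finite sets.\<close>

definition cpres :: "('f, 'r, 'a) pstruct \<Rightarrow> ('f, 'r, 'b) pstruct \<Rightarrow> ('a \<times> 'b) set \<Rightarrow> bool" where
 "cpres p q G \<longleftrightarrow> (\<forall>a b B. (a, b) \<in> G --> B \<subseteq> G --> finite B --> (a \<in> snd p (Domain B) \<longleftrightarrow> b \<in> snd q (Range B)))"

definition cemb :: "('f, 'r) lang \<Rightarrow> ('f, 'r, 'a) pstruct \<Rightarrow> ('f, 'r, 'b) pstruct \<Rightarrow> ('a \<times> 'b) set \<Rightarrow> bool" where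
 "cemb L p q G \<longleftrightarrow> pel L (fst p) (fst q) G \<and> closed_set (U p) (snd p) (Domain G) \<and>
   closed_set (U q) (snd q) (Range G) \<and> cpres p q G"

lemma cpres_half:
 assumes "pregeo (U p) (snd p)" "pregeo (U q) (snd q)" "pel L (fst p) (fst q) G" "cpres p q G"
  and "(a, b) \<in> G" "B \<subseteq> G" "a \<in> snd p (Domain B)"
 shows "b \<in> snd q (Range B)"
proof -
 interpret P: pregeo "U p" "snd p" by fact
 interpret Q: pregeo "U q" "snd q" by fact
 have BU: "Domain B \<subseteq> U p" "Range B \<subseteq> U q" using pel_univ[OF assms(3)] assms(6) by blast+
 obtain F where F: "F \<subseteq> Domain B" "finite F" "a \<in> snd p F" using P.cl_fin[OF BU(1) assms(7)] by blast
 have "F \<subseteq> fst ` B" using F(1) by force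
 then obtain B0 where B0: "B0 \<subseteq> B" "finite B0" "F = fst ` B0" using finite_subset_image[OF F(2)] by metis
 then have "a \<in> snd p (Domain B0)" using F(3) by (simp add: Domain_fst)
 moreover have "B0 \<subseteq> G" using B0(1) assms(6) by (rule subset_trans)
 ultimately have "b \<in> snd q (Range B0)" using assms(4,5) B0(2) unfolding cpres_def by blast
 moreover have "snd q (Range B0) \<subseteq> snd q (Range B)" by (rule Q.cl_mono[OF Range_mono[OF B0(1)] BU(2)])
 ultimately show ?thesis by blast
qed

lemma cpres_converse: "cpres p q G ==> cpres q p (G\<inverse>)"
 unfolding cpres_def
proof (intro allI impI)
 fix a b B assume c: "\<forall>a b B. (a, b) \<in> G --> B \<subseteq> G --> finite B --> (a \<in> snd p (Domain B) \<longleftrightarrow> b \<in> snd q (Range B))"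
  and h: "(a, b) \<in> G\<inverse>" "B \<subseteq> G\<inverse>" "finite B"
 have "(b, a) \<in> G" "B\<inverse> \<subseteq> G" "finite (B\<inverse>)" using h by auto
 then have "b \<in> snd p (Domain (B\<inverse>)) \<longleftrightarrow> a \<in> snd q (Range (B\<inverse>))" using c by blast
 then show "a \<in> snd q (Domain B) \<longleftrightarrow> b \<in> snd p (Range B)" by simp
qed

lemma cpres_iff:
 assumes "pregeo (U p) (snd p)" "pregeo (U q) (snd q)" "pel L (fst p) (fst q) G" "cpres p q G"
  and "(a, b) \<in> G" "S \<subseteq> Domain G"
 shows "a \<in> snd p S \<longleftrightarrow> b \<in> snd q (G `` S)"
proof -
 define B where "B = G Int S \<times> UNIV"
 have B: "B \<subseteq> G" "Domain B = S" "Range B = G `` S" using Domain_restrict[OF assms(6)] by (auto simp: B_def)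
 have "B\<inverse> \<subseteq> G\<inverse>" using B(1) by auto
 then show ?thesis
  using cpres_half[OF assms(1-5) B(1)] cpres_half[OF assms(2,1), of L "G\<inverse>" b a "B\<inverse>"]
   assms(3,5) cpres_converse[OF assms(4)] B by auto
qed

lemma cemb_closed_image:
 assumes "pregeo (U p) (snd p)" "pregeo (U q) (snd q)" "cemb L p q G" "closed_set (U p) (snd p) A" "A \<subseteq> Domain G"
 shows "closed_set (U q) (snd q) (G `` A)"
proof -
 interpret Q: pregeo "U q" "snd q" by fact
 have G: "pel L (fst p) (fst q) G" "cpres p q G" "closed_set (U q) (snd q) (Range G)" using assms(3) by (simp_all add: cemb_def)
 have sub: "G `` A \<subseteq> Range G" by blast
 then have sU: "G `` A \<subseteq> U q" using pel_univ[OF G(1)] by blast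
 have "snd q (G `` A) \<subseteq> G `` A"
 proof
  fix b assume b: "b \<in> snd q (G `` A)"
  then have "b \<in> Range G" using Q.cl_least'[OF G(3) sub] by blast
  then obtain a where a: "(a, b) \<in> G" by blast
  then have "a \<in> snd p A" using cpres_iff[OF assms(1,2) G(1,2) a assms(5)] b by simp
  then show "b \<in> G `` A" using a assms(4) by (auto simp: closed_set_def)
 qed
 then show ?thesis using sU Q.cl_ext[OF sU] by (auto simp: closed_set_def)
qed

lemma cpres_comp:
 assumes G: "pel L (fst p) (fst q) G" "cpres p q G" and H: "pel L' (fst q) (fst r) H" "cpres q r H"
 shows "cpres p r (G O H)"
 unfolding cpres_def
proof (intro allI impI)
 fix a c B assume ac: "(a, c) \<in> G O H" and B: "B \<subseteq> G O H" "finite B"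
 obtain b where b: "(a, b) \<in> G" "(b, c) \<in> H" using ac by blast
 define B1 where "B1 = G Int Domain B \<times> UNIV"
 define B2 where "B2 = H Int Range B1 \<times> UNIV"
 have D1: "Domain B1 = Domain B" unfolding B1_def by (rule Domain_restrict) (use B in auto)
 have B1G: "B1 \<subseteq> G" by (auto simp: B1_def)
 have "pel L (fst p) (fst q) B1" by (rule pel_subset[OF G(1) B1G])
 then have f1: "finite B1" by (rule pel_finite_dom) (simp add: D1 B finite_Domain)
 have RH: "Range B1 \<subseteq> Domain H"
 proof
  fix y assume "y \<in> Range B1"
  then obtain x where x: "(x, y) \<in> G" "x \<in> Domain B" unfolding B1_def by blast
  then obtain z y' where "(x, y') \<in> G" "(y', z) \<in> H" using B(1) by blast
  then show "y \<in> Domain H" using pel_inj[OF G(1) x(1)] by blast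
 qed
 have D2: "Domain B2 = Range B1" unfolding B2_def by (rule Domain_restrict[OF RH])
 have B2H: "B2 \<subseteq> H" by (auto simp: B2_def)
 have "pel L' (fst q) (fst r) B2" by (rule pel_subset[OF H(1) B2H])
 then have f2: "finite B2" by (rule pel_finite_dom) (simp add: D2 f1 finite_Range)
 have R2: "Range B2 = Range B"
 proof
  show "Range B \<subseteq> Range B2"
  proof
   fix z assume "z \<in> Range B"
   then obtain x where x: "(x, z) \<in> B" by blast
   then obtain y where "(x, y) \<in> G" "(y, z) \<in> H" using B(1) by blast
   then show "z \<in> Range B2" using x unfolding B1_def B2_def by blast
  qed
  show "Range B2 \<subseteq> Range B"
  proof
   fix z assume "z \<in> Range B2"
   then obtain x y where y: "(y, z) \<in> H" "(x, y) \<in> G" "x \<in> Domain B" unfolding B1_def B2_def by blast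
   then obtain z' where z': "(x, z') \<in> B" by blast
   then obtain y' where y': "(x, y') \<in> G" "(y', z') \<in> H" using B(1) by blast
   then have "y' = y" using pel_inj[OF G(1) y(2) y'(1)] by simp
   then have "z' = z" using pel_inj[OF H(1) y(1), of y' z'] y'(2) by simp
   then show "z \<in> Range B" using z' by blast
  qed
 qed
 have "a \<in> snd p (Domain B1) \<longleftrightarrow> b \<in> snd q (Range B1)" using G(2) b(1) B1G f1 unfolding cpres_def by blast
 moreover have "b \<in> snd q (Domain B2) \<longleftrightarrow> c \<in> snd r (Range B2)" using H(2) b(2) B2H f2 unfolding cpres_def by blast
 ultimately show "a \<in> snd p (Domain B) \<longleftrightarrow> c \<in> snd r (Range B)" using D1 D2 R2 by simp
qed

locale qmM =
 fixes L :: "('f, 'r) lang" and M :: "('f, 'r, 'm) struct" and cl :: "'m set \<Rightarrow> 'm set"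
 assumes qm: "qm_structure L M cl"
begin

sublocale M: qmc L "{(M, cl)}"
 by (rule weakly_qm_qmc) (use qm in \<open>simp add: qm_structure_def\<close>)

lemma M_struct: "is_struct L M"
 using qm by (simp add: qm_structure_def weakly_qm_structure_def)

sublocale PM: pregeo "univ M" cl
 using M.pgi[of "(M, cl)"] by simp

lemma M_infd: "infd cl (univ M)"
proof -
 have "closed_set (univ M) cl (univ M)" using PM.cl_ext[of "univ M"] PM.cl_in[of "univ M"] by (auto simp: closed_set_def)
 then show ?thesis using PM.finite_dim_iff qm by (simp add: qm_structure_def QM2_def)
qed

text \<open>Suppose that the value \<open>t\<close> at arguments \<open>xs\<close> from
  \<open>H\<close> lies outside \<open>H\<close>, hence outside the closure \<open>H0\<close> of
  \<open>xs\<close>. By QM4 every \<open>t'\<close> outside \<open>H0\<close> has the same type over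
  \<open>H0\<close> as \<open>t\<close>, and since \<open>t\<close> is determined by
  \<open>xs\<close> this gives \<open>t' = t\<close>. Then \<open>M\<close> is the closure of
  \<open>t\<close> and \<open>xs\<close>, against infinite dimension.\<close>

lemma M_closed_struct:
 assumes H: "closed_set (univ M) cl H"
 shows "is_struct L (restr M H)"
proof (rule is_struct_restr[OF M_struct])
 have HU: "H \<subseteq> univ M" using H by (simp add: closed_set_def)
 then show "H \<subseteq> univ M" .
 fix f xs assume f: "f \<in> funs L" "length xs = far L f" "set xs \<subseteq> H"
 show "fn M f xs \<in> H"
 proof (rule ccontr)
  assume nH: "fn M f xs \<notin> H"
  have xsU: "set xs \<subseteq> univ M" using f HU by blast
  define t where "t = fn M f xs"
  define H0 where "H0 = cl (set xs)"
  have tU: "t \<in> univ M" unfolding t_def by (rule is_struct_fn[OF M_struct f(1,2) xsU])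
  have xH0: "set xs \<subseteq> H0" unfolding H0_def by (rule PM.cl_ext[OF xsU])
  have H0H: "H0 \<subseteq> H" unfolding H0_def by (rule PM.cl_least'[OF H f(3)])
  have c0: "M.ciso (M, cl) (M, cl) (Id_on H0)" by (rule M.ciso_Id_on) (simp add: H0_def PM.closed_cl[OF xsU])
  have cc: "countable (Domain (Id_on H0))" using M.qm3[of "(M, cl)" "set xs"] xsU by (simp add: H0_def)
  have "t' = t" if t': "t' \<in> univ M" "t' \<notin> H0" for t'
  proof -
   have "t \<notin> H0" using nH H0H t_def by blast
   then have "pel L M M (insert (t, t') (Id_on H0))"
    using M.qm4[of "(M, cl)" "(M, cl)" "Id_on H0" t t'] c0 cc tU t' by (simp add: M.ciso_def)
   moreover define g where "g x = (if x = t then t' else x)" for x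
   moreover have "insert (t, t') (Id_on H0) = gr g (insert t H0)"
   proof -
    have "gr g H0 = gr id H0" unfolding gr_def by (rule image_cong) (use \<open>t \<notin> H0\<close> in \<open>auto simp: g_def\<close>)
    moreover have "gr g (insert t H0) = insert (t, t') (gr g H0)" by (simp add: gr_def g_def)
    ultimately show ?thesis by (simp add: gr_id)
   qed
   ultimately have p: "pel L M M (gr g (insert t H0))" by simp
   have "g (fn M f xs) = fn M f (map g xs)"
    by (rule pel_fn[OF p f(1,2)]) (use xH0 in \<open>auto simp: t_def\<close>)
   moreover have "map g xs = xs" using xH0 \<open>t \<notin> H0\<close> by (intro map_idI) (auto simp: g_def)
   ultimately show ?thesis by (simp add: t_def g_def)
  qed
  then have "univ M \<subseteq> insert t H0" by blast
  moreover have "insert t H0 \<subseteq> cl (insert t (set xs))"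
   unfolding H0_def using PM.cl_mono[of "set xs" "insert t (set xs)"] PM.cl_ext[of "insert t (set xs)"] tU xsU by auto
  ultimately have "univ M \<subseteq> cl (insert t (set xs))" by (rule subset_trans)
  moreover have "insert t (set xs) \<subseteq> univ M" "finite (insert t (set xs))" using tU xsU by auto
  ultimately show False using M_infd unfolding infd_def by blast
 qed
qed

text \<open>The members of the class, described without reference to chains: closures of finite sets embed in
 \<open>M\<close> as closed sets.\<close>

definition fgood :: "('f, 'r, 'a) pstruct \<Rightarrow> bool" where
 "fgood p \<longleftrightarrow> is_struct L (fst p) \<and> pregeo (U p) (snd p) \<and>
   (\<forall>X\<subseteq>U p. finite X --> (\<exists>G. cemb L p (M, cl) G \<and> Domain G = snd p X))"

text \<open>The embeddings given for finite sets need not cohere. If \<open>G\<close> embeds the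
  closure of \<open>F n\<close> and \<open>K\<close> that of \<open>F (Suc n)\<close>, then
  \<open>K\<inverse> O G\<close> is an isomorphism between countable closed subsets of
  \<open>M\<close>. It extends by \<open>step\<close> to the range of \<open>K\<close>, the image of
  the new point being found because \<open>M\<close> is infinite-dimensional. \<open>K\<close>
  followed by this extension continues \<open>G\<close>.\<close>

lemma fgood_countable:
 assumes p: "fgood p" and X: "X \<subseteq> U p" "countable X"
 shows "\<exists>G. cemb L p (M, cl) G \<and> Domain G = snd p X"
proof (cases "X = {}")
 case True
 then show ?thesis using p by (simp add: fgood_def)
next
 case False
 interpret P: pregeo "U p" "snd p" using p by (simp add: fgood_def)
 define x where "x = from_nat_into X"
 have xX: "range x = X" unfolding x_def by (rule range_from_nat_into[OF False X(2)])
 define F where "F n = x ` {..<n}" for n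
 have FX: "F n \<subseteq> X" and finF: "finite (F n)" for n using xX by (auto simp: F_def)
 have FU: "F n \<subseteq> U p" for n using FX X(1) by blast
 have FS: "F (Suc n) = insert (x n) (F n)" for n by (auto simp: F_def lessThan_Suc)
 define I where "I n G \<longleftrightarrow> cemb L p (M, cl) G \<and> Domain G = snd p (F n)" for n G
 have fin: "\<exists>K. I n K" for n using p FU[of n] finF[of n] unfolding fgood_def I_def by blast
 then obtain G0 where I0: "I 0 G0" by blast
 have IS: "\<exists>G'. I (Suc n) G' \<and> G \<subseteq> G'" if G: "I n G" for n G
 proof (cases "x n \<in> snd p (F n)")
  case True
  have "snd p (F (Suc n)) = snd p (F n)"
  proof
   show "snd p (F (Suc n)) \<subseteq> snd p (F n)" by (rule P.cl_least[OF FU]) (use True P.cl_ext[OF FU] FS in auto)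
   show "snd p (F n) \<subseteq> snd p (F (Suc n))" by (rule P.cl_mono[OF _ FU]) (use FS in auto)
  qed
  then have "I (Suc n) G" using G by (simp add: I_def)
  then show ?thesis by blast
 next
  case False
  obtain K where "I (Suc n) K" using fin by blast
  then have K: "cemb L p (M, cl) K" "Domain K = snd p (F (Suc n))" by (simp_all add: I_def)
  have G': "cemb L p (M, cl) G" "Domain G = snd p (F n)" using G by (simp_all add: I_def)
  have pK: "pel L (fst p) M K" "cpres p (M, cl) K" "closed_set (univ M) cl (Range K)" using K(1) by (simp_all add: cemb_def)
  have pG: "pel L (fst p) M G" "cpres p (M, cl) G" "closed_set (univ M) cl (Range G)" using G'(1) by (simp_all add: cemb_def)
  have pgs: "pregeo (U p) (snd p)" "pregeo (U (M, cl)) (snd (M, cl))" by (rule P.pregeo_axioms) (simp add: PM.pregeo_axioms)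
  have pK': "pel L (fst p) (fst (M, cl)) K" and pG': "pel L (fst p) (fst (M, cl)) G" using pK(1) pG(1) by simp_all
  have GK: "Domain G \<subseteq> Domain K" unfolding G' K by (rule P.cl_mono[OF _ FU]) (use FS in auto)
  have FG: "F n \<subseteq> Domain G" using G'(2) P.cl_ext[OF FU] by simp
  have xK: "x n \<in> Domain K" using K(2) P.cl_ext[OF FU[of "Suc n"]] FS by auto
  then obtain m where m: "(x n, m) \<in> K" by blast
  define P0 where "P0 = K\<inverse> O G"
  have DP0: "Domain P0 = K `` Domain G" and RP0: "Range P0 = Range G" using GK unfolding P0_def by blast+
  have cloG: "closed_set (U p) (snd p) (Domain G)" using G'(1) by (simp add: cemb_def)
  have c1: "closed_set (univ M) cl (K `` Domain G)" using cemb_closed_image[OF pgs K(1) cloG GK] by simp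
  have pP0: "pel L M M P0" unfolding P0_def by (rule pel_comp[OF _ pG(1)]) (simp add: pK)
  have P0: "M.ciso (M, cl) (M, cl) P0" unfolding M.ciso_def DP0 RP0 using c1 pG(3) pP0 by simp
  have cD: "countable (Domain P0)"
  proof -
   have gen: "K `` Domain G \<subseteq> cl (K `` F n)"
   proof
    fix b assume "b \<in> K `` Domain G"
    then obtain a where a: "a \<in> Domain G" "(a, b) \<in> K" by blast
    then show "b \<in> cl (K `` F n)" using cpres_iff[OF pgs pK' pK(2) a(2), of "F n"] G'(2) FG GK by auto
   qed
   have "K `` F n \<subseteq> univ M" "finite (K `` F n)" using pel_univ[OF pK(1)] pel_finite_Image[OF pK(1) finF] by blast+
   then have "countable (cl (K `` F n))" using M.qm3[of "(M, cl)" "K `` F n"] by simp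
   then show ?thesis using gen DP0 countable_subset by metis
  qed
  have mU: "m \<in> univ M" using pel_univ[OF pK(1)] m by blast
  have mP: "m \<notin> Domain P0"
  proof
   assume "m \<in> Domain P0"
   then obtain a where "a \<in> Domain G" "(a, m) \<in> K" unfolding DP0 by blast
   then have "x n \<in> Domain G" using pel_inj[OF pK(1) m, of a m] by simp
   then show False using False G'(2) by simp
  qed
  have fG: "G `` F n \<subseteq> univ M" "finite (G `` F n)" "G `` F n \<subseteq> Range G"
   using pel_univ[OF pG(1)] pel_finite_Image[OF pG(1) finF] by blast+
  have "Range G \<subseteq> cl (G `` F n)"
  proof
   fix b assume "b \<in> Range G"
   then obtain a where a: "(a, b) \<in> G" by blast
   then have "a \<in> snd p (F n)" using G'(2) by blast
   then show "b \<in> cl (G `` F n)" using cpres_iff[OF pgs pG' pG(2) a FG] by simp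
  qed
  moreover have "\<not> univ M \<subseteq> cl (G `` F n)" using M_infd fG unfolding infd_def by blast
  ultimately obtain m' where m': "m' \<in> univ M" "m' \<notin> Range P0" unfolding RP0 by blast
  obtain P1 where P1: "M.ciso (M, cl) (M, cl) P1" "insert (m, m') P0 \<subseteq> P1"
   "Domain P1 = cl (insert m (Domain P0))" "Range P1 = cl (insert m' (Range P0))"
   using M.step[of "(M, cl)" "(M, cl)" P0 m m'] P0 cD mU mP m' by auto
  have elP1: "pel L M M P1" using M.ciso_el[OF P1(1)] by simp
  have cpP1: "cpres (M, cl) (M, cl) P1"
   unfolding cpres_def using M.cl_iff[of "(M, cl)" "(M, cl)" P1] elP1 by simp
  have RK: "Range K = Domain P1"
  proof
   have "insert m (Domain P0) \<subseteq> Range K" using m DP0 by blast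
   then show "Domain P1 \<subseteq> Range K" unfolding P1(3) by (rule PM.cl_least'[OF pK(3)])
   show "Range K \<subseteq> Domain P1"
   proof
    fix b assume "b \<in> Range K"
    then obtain a where a: "(a, b) \<in> K" by blast
    have FK: "F (Suc n) \<subseteq> Domain K" using K(2) P.cl_ext[OF FU] by simp
    have "a \<in> snd p (F (Suc n))" using a K(2) by blast
    then have "b \<in> cl (K `` F (Suc n))" using cpres_iff[OF pgs pK' pK(2) a FK] by simp
    moreover have "K `` F (Suc n) \<subseteq> insert m (Domain P0)"
    proof
     fix c assume "c \<in> K `` F (Suc n)"
     then obtain a where a: "a \<in> F (Suc n)" "(a, c) \<in> K" by blast
     show "c \<in> insert m (Domain P0)"
     proof (cases "a = x n")
      case True
      then show ?thesis using pel_inj[OF pK(1) m a(2)] by simp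
     next
      case False
      then have "a \<in> Domain G" using a(1) FS FG by auto
      then show ?thesis using a(2) DP0 by blast
     qed
    qed
    moreover have "insert m (Domain P0) \<subseteq> univ M" using mU pel_univ[OF pP0] by blast
    ultimately show "b \<in> Domain P1" unfolding P1(3) using PM.cl_mono by blast
   qed
  qed
  define G1 where "G1 = K O P1"
  have DG1: "Domain G1 = Domain K" and RG1: "Range G1 = Range P1" using RK unfolding G1_def by blast+
  have "cemb L p (M, cl) G1"
   unfolding cemb_def DG1 RG1
  proof (intro conjI)
   show "pel L (fst p) (fst (M, cl)) G1" unfolding G1_def using pel_comp[OF pK(1) elP1] by simp
   show "closed_set (U p) (snd p) (Domain K)" using K(1) by (simp add: cemb_def)
   show "closed_set (U (M, cl)) (snd (M, cl)) (Range P1)" using M.ciso_Range[OF P1(1)] by simp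
   show "cpres p (M, cl) G1" unfolding G1_def by (rule cpres_comp[OF _ pK(2) _ cpP1]) (use pK(1) elP1 in simp_all)
  qed
  then have "I (Suc n) G1" using DG1 K(2) by (simp add: I_def)
  moreover have "G \<subseteq> G1"
  proof
   fix t assume t: "t \<in> G"
   obtain a b where ab: "t = (a, b)" by force
   then obtain c where c: "(a, c) \<in> K" using t GK by blast
   then have "(c, b) \<in> P0" using t ab unfolding P0_def by blast
   then show "t \<in> G1" using c ab P1(2) unfolding G1_def by blast
  qed
  ultimately show ?thesis by blast
 qed
 obtain f where f: "\<And>n. I n (f n)" "\<And>n. f n \<subseteq> f (Suc n)"
  using nat_choice[of I G0 "\<lambda>_ K K'. K \<subseteq> K'", OF I0 IS] by blast
 have mono: "f m \<subseteq> f n" if "m \<le> n" for m n by (rule lift_Suc_mono_le[of f, OF f(2) that])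
 have fc: "pel L (fst p) M (f n)" "cpres p (M, cl) (f n)" "closed_set (univ M) cl (Range (f n))" "Domain (f n) = snd p (F n)" for n
  using f(1)[of n] by (simp_all add: I_def cemb_def)
 let ?G = "\<Union>(range f)"
 have el: "pel L (fst p) M ?G" by (rule pel_UN_nat[where f = f, OF fc(1) f(2)])
 have fch: "subset.chain UNIV (range f)"
 proof -
  have "f m \<subseteq> f n \<or> f n \<subseteq> f m" for m n using mono nat_le_linear by blast
  then show ?thesis unfolding subset_chain_def by blast
 qed
 have finsub: "\<exists>n. B \<subseteq> f n" if "finite B" "B \<subseteq> ?G" for B
  using finite_subset_Union_chain[OF that _ fch] by blast
 have cp: "cpres p (M, cl) ?G"
  unfolding cpres_def
 proof (intro allI impI)
  fix a b B assume ab: "(a, b) \<in> ?G" and B: "B \<subseteq> ?G" "finite B"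
  obtain n where n: "insert (a, b) B \<subseteq> f n" using finsub[of "insert (a, b) B"] ab B by auto
  then show "a \<in> snd p (Domain B) \<longleftrightarrow> b \<in> snd (M, cl) (Range B)" using fc(2)[of n] B(2) unfolding cpres_def by blast
 qed
 have D: "Domain ?G = snd p X"
 proof
  have "Domain (f n) \<subseteq> snd p X" for n unfolding fc(4) by (rule P.cl_mono[OF FX X(1)])
  then show "Domain ?G \<subseteq> snd p X" by blast
  show "snd p X \<subseteq> Domain ?G"
  proof
   fix a assume "a \<in> snd p X"
   then obtain Y where Y: "Y \<subseteq> X" "finite Y" "a \<in> snd p Y" using P.cl_fin[OF X(1)] by blast
   have "\<exists>n. Y \<subseteq> F n" using Y(2,1)
   proof (induction rule: finite_induct)
    case (insert y Y)
    then obtain n where n: "Y \<subseteq> F n" by auto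
    obtain m where m: "x m = y" using insert xX by blast
    have "insert y Y \<subseteq> F (Suc (max n m))" using n m by (auto simp: F_def)
    then show ?case by blast
   qed auto
   then obtain n where "Y \<subseteq> F n" by blast
   then have "a \<in> snd p (F n)" using Y(3) P.cl_mono[OF _ FU] by blast
   then have "a \<in> Domain (f n)" using fc(4) by simp
   then show "a \<in> Domain ?G" by blast
  qed
 qed
 have "closed_set (univ M) cl (Range ?G)"
 proof -
  have RU: "Range ?G \<subseteq> univ M" using pel_univ[OF el] by blast
  have "cl (Range ?G) \<subseteq> Range ?G"
  proof
   fix b assume "b \<in> cl (Range ?G)"
   then obtain Y where Y: "Y \<subseteq> Range ?G" "finite Y" "b \<in> cl Y" using PM.cl_fin[OF RU] by blast
   have "Y \<subseteq> snd ` ?G" using Y(1) by force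
   then obtain B where B: "B \<subseteq> ?G" "finite B" "Y = snd ` B" using finite_subset_image[OF Y(2)] by metis
   obtain n where "B \<subseteq> f n" using finsub[OF B(2,1)] by blast
   then have "Y \<subseteq> Range (f n)" using B(3) by force
   then have "b \<in> Range (f n)" using PM.cl_least'[OF fc(3)] Y(3) by blast
   then show "b \<in> Range ?G" by blast
  qed
  then show ?thesis using RU PM.cl_ext[OF RU] by (simp add: closed_set_def subset_antisym)
 qed
 moreover have "closed_set (U p) (snd p) (Domain ?G)" unfolding D by (rule P.closed_cl[OF X(1)])
 ultimately have "cemb L p (M, cl) ?G" using el cp by (simp add: cemb_def)
 then show ?thesis using D by blast
qed

end

section \<open>Pregeometries on closed subsets, isomorphic copies and unions of chains\<close>

lemma pregeo_sub:
 assumes "pregeo X cl" "closed_set X cl H" "\<And>Y. Y \<subseteq> H ==> c Y = cl Y"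
 shows "pregeo H c"
proof
 interpret P: pregeo X cl by fact
 have H: "H \<subseteq> X" "cl H = H" using assms(2) by (simp_all add: closed_set_def)
 have in_H: "c A \<subseteq> H" if "A \<subseteq> H" for A using P.cl_least'[OF assms(2) that] assms(3)[OF that] by simp
 show "pregeometry H c"
  unfolding pregeometry_def
 proof (intro conjI allI impI ballI)
  fix A assume A: "A \<subseteq> H"
  have AX: "A \<subseteq> X" using A H by blast
  show "A \<subseteq> c A" using P.cl_ext[OF AX] assms(3)[OF A] by simp
  show "c A \<subseteq> H" by (rule in_H[OF A])
  show "c (c A) = c A" using assms(3)[OF in_H[OF A]] assms(3)[OF A] P.cl_idem[OF AX] by simp
  show "\<exists>F\<subseteq>A. finite F \<and> a \<in> c F" if a: "a \<in> c A" for a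
  proof -
   obtain F where F: "F \<subseteq> A" "finite F" "a \<in> cl F" using P.cl_fin[OF AX, of a] a assms(3)[OF A] by auto
   then show ?thesis using assms(3)[OF subset_trans[OF F(1) A]] by blast
  qed
  show "b \<in> c (insert a A)" if "a \<in> H" "b \<in> H" "a \<in> c (insert b A) \<and> a \<notin> c A" for a b
   using P.cl_exch[OF AX, of b a] that assms(3)[of "insert b A"] assms(3)[of "insert a A"] assms(3)[OF A] A H(1) by auto
 next
  fix A B assume AB: "A \<subseteq> B \<and> B \<subseteq> H"
  then have s: "A \<subseteq> B" "A \<subseteq> H" "B \<subseteq> H" "B \<subseteq> X" using H(1) by blast+
  show "c A \<subseteq> c B" using P.cl_mono[OF s(1,4)] assms(3)[OF s(2)] assms(3)[OF s(3)] by simp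
 qed
qed

lemma bij_preimage:
 assumes "bij_betw g X X'" "A' \<subseteq> X'"
 obtains A where "A \<subseteq> X" "g ` A = A'"
proof -
 have "A' \<subseteq> g ` X" using assms by (simp add: bij_betw_def)
 then show thesis using that subset_imageE by metis
qed

lemma pregeo_bij:
 assumes "pregeo X c" "bij_betw g X X'" "\<And>Y. Y \<subseteq> X ==> c' (g ` Y) = g ` c Y"
 shows "pregeo X' c'"
proof
 interpret P: pregeo X c by fact
 have g: "inj_on g X" "g ` X = X'" using assms(2) by (simp_all add: bij_betw_def)
 show "pregeometry X' c'"
  unfolding pregeometry_def
 proof (intro conjI allI impI ballI)
  fix A' assume A': "A' \<subseteq> X'"
  obtain A where A: "A \<subseteq> X" "g ` A = A'" by (rule bij_preimage[OF assms(2) A'])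
  have cA: "c' A' = g ` c A" using assms(3)[OF A(1)] A(2) by simp
  show "A' \<subseteq> c' A'" using image_mono[OF P.cl_ext[OF A(1)], of g] cA A(2) by simp
  show "c' A' \<subseteq> X'" using image_mono[OF P.cl_in[OF A(1)], of g] cA g(2) by simp
  show "c' (c' A') = c' A'" unfolding cA using assms(3)[OF P.cl_in[OF A(1)]] P.cl_idem[OF A(1)] by simp
  show "\<exists>F\<subseteq>A'. finite F \<and> a \<in> c' F" if aA: "a \<in> c' A'" for a
  proof -
   obtain b where b: "b \<in> c A" "a = g b" using aA cA by blast
   obtain F where F: "F \<subseteq> A" "finite F" "b \<in> c F" using P.cl_fin[OF A(1) b(1)] by blast
   have "a \<in> c' (g ` F)" using assms(3)[of F] F A(1) b(2) by auto
   then show ?thesis using F A(2) by (intro exI[of _ "g ` F"]) auto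
  qed
  show "b' \<in> c' (insert a' A')" if ab: "a' \<in> X'" "b' \<in> X'" "a' \<in> c' (insert b' A') \<and> a' \<notin> c' A'" for a' b'
  proof -
   obtain a b where a: "a \<in> X" "a' = g a" and b: "b \<in> X" "b' = g b" using ab g(2) by blast
   have ins: "c' (insert (g x) A') = g ` c (insert x A)" if "x \<in> X" for x
    using assms(3)[of "insert x A"] that A by simp
   have mem: "g x \<in> g ` Y \<longleftrightarrow> x \<in> Y" if "x \<in> X" "Y \<subseteq> X" for x Y using inj_on_image_mem_iff[OF g(1)] that by blast
   have sub: "c (insert b A) \<subseteq> X" "c (insert a A) \<subseteq> X" "c A \<subseteq> X" using P.cl_in A(1) a b by auto
   have "a \<in> c (insert b A)" "a \<notin> c A" using ab(3) ins[OF b(1)] cA a b mem[OF a(1)] sub by auto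
   then have "b \<in> c (insert a A)" using P.cl_exch[OF A(1) b(1)] by blast
   then show ?thesis using ins[OF a(1)] a(2) b(2) by blast
  qed
 next
  fix A' B' assume AB: "A' \<subseteq> B' \<and> B' \<subseteq> X'"
  obtain B where B: "B \<subseteq> X" "g ` B = B'" by (rule bij_preimage[OF assms(2) conjunct2[OF AB]])
  obtain A where A: "A \<subseteq> B" "g ` A = A'" using AB B(2) subset_imageE by metis
  have "c A \<subseteq> c B" by (rule P.cl_mono[OF A(1) B(1)])
  then show "c' A' \<subseteq> c' B'" using assms(3)[OF B(1)] assms(3)[of A] A B by auto
 qed
qed

lemma closed_sub_Id:
 assumes "closed_sub L p q"
 shows "pel L (fst p) (fst q) (Id_on (U p))" "cpres p q (Id_on (U p))"
proof -
 have s: "substr L (fst p) (fst q)" and c: "\<And>X. X \<subseteq> U p ==> snd p X = snd q X" using assms by (simp_all add: closed_sub_def)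
 have st: "is_struct L (restr (fst q) (U p))" "U p \<subseteq> U q" using s substr_eq[OF s] by (simp_all add: substr_def)
 show "pel L (fst p) (fst q) (Id_on (U p))" using pel_restr[OF st] substr_eq[OF s] by simp
 show "cpres p q (Id_on (U p))"
  unfolding cpres_def
 proof (intro allI impI)
  fix a b B assume h: "(a, b) \<in> Id_on (U p)" "B \<subseteq> Id_on (U p)"
  then have "Domain B = Range B" "Domain B \<subseteq> U p" "a = b" by auto
  then show "a \<in> snd p (Domain B) \<longleftrightarrow> b \<in> snd q (Range B)" using c by simp
 qed
qed

text \<open>A finite set lies in a single member of the chain, and the closures of a set computed in
  different members containing it agree (\<open>clp\<close>); so each law is verified inside one
  member.\<close>

lemma pchain_union_sub:
 assumes C: "C \<noteq> {}" and st: "\<And>p. p \<in> C ==> is_struct L (fst p)" and pg: "\<And>p. p \<in> C ==> pregeo (U p) (snd p)"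
  and ch: "\<And>p q. p \<in> C ==> q \<in> C ==> closed_sub L p q \<or> closed_sub L q p"
 shows "is_struct L (fst (pchain_union C))" "pregeo (U (pchain_union C)) (snd (pchain_union C))"
  "\<And>p. p \<in> C ==> closed_sub L p (pchain_union C)"
  "\<And>F. finite F ==> F \<subseteq> U (pchain_union C) ==> \<exists>p\<in>C. F \<subseteq> U p"
proof -
 let ?u = "pchain_union C"
 have fu: "fst ?u = chain_union (fst ` C)" and su: "snd ?u = (\<lambda>X. \<Union>p\<in>C. snd p (X Int U p))" by (simp_all add: pchain_union_def)
 have sub: "substr L A B \<or> substr L B A" if "A \<in> fst ` C" "B \<in> fst ` C" for A B
 proof -
  have "\<exists>p q. p \<in> C \<and> q \<in> C \<and> A = fst p \<and> B = fst q" using that by blast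
  then obtain p q where "p \<in> C" "q \<in> C" "A = fst p" "B = fst q" by blast
  then show ?thesis using ch[of p q] by (auto simp: closed_sub_def)
 qed
 have Cne: "fst ` C \<noteq> {}" and stC: "\<And>A. A \<in> fst ` C ==> is_struct L A" using C st by auto
 note cu = chain_union_substr[OF Cne stC sub]
 show isu: "is_struct L (fst ?u)" using cu(1) fu by simp
 have uni: "U ?u = (\<Union>p\<in>C. U p)" by (simp add: fu chain_union_def)
 have chU: "subset.chain UNIV ((\<lambda>p. U p) ` C)"
 proof -
  have "U p \<subseteq> U q \<or> U q \<subseteq> U p" if "p \<in> C" "q \<in> C" for p q
   using ch[OF that] by (auto simp: closed_sub_def substr_def)
  then show ?thesis unfolding subset_chain_def by blast
 qed
 show fin: "\<exists>p\<in>C. F \<subseteq> U p" if F: "finite F" "F \<subseteq> U ?u" for F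
 proof -
  have "F \<subseteq> \<Union>((\<lambda>p. U p) ` C)" using F uni by simp
  then obtain Y where "Y \<in> (\<lambda>p. U p) ` C" "F \<subseteq> Y"
   using finite_subset_Union_chain[OF F(1) _ _ chU] C by blast
  then show ?thesis by blast
 qed
 have clp: "snd ?u Y = snd p Y" if p: "p \<in> C" and Y: "Y \<subseteq> U p" for p Y
 proof
  have "Y Int U p = Y" using Y by blast
  then show "snd p Y \<subseteq> snd ?u Y" using p unfolding su by auto
  interpret P: pregeo "U p" "snd p" by (rule pg[OF p])
  have "snd r (Y Int U r) \<subseteq> snd p Y" if r: "r \<in> C" for r
   using ch[OF p r]
  proof
   assume "closed_sub L p r"
   then have "U p \<subseteq> U r" "snd r Y = snd p Y" using Y by (auto simp: closed_sub_def substr_def)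
   moreover have "Y Int U r = Y" using Y calculation(1) by blast
   ultimately show ?thesis by simp
  next
   assume "closed_sub L r p"
   then have "snd r (Y Int U r) = snd p (Y Int U r)" by (simp add: closed_sub_def)
   then show ?thesis using P.cl_mono[of "Y Int U r" Y] Y by auto
  qed
  then show "snd ?u Y \<subseteq> snd p Y" unfolding su by blast
 qed
 have fc: "\<exists>F p. F \<subseteq> A \<and> finite F \<and> p \<in> C \<and> F \<subseteq> U p \<and> x \<in> snd p F" if x: "x \<in> snd ?u A" for x A
 proof -
  obtain p where p: "p \<in> C" "x \<in> snd p (A Int U p)" using x unfolding su by blast
  interpret P: pregeo "U p" "snd p" by (rule pg[OF p(1)])
  obtain F where "F \<subseteq> A Int U p" "finite F" "x \<in> snd p F" using P.cl_fin[OF _ p(2)] by blast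
  then show ?thesis using p(1) by blast
 qed
 have mono: "snd ?u A \<subseteq> snd ?u B" if "A \<subseteq> B" for A B
 proof -
  have "snd p (A Int U p) \<subseteq> snd p (B Int U p)" if p: "p \<in> C" for p
   by (rule pregeo.cl_mono[OF pg[OF p]]) (use \<open>A \<subseteq> B\<close> in auto)
  then show ?thesis unfolding su by blast
 qed
 have inU: "snd ?u A \<subseteq> U ?u" for A
 proof -
  have "snd p (A Int U p) \<subseteq> U p" if p: "p \<in> C" for p by (rule pregeo.cl_in[OF pg[OF p]]) auto
  then show ?thesis unfolding su uni by blast
 qed
 have pu: "closed_sub L p ?u" if p: "p \<in> C" for p
  unfolding closed_sub_def
 proof (intro conjI allI impI)
  show "substr L (fst p) (fst ?u)" using cu(2)[of "fst p"] p fu by simp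
  show "closed_set (U ?u) (snd ?u) (U p)"
   unfolding closed_set_def using clp[OF p subset_refl] pregeo.cl_ext[OF pg[OF p] subset_refl]
    pregeo.cl_in[OF pg[OF p] subset_refl] p uni by auto
  show "snd p X = snd ?u X" if "X \<subseteq> U p" for X using clp[OF p that] by simp
 qed
 then show "\<And>p. p \<in> C ==> closed_sub L p ?u" .
 show "pregeo (U ?u) (snd ?u)"
 proof
  show "pregeometry (U ?u) (snd ?u)"
   unfolding pregeometry_def
  proof (intro conjI allI impI ballI)
   fix A assume A: "A \<subseteq> U ?u"
   show ext: "A \<subseteq> snd ?u A"
   proof
    fix a assume a: "a \<in> A"
    then obtain p where p: "p \<in> C" "a \<in> U p" using A uni by blast
    then have "a \<in> snd p (A Int U p)" using pregeo.cl_ext[OF pg[OF p(1)], of "A Int U p"] a by blast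
    then show "a \<in> snd ?u A" using p(1) unfolding su by blast
   qed
   show "snd ?u A \<subseteq> U ?u" by (rule inU)
   show "\<exists>F\<subseteq>A. finite F \<and> a \<in> snd ?u F" if aA: "a \<in> snd ?u A" for a
   proof -
    obtain F p where F: "F \<subseteq> A" "finite F" "p \<in> C" "F \<subseteq> U p" "a \<in> snd p F" using fc[OF aA] by blast
    then show ?thesis using clp[OF F(3,4)] by blast
   qed
   show "snd ?u (snd ?u A) = snd ?u A"
   proof
    show "snd ?u (snd ?u A) \<subseteq> snd ?u A"
    proof
     fix x assume x: "x \<in> snd ?u (snd ?u A)"
     obtain F p where F: "F \<subseteq> snd ?u A" "finite F" "p \<in> C" "F \<subseteq> U p" "x \<in> snd p F" using fc[OF x] by blast
     have "\<exists>G. G \<subseteq> A \<and> finite G \<and> F \<subseteq> snd ?u G" using F(2,1)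
     proof (induction rule: finite_induct)
      case (insert y F)
      then obtain G where G: "G \<subseteq> A" "finite G" "F \<subseteq> snd ?u G" by auto
      obtain H q where H: "H \<subseteq> A" "finite H" "q \<in> C" "H \<subseteq> U q" "y \<in> snd q H" using fc[of y A] insert.prems by blast
      then have "y \<in> snd ?u H" using clp[OF H(3,4)] by simp
      then have "insert y F \<subseteq> snd ?u (G Un H)" using G(3) mono[of G "G Un H"] mono[of H "G Un H"] by auto
      then show ?case using G H by (intro exI[of _ "G Un H"]) auto
     qed auto
     then obtain G where G: "G \<subseteq> A" "finite G" "F \<subseteq> snd ?u G" by blast
     have "F Un G \<subseteq> U ?u" using F(1) G(1) A inU by blast
     then obtain r where r: "r \<in> C" "F Un G \<subseteq> U r" using fin[of "F Un G"] F(2) G(2) by auto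
     interpret R: pregeo "U r" "snd r" by (rule pg[OF r(1)])
     have "snd ?u G = snd r G" "snd p F = snd r F" using clp[OF r(1)] clp[OF F(3,4)] r(2) by auto
     then have "x \<in> snd r G" using R.cl_least[of G F] G(3) F(5) r(2) by auto
     then show "x \<in> snd ?u A" using \<open>snd ?u G = snd r G\<close> mono[OF G(1)] by blast
    qed
    show "snd ?u A \<subseteq> snd ?u (snd ?u A)" by (rule mono[OF ext])
   qed
   show "b \<in> snd ?u (insert a A)" if ab: "a \<in> U ?u" "b \<in> U ?u" "a \<in> snd ?u (insert b A) \<and> a \<notin> snd ?u A" for a b
   proof -
    obtain F p where F: "F \<subseteq> insert b A" "finite F" "p \<in> C" "F \<subseteq> U p" "a \<in> snd p F" using fc[OF conjunct1[OF ab(3)]] by blast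
    have aF: "finite ({a, b} Un F)" "{a, b} Un F \<subseteq> U ?u" using F(1,2) A ab(1,2) by auto
    obtain r where r: "r \<in> C" "{a, b} Un F \<subseteq> U r" using fin[OF aF] by blast
    interpret R: pregeo "U r" "snd r" by (rule pg[OF r(1)])
    have Fr: "F - {b} \<subseteq> U r" "F \<subseteq> insert b (F - {b})" "insert b (F - {b}) \<subseteq> U r" "insert a (F - {b}) \<subseteq> U r" using r(2) by auto
    have "a \<in> snd r F" using F(5) clp[OF F(3,4)] clp[OF r(1), of F] r(2) by simp
    then have 1: "a \<in> snd r (insert b (F - {b}))" using R.cl_mono[OF Fr(2,3)] by blast
    have "F - {b} \<subseteq> A" using F(1) by blast
    then have "a \<notin> snd r (F - {b})" using ab(3) mono[of "F - {b}" A] clp[OF r(1) Fr(1)] by blast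
    then have "b \<in> snd r (insert a (F - {b}))" using R.cl_exch[OF Fr(1) _ 1] r(2) by blast
    then have "b \<in> snd ?u (insert a (F - {b}))" using clp[OF r(1) Fr(4)] by simp
    moreover have "insert a (F - {b}) \<subseteq> insert a A" using F(1) by blast
    ultimately show ?thesis using mono[of "insert a (F - {b})" "insert a A"] by blast
   qed
  next
   fix A B assume "A \<subseteq> B \<and> B \<subseteq> U ?u"
   then show "snd ?u A \<subseteq> snd ?u B" using mono by blast
  qed
 qed
qed

section \<open>Members of the class inherit the axioms and closed substructures\<close>

context qmM begin

lemma fgood_struct: "fgood p ==> is_struct L (fst p)" and fgood_pregeo: "fgood p ==> pregeo (U p) (snd p)"
 by (simp_all add: fgood_def)

lemma fgood_emb:
 assumes "fgood p" "X \<subseteq> U p" "countable X"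
 obtains G where "pel L (fst p) M G" "cpres p (M, cl) G" "closed_set (univ M) cl (Range G)" "Domain G = snd p X"
 using fgood_countable[OF assms] by (auto simp: cemb_def)

text \<open>The axioms concern countable relations, so the closures of domain and range embed in
  \<open>M\<close>, by \<open>G1\<close> and \<open>G2\<close>. Conjugation turns the relation into
  one inside \<open>M\<close>, where the axiom is known. The auxiliary facts \<open>T\<close>,
  \<open>Tp\<close> and \<open>Tb\<close> are the passage to \<open>M\<close> and back.\<close>

lemma fgood_qmc: "qmc L (Collect fgood :: ('f, 'r, 'a) pstruct set)"
proof -
 have pM: "pregeo (U (M, cl)) (snd (M, cl))" by (simp add: PM.pregeo_axioms)
 have T: "Domain (G1\<inverse> O K O G2) = G1 `` Domain K" "Range (G1\<inverse> O K O G2) = G2 `` Range K"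
  "K \<subseteq> G1 O (G1\<inverse> O K O G2) O G2\<inverse>"
  if h1: "Domain K \<subseteq> Domain G1" and h2: "Range K \<subseteq> Domain G2" for G1 G2 :: "('a \<times> 'm) set" and K
 proof -
  show "Domain (G1\<inverse> O K O G2) = G1 `` Domain K" using h2 by blast
  show "Range (G1\<inverse> O K O G2) = G2 `` Range K" using h1 by blast
  show "K \<subseteq> G1 O (G1\<inverse> O K O G2) O G2\<inverse>"
  proof
   fix t assume t: "t \<in> K"
   obtain u v where uv: "t = (u, v)" by force
   obtain m n where "(u, m) \<in> G1" "(v, n) \<in> G2" using t uv h1 h2 by blast
   then show "t \<in> G1 O (G1\<inverse> O K O G2) O G2\<inverse>" using t uv by blast
  qed
 qed
 have Tp: "pel L M M (G1\<inverse> O K O G2)"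
  if "pel L (fst p) M G1" "pel L (fst q) M G2" "pel L (fst p) (fst q) K" for G1 G2 :: "('a \<times> 'm) set" and K and p q :: "('f, 'r, 'a) pstruct"
  by (rule pel_comp[OF _ pel_comp[OF that(3,2)]]) (simp add: that(1))
 have Tb: "pel L (fst p) (fst q) (G1 O K O G2\<inverse>)"
  if "pel L (fst p) M G1" "pel L (fst q) M G2" "pel L M M K" for G1 G2 :: "('a \<times> 'm) set" and K and p q :: "('f, 'r, 'a) pstruct"
  by (rule pel_comp[OF that(1) pel_comp[OF that(3)]]) (simp add: that(2))
 show ?thesis
 proof (unfold_locales, goal_cases)
  case (1 p)
  then show ?case using fgood_pregeo pregeo.pregeometry by blast
 next
  case (2 p q)
  obtain G1 where G1: "pel L (fst p) M G1" by (rule fgood_emb[of p "{}"]) (use 2 in auto)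
  obtain G2 where G2: "pel L (fst q) M G2" by (rule fgood_emb[of q "{}"]) (use 2 in auto)
  have "pel L M M {}" by (rule pel_subset[OF pel_Id_on[of "{}"]]) auto
  from Tb[OF G1 G2 this] show ?case by simp
 next
  case (3 p q G a a' B)
  then have p: "fgood p" "fgood q" by simp_all
  have BU: "insert a (Domain B) \<subseteq> U p" "insert a' (Range B) \<subseteq> U q" using pel_univ[OF 3(3)] 3(4,5) by blast+
  have cB: "countable (insert a (Domain B))" "countable (insert a' (Range B))"
   using 3(6) by (simp_all add: countable_finite finite_Domain finite_Range)
  obtain G1 where G1: "pel L (fst p) M G1" "cpres p (M, cl) G1" "Domain G1 = snd p (insert a (Domain B))"
   by (rule fgood_emb[OF p(1) BU(1) cB(1)])
  obtain G2 where G2: "pel L (fst q) M G2" "cpres q (M, cl) G2" "Domain G2 = snd q (insert a' (Range B))"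
   by (rule fgood_emb[OF p(2) BU(2) cB(2)])
  have D1: "insert a (Domain B) \<subseteq> Domain G1" unfolding G1(3) by (rule pregeo.cl_ext[OF fgood_pregeo[OF p(1)] BU(1)])
  have D2: "insert a' (Range B) \<subseteq> Domain G2" unfolding G2(3) by (rule pregeo.cl_ext[OF fgood_pregeo[OF p(2)] BU(2)])
  obtain m m' where m: "(a, m) \<in> G1" "(a', m') \<in> G2" using D1 D2 by blast
  have B0: "Domain B \<subseteq> Domain G1" "Range B \<subseteq> Domain G2" using D1 D2 by auto
  define TB where "TB = G1\<inverse> O B O G2"
  note TBs = T[OF B0, folded TB_def]
  have elB: "pel L (fst p) (fst q) (insert (a, a') B)" by (rule pel_subset[OF 3(3)]) (use 3 in auto)
  have el: "pel L M M (G1\<inverse> O insert (a, a') B O G2)" by (rule Tp[OF G1(1) G2(1) elB])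
  have sub: "insert (m, m') TB \<subseteq> G1\<inverse> O insert (a, a') B O G2" using m unfolding TB_def by blast
  have elT: "pel L M M (insert (m, m') TB)" by (rule pel_subset[OF el sub])
  have "finite TB"
   by (rule pel_finite_dom[OF pel_subset[OF elT]]) (use TBs(1) pel_finite_Image[OF G1(1)] 3(6) in \<open>auto simp: finite_Domain\<close>)
  have pG1: "pel L (fst p) (fst (M, cl)) G1" "pel L (fst q) (fst (M, cl)) G2" using G1 G2 by simp_all
  have "m \<in> cl (G1 `` Domain B)"
   using cpres_iff[OF fgood_pregeo[OF p(1)] pM pG1(1) G1(2) m(1) B0(1)] 3(7) by simp
  then have "m' \<in> cl (G2 `` Range B)"
   using M.qm1[of "(M, cl)" "(M, cl)" "insert (m, m') TB" m m' TB] elT \<open>finite TB\<close> TBs by auto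
  then show ?case
   using cpres_iff[OF fgood_pregeo[OF p(2)] pM pG1(2) G2(2) m(2) B0(2)] by simp
 next
  case (4 p F)
  then have p: "fgood p" by simp
  obtain G where G: "pel L (fst p) M G" "cpres p (M, cl) G" "Domain G = snd p F"
   by (rule fgood_emb[OF p 4(3) countable_finite[OF 4(2)]])
  have FG: "F \<subseteq> Domain G" unfolding G(3) by (rule pregeo.cl_ext[OF fgood_pregeo[OF p] 4(3)])
  have pG: "pel L (fst p) (fst (M, cl)) G" using G by simp
  have "Range G \<subseteq> cl (G `` F)"
  proof
   fix b assume "b \<in> Range G"
   then obtain a where a: "(a, b) \<in> G" by blast
   then have "a \<in> snd p F" using G(3) by blast
   then show "b \<in> cl (G `` F)" using cpres_iff[OF fgood_pregeo[OF p] pM pG G(2) a FG] by simp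
  qed
  moreover have "countable (cl (G `` F))"
   using M.qm3[of "(M, cl)" "G `` F"] pel_finite_Image[OF G(1) 4(2)] pel_univ[OF G(1)] by auto
  ultimately have "countable (Range G)" using countable_subset by blast
  then have "countable (Range (G\<inverse>))" using pel_countable_Range[of L M "fst p" "G\<inverse>"] G(1) by simp
  then show ?case using G(3) by simp
 next
  case (5 p q G a a')
  then have p: "fgood p" "fgood q" by simp_all
  note DU = pel_univ[OF 5(3)]
  have BU: "insert a (Domain G) \<subseteq> U p" "insert a' (Range G) \<subseteq> U q" using DU 5(7,8) by auto
  have cB: "countable (insert a (Domain G))" "countable (insert a' (Range G))"
   using 5(6) pel_countable_Range[OF 5(3,6)] by simp_all
  obtain G1 where G1: "pel L (fst p) M G1" "cpres p (M, cl) G1" "closed_set (univ M) cl (Range G1)" "Domain G1 = snd p (insert a (Domain G))"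
   by (rule fgood_emb[OF p(1) BU(1) cB(1)])
  obtain G2 where G2: "pel L (fst q) M G2" "cpres q (M, cl) G2" "closed_set (univ M) cl (Range G2)" "Domain G2 = snd q (insert a' (Range G))"
   by (rule fgood_emb[OF p(2) BU(2) cB(2)])
  have D1: "insert a (Domain G) \<subseteq> Domain G1" unfolding G1(4) by (rule pregeo.cl_ext[OF fgood_pregeo[OF p(1)] BU(1)])
  have D2: "insert a' (Range G) \<subseteq> Domain G2" unfolding G2(4) by (rule pregeo.cl_ext[OF fgood_pregeo[OF p(2)] BU(2)])
  obtain m m' where m: "(a, m) \<in> G1" "(a', m') \<in> G2" using D1 D2 by blast
  have B0: "Domain G \<subseteq> Domain G1" "Range G \<subseteq> Domain G2" using D1 D2 by auto
  have ce: "cemb L p (M, cl) G1" "cemb L q (M, cl) G2"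
   unfolding cemb_def G1(4) G2(4) using G1 G2 pregeo.closed_cl[OF fgood_pregeo[OF p(1)] BU(1)]
    pregeo.closed_cl[OF fgood_pregeo[OF p(2)] BU(2)] by simp_all
  define TG where "TG = G1\<inverse> O G O G2"
  note TGs = T[OF B0, folded TG_def]
  have elT: "pel L M M TG" unfolding TG_def by (rule Tp[OF G1(1) G2(1) 5(3)])
  have c1: "closed_set (univ M) cl (Domain TG)"
   using cemb_closed_image[OF fgood_pregeo[OF p(1)] pM ce(1) 5(4) B0(1)] TGs by simp
  have c2: "closed_set (univ M) cl (Range TG)"
   using cemb_closed_image[OF fgood_pregeo[OF p(2)] pM ce(2) 5(5) B0(2)] TGs by simp
  have "pel L (fst p) M (G1 Int Domain G \<times> UNIV)" by (rule pel_subset[OF G1(1)]) auto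
  then have "countable (Range (G1 Int Domain G \<times> UNIV))"
   by (rule pel_countable_Range) (use Domain_restrict[OF B0(1)] 5(6) in simp)
  moreover have "Range (G1 Int Domain G \<times> UNIV) = Domain TG" unfolding TGs(1) by auto
  ultimately have c3: "countable (Domain TG)" by simp
  have mU: "m \<in> univ M" "m' \<in> univ M" using m pel_univ[OF G1(1)] pel_univ[OF G2(1)] by blast+
  have "m \<notin> Domain TG"
  proof
   assume "m \<in> Domain TG"
   then obtain x where x: "x \<in> Domain G" "(x, m) \<in> G1" unfolding TGs(1) by blast
   then show False using pel_inj[OF G1(1) m(1) x(2)] 5(7) by simp
  qed
  moreover have "m' \<notin> Range TG"
  proof
   assume "m' \<in> Range TG"
   then obtain x where x: "x \<in> Range G" "(x, m') \<in> G2" unfolding TGs(2) by blast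
   then show False using pel_inj[OF G2(1) m(2) x(2)] 5(8) by simp
  qed
  ultimately have "pel L M M (insert (m, m') TG)"
   using M.qm4[of "(M, cl)" "(M, cl)" TG m m'] elT c1 c2 c3 mU by simp
  from Tb[OF G1(1) G2(1) this] have b: "pel L (fst p) (fst q) (G1 O insert (m, m') TG O G2\<inverse>)" .
  have "insert (a, a') G \<subseteq> G1 O insert (m, m') TG O G2\<inverse>"
  proof
   fix t assume t: "t \<in> insert (a, a') G"
   show "t \<in> G1 O insert (m, m') TG O G2\<inverse>"
   proof (cases "t \<in> G")
    case True
    then show ?thesis using TGs(3) by blast
   next
    case False
    then show ?thesis using t m by blast
   qed
  qed
  then show ?case by (rule pel_subset[OF b])
 next
  case (6 p q G B a)
  then have p: "fgood p" "fgood q" by simp_all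
  let ?K = "G Un B"
  note DU = pel_univ[OF 6(3)]
  have elG: "pel L (fst p) (fst q) G" by (rule pel_subset[OF 6(3)]) simp
  have "countable (Domain G)" using 6(5) by auto
  then have cB: "countable (Domain ?K)" using 6(4) by (simp add: Domain_Un_eq countable_finite finite_Domain)
  then have cR: "countable (Range ?K)" by (rule pel_countable_Range[OF 6(3)])
  have DU1: "Domain ?K \<subseteq> U p" and DU2: "Range ?K \<subseteq> U q" using DU by simp_all
  obtain G1 where G1: "pel L (fst p) M G1" "cpres p (M, cl) G1" "closed_set (univ M) cl (Range G1)" "Domain G1 = snd p (Domain ?K)"
   by (rule fgood_emb[OF p(1) DU1 cB])
  obtain G2 where G2: "pel L (fst q) M G2" "cpres q (M, cl) G2" "closed_set (univ M) cl (Range G2)" "Domain G2 = snd q (Range ?K)"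
   by (rule fgood_emb[OF p(2) DU2 cR])
  have D1: "Domain ?K \<subseteq> Domain G1" unfolding G1(4) by (rule pregeo.cl_ext[OF fgood_pregeo[OF p(1)] DU1])
  have D2: "Range ?K \<subseteq> Domain G2" unfolding G2(4) by (rule pregeo.cl_ext[OF fgood_pregeo[OF p(2)] DU2])
  have B0: "Domain G \<subseteq> Domain G1" "Range G \<subseteq> Domain G2" "Domain B \<subseteq> Domain G1" "Range B \<subseteq> Domain G2" using D1 D2 by auto
  have ce: "cemb L p (M, cl) G1" "cemb L q (M, cl) G2"
   unfolding cemb_def G1(4) G2(4) using G1 G2 pregeo.closed_cl[OF fgood_pregeo[OF p(1)] DU1]
    pregeo.closed_cl[OF fgood_pregeo[OF p(2)] DU2] by simp_all
  define TG where "TG = G1\<inverse> O G O G2"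
  define TB where "TB = G1\<inverse> O B O G2"
  define TK where "TK = G1\<inverse> O ?K O G2"
  note TGs = T[OF B0(1,2), folded TG_def]
  note TBs = T[OF B0(3,4), folded TB_def]
  note TKs = T[OF D1 D2, folded TK_def]
  have TK: "TK = TG Un TB" unfolding TK_def TG_def TB_def by blast
  have elT: "pel L M M TK" unfolding TK_def by (rule Tp[OF G1(1) G2(1) 6(3)])
  have fB: "finite TB"
   by (rule pel_finite_dom[OF pel_subset[OF elT]]) (use TK TBs(1) pel_finite_Image[OF G1(1)] 6(4) in \<open>auto simp: finite_Domain\<close>)
  have cG: "TG = {} \<or> closed_set (univ M) cl (Domain TG) \<and> closed_set (univ M) cl (Range TG) \<and> countable (Domain TG)"
  proof (cases "G = {}")
   case True
   then show ?thesis by (simp add: TG_def)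
  next
   case False
   then have h: "closed_set (U p) (snd p) (Domain G)" "closed_set (U q) (snd q) (Range G)" "countable (Domain G)" using 6(5) by simp_all
   have "closed_set (univ M) cl (Domain TG)"
    using cemb_closed_image[OF fgood_pregeo[OF p(1)] pM ce(1) h(1) B0(1)] TGs by simp
   moreover have "closed_set (univ M) cl (Range TG)"
    using cemb_closed_image[OF fgood_pregeo[OF p(2)] pM ce(2) h(2) B0(2)] TGs by simp
   moreover have "countable (Domain TG)"
   proof -
    have "pel L (fst p) M (G1 Int Domain G \<times> UNIV)" by (rule pel_subset[OF G1(1)]) auto
    then have "countable (Range (G1 Int Domain G \<times> UNIV))"
     by (rule pel_countable_Range) (use Domain_restrict[OF B0(1)] h(3) in simp)
    moreover have "Range (G1 Int Domain G \<times> UNIV) = Domain TG" unfolding TGs(1) by auto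
    ultimately show ?thesis by simp
   qed
   ultimately show ?thesis by blast
  qed
  obtain m where m: "(a, m) \<in> G1" using 6(6) G1(4) by blast
  have pG1: "pel L (fst p) (fst (M, cl)) G1" using G1 by simp
  have mc: "m \<in> cl (Domain TK)"
   using cpres_iff[OF fgood_pregeo[OF p(1)] pM pG1 G1(2) m D1] 6(6) TKs(1) by simp
  then obtain m' where m': "pel L M M (insert (m, m') TK)"
   using M.qm5[of "(M, cl)" "(M, cl)" TG TB m] elT fB cG by (auto simp: TK)
  \<comment> \<open>The point supplied by QM5 lies in the closure of the range, hence in the closed
    range of \<open>G2\<close>, and can be pulled back to \<open>q\<close>.\<close>
  have "m' \<in> cl (Range TK)" using M.cl_imp[of "(M, cl)" "(M, cl)" "insert (m, m') TK" m m' TK] m' mc by auto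
  moreover have "cl (Range TK) \<subseteq> Range G2"
   by (rule PM.cl_least'[OF G2(3)]) (use TKs(2) in blast)
  ultimately obtain a' where a': "(a', m') \<in> G2" by blast
  have b: "pel L (fst p) (fst q) (G1 O insert (m, m') TK O G2\<inverse>)" by (rule Tb[OF G1(1) G2(1) m'])
  have "insert (a, a') ?K \<subseteq> G1 O insert (m, m') TK O G2\<inverse>"
  proof
   fix t assume t: "t \<in> insert (a, a') ?K"
   show "t \<in> G1 O insert (m, m') TK O G2\<inverse>"
   proof (cases "t \<in> ?K")
    case True
    then show ?thesis using TKs(3) by blast
   next
    case False
    then show ?thesis using t m a' by blast
   qed
  qed
  then have "pel L (fst p) (fst q) (insert (a, a') ?K)" by (rule pel_subset[OF b])
  then show ?case by blast
 qed
qed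

end

lemma substr_cover_eq:
 assumes A: "is_struct L A" and B: "is_struct L B" and u: "univ A = univ B"
  and c: "\<And>F. finite F ==> F \<subseteq> univ A ==> \<exists>D. F \<subseteq> univ D \<and> substr L D A \<and> substr L D B"
 shows "A = B"
proof (rule struct_eqI[OF u])
 show "fn A f xs = fn B f xs" for f xs
 proof (cases "set xs \<subseteq> univ A")
  case True
  obtain D where D: "set xs \<subseteq> univ D" "substr L D A" "substr L D B" using c[OF finite_set True] by blast
  show ?thesis using substr_fn[OF D(2,1), of f] substr_fn[OF D(3,1), of f] by simp
 next
  case False
  then show ?thesis using is_struct_undefined[OF A] is_struct_undefined[OF B] u by metis
 qed
 show "rel A r xs = rel B r xs" for r xs
 proof (cases "set xs \<subseteq> univ A")
  case True
  obtain D where D: "set xs \<subseteq> univ D" "substr L D A" "substr L D B" using c[OF finite_set True] by blast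
  show ?thesis using substr_rel[OF D(2), of r xs] substr_rel[OF D(3), of r xs] D(1) by simp
 next
  case False
  then show ?thesis using is_struct_rel[OF A, of r xs] is_struct_rel[OF B, of r xs] u by auto
 qed
qed

lemma pchain_union_sub_ball:
 assumes C: "C \<noteq> {}" and st: "\<forall>p\<in>C. is_struct L (fst p)" and pg: "\<forall>p\<in>C. pregeo (U p) (snd p)"
  and ch: "\<forall>p\<in>C. \<forall>q\<in>C. closed_sub L p q \<or> closed_sub L q p"
 shows "is_struct L (fst (pchain_union C))" "pregeo (U (pchain_union C)) (snd (pchain_union C))"
  "p \<in> C ==> closed_sub L p (pchain_union C)"
  "finite F ==> F \<subseteq> U (pchain_union C) ==> \<exists>p\<in>C. F \<subseteq> U p"
proof -
 show "is_struct L (fst (pchain_union C))" by (rule pchain_union_sub(1)) (use assms in blast)+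
 show "pregeo (U (pchain_union C)) (snd (pchain_union C))" by (rule pchain_union_sub(2)[where L = L]) (use assms in blast)+
 show "closed_sub L p (pchain_union C)" if "p \<in> C" by (rule pchain_union_sub(3)) (use assms that in blast)+
 show "\<exists>p\<in>C. F \<subseteq> U p" if "finite F" "F \<subseteq> U (pchain_union C)"
  by (rule pchain_union_sub(4)[where L = L]) (use assms that in blast)+
qed

lemma cpres_subset: "cpres p q G ==> K \<subseteq> G ==> cpres p q K"
 unfolding cpres_def by (meson subset_iff)

lemma closed_sub_trans:
 assumes "closed_sub L p q" "closed_sub L q r"
 shows "closed_sub L p r"
proof -
 have 1: "substr L (fst p) (fst q)" "closed_set (U q) (snd q) (U p)" "\<And>X. X \<subseteq> U p ==> snd p X = snd q X"
  using assms(1) by (simp_all add: closed_sub_def)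
 have 2: "substr L (fst q) (fst r)" "closed_set (U r) (snd r) (U q)" "\<And>X. X \<subseteq> U q ==> snd q X = snd r X"
  using assms(2) by (simp_all add: closed_sub_def)
 have s: "U p \<subseteq> U q" "U q \<subseteq> U r" using 1(2) 2(2) by (simp_all add: closed_set_def)
 have "closed_set (U r) (snd r) (U p)" using 1(2) 2(3)[OF s(1)] s by (auto simp: closed_set_def)
 moreover have "snd p X = snd r X" if "X \<subseteq> U p" for X using 1(3)[OF that] 2(3)[of X] that s(1) by auto
 ultimately show ?thesis using substr_trans[OF 1(1) 2(1)] by (simp add: closed_sub_def)
qed

lemma cemb_closed_sub:
 assumes pu: "closed_sub L p u" and K: "cemb L p q K"
 shows "cemb L u q K"
proof -
 have k: "pel L (fst p) (fst q) K" "closed_set (U p) (snd p) (Domain K)" "closed_set (U q) (snd q) (Range K)" "cpres p q K"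
  using K by (simp_all add: cemb_def)
 have c: "\<And>X. X \<subseteq> U p ==> snd p X = snd u X" and U: "U p \<subseteq> U u" using pu by (simp_all add: closed_sub_def substr_def)
 have D: "Domain K \<subseteq> U p" using k(2) by (simp add: closed_set_def)
 have "pel L (fst u) (fst p) (Id_on (U p))" using closed_sub_Id(1)[OF pu] pel_converse[of L "fst u" "fst p" "Id_on (U p)"] by simp
 from pel_comp[OF this k(1)] have "pel L (fst u) (fst q) (Id_on (U p) O K)" .
 moreover have "Id_on (U p) O K = K" using D by auto
 moreover have "closed_set (U u) (snd u) (Domain K)" using k(2) c[OF D] U D by (auto simp: closed_set_def)
 moreover have "cpres u q K"
  unfolding cpres_def
 proof (intro allI impI)
  fix a b B assume h: "(a, b) \<in> K" "B \<subseteq> K" "finite B"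
  then have "Domain B \<subseteq> U p" using D by blast
  then show "a \<in> snd u (Domain B) \<longleftrightarrow> b \<in> snd q (Range B)" using k(4) h c unfolding cpres_def by metis
 qed
 ultimately show ?thesis using k(3) by (simp add: cemb_def)
qed

lemma cemb_converse: "cemb L p q G ==> cemb L q p (G\<inverse>)"
 using cpres_converse[of p q G] by (simp add: cemb_def)

lemma cemb_comp:
 assumes "cemb L p q G" "cemb L q r K" "Range G = Domain K"
 shows "cemb L p r (G O K)" "Domain (G O K) = Domain G"
proof -
 have D: "Domain (G O K) = Domain G" "Range (G O K) = Range K" using assms(3) by blast+
 have g: "pel L (fst p) (fst q) G" "cpres p q G" and k: "pel L (fst q) (fst r) K" "cpres q r K"
  using assms(1,2) by (simp_all add: cemb_def)
 show "cemb L p r (G O K)" unfolding cemb_def D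
  using assms(1,2) pel_comp[OF g(1) k(1)] cpres_comp[OF g k] by (simp add: cemb_def)
 show "Domain (G O K) = Domain G" by (rule D)
qed

lemma piso_restrict:
 assumes pr: "piso L p r g" and p: "pregeo (U p) (snd p)" and q: "closed_sub L q r"
  and st: "\<And>H. closed_set (U p) (snd p) H ==> is_struct L (restr (fst p) H)"
 shows "\<exists>q0. closed_sub L q0 p \<and> piso L q0 q g"
proof -
 interpret P: pregeo "U p" "snd p" by (rule p)
 have i: "is_struct L (fst p)" "is_struct L (fst r)" "inj_on g (U p)" "g ` U p = U r"
  and fi: "\<And>f xs. f \<in> funs L ==> length xs = far L f ==> set xs \<subseteq> U p ==> g (fn (fst p) f xs) = fn (fst r) f (map g xs)"
  and ri: "\<And>R xs. R \<in> rels L ==> length xs = rar L R ==> set xs \<subseteq> U p ==> rel (fst p) R xs \<longleftrightarrow> rel (fst r) R (map g xs)"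
  using pr by (simp_all add: piso_def iso_def bij_betw_def)
 have cg: "\<And>X. X \<subseteq> U p ==> snd r (g ` X) = g ` snd p X" using pr by (simp add: piso_def)
 have sq: "substr L (fst q) (fst r)" "closed_set (U r) (snd r) (U q)" and cq: "\<And>X. X \<subseteq> U q ==> snd q X = snd r X"
  using q by (simp_all add: closed_sub_def)
 have qr: "U q \<subseteq> g ` U p" using sq(2) i(4) by (simp add: closed_set_def)
 define H where "H = U p Int g -` U q"
 have H: "H \<subseteq> U p" "g ` H = U q" using qr by (auto simp: H_def)
 have "g ` snd p H = g ` H" using cg[OF H(1)] H(2) sq(2) by (simp add: closed_set_def)
 then have cH: "snd p H = H" using inj_on_image_eq_iff[OF i(3) P.cl_in[OF H(1)] H(1)] by simp
 have clH: "closed_set (U p) (snd p) H" using cH H by (simp add: closed_set_def)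
 have sH: "is_struct L (restr (fst p) H)" by (rule st[OF clH])
 have 1: "closed_sub L (restr (fst p) H, snd p) p"
  using substr_restr[OF i(1) sH H(1)] clH by (simp add: closed_sub_def)
 have "iso L (restr (fst p) H) (fst q) g"
  unfolding iso_def
 proof (intro conjI ballI allI impI)
  show "is_struct L (restr (fst p) H)" by (rule sH)
  show "is_struct L (fst q)" using sq(1) by (simp add: substr_def)
  show "bij_betw g (univ (restr (fst p) H)) (U q)"
   using H inj_on_subset[OF i(3) H(1)] by (simp add: bij_betw_def)
  fix xs
  { fix f assume f: "f \<in> funs L" "length xs = far L f \<and> set xs \<subseteq> univ (restr (fst p) H)"
   then have s: "set xs \<subseteq> H" "set xs \<subseteq> U p" "set (map g xs) \<subseteq> U q" using H by auto
   show "g (fn (restr (fst p) H) f xs) = fn (fst q) f (map g xs)"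
    using fi[OF f(1) _ s(2)] f(2) s(1) substr_fn[OF sq(1) s(3), of f] by (simp add: restr_fn) }
  { fix R assume f: "R \<in> rels L" "length xs = rar L R \<and> set xs \<subseteq> univ (restr (fst p) H)"
   then have s: "set xs \<subseteq> H" "set xs \<subseteq> U p" "set (map g xs) \<subseteq> U q" using H by auto
   show "rel (restr (fst p) H) R xs = rel (fst q) R (map g xs)"
    using ri[OF f(1) _ s(2)] f(2) s(1,3) substr_rel[OF sq(1), of R "map g xs"] by (simp add: restr_rel) }
 qed
 moreover have "snd q (g ` X) = g ` snd p X" if X: "X \<subseteq> H" for X
  using cq[OF image_mono[OF X, of g, unfolded H(2)]] cg[OF subset_trans[OF X H(1)]] by simp
 ultimately have "piso L (restr (fst p) H, snd p) q g" by (simp add: piso_def)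
 then show ?thesis using 1 by blast
qed

lemma piso_id:
 assumes "is_struct L N" "\<And>X. X \<subseteq> univ N ==> d X = c X"
 shows "piso L (N, c) (N, d) id"
 using assms by (simp add: piso_def iso_def)

context qmM begin

lemma closed_sub_fgood:
 assumes "closed_sub L p (M, cl)"
 shows "fgood p"
proof -
 have s: "substr L (fst p) M" "closed_set (univ M) cl (U p)" and c: "\<And>X. X \<subseteq> U p ==> snd p X = cl X"
  using assms by (simp_all add: closed_sub_def)
 have pg: "pregeo (U p) (snd p)" by (rule pregeo_sub[OF PM.pregeo_axioms s(2) c])
 interpret P: pregeo "U p" "snd p" by (rule pg)
 have "\<exists>G. cemb L p (M, cl) G \<and> Domain G = snd p X" if X: "X \<subseteq> U p" for X
 proof -
  have cX: "closed_set (U p) (snd p) (snd p X)" by (rule P.closed_cl[OF X])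
  have sX: "snd p X \<subseteq> U p" by (rule P.cl_in[OF X])
  have UM: "U p \<subseteq> univ M" using s(2) by (simp add: closed_set_def)
  have "closed_set (univ M) cl (snd p X)" using cX c[OF sX] sX UM by (auto simp: closed_set_def)
  moreover have "pel L (fst p) M (Id_on (snd p X))" using pel_subset[OF closed_sub_Id(1)[OF assms], of "Id_on (snd p X)"] sX by auto
  moreover have "cpres p (M, cl) (Id_on (snd p X))"
   by (rule cpres_subset[OF closed_sub_Id(2)[OF assms]]) (use sX in auto)
  ultimately have "cemb L p (M, cl) (Id_on (snd p X))" using cX by (simp add: cemb_def)
  then show ?thesis by (intro exI[of _ "Id_on (snd p X)"]) simp
 qed
 then show ?thesis using s(1) pg by (simp add: fgood_def substr_def)
qed

lemma piso_fgood:
 assumes p: "fgood p" and pq: "piso L p q g"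
 shows "fgood q"
proof -
 have i: "iso L (fst p) (fst q) g" and cg: "\<And>X. X \<subseteq> U p ==> snd q (g ` X) = g ` snd p X" using pq by (simp_all add: piso_def)
 have b: "bij_betw g (U p) (U q)" "inj_on g (U p)" "g ` U p = U q" using i by (simp_all add: iso_def bij_betw_def)
 interpret P: pregeo "U p" "snd p" using p by (simp add: fgood_def)
 have pg: "pregeo (U q) (snd q)" by (rule pregeo_bij[OF P.pregeo_axioms b(1) cg])
 interpret Q: pregeo "U q" "snd q" by (rule pg)
 have "\<exists>G. cemb L q (M, cl) G \<and> Domain G = snd q Y" if Y: "Y \<subseteq> U q" "finite Y" for Y
 proof -
  have "Y \<subseteq> g ` U p" using Y b by simp
  then obtain X where X: "X \<subseteq> U p" "finite X" "Y = g ` X" using finite_subset_image[OF Y(2)] by metis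
  have "\<exists>K. cemb L p (M, cl) K \<and> Domain K = snd p X" using p X(1,2) by (simp add: fgood_def)
  then obtain K where K: "cemb L p (M, cl) K" "Domain K = snd p X" by blast
  define J where "J = gr g (snd p X)"
  have sX: "snd p X \<subseteq> U p" by (rule P.cl_in[OF X(1)])
  have RJ: "Range J = snd q Y" and DJ: "Domain J = snd p X" using cg[OF X(1)] X(3) by (simp_all add: J_def)
  have "J \<subseteq> gr g (U p)" unfolding J_def gr_def by (rule image_mono[OF sX])
  then have el: "pel L (fst p) (fst q) J" by (rule pel_subset[OF iso_pel[OF i]])
  have "cpres p q J"
   unfolding cpres_def
  proof (intro allI impI)
   fix a b' B assume h: "(a, b') \<in> J" "B \<subseteq> J" "finite B"
   have a: "b' = g a" "a \<in> U p" using h(1) sX by (auto simp: J_def)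
   have D: "Domain B \<subseteq> U p" using h(2) DJ sX by blast
   have "Range B = g ` Domain B" using h(2) by (force simp: J_def)
   then have "snd q (Range B) = g ` snd p (Domain B)" using cg[OF D] by simp
   then show "a \<in> snd p (Domain B) \<longleftrightarrow> b' \<in> snd q (Range B)"
    using inj_on_image_mem_iff[OF b(2) a(2) P.cl_in[OF D]] a(1) by simp
  qed
  then have J: "cemb L p q J" unfolding cemb_def RJ DJ using el P.closed_cl[OF X(1)] Q.closed_cl[OF Y(1)] by simp
  have "Range (J\<inverse>) = Domain K" using DJ K(2) by simp
  from cemb_comp[OF cemb_converse[OF J] K(1) this] show ?thesis using RJ by (metis Domain_converse)
 qed
 then show ?thesis using i pg by (simp add: fgood_def iso_def)
qed

lemma chain_fgood:
 assumes C: "C \<noteq> {}" and g: "\<And>p. p \<in> C ==> fgood p"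
  and ch: "\<And>p q. p \<in> C ==> q \<in> C ==> closed_sub L p q \<or> closed_sub L q p"
 shows "fgood (pchain_union C)"
proof -
 have g1: "\<And>p. p \<in> C ==> is_struct L (fst p)" and g2: "\<And>p. p \<in> C ==> pregeo (U p) (snd p)"
  using g fgood_struct fgood_pregeo by blast+
 have b: "\<forall>p\<in>C. is_struct L (fst p)" "\<forall>p\<in>C. pregeo (U p) (snd p)" "\<forall>p\<in>C. \<forall>q\<in>C. closed_sub L p q \<or> closed_sub L q p"
  using g1 g2 ch by blast+
 note u = pchain_union_sub_ball[OF C b]
 have "\<exists>G. cemb L (pchain_union C) (M, cl) G \<and> Domain G = snd (pchain_union C) X"
  if X: "X \<subseteq> U (pchain_union C)" "finite X" for X
 proof -
  obtain p where p: "p \<in> C" "X \<subseteq> U p" using u(4)[OF X(2,1)] by blast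
  have "\<exists>K. cemb L p (M, cl) K \<and> Domain K = snd p X" using g[OF p(1)] p(2) X(2) by (simp add: fgood_def)
  then obtain K where K: "cemb L p (M, cl) K" "Domain K = snd p X" by blast
  have "snd p X = snd (pchain_union C) X" using u(3)[OF p(1)] p(2) by (simp add: closed_sub_def)
  then show ?thesis using cemb_closed_sub[OF u(3)[OF p(1)] K(1)] K(2) by metis
 qed
 then show ?thesis using u(1,2) by (simp add: fgood_def)
qed

lemma K_gen_fgood: "p \<in> K_gen L M cl ==> fgood p"
proof (induction rule: K_gen.induct)
 case (base p)
 then obtain p0 g where "closed_sub L p0 (M, cl)" "piso L p0 p g" by (auto simp: K_minus_def)
 then show ?case using closed_sub_fgood piso_fgood by blast
next
 case (iso p q g)
 then show ?case using piso_fgood by blast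
next
 case (union C)
 have "\<forall>p\<in>C. fgood p" "C \<noteq> {}" "\<forall>p\<in>C. \<forall>q\<in>C. closed_sub L p q \<or> closed_sub L q p"
  using union.IH union.hyps by simp_all
 then show ?case using chain_fgood[of C] by simp
qed

text \<open>The structure may have finite dimension, so the argument for \<open>M\<close> does not
  carry over. Instead the closure of the arguments and the value is embedded in \<open>M\<close>,
  where closed sets are closed under the functions.\<close>

lemma fgood_closed_struct:
 assumes p: "fgood p" and H: "closed_set (U p) (snd p) H"
 shows "is_struct L (restr (fst p) H)"
proof (rule is_struct_restr[OF fgood_struct[OF p]])
 interpret P: pregeo "U p" "snd p" by (rule fgood_pregeo[OF p])
 show HU: "H \<subseteq> U p" using H by (simp add: closed_set_def)
 fix f xs assume f: "f \<in> funs L" "length xs = far L f" "set xs \<subseteq> H"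
 define t where "t = fn (fst p) f xs"
 have xU: "set xs \<subseteq> U p" using f(3) HU by blast
 have tU: "t \<in> U p" unfolding t_def by (rule is_struct_fn[OF fgood_struct[OF p] f(1,2) xU])
 have XU: "insert t (set xs) \<subseteq> U p" using tU xU by blast
 have "\<exists>K. cemb L p (M, cl) K \<and> Domain K = snd p (insert t (set xs))" using p XU unfolding fgood_def by blast
 then obtain K where K: "cemb L p (M, cl) K" "Domain K = snd p (insert t (set xs))" by blast
 have elK: "pel L (fst p) M K" using K(1) by (simp add: cemb_def)
 obtain g where g: "K = gr g (Domain K)" "inj_on g (Domain K)" by (rule pel_gr[OF elK])
 have XD: "insert t (set xs) \<subseteq> Domain K" unfolding K(2) by (rule P.cl_ext[OF XU])
 have c0: "closed_set (U p) (snd p) (snd p (set xs))" by (rule P.closed_cl[OF xU])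
 have sD: "snd p (set xs) \<subseteq> Domain K" unfolding K(2) by (rule P.cl_mono) (use XU in auto)
 have pM: "pregeo (U (M, cl)) (snd (M, cl))" by (simp add: PM.pregeo_axioms)
 have "closed_set (univ M) cl (K `` snd p (set xs))"
  using cemb_closed_image[OF P.pregeo_axioms pM K(1) c0 sD] by simp
 moreover have KI: "K `` snd p (set xs) = g ` snd p (set xs)" using gr_Image[OF sD, of g] g(1) by simp
 ultimately have cR: "closed_set (univ M) cl (g ` snd p (set xs))" by simp
 have elg: "pel L (fst p) M (gr g (Domain K))" using elK g(1) by simp
 have gt: "g t = fn M f (map g xs)" unfolding t_def
  by (rule pel_fn[OF elg f(1,2)]) (use XD in \<open>auto simp: t_def\<close>)
 have xs': "set (map g xs) \<subseteq> g ` snd p (set xs)" using P.cl_ext[OF xU] by auto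
 have "fn (restr M (g ` snd p (set xs))) f (map g xs) \<in> univ (restr M (g ` snd p (set xs)))"
  by (rule is_struct_fn[OF M_closed_struct[OF cR] f(1)]) (use f(2) xs' in simp_all)
 then have "g t \<in> g ` snd p (set xs)" using xs' gt by (simp add: restr_fn)
 then have "t \<in> snd p (set xs)" using inj_on_image_mem_iff[OF g(2) _ sD] XD by blast
 then show "fn (fst p) f xs \<in> H" using P.cl_least'[OF H f(3)] t_def by blast
qed

lemma fgood_closed_sub:
 assumes p: "fgood p" and H: "closed_set (U p) (snd p) H"
 shows "closed_sub L (restr (fst p) H, snd p) p"
 using substr_restr[OF fgood_struct[OF p] fgood_closed_struct[OF p H]] H by (simp add: closed_sub_def closed_set_def)

text \<open>The generation of the class provides closed substructures at the level of
  \<open>M\<close> only. They are pulled back along isomorphisms; for the union of a chain, the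
  traces \<open>t p\<close> of the substructure on the members form a chain of closed substructures
  with the required union.\<close>

lemma K_gen_closed_sub: "(p :: ('f, 'r, 'a) pstruct) \<in> K_gen L M cl ==> closed_sub L q p ==> q \<in> K_gen L M cl"
proof (induction arbitrary: q rule: K_gen.induct)
 case (base p)
 then obtain p0 g where p0: "closed_sub L p0 (M, cl)" "piso L p0 p g" by (auto simp: K_minus_def)
 have f: "fgood p0" by (rule closed_sub_fgood[OF p0(1)])
 obtain q0 where q0: "closed_sub L q0 p0" "piso L q0 q g"
  using piso_restrict[OF p0(2) fgood_pregeo[OF f] base(2) fgood_closed_struct[OF f]] by blast
 have "q \<in> K_minus L M cl" using closed_sub_trans[OF q0(1) p0(1)] q0(2) unfolding K_minus_def by blast
 then show ?case by (rule K_gen.base)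
next
 case (iso p r g)
 have f: "fgood p" by (rule K_gen_fgood[OF iso(1)])
 obtain q0 where q0: "closed_sub L q0 p" "piso L q0 q g"
  using piso_restrict[OF iso(2) fgood_pregeo[OF f] iso(4) fgood_closed_struct[OF f]] by blast
 show ?case by (rule K_gen.iso[OF iso(3)[OF q0(1)] q0(2)])
next
 case (union C)
 have IH2: "q \<in> K_gen L M cl" if "p \<in> C" "closed_sub L q p" for p q
  using bspec[OF union.IH that(1)] that(2) by blast
 have IH: "\<forall>p\<in>C. p \<in> K_gen L M cl" and Cne: "C \<noteq> {}" and Cch: "\<forall>p\<in>C. \<forall>q\<in>C. closed_sub L p q \<or> closed_sub L q p"
  using union.IH union.hyps by simp_all
 have g: "\<And>p. p \<in> C ==> fgood p" using IH K_gen_fgood by blast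
 have g1: "\<And>p. p \<in> C ==> is_struct L (fst p)" and g2: "\<And>p. p \<in> C ==> pregeo (U p) (snd p)"
  using g fgood_struct fgood_pregeo by blast+
 have ch: "\<And>p q. p \<in> C ==> q \<in> C ==> closed_sub L p q \<or> closed_sub L q p" using Cch by blast
 define u where "u = pchain_union C"
 have b: "\<forall>p\<in>C. is_struct L (fst p)" "\<forall>p\<in>C. pregeo (U p) (snd p)" using g1 g2 by blast+
 note u = pchain_union_sub_ball[OF Cne b Cch, folded u_def]
 have qu: "closed_sub L q u" using union.prems by (simp add: u_def)
 define H where "H p = U p Int U q" for p :: "('f, 'r, 'a) pstruct"
 define t where "t p = (restr (fst p) (H p), snd p)" for p :: "('f, 'r, 'a) pstruct"
 have cq: "closed_set (U u) (snd u) (U q)" and cqs: "\<And>X. X \<subseteq> U q ==> snd q X = snd u X" and qs: "substr L (fst q) (fst u)"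
  using qu by (simp_all add: closed_sub_def)
 interpret PU: pregeo "U u" "snd u" by (rule u(2))
 have Hc: "closed_set (U p) (snd p) (H p)" if p: "p \<in> C" for p
 proof -
  have c: "snd p (H p) = snd u (H p)" and cp: "closed_set (U u) (snd u) (U p)"
   using u(3)[OF p] by (simp_all add: closed_sub_def H_def)
  have "snd u (H p) \<subseteq> U p" "snd u (H p) \<subseteq> U q"
   by (rule PU.cl_least'[OF cp], simp add: H_def, rule PU.cl_least'[OF cq], simp add: H_def)
  moreover have "H p \<subseteq> snd p (H p)" by (rule pregeo.cl_ext[OF g2[OF p]]) (simp add: H_def)
  ultimately show ?thesis using c by (auto simp: closed_set_def H_def)
 qed
 have ts: "closed_sub L (t p) p" if p: "p \<in> C" for p
  unfolding t_def by (rule fgood_closed_sub[OF g[OF p] Hc[OF p]])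
 have Ut: "U (t p) = H p" "snd (t p) = snd p" for p by (simp_all add: t_def)
 have tK: "t p \<in> K_gen L M cl" if p: "p \<in> C" for p by (rule IH2[OF p ts[OF p]])
 have tc1: "closed_sub L (t p) (t r)" if pr: "closed_sub L p r" "p \<in> C" "r \<in> C" for p r
 proof -
  have s: "fst p = restr (fst r) (U p)" "U p \<subseteq> U r" "\<And>X. X \<subseteq> U p ==> snd p X = snd r X"
   using pr(1) substr_eq by (auto simp: closed_sub_def substr_def)
  have HH: "H p \<subseteq> H r" "H p \<subseteq> U p" using s(2) by (auto simp: H_def)
  have "fst (t p) = restr (restr (fst r) (U p)) (H p)" using s(1) by (simp add: t_def)
  also have "\<dots> = restr (fst r) (H p)" by (rule restr_restr[OF HH(2)])
  also have "\<dots> = restr (fst (t r)) (H p)" by (simp add: t_def restr_restr[OF HH(1)])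
  finally have 1: "fst (t p) = restr (fst (t r)) (U (t p))" by (simp add: Ut)
  have st: "is_struct L (fst (t p))" "is_struct L (fst (t r))"
   unfolding t_def using fgood_closed_struct[OF g[OF pr(2)] Hc[OF pr(2)]] fgood_closed_struct[OF g[OF pr(3)] Hc[OF pr(3)]] by simp_all
  have "substr L (fst (t p)) (fst (t r))" unfolding substr_def using 1 st HH(1) by (simp add: Ut)
  moreover have "closed_set (U (t r)) (snd (t r)) (U (t p))"
   using Hc[OF pr(2)] s(3)[OF HH(2)] HH(1) by (simp add: Ut closed_set_def)
  moreover have "snd (t p) X = snd (t r) X" if "X \<subseteq> U (t p)" for X
   using s(3)[of X] that HH(2) by (simp add: Ut)
  ultimately show ?thesis by (simp add: closed_sub_def)
 qed
 have tch: "\<forall>p\<in>t ` C. \<forall>r\<in>t ` C. closed_sub L p r \<or> closed_sub L r p"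
 proof (intro ballI)
  fix p' r' assume "p' \<in> t ` C" "r' \<in> t ` C"
  then obtain p r where pr: "p \<in> C" "r \<in> C" "p' = t p" "r' = t r" by blast
  show "closed_sub L p' r' \<or> closed_sub L r' p'" using ch[OF pr(1,2)] tc1[of p r] tc1[of r p] pr by blast
 qed
 define v where "v = pchain_union (t ` C)"
 have tK': "\<forall>p\<in>t ` C. p \<in> K_gen L M cl" using tK by blast
 have vK: "v \<in> K_gen L M cl" unfolding v_def by (rule K_gen.union[OF _ tK' tch]) (use Cne in simp)
 have ne: "t ` C \<noteq> {}" using Cne by simp
 have tg: "\<And>p. p \<in> t ` C ==> fgood p" using tK' K_gen_fgood by blast
 have tg1: "\<And>p. p \<in> t ` C ==> is_struct L (fst p)" and tg2: "\<And>p. p \<in> t ` C ==> pregeo (U p) (snd p)"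
  using tg fgood_struct fgood_pregeo by blast+
 have tb: "\<forall>p\<in>t ` C. is_struct L (fst p)" "\<forall>p\<in>t ` C. pregeo (U p) (snd p)" using tg1 tg2 by blast+
 note v = pchain_union_sub_ball[OF ne tb tch, folded v_def]
 have Uu: "U u = (\<Union>p\<in>C. U p)" by (simp add: u_def pchain_union_def chain_union_def)
 have "U v = (\<Union>p\<in>C. H p)" by (simp add: v_def pchain_union_def chain_union_def Ut)
 also have "\<dots> = U q" using cq Uu by (auto simp: H_def closed_set_def)
 finally have Uv: "U v = U q" .
 have sq: "is_struct L (fst q)" using qs by (simp add: substr_def)
 have e1: "fst v = fst q"
 proof (rule substr_cover_eq[OF v(1) sq Uv])
  fix F assume F: "finite F" "F \<subseteq> U v"
  have "F \<subseteq> U u" using F(2) Uv cq by (auto simp: closed_set_def)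
  then obtain p where p: "p \<in> C" "F \<subseteq> U p" using u(4)[OF F(1)] by blast
  have FH: "F \<subseteq> U (t p)" using p(2) F(2) Uv by (simp add: Ut H_def)
  have 1: "substr L (fst (t p)) (fst v)" using v(3)[of "t p"] p(1) by (simp add: closed_sub_def)
  have 2: "substr L (fst (t p)) (fst u)" using closed_sub_trans[OF ts[OF p(1)] u(3)[OF p(1)]] by (simp add: closed_sub_def)
  have Hq: "U (t p) \<subseteq> U q" by (simp add: Ut H_def)
  have "fst (t p) = restr (fst u) (U (t p))" by (rule substr_eq[OF 2])
  also have "\<dots> = restr (restr (fst u) (U q)) (U (t p))" by (simp add: restr_restr[OF Hq])
  also have "restr (fst u) (U q) = fst q" using substr_eq[OF qs] by simp
  finally have "substr L (fst (t p)) (fst q)" using sq 2 Hq by (simp add: substr_def)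
  then show "\<exists>D. F \<subseteq> univ D \<and> substr L D (fst v) \<and> substr L D (fst q)" using 1 FH by blast
 qed
 have e2: "snd q X = snd v X" if X: "X \<subseteq> U q" for X
 proof -
  have "X Int H p = X Int U p" for p :: "('f, 'r, 'a) pstruct" using X by (auto simp: H_def)
  then have "snd v X = (\<Union>p\<in>C. snd p (X Int U p))" by (simp add: v_def pchain_union_def Ut)
  also have "\<dots> = snd u X" by (simp add: u_def pchain_union_def)
  finally show ?thesis using cqs[OF X] by simp
 qed
 \<comment> \<open>The operators of \<open>v\<close> and \<open>q\<close> agree on subsets of the
   carrier but may differ elsewhere, so \<open>q\<close> is reached as an isomorphic copy of
   \<open>v\<close>.\<close>
 have "piso L (fst v, snd v) (fst v, snd q) id" by (rule piso_id[OF v(1)]) (use e2 Uv in simp)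
 then have "piso L v q id" using e1 by (metis prod.collapse)
 then show ?case by (rule K_gen.iso[OF vK])
qed

end

section \<open>The abstract elementary class and its Loewenheim-Skolem property\<close>

lemma infd_cong: "(\<And>X. X \<subseteq> H ==> c X = d X) ==> infd c H = infd d H"
 unfolding infd_def by metis

locale qmK = qmM L M cl
 for L :: "('f, 'r) lang" and M :: "('f, 'r, 'm) struct" and cl :: "'m set \<Rightarrow> 'm set" +
 fixes ty :: "'a itself"
 assumes cL: "countable_lang L" and unc: "uncountable (UNIV :: 'a set)"
begin

abbreviation KK :: "('f, 'r, 'a) struct set" where "KK \<equiv> qm_class L M cl"
abbreviation le :: "('f, 'r, 'a) struct \<Rightarrow> ('f, 'r, 'a) struct \<Rightarrow> bool" where "le \<equiv> qm_le L M cl"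

text \<open>In \<open>qm_class\<close> the closure operator is hidden by an existential quantifier;
  here it stays visible, and infinite dimension takes the form \<open>infd\<close>.\<close>

definition KI :: "('f, 'r, 'a) pstruct \<Rightarrow> bool" where
 "KI p \<longleftrightarrow> p \<in> K_gen L M cl \<and> infd (snd p) (U p)"

sublocale F: qmc L "Collect fgood :: ('f, 'r, 'a) pstruct set"
 by (rule fgood_qmc)

lemma KI_F: "KI p ==> p \<in> Collect fgood" and KI_fgood: "KI p ==> fgood p"
proof -
 show "fgood p" if "KI p" using K_gen_fgood[of p] that by (simp add: KI_def)
 then show "p \<in> Collect fgood" if "KI p" using that by simp
qed

lemma KI_struct: "KI p ==> is_struct L (fst p)" and KI_pregeo: "KI p ==> pregeo (U p) (snd p)"
 and KI_infd: "KI p ==> infd (snd p) (U p)" and KI_gen: "KI p ==> p \<in> K_gen L M cl"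
 using fgood_struct[OF KI_fgood] fgood_pregeo[OF KI_fgood] by (simp_all add: KI_def)

lemma clo_univ: "pregeo (U p) (snd p) ==> closed_set (U p) (snd p) (U p)"
 using pregeo.cl_ext[of "U p" "snd p" "U p"] pregeo.cl_in[of "U p" "snd p" "U p"] by (auto simp: closed_set_def)

lemma KI_clo: "KI p ==> closed_set (U p) (snd p) (U p)"
 by (rule clo_univ[OF KI_pregeo])

lemma K_gen_finite_dim: "(p :: ('f, 'r, 'a) pstruct) \<in> K_gen L M cl ==> finite_dim (U p) (snd p) \<longleftrightarrow> \<not> infd (snd p) (U p)"
 using pregeo.finite_dim_iff[OF fgood_pregeo[OF K_gen_fgood] clo_univ[OF fgood_pregeo[OF K_gen_fgood]]] by blast

lemma KI_iff: "KI (N, c) \<longleftrightarrow> (N, c) \<in> K_gen L M cl \<and> \<not> finite_dim (univ N) c"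
 using K_gen_finite_dim[of "(N, c)"] by (auto simp: KI_def)

lemma KK_iff: "N \<in> KK \<longleftrightarrow> (\<exists>c. KI (N, c))"
 unfolding qm_class_def KI_iff by simp

text \<open>The identity of \<open>N\<close> is elementary between the two expansions by
  \<open>c\<close> and \<open>d\<close>, which belong to the same family; \<open>qm1\<close>
  therefore compares the two closures.\<close>

lemma cl_unique:
 assumes "fgood (N, c)" "fgood (N, d)" "X \<subseteq> univ (N :: ('f, 'r, 'a) struct)"
 shows "c X = d X"
proof -
 have el: "pel L N N (Id_on (univ N))" by (rule pel_Id_on) auto
 have "a \<in> c X \<longleftrightarrow> a \<in> d X" if a: "a \<in> univ N" for a
 proof -
  have "Id_on (univ N) `` X = X" using assms(3) by auto
  then show ?thesis using F.cl_iff_Image[of "(N, c)" "(N, d)" "Id_on (univ N)" a a X] el assms a by auto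
 qed
 moreover have "c X \<subseteq> univ N" "d X \<subseteq> univ N"
  using pregeo.cl_in[OF fgood_pregeo[OF assms(1)]] pregeo.cl_in[OF fgood_pregeo[OF assms(2)]] assms(3) by simp_all
 ultimately show ?thesis by blast
qed

lemma KI_sub:
 assumes p: "KI p" and H: "closed_set (U p) (snd p) H" "infd (snd p) H"
 shows "KI (restr (fst p) H, snd p)" "closed_sub L (restr (fst p) H, snd p) p" "le (restr (fst p) H) (fst p)"
proof -
 show c: "closed_sub L (restr (fst p) H, snd p) p" by (rule fgood_closed_sub[OF KI_fgood[OF p] H(1)])
 show k: "KI (restr (fst p) H, snd p)"
  using K_gen_closed_sub[OF KI_gen[OF p] c] H(2) by (simp add: KI_def)
 have "KI (fst p, snd p)" using p by simp
 moreover have "closed_sub L (restr (fst p) H, snd p) (fst p, snd p)" using c by simp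
 ultimately show "le (restr (fst p) H) (fst p)" using k unfolding qm_le_def KI_iff by blast
qed

text \<open>The relation \<open>le\<close> merely asserts that suitable closure operators exist. By
  \<open>cl_unique\<close> every operator that makes \<open>B\<close> a member can take their
  place.\<close>

lemma leD:
 assumes le: "le A B" and B: "KI (B, d)"
 shows "closed_set (univ B) d (univ A)" "infd d (univ A)" "A = restr B (univ A)" "KI (A, d)" "closed_sub L (A, d) (B, d)"
proof -
 obtain c d' where h: "KI (A, c)" "KI (B, d')" "closed_sub L (A, c) (B, d')"
  using le unfolding qm_le_def KI_iff by blast
 have s: "substr L A B" "closed_set (univ B) d' (univ A)" "\<And>X. X \<subseteq> univ A ==> c X = d' X"
  using h(3) by (simp_all add: closed_sub_def)
 have sub: "univ A \<subseteq> univ B" using s(2) by (simp add: closed_set_def)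
 have dd: "d' X = d X" if "X \<subseteq> univ B" for X by (rule cl_unique[OF KI_fgood[OF h(2)] KI_fgood[OF B] that])
 show 1: "closed_set (univ B) d (univ A)" using s(2) dd[OF sub] by (simp add: closed_set_def)
 have "infd c (univ A) = infd d (univ A)"
  by (rule infd_cong) (use s(3) dd sub in auto)
 then show 2: "infd d (univ A)" using KI_infd[OF h(1)] by simp
 show 3: "A = restr B (univ A)" by (rule substr_eq[OF s(1)])
 show "KI (A, d)" "closed_sub L (A, d) (B, d)" using KI_sub(1,2)[OF B, of "univ A"] 1 2 3 by simp_all
qed

lemma leI:
 assumes "KI (B, d)" "closed_set (univ B) d (univ A)" "infd d (univ A)" "A = restr B (univ A)"
 shows "le A B"
proof -
 have "le (restr B (univ A)) B" using KI_sub(3)[OF assms(1)] assms(2,3) by simp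
 then show ?thesis using assms(4) by metis
qed

lemma le_refl: "KI (A, c) ==> le A A"
 by (rule leI) (use KI_clo[of "(A, c)"] KI_infd[of "(A, c)"] KI_struct[of "(A, c)"] restr_univ[of L A] in auto)

lemma piso_KI:
 assumes A: "KI (A, c)" and g: "iso L A B g"
 shows "\<exists>d. KI (B, d) \<and> piso L (A, c) (B, d) g"
proof -
 define d where "d Y = g ` c (univ A Int g -` Y)" for Y
 have b: "inj_on g (univ A)" "g ` univ A = univ B" using g by (simp_all add: iso_def bij_betw_def)
 have "d (g ` X) = g ` c X" if X: "X \<subseteq> univ A" for X
 proof -
  have "univ A Int g -` (g ` X) = X" using X b(1) by (auto simp: inj_on_def)
  then show ?thesis by (simp add: d_def)
 qed
 then have p: "piso L (A, c) (B, d) g" using g by (simp add: piso_def)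
 have k: "(B, d) \<in> K_gen L M cl" by (rule K_gen.iso[OF KI_gen[OF A] p])
 have "F.ciso (A, c) (B, d) (gr g (univ A))"
  using iso_pel[OF g] KI_clo[OF A] clo_univ[OF fgood_pregeo[OF K_gen_fgood[OF k]]] b(2) by (simp add: F.ciso_def)
 from F.infd_image[OF _ _ this] have "infd d (univ B)" using KI_F[OF A] K_gen_fgood[OF k] KI_infd[OF A] b(2) by simp
 then show ?thesis using k p by (auto simp: KI_def)
qed

text \<open>The operators on the members are chosen separately. Since they agree by
  \<open>cl_unique\<close>, the chain of structures lifts to a chain of structures with closures, to
  which the union clause of \<open>K_gen\<close> applies.\<close>

lemma KK_chain:
 assumes C: "C \<noteq> {}" "C \<subseteq> KK" and ch: "\<forall>A\<in>C. \<forall>B\<in>C. le A B \<or> le B A"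
 shows "\<exists>d. KI (chain_union C, d) \<and> (\<forall>A\<in>C. closed_sub L (A, d) (chain_union C, d) \<and> infd d (univ A))"
  "finite X ==> X \<subseteq> univ (chain_union C) ==> \<exists>A\<in>C. X \<subseteq> univ A"
proof -
 define c where "c A = (SOME c. KI (A, c))" for A
 have c: "KI (A, c A)" if A: "A \<in> C" for A
 proof -
  have "A \<in> KK" using A C(2) by blast
  then have "\<exists>c. KI (A, c)" by (simp only: KK_iff)
  then show ?thesis unfolding c_def by (rule someI_ex)
 qed
 define C' where "C' = (\<lambda>A. (A, c A)) ` C"
 have cs: "closed_sub L (A, c A) (B, c B)" if "le A B" "A \<in> C" "B \<in> C" for A B
 proof -
  note l = leD[OF that(1) c[OF that(3)]]
  have "c A X = c B X" if "X \<subseteq> univ A" for X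
   by (rule cl_unique[OF KI_fgood[OF c] KI_fgood[OF l(4)] that]) fact
  then show ?thesis using l(5) by (simp add: closed_sub_def)
 qed
 have ne: "C' \<noteq> {}" using C(1) by (simp add: C'_def)
 have KC: "\<forall>p\<in>C'. KI p" unfolding C'_def using c by simp
 have chC: "\<forall>p\<in>C'. \<forall>q\<in>C'. closed_sub L p q \<or> closed_sub L q p"
 proof (intro ballI)
  fix p q assume "p \<in> C'" "q \<in> C'"
  then obtain A B where AB: "A \<in> C" "B \<in> C" "p = (A, c A)" "q = (B, c B)" unfolding C'_def by blast
  then show "closed_sub L p q \<or> closed_sub L q p" using ch cs[of A B] cs[of B A] by blast
 qed
 have b: "\<forall>p\<in>C'. is_struct L (fst p)" "\<forall>p\<in>C'. pregeo (U p) (snd p)" using KC KI_struct KI_pregeo by blast+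
 note u = pchain_union_sub_ball[OF ne b chC]
 define d where "d = snd (pchain_union C')"
 have fC: "fst ` C' = C" unfolding C'_def by force
 have fu: "fst (pchain_union C') = chain_union C" by (simp add: pchain_union_def fC)
 then have pu: "pchain_union C' = (chain_union C, d)" by (simp add: d_def prod_eq_iff)
 have KCg: "\<forall>p\<in>C'. p \<in> K_gen L M cl" using KC by (simp add: KI_def)
 have k: "(chain_union C, d) \<in> K_gen L M cl" using K_gen.union[OF ne KCg chC] pu by simp
 have sub: "closed_sub L (A, c A) (chain_union C, d)" if "A \<in> C" for A
  using u(3)[of "(A, c A)"] that unfolding pu by (simp add: C'_def)
 show ex: "\<exists>A\<in>C. X \<subseteq> univ A" if X: "finite X" "X \<subseteq> univ (chain_union C)" for X
 proof -
  have "\<exists>p\<in>C'. X \<subseteq> U p" using u(4)[OF X(1)] X(2) pu by simp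
  then show ?thesis unfolding C'_def by auto
 qed
 have inA: "closed_sub L (A, d) (chain_union C, d) \<and> infd d (univ A)" if A: "A \<in> C" for A
 proof -
  have "infd (c A) (univ A) = infd d (univ A)" by (rule infd_cong) (use sub[OF A] in \<open>simp add: closed_sub_def\<close>)
  then show ?thesis using KI_infd[OF c[OF A]] sub[OF A] by (simp add: closed_sub_def)
 qed
 have "infd d (univ (chain_union C))"
  unfolding infd_def
 proof (intro allI impI notI)
  fix X assume X: "X \<subseteq> univ (chain_union C)" "finite X" "univ (chain_union C) \<subseteq> d X"
  obtain A where A: "A \<in> C" "X \<subseteq> univ A" using ex[OF X(2,1)] by blast
  have "univ A \<subseteq> univ (chain_union C)" using sub[OF A(1)] by (simp add: closed_sub_def substr_def)
  then have "univ A \<subseteq> d X" using X(3) by blast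
  then show False using inA[OF A(1)] A(2) X(2) unfolding infd_def by blast
 qed
 then have "KI (chain_union C, d)" using k by (simp add: KI_def)
 then show "\<exists>d. KI (chain_union C, d) \<and> (\<forall>A\<in>C. closed_sub L (A, d) (chain_union C, d) \<and> infd d (univ A))"
  using inA by blast
qed

lemma le_trans:
 assumes "le A B" "le B C"
 shows "le A C"
proof -
 obtain d where d: "KI (C, d)" using assms(2) unfolding qm_le_def KI_iff by blast
 note b = leD[OF assms(2) d]
 note a = leD[OF assms(1) b(4)]
 have s: "univ A \<subseteq> univ B" "univ B \<subseteq> univ C" using a(1) b(1) by (simp_all add: closed_set_def)
 have "A = restr C (univ A)" using a(3) b(3) restr_restr[OF s(1), of C] by simp
 moreover have "closed_set (univ C) d (univ A)" using a(1) s by (simp add: closed_set_def)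
 ultimately show ?thesis using leI[OF d _ a(2)] by blast
qed

lemma chain_le:
 assumes C: "C \<noteq> {}" "C \<subseteq> KK" and ch: "\<forall>A\<in>C. \<forall>B\<in>C. le A B \<or> le B A"
 shows "chain_union C \<in> KK \<and> (\<forall>A\<in>C. le A (chain_union C)) \<and> (\<forall>B\<in>KK. (\<forall>A\<in>C. le A B) --> le (chain_union C) B)"
proof -
 obtain d where d: "KI (chain_union C, d)" "\<forall>A\<in>C. closed_sub L (A, d) (chain_union C, d) \<and> infd d (univ A)"
  using KK_chain(1)[OF C ch] by blast
 have 1: "chain_union C \<in> KK" using d(1) KK_iff by blast
 have 2: "le A (chain_union C)" if A: "A \<in> C" for A
 proof -
  have s: "substr L A (chain_union C)" "closed_set (univ (chain_union C)) d (univ A)" "infd d (univ A)"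
   using d(2) A by (auto simp: closed_sub_def)
  show ?thesis by (rule leI[OF d(1) s(2,3) substr_eq[OF s(1)]])
 qed
 have 3: "le (chain_union C) B" if B: "B \<in> KK" "\<forall>A\<in>C. le A B" for B
 proof -
  obtain e where e: "KI (B, e)" using B(1) KK_iff by blast
  interpret PB: pregeo "univ B" e using KI_pregeo[OF e] by simp
  have l: "closed_set (univ B) e (univ A)" "infd e (univ A)" "A = restr B (univ A)" if "A \<in> C" for A
   using leD[OF B(2)[rule_format, OF that] e] by simp_all
  let ?V = "univ (chain_union C)"
  have V: "?V = (\<Union>A\<in>C. univ A)" by (simp add: chain_union_def)
  have AB: "univ A \<subseteq> univ B" if "A \<in> C" for A using l(1)[OF that] by (simp add: closed_set_def)
  have VB: "?V \<subseteq> univ B" unfolding V using AB by blast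
  have "e ?V \<subseteq> ?V"
  proof
   fix a assume "a \<in> e ?V"
   then obtain X where X: "X \<subseteq> ?V" "finite X" "a \<in> e X" using PB.cl_fin[OF VB] by blast
   obtain A where A: "A \<in> C" "X \<subseteq> univ A" using KK_chain(2)[OF C ch X(2,1)] by blast
   have "a \<in> univ A" using PB.cl_least'[OF l(1)[OF A(1)] A(2)] X(3) by blast
   then show "a \<in> ?V" unfolding V using A(1) by blast
  qed
  then have cV: "closed_set (univ B) e ?V" using PB.cl_ext[OF VB] VB by (auto simp: closed_set_def)
  have "infd e ?V"
   unfolding infd_def
  proof (intro allI impI notI)
   fix X assume X: "X \<subseteq> ?V" "finite X" "?V \<subseteq> e X"
   obtain A where A: "A \<in> C" "X \<subseteq> univ A" using KK_chain(2)[OF C ch X(2,1)] by blast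
   have "univ A \<subseteq> e X" using X(3) A(1) unfolding V by blast
   then show False using l(2)[OF A(1)] A(2) X(2) unfolding infd_def by blast
  qed
  moreover have "chain_union C = restr B ?V"
  proof (rule substr_cover_eq)
   show "is_struct L (chain_union C)" using KI_struct[OF d(1)] by simp
   show sB: "is_struct L (restr B ?V)" using fgood_closed_struct[OF KI_fgood[OF e]] cV by simp
   show "univ (chain_union C) = univ (restr B ?V)" by simp
   fix X assume X: "finite X" "X \<subseteq> ?V"
   obtain A where A: "A \<in> C" "X \<subseteq> univ A" using KK_chain(2)[OF C ch X] by blast
   have s: "substr L A (chain_union C)" using d(2) A(1) by (auto simp: closed_sub_def)
   have AV: "univ A \<subseteq> ?V" unfolding V using A(1) by blast
   have "A = restr (restr B ?V) (univ A)" using l(3)[OF A(1)] restr_restr[OF AV, of B] by simp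
   then have "substr L A (restr B ?V)" using s sB AV by (simp add: substr_def)
   then show "\<exists>D. X \<subseteq> univ D \<and> substr L D (chain_union C) \<and> substr L D (restr B ?V)" using s A(2) by blast
  qed
  ultimately show ?thesis using leI[OF e cV] by blast
 qed
 show ?thesis using 1 2 3 by blast
qed

lemma le_iso:
 assumes le: "le A B" and g: "iso L B B' g"
 shows "le (restr B' (g ` univ A)) B'"
proof -
 obtain d where d: "KI (B, d)" using le unfolding qm_le_def KI_iff by blast
 note l = leD[OF le d]
 obtain d' where d': "KI (B', d')" "piso L (B, d) (B', d') g" using piso_KI[OF d g] by blast
 have s: "univ A \<subseteq> univ B" "d (univ A) = univ A" using l(1) by (simp_all add: closed_set_def)
 have gB: "g ` univ B = univ B'" using g by (simp add: iso_def bij_betw_def)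
 have "d' (g ` univ A) = g ` univ A" using d'(2) s by (simp add: piso_def)
 then have c: "closed_set (univ B') d' (g ` univ A)" using gB s(1) by (auto simp: closed_set_def)
 let ?G = "gr g (univ A)"
 have "?G \<subseteq> gr g (univ B)" unfolding gr_def by (rule image_mono[OF s(1)])
 then have "pel L B B' ?G" by (rule pel_subset[OF iso_pel[OF g]])
 then have "F.ciso (B, d) (B', d') ?G" using l(1) c by (simp add: F.ciso_def)
 from F.infd_image[OF _ _ this] have "infd d' (g ` univ A)" using KI_F[OF d] KI_F[OF d'(1)] l(2) by simp
 then show ?thesis using leI[OF d'(1), of "restr B' (g ` univ A)"] c by simp
qed

lemma aec: "aec_axioms L KK le"
 unfolding aec_axioms_def
proof (intro conjI allI impI ballI)
 show "is_struct L A" if A: "A \<in> KK" for A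
 proof -
  obtain c where "KI (A, c)" using A KK_iff by blast
  then show ?thesis using KI_struct[of "(A, c)"] by simp
 qed
 show "B \<in> KK" if "A \<in> KK \<and> iso L A B g" for A B g
 proof -
  have "\<exists>c. KI (A, c)" using that KK_iff by blast
  then obtain c where "KI (A, c)" by blast
  from piso_KI[OF this] show ?thesis unfolding KK_iff using that by blast
 qed
 show "le (restr B' (g ` univ A)) B'" if "le A B \<and> iso L B B' g" for A B B' g by (rule le_iso) (use that in auto)
 show "A \<in> KK" "B \<in> KK" "substr L A B" if "le A B" for A B
 proof -
  have "\<exists>c d. KI (A, c) \<and> KI (B, d) \<and> closed_sub L (A, c) (B, d)" using that unfolding qm_le_def KI_iff by blast
  then obtain c d where k: "KI (A, c)" "KI (B, d)" "closed_sub L (A, c) (B, d)" by blast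
  show "A \<in> KK" "B \<in> KK" unfolding KK_iff using k(1,2) by blast+
  show "substr L A B" using k(3) by (simp add: closed_sub_def)
 qed
 show "le A A" if "A \<in> KK" for A
 proof -
  have "\<exists>c. KI (A, c)" using that KK_iff by blast
  then show ?thesis using le_refl by blast
 qed
 show "le A C" if "le A B \<and> le B C" for A B C by (rule le_trans[of A B C]) (use that in auto)
 show "A = B" if h: "le A B \<and> le B A" for A B
 proof -
  obtain c d where k: "KI (A, c)" "KI (B, d)" using h unfolding qm_le_def KI_iff by blast
  have "univ A \<subseteq> univ B" "A = restr B (univ A)" using leD[of A B d] h k by (auto simp: closed_set_def)
  moreover have "univ B \<subseteq> univ A" "restr B (univ B) = B"
   using leD(1)[of B A c] h k KI_struct[OF k(2)] restr_univ[of L B] by (auto simp: closed_set_def)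
  ultimately show ?thesis by simp
 qed
 show "chain_union C \<in> KK" if "C \<noteq> {} \<and> C \<subseteq> KK \<and> (\<forall>A\<in>C. \<forall>B\<in>C. le A B \<or> le B A)" for C
  using chain_le[of C] that by blast
 show "le A (chain_union C)" if "C \<noteq> {} \<and> C \<subseteq> KK \<and> (\<forall>A\<in>C. \<forall>B\<in>C. le A B \<or> le B A)" "A \<in> C" for C A
  using chain_le[of C] that by blast
 show "le (chain_union C) B" if "C \<noteq> {} \<and> C \<subseteq> KK \<and> (\<forall>A\<in>C. \<forall>B\<in>C. le A B \<or> le B A)" "B \<in> KK" "\<forall>A\<in>C. le A B" for C B
  using chain_le[of C] that by blast
 show "le A B" if h: "le A C \<and> le B C \<and> substr L A B" for A B C
 proof -
  obtain d where d: "KI (C, d)" using h unfolding qm_le_def KI_iff by blast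
  note a = leD[OF conjunct1[OF h] d]
  note b = leD[OF conjunct1[OF conjunct2[OF h]] d]
  have s: "univ A \<subseteq> univ B" "A = restr B (univ A)" using h substr_eq by (auto simp: substr_def)
  have "closed_set (univ B) d (univ A)" using a(1) s(1) by (simp add: closed_set_def)
  then show ?thesis using leI[OF b(4) _ a(2) s(2)] by blast
 qed
qed

lemma KI_infinite: "KI p ==> infinite (U p)"
 using KI_infd[of p] pregeo.cl_ext[OF KI_pregeo, of p "U p"] unfolding infd_def by blast

lemma LS: "LS_omega L KK le"
 unfolding LS_omega_def
proof (intro conjI ballI allI impI)
 show "countable_lang L" by (rule cL)
 fix A X assume A: "A \<in> KK" and X: "X \<subseteq> univ A"
 obtain c where c: "KI (A, c)" using A KK_iff by blast
 interpret P: pregeo "univ A" c using KI_pregeo[OF c] by simp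
 have cf: "(A, c) \<in> Collect fgood" by (rule KI_F[OF c])
 obtain B0 E Z where B0': "B0 \<subseteq> U (A, c)" "countable B0" "infinite B0" "indp (snd (A, c)) {} B0" "E = snd (A, c) B0"
  "closed_set (U (A, c)) (snd (A, c)) E" "countable E" "infd (snd (A, c)) E" "E \<subseteq> U (A, c)" "Z \<subseteq> U (A, c)"
  "indp (snd (A, c)) E Z" "U (A, c) = snd (A, c) (E Un Z)"
  by (rule F.countable_infd_subset[OF cf KI_clo[OF c] KI_infd[OF c]])
 have B0: "B0 \<subseteq> univ A" "countable B0" "infinite B0" "indp c {} B0" using B0'(1-4) by simp_all
 \<comment> \<open>The countably infinite independent set \<open>B0\<close> keeps the closure
   infinite-dimensional whatever \<open>X\<close> is, and adds only countably many
   generators.\<close>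
 define H where "H = c (X Un B0)"
 have XB: "X Un B0 \<subseteq> univ A" using X B0 by blast
 have clH: "closed_set (univ A) c H" unfolding H_def by (rule P.closed_cl[OF XB])
 have "infd c H"
 proof -
  obtain B1 where B1: "B0 \<subseteq> B1" "B1 \<subseteq> X Un B0" "indp c {} B1" "X Un B0 \<subseteq> c ({} Un B1)"
   by (rule P.max_indp[OF B0(4) _ XB]) auto
  have B1U: "B1 \<subseteq> univ A" using B1(2) XB by blast
  have "c (X Un B0) = c B1"
   using P.cl_least[OF B1U, of "X Un B0"] B1(4) P.cl_mono[OF B1(2) XB] by simp
  moreover have "infinite B1" using B0(3) B1(1) finite_subset by blast
  ultimately show ?thesis unfolding H_def using P.infd_cl[of B1 "{}"] B1(3) B1U by simp
 qed
 from KI_sub(3)[OF c, of H] clH this have le: "le (restr A H) A" by simp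
 have r: "Card_order ( |X| +c natLeq)" "\<not> finite (Field ( |X| +c natLeq))"
 proof -
  show "Card_order ( |X| +c natLeq)" by (rule Card_order_csum)
  have "Cinfinite ( |X| +c natLeq)" by (rule Cinfinite_csum) (use natLeq_Cinfinite in blast)
  then show "\<not> finite (Field ( |X| +c natLeq))" by (simp add: cinfinite_def)
 qed
 have "|X Un B0| \<le>o |X| +c natLeq"
 proof -
  have "|X Un B0| \<le>o |X| +c |B0|" by (rule Un_csum)
  moreover have "|X| +c |B0| \<le>o |X| +c natLeq"
   by (rule csum_mono2) (use B0(2) in \<open>simp add: countable_card_le_natLeq\<close>)
  ultimately show ?thesis by (rule ordLeq_transitive)
 qed
 then have "|H| \<le>o |X| +c natLeq" using F.card_cl[OF cf _ r, of "X Un B0"] XB by (simp add: H_def)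
 moreover have "X \<subseteq> H" using P.cl_ext[OF XB] by (simp add: H_def)
 ultimately show "\<exists>B. le B A \<and> X \<subseteq> univ B \<and> |univ B| \<le>o |X| +c natLeq"
  using le by (intro exI[of _ "restr A H"]) simp
qed

text \<open>With \<open>embD\<close> this identifies embeddings of the class with isomorphisms onto
  closed sets, so that amalgamation becomes a question about extending \<open>ciso\<close>.\<close>

lemma embI:
 assumes A: "KI (A, c)" and B: "KI (B, d)" and f: "F.ciso (A, c) (B, d) f" "Domain f = univ A"
 shows "\<exists>g. emb L le A B g \<and> f = gr g (univ A)"
proof -
 have el: "pel L A B f" using F.ciso_el[OF f(1)] by simp
 obtain g where "f = gr g (Domain f)" by (rule pel_gr[OF el])
 then have g: "f = gr g (univ A)" using f(2) by simp
 have R: "Range f = g ` univ A" by (subst g) simp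
 have cl: "closed_set (univ B) d (g ` univ A)" using F.ciso_Range[OF f(1)] R by simp
 have inf: "infd d (g ` univ A)" using F.infd_image[OF KI_F[OF A] KI_F[OF B] f(1)] KI_infd[OF A] f(2) R by simp
 have s: "is_struct L (restr B (g ` univ A))" using fgood_closed_struct[OF KI_fgood[OF B]] cl by simp
 have sA: "is_struct L A" "restr A (univ A) = A" using KI_struct[OF A] restr_univ by auto
 have fsub: "f \<subseteq> univ A \<times> g ` univ A" using g by (auto simp: gr_def)
 have "pel L (restr A (univ A)) (restr B (g ` univ A)) f"
  using pel_restr_iff[of L A "univ A" B "g ` univ A" f] s sA el cl fsub by (auto simp: closed_set_def)
 then have "iso L A (restr B (g ` univ A)) g" using pel_iso[OF sA(1) s] sA(2) g by simp
 then have "emb L le A B g" unfolding emb_def using leI[OF B, of "restr B (g ` univ A)"] cl inf by simp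
 then show ?thesis using g by blast
qed

lemma embD:
 assumes e: "emb L le A B g" and A: "KI (A, c)" and B: "KI (B, d)"
 shows "F.ciso (A, c) (B, d) (gr g (univ A))"
proof -
 have i: "iso L A (restr B (g ` univ A)) g" and l: "le (restr B (g ` univ A)) B" using e by (simp_all add: emb_def)
 have cl: "closed_set (univ B) d (g ` univ A)" using leD(1)[OF l B] by simp
 have s: "is_struct L (restr B (g ` univ A))" using i by (simp add: iso_def)
 have sA: "is_struct L A" "restr A (univ A) = A" using KI_struct[OF A] restr_univ by auto
 have "pel L (restr A (univ A)) (restr B (g ` univ A)) (gr g (univ A))" using iso_pel[OF i] sA(2) by simp
 moreover have gr_sub: "gr g (univ A) \<subseteq> univ A \<times> g ` univ A" unfolding gr_def by auto
 ultimately have "pel L A B (gr g (univ A))"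
  using pel_restr_iff[of L A "univ A" B "g ` univ A" "gr g (univ A)"] s sA cl gr_sub by (auto simp: closed_set_def)
 then show ?thesis using cl KI_clo[OF A] by (simp add: F.ciso_def)
qed

end

section \<open>Large members, joint embedding, amalgamation and monster models\<close>

text \<open>An infinite set is equinumerous with its square; two disjoint rows of the square give
  the parts.\<close>

lemma split_infinite:
 assumes "infinite V"
 shows "\<exists>V0 V1. V0 \<subseteq> V \<and> V1 \<subseteq> V \<and> V0 Int V1 = {} \<and> |V| \<le>o |V0| \<and> |V| \<le>o |V1|"
proof -
 have "|V \<times> V| =o |V|" by (rule card_of_Times_same_infinite[OF assms])
 then obtain \<beta> where \<beta>: "bij_betw \<beta> (V \<times> V) V" using card_of_ordIso by blast
 have i: "inj_on \<beta> (V \<times> V)" "\<beta> ` (V \<times> V) = V" using \<beta> by (simp_all add: bij_betw_def)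
 obtain u where u: "u \<in> V" using assms by fastforce
 have "infinite (V - {u})" using assms by simp
 then obtain w where w: "w \<in> V" "w \<noteq> u" by (metis Diff_iff finite.emptyI insertI1 subsetI subset_empty)
 have big: "|V| \<le>o |\<beta> ` ({x} \<times> V)|" if x: "x \<in> V" for x
 proof -
  have "inj_on (\<lambda>y. \<beta> (x, y)) V" using i(1) x by (auto simp: inj_on_def)
  moreover have "(\<lambda>y. \<beta> (x, y)) ` V \<subseteq> \<beta> ` ({x} \<times> V)" by auto
  ultimately show ?thesis using card_of_ordLeq[of V "\<beta> ` ({x} \<times> V)"] by blast
 qed
 have "\<beta> ` ({u} \<times> V) Int \<beta> ` ({w} \<times> V) = \<beta> ` ({u} \<times> V Int {w} \<times> V)"
  by (rule inj_on_image_Int[OF i(1), symmetric]) (use u w in auto)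
 also have "\<dots> = {}" using w(2) by auto
 finally have "\<beta> ` ({u} \<times> V) Int \<beta> ` ({w} \<times> V) = {}" .
 moreover have "\<beta> ` ({u} \<times> V) \<subseteq> V" "\<beta> ` ({w} \<times> V) \<subseteq> V" using i(2) u w by auto
 ultimately show ?thesis using big[OF u] big[OF w(1)] by blast
qed

lemma iso_id_eq:
 assumes i: "iso L A B g" and id: "\<And>x. x \<in> univ A ==> g x = x"
 shows "A = B"
proof -
 have s: "is_struct L A" "is_struct L B" "g ` univ A = univ B" using i by (simp_all add: iso_def bij_betw_def)
 have u: "univ A = univ B" using s(3) id by force
 have m: "map g xs = xs" if "set xs \<subseteq> univ A" for xs using that id by (intro map_idI) auto
 show ?thesis
 proof (rule struct_eqI[OF u])
  show "fn A f xs = fn B f xs" for f xs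
  proof (cases "f \<in> funs L \<and> length xs = far L f \<and> set xs \<subseteq> univ A")
   case True
   then have "g (fn A f xs) = fn B f (map g xs)" using i by (simp add: iso_def)
   then show ?thesis using id[OF is_struct_fn[OF s(1), of f xs]] True m by simp
  next
   case False
   then have "fn A f xs = undefined" "fn B f xs = undefined" using s(1,2) u unfolding is_struct_def by metis+
   then show ?thesis by simp
  qed
  show "rel A r xs = rel B r xs" for r xs
  proof (cases "r \<in> rels L \<and> length xs = rar L r \<and> set xs \<subseteq> univ A")
   case True
   then have "rel A r xs \<longleftrightarrow> rel B r (map g xs)" using i by (simp add: iso_def)
   then show ?thesis using True m by simp
  next
   case False
   then show ?thesis using s(1,2) u unfolding is_struct_def by blast
  qed
 qed
qed

lemma transport_struct:
 assumes A: "is_struct L A" and g: "inj_on g (univ A)"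
 shows "\<exists>B. iso L A B g"
proof -
 define h where "h = inv_into (univ A) g"
 let ?V = "g ` univ A"
 define B where "B = \<lparr>univ = ?V,
   fn = (\<lambda>f ys. if f \<in> funs L \<and> length ys = far L f \<and> set ys \<subseteq> ?V then g (fn A f (map h ys)) else undefined),
   rel = (\<lambda>r ys. set ys \<subseteq> ?V \<and> rel A r (map h ys))\<rparr>"
 have hin: "set (map h ys) \<subseteq> univ A" if "set ys \<subseteq> ?V" for ys
  using that inv_into_into[of _ g "univ A"] by (auto simp: h_def)
 have hg: "map h (map g xs) = xs" if "set xs \<subseteq> univ A" for xs
 proof -
  have "map (\<lambda>x. h (g x)) xs = xs"
   by (rule map_idI) (use that g in \<open>auto simp: h_def inv_into_f_f\<close>)
  then show ?thesis by (simp add: comp_def)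
 qed
 have B: "is_struct L B"
  unfolding is_struct_def
 proof (intro conjI allI impI)
  fix f xs
  show "if f \<in> funs L \<and> length xs = far L f \<and> set xs \<subseteq> univ B then fn B f xs \<in> univ B else fn B f xs = undefined"
  proof (cases "f \<in> funs L \<and> length xs = far L f \<and> set xs \<subseteq> ?V")
   case True
   then have "fn A f (map h xs) \<in> univ A" using is_struct_fn[OF A, of f "map h xs"] hin by simp
   then show ?thesis using True by (simp add: B_def)
  next
   case False
   then show ?thesis by (auto simp: B_def)
  qed
  fix r
  assume r: "rel B r xs"
  then have "rel A r (map h xs)" "set xs \<subseteq> ?V" by (simp_all add: B_def)
  then have "r \<in> rels L \<and> length (map h xs) = rar L r" "set xs \<subseteq> ?V" using A unfolding is_struct_def by blast+
  then show "r \<in> rels L" "length xs = rar L r" "set xs \<subseteq> univ B" by (simp_all add: B_def)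
 qed
 have V: "set (map g xs) \<subseteq> ?V" if "set xs \<subseteq> univ A" for xs using that by auto
 have "iso L A B g"
  unfolding iso_def
 proof (intro conjI ballI allI impI)
  show "bij_betw g (univ A) (univ B)" using g by (simp add: bij_betw_def B_def)
  fix xs
  show "g (fn A f xs) = fn B f (map g xs)" if "f \<in> funs L" "length xs = far L f \<and> set xs \<subseteq> univ A" for f
   using that hg[of xs] V[of xs] by (simp add: B_def)
  show "rel A r xs \<longleftrightarrow> rel B r (map g xs)" if "r \<in> rels L" "length xs = rar L r \<and> set xs \<subseteq> univ A" for r
   using that hg[of xs] V[of xs] by (simp add: B_def)
 qed (rule A, rule B)
 then show ?thesis by blast
qed

lemma transport_pstruct:
 assumes A: "is_struct L A" and g: "inj_on g (univ A)"
 shows "\<exists>B d. piso L (A, c) (B, d) g"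
proof -
 obtain B where B: "iso L A B g" using transport_struct[OF A g] by blast
 define d where "d Y = g ` c (univ A Int g -` Y)" for Y
 have "d (g ` X) = g ` c X" if X: "X \<subseteq> univ A" for X
 proof -
  have "univ A Int g -` (g ` X) = X" using X g by (auto simp: inj_on_def)
  then show ?thesis by (simp add: d_def)
 qed
 then have "piso L (A, c) (B, d) g" using B by (simp add: piso_def)
 then show ?thesis by blast
qed

lemma piso_infd:
 assumes pq: "piso L p q g" and p: "pregeo (U p) (snd p)" and inf: "infd (snd p) (U p)"
 shows "infd (snd q) (U q)"
 unfolding infd_def
proof (intro allI impI notI)
 have b: "inj_on g (U p)" "g ` U p = U q" and c: "\<And>X. X \<subseteq> U p ==> snd q (g ` X) = g ` snd p X"
  using pq by (simp_all add: piso_def iso_def bij_betw_def)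
 fix Y assume Y: "Y \<subseteq> U q" "finite Y" "U q \<subseteq> snd q Y"
 have "Y \<subseteq> g ` U p" using Y(1) b(2) by simp
 then obtain X where X: "X \<subseteq> U p" "finite X" "Y = g ` X" using finite_subset_image[OF Y(2)] by metis
 have XU: "snd p X \<subseteq> U p" by (rule pregeo.cl_in[OF p X(1)])
 have "g ` U p \<subseteq> g ` snd p X" using Y(3) b(2) c[OF X(1)] X(3) by simp
 then have "U p \<subseteq> snd p X" using inj_on_image_mem_iff[OF b(1) _ XU] by blast
 then show False using inf X(1,2) unfolding infd_def by blast
qed

lemma iso_restrI:
 assumes "is_struct L (restr N H)" "H \<subseteq> univ N" "is_struct L (restr N' (g ` H))" "g ` H \<subseteq> univ N'" "pel L N N' (gr g H)"
 shows "iso L (restr N H) (restr N' (g ` H)) g"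
proof (rule pel_iso[OF assms(1,3)])
 have "gr g H \<subseteq> H \<times> g ` H" by (auto simp: gr_def)
 then show "pel L (restr N H) (restr N' (g ` H)) (gr g (univ (restr N H)))"
  using pel_restr_iff[OF assms(1-4)] assms(5) by simp
qed simp

lemma iso_restrD:
 assumes i: "iso L (restr N H) (restr N' H') g" and H: "H \<subseteq> univ N" "H' \<subseteq> univ N'"
 shows "pel L N N' (gr g H)" "g ` H = H'"
proof -
 show g: "g ` H = H'" using i by (simp add: iso_def bij_betw_def)
 have s: "is_struct L (restr N H)" "is_struct L (restr N' H')" using i by (simp_all add: iso_def)
 have "gr g H \<subseteq> H \<times> H'" using g by (auto simp: gr_def)
 then show "pel L N N' (gr g H)" using pel_restr_iff[OF s(1) H(1) s(2) H(2)] iso_pel[OF i] by simp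
qed

context qmK begin

lemma natLeq_UNIV: "natLeq <o |UNIV :: 'a set|"
 using unc countable_card_le_natLeq[of "UNIV :: 'a set"] not_ordLeq_iff_ordLess[OF natLeq_Well_order card_of_Well_order] by blast

text \<open>\<open>M\<close> may be too large for the type \<open>'a\<close>, but a countable
  infinite-dimensional closed part of it fits.\<close>

lemma KI_ex: "\<exists>q. KI q"
proof -
 have cM: "closed_set (U (M, cl)) (snd (M, cl)) (univ M)" using PM.cl_ext[of "univ M"] PM.cl_in[of "univ M"] by (auto simp: closed_set_def)
 have iM: "infd (snd (M, cl)) (univ M)" using M_infd by simp
 obtain B0 E Z where E: "B0 \<subseteq> univ M" "countable B0" "infinite B0" "indp (snd (M, cl)) {} B0" "E = snd (M, cl) B0"
  "closed_set (U (M, cl)) (snd (M, cl)) E" "countable E" "infd (snd (M, cl)) E" "E \<subseteq> univ M" "Z \<subseteq> univ M"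
  "indp (snd (M, cl)) E Z" "univ M = snd (M, cl) (E Un Z)"
  by (rule M.countable_infd_subset[OF _ cM iM]) simp
 have cE: "closed_set (univ M) cl E" "infd cl E" using E(6,8) by simp_all
 have "|E| \<le>o |UNIV :: 'a set|"
 proof -
  have "|E| \<le>o natLeq" using E(7) countable_card_le_natLeq by blast
  then show ?thesis using natLeq_UNIV ordLess_imp_ordLeq ordLeq_transitive by blast
 qed
 then have "\<exists>g :: 'm \<Rightarrow> 'a. inj_on g E \<and> g ` E \<subseteq> UNIV" unfolding card_of_ordLeq .
 then obtain g :: "'m \<Rightarrow> 'a" where g: "inj_on g E" by blast
 let ?p = "(restr M E, cl)"
 have sE: "is_struct L (restr M E)" by (rule M_closed_struct[OF cE(1)])
 have cs: "closed_sub L ?p (M, cl)"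
  using substr_restr[OF M_struct sE] cE(1) by (simp add: closed_sub_def closed_set_def)
 obtain B d where q: "piso L ?p (B, d) g" using transport_pstruct[OF sE, of g cl] g by auto
 have "(B, d) \<in> K_minus L M cl" unfolding K_minus_def using cs q by blast
 then have "(B, d) \<in> K_gen L M cl" by (rule K_gen.base)
 moreover have "infd (snd (B, d)) (U (B, d))"
  by (rule piso_infd[OF q fgood_pregeo[OF closed_sub_fgood[OF cs]]]) (use cE(2) in simp)
 ultimately have "KI (B, d)" unfolding KI_def by blast
 then show ?thesis by blast
qed

text \<open>An infinite basis is in bijection with itself minus one element \<open>b\<close>. The
  isomorphism that extends this bijection embeds the structure in itself and misses
  \<open>b\<close>.\<close>

lemma proper_copy:
 assumes p: "KI p"
 shows "\<exists>\<phi> b. b \<in> U p \<and> b \<notin> \<phi> ` U p \<and> F.ciso p p (gr \<phi> (U p)) \<and> inj_on \<phi> (U p)"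
proof -
 interpret P: pregeo "U p" "snd p" by (rule KI_pregeo[OF p])
 have pF: "p \<in> Collect fgood" by (rule KI_F[OF p])
 obtain B where B: "B \<subseteq> U p" "indp (snd p) {} B" "U p \<subseteq> snd p ({} Un B)" by (rule P.basis_of[OF subset_refl empty_subsetI])
 have "infinite B" by (rule P.infd_infinite_basis[OF KI_infd[OF p] _ _ B(1), of "{}"]) (use B(3) in auto)
 then obtain b where b: "b \<in> B" by fastforce
 obtain j where j: "bij_betw j B (B - {b})" using infinite_imp_bij_betw[OF \<open>infinite B\<close>] by blast
 let ?I = "Id_on (snd p {})"
 have I: "F.ciso p p ?I" by (rule F.ciso_Id_on) (simp add: P.closed_cl)
 have DI: "Domain ?I = snd p {}" "Range ?I = snd p {}" by auto
 have i1: "indp (snd p) (Domain ?I) B" unfolding DI using P.indp_cl[OF empty_subsetI B(1)] B(2) by simp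
 have i2: "indp (snd p) (Range ?I) (B - {b})"
  unfolding DI using P.indp_subset[OF i1 _ _ B(1)] P.cl_in[of "{}"] by simp
 have bU: "B - {b} \<subseteq> U p" using B(1) by blast
 obtain f where f: "F.ciso p p f" "Domain f = snd p (Domain ?I Un B)" "Range f = snd p (Range ?I Un (B - {b}))"
  using F.gext1[OF pF pF I B(1) i1 bU i2 j] by blast
 have D: "Domain f = U p" unfolding f(2) DI using P.cl_Un_cl[of "{}" B] B P.cl_in[OF B(1)] by simp
 have R: "b \<notin> Range f"
  unfolding f(3) DI using P.cl_Un_cl[of "{}" "B - {b}"] bU P.indp_notin'[OF B(2) _ B(1) b, of "B - {b}"] by simp
 obtain \<phi> where \<phi>: "f = gr \<phi> (Domain f)" "inj_on \<phi> (Domain f)" by (rule pel_gr[OF F.ciso_el[OF f(1)]])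
 have f': "f = gr \<phi> (U p)" using \<phi>(1) D by simp
 have "Range f = \<phi> ` U p" by (subst f') simp
 then show ?thesis using f(1) f' R \<phi>(2) D b B(1) by (intro exI[of _ \<phi>] exI[of _ b]) auto
qed

text \<open>\<open>proper_copy\<close> is read backwards: \<open>\<iota>\<close> renames the points
  of the proper copy inside \<open>N\<close> to the points of \<open>N\<close>, and the remaining
  points to elements outside \<open>N\<close>. The renamed structure contains \<open>N\<close> as a
  proper closed submodel.\<close>

lemma proper_extension:
 assumes N: "KI (N, c)" and small: "|univ N| <o |UNIV :: 'a set|"
 shows "\<exists>N'. N' \<in> KK \<and> le N N' \<and> N' \<noteq> N"
proof -
 obtain \<phi> b where b: "b \<in> univ N" "b \<notin> \<phi> ` univ N" and phi: "F.ciso (N, c) (N, c) (gr \<phi> (univ N))" "inj_on \<phi> (univ N)"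
  using proper_copy[OF N] by auto
 have pU: "\<phi> ` univ N \<subseteq> univ N" using F.ciso_Range[OF phi(1)] by (simp add: closed_set_def)
 \<comment> \<open>Otherwise the whole type would be the union of two sets of size at most that of
   \<open>N\<close>, hence no larger than the infinite \<open>univ N\<close>.\<close>
 have "|univ N| \<le>o |UNIV - univ N|"
 proof (rule ccontr)
  assume "\<not> ?thesis"
  then have "|UNIV - univ N| <o |univ N|" using not_ordLeq_iff_ordLess[OF card_of_Well_order card_of_Well_order] by blast
  then have le: "|UNIV - univ N| \<le>o |univ N|" by (rule ordLess_imp_ordLeq)
  have "\<not> finite (univ N)" using KI_infinite[OF N] by simp
  then have "|univ N Un (UNIV - univ N)| \<le>o |univ N|" using card_of_Un_ordLeq_infinite_Field[of "|univ N|" "univ N" "UNIV - univ N"] card_of_Card_order[of "univ N"] ordLeq_refl[OF card_of_Card_order[of "univ N"]] le by (simp add: Field_card_of)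
  moreover have "univ N Un (UNIV - univ N) = UNIV" by blast
  ultimately show False using small not_ordLess_ordLeq by metis
 qed
 then have "\<exists>\<kappa>. inj_on \<kappa> (univ N) \<and> \<kappa> ` univ N \<subseteq> UNIV - univ N" unfolding card_of_ordLeq .
 then obtain \<kappa> where \<kappa>: "inj_on \<kappa> (univ N)" "\<kappa> ` univ N \<subseteq> UNIV - univ N" by blast
 define \<iota> where "\<iota> y = (if y \<in> \<phi> ` univ N then inv_into (univ N) \<phi> y else \<kappa> y)" for y
 have \<iota>\<phi>: "\<iota> (\<phi> x) = x" if "x \<in> univ N" for x using that phi(2) by (simp add: \<iota>_def inv_into_f_f)
 have k: "\<kappa> y \<notin> univ N" if "y \<in> univ N" for y using that \<kappa>(2) by blast
 have inv: "inv_into (univ N) \<phi> y \<in> univ N" if "y \<in> \<phi> ` univ N" for y using that by (rule inv_into_into)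
 have inj: "inj_on \<iota> (univ N)"
 proof (rule inj_onI)
  fix x y assume h: "x \<in> univ N" "y \<in> univ N" "\<iota> x = \<iota> y"
  consider "x \<in> \<phi> ` univ N" "y \<in> \<phi> ` univ N" | "x \<notin> \<phi> ` univ N" "y \<notin> \<phi> ` univ N"
   | "x \<in> \<phi> ` univ N" "y \<notin> \<phi> ` univ N" | "x \<notin> \<phi> ` univ N" "y \<in> \<phi> ` univ N" by blast
  then show "x = y"
  proof cases
   case 1
   then show ?thesis using h \<iota>\<phi> by auto
  next
   case 2
   then show ?thesis using h inj_onD[OF \<kappa>(1), of x y] by (simp add: \<iota>_def)
  next
   case 3
   then show ?thesis using h k[of y] inv[of x] by (simp add: \<iota>_def)
  next
   case 4
   then show ?thesis using h k[of x] inv[of y] by (simp add: \<iota>_def)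
  qed
 qed
 have sN: "is_struct L N" using KI_struct[OF N] by simp
 obtain N' c' where q: "piso L (N, c) (N', c') \<iota>" using transport_pstruct[OF sN inj] by blast
 have KI': "KI (N', c')"
  unfolding KI_def using K_gen.iso[OF KI_gen[OF N] q] piso_infd[OF q KI_pregeo[OF N] KI_infd[OF N]] by blast
 have iN: "iso L N N' \<iota>" using q by (simp add: piso_def)
 have UN': "\<iota> ` univ N = univ N'" using iN by (simp add: iso_def bij_betw_def)
 have "Id_on (univ N) \<subseteq> gr \<phi> (univ N) O gr \<iota> (univ N)"
 proof
  fix t assume "t \<in> Id_on (univ N)"
  then obtain x where x: "x \<in> univ N" "t = (x, x)" by auto
  then have "(x, \<phi> x) \<in> gr \<phi> (univ N)" "(\<phi> x, x) \<in> gr \<iota> (univ N)" using pU \<iota>\<phi> by auto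
  then show "t \<in> gr \<phi> (univ N) O gr \<iota> (univ N)" using x(2) by blast
 qed
 moreover have "pel L N N (gr \<phi> (univ N))" using F.ciso_el[OF phi(1)] by simp
 ultimately have el: "pel L N N' (Id_on (univ N))" using pel_subset[OF pel_comp[OF _ iso_pel[OF iN]]] by blast
 have sub: "univ N \<subseteq> univ N'" using pel_univ[OF el] by auto
 have "c' (univ N) = univ N"
 proof -
  have e: "\<iota> ` \<phi> ` univ N = univ N" using \<iota>\<phi> by (force simp: image_image)
  have "c (\<phi> ` univ N) = \<phi> ` univ N" using F.ciso_Range[OF phi(1)] by (simp add: closed_set_def)
  then have "c' (\<iota> ` \<phi> ` univ N) = \<iota> ` \<phi> ` univ N" using q pU by (simp add: piso_def)
  then show ?thesis using e by simp
 qed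
 then have cl: "closed_set (univ N') c' (univ N)" using sub by (simp add: closed_set_def)
 have DR: "Domain (Id_on (univ N)) = univ N" "Range (Id_on (univ N)) = univ N" by auto
 have "F.ciso (N, c) (N', c') (Id_on (univ N))" using el cl KI_clo[OF N] by (simp add: F.ciso_def DR)
 from embI[OF N KI' this] obtain g where g: "emb L le N N' g" "Id_on (univ N) = gr g (univ N)" by auto
 have gid: "g x = x" if "x \<in> univ N" for x
 proof -
  have "(x, x) \<in> gr g (univ N)" using that g(2) by blast
  then show ?thesis by simp
 qed
 have gU: "g ` univ N = univ N" using gid by force
 have "iso L N (restr N' (univ N)) g" "le (restr N' (univ N)) N'" using g(1) gU by (simp_all add: emb_def)
 then have "le N N'" using iso_id_eq gid by metis
 moreover have "\<iota> b \<in> univ N'" "\<iota> b \<notin> univ N" using UN' b k[of b] by (auto simp: \<iota>_def)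
 moreover have "N' \<in> KK" using KI' KK_iff by blast
 ultimately show ?thesis by blast
qed

text \<open>Unions of chains are upper bounds, so Zorn's lemma gives a maximal member. By
  \<open>proper_extension\<close> it has the size of the whole type.\<close>

lemma big_model: "\<exists>D d. KI (D, d) \<and> |univ D| =o |UNIV :: 'a set|"
proof -
 have a: "le N N'' ==> le N'' N ==> N = N''" "A \<in> KK ==> le A A" for N N'' A 
 proof -
  have "\<forall>A B. le A B \<and> le B A --> A = B" using aec unfolding aec_axioms_def by (elim conjE)
  then show "N = N''" if "le N N''" "le N'' N" using that by blast
  have "\<forall>A\<in>KK. le A A" using aec unfolding aec_axioms_def by (elim conjE)
  then show "le A A" if "A \<in> KK" using that by blast
 qed
 have po: "partial_order_on KK (relation_of le KK)"
  unfolding partial_order_on_def preorder_on_def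
 proof (intro conjI)
  show "relation_of le KK \<subseteq> KK \<times> KK" by (auto simp: relation_of_def)
  show "refl_on KK (relation_of le KK)" using a(2) by (auto simp: refl_on_def relation_of_def)
  show "trans (relation_of le KK)" 
  proof (rule transI)
   fix x y z assume "(x, y) \<in> relation_of le KK" "(y, z) \<in> relation_of le KK"
   then have "x \<in> KK" "z \<in> KK" "le x y" "le y z" by (auto simp: relation_of_def)
   then show "(x, z) \<in> relation_of le KK" using le_trans[of x y z] by (simp add: relation_of_def)
  qed
  show "antisym (relation_of le KK)" 
  proof (rule antisymI)
   fix x y assume "(x, y) \<in> relation_of le KK" "(y, x) \<in> relation_of le KK"
   then show "x = y" using a(1)[of x y] by (simp add: relation_of_def)
  qed
 qed
 have "\<exists>m\<in>KK. \<forall>a\<in>KK. le m a --> a = m"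
 proof (rule predicate_Zorn[OF po])
  fix C assume C: "C \<in> Chains (relation_of le KK)"
  have ch: "\<forall>A\<in>C. \<forall>B\<in>C. le A B \<or> le B A" and CK: "C \<subseteq> KK" using C by (auto simp: Chains_def relation_of_def)
  show "\<exists>u\<in>KK. \<forall>a\<in>C. le a u"
  proof (cases "C = {}")
   case True
   obtain N c where "KI (N, c)" using KI_ex by auto
   then have "N \<in> KK" using KK_iff by blast
   then show ?thesis using True by blast
  next
   case False
   show ?thesis using chain_le[OF False CK ch] by blast
  qed
 qed
 then obtain N where N: "N \<in> KK" "\<forall>a\<in>KK. le N a --> a = N" by blast
 obtain c where c: "KI (N, c)" using N(1) KK_iff by blast
 have "\<not> |univ N| <o |UNIV :: 'a set|" using proper_extension[OF c] N(2) by blast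
 then have "|UNIV :: 'a set| \<le>o |univ N|" using not_ordLess_iff_ordLeq[OF card_of_Well_order card_of_Well_order] by blast
 moreover have "|univ N| \<le>o |UNIV :: 'a set|" by (rule card_of_mono1) simp
 ultimately have "|univ N| =o |UNIV :: 'a set|" using ordIso_iff_ordLeq by blast
 then show ?thesis using c by blast
qed

text \<open>No basis is larger than the type, so a basis over the domain of \<open>G\<close> can be
  mapped injectively into \<open>V\<close>, and \<open>gext1\<close> follows this map.\<close>

lemma ext_into:
 assumes p: "fgood p" "fgood q" and G: "F.ciso p q G" and V: "V \<subseteq> U q" "indp (snd q) (Range G) V" "|UNIV :: 'a set| \<le>o |V|"
 shows "\<exists>h. F.ciso p q h \<and> G \<subseteq> h \<and> Domain h = U p \<and> Range h \<subseteq> snd q (Range G Un V)"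
proof -
 have pF: "p \<in> Collect fgood" "q \<in> Collect fgood" using p by simp_all
 interpret P: pregeo "U p" "snd p" by (rule fgood_pregeo[OF p(1)])
 interpret Q: pregeo "U q" "snd q" by (rule fgood_pregeo[OF p(2)])
 note GU = F.el_U[OF F.ciso_el[OF G]]
 obtain X where X: "X \<subseteq> U p" "indp (snd p) (Domain G) X" "U p \<subseteq> snd p (Domain G Un X)"
  by (rule P.basis_of[OF subset_refl GU(1)])
 have "|X| \<le>o |UNIV :: 'a set|" by (rule card_of_mono1) simp
 then have "|X| \<le>o |V|" using V(3) ordLeq_transitive by blast
 then have "\<exists>j. inj_on j X \<and> j ` X \<subseteq> V" unfolding card_of_ordLeq .
 then obtain j where j: "inj_on j X" "j ` X \<subseteq> V" by blast
 have jU: "j ` X \<subseteq> U q" using j(2) V(1) by blast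
 have i: "indp (snd q) (Range G) (j ` X)" by (rule Q.indp_subset[OF V(2) j(2) GU(2) V(1)])
 have bj: "bij_betw j X (j ` X)" using j(1) by (simp add: bij_betw_def)
 obtain h where h: "F.ciso p q h" "G \<subseteq> h" "Domain h = snd p (Domain G Un X)" "Range h = snd q (Range G Un j ` X)"
  using F.gext1[OF pF G X(1,2) jU i bj] by blast
 have "Domain h = U p" unfolding h(3) using X(1,3) P.cl_in[of "Domain G Un X"] GU(1) by blast
 moreover have "Range h \<subseteq> snd q (Range G Un V)" unfolding h(4) by (rule Q.cl_mono) (use j(2) GU(2) V(1) in auto)
 ultimately show ?thesis using h(1,2) by blast
qed

lemma start_ciso:
 assumes p: "fgood p" "fgood q"
 shows "\<exists>G. F.ciso p q G \<and> Domain G = snd p {} \<and> Range G = snd q {}"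
proof -
 have pF: "p \<in> Collect fgood" "q \<in> Collect fgood" using p by simp_all
 obtain G where "F.ciso p q G" "{} \<subseteq> G" "Domain G = snd p (Domain ({} :: ('a \<times> 'a) set))" "Range G = snd q (Range ({} :: ('a \<times> 'a) set))"
  by (rule F.cl_fin_el[OF pF F.qm0[OF pF] finite.emptyI])
 then have "F.ciso p q G \<and> Domain G = snd p {} \<and> Range G = snd q {}" by simp
 then show ?thesis by blast
qed

text \<open>In an amalgamation \<open>V0\<close> receives the common part, and \<open>V1\<close> is
  kept as room for the extensions.\<close>

lemma big_basis:
 "\<exists>D d V0 V1. KI (D, d) \<and> |univ D| =o |UNIV :: 'a set| \<and> V0 \<subseteq> univ D \<and> V1 \<subseteq> univ D \<and> indp d (d {}) V0 \<and> indp d (d V0) V1 \<and>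
  |UNIV :: 'a set| \<le>o |V0| \<and> |UNIV :: 'a set| \<le>o |V1|"
proof -
 obtain D d where D: "KI (D, d)" "|univ D| =o |UNIV :: 'a set|" using big_model by blast
 interpret P: pregeo "univ D" d using KI_pregeo[OF D(1)] by simp
 obtain V where V: "V \<subseteq> univ D" "indp d {} V" "univ D \<subseteq> d ({} Un V)" by (rule P.basis_of[OF subset_refl empty_subsetI])
 have nU: "natLeq <o |U (D, d)|" using ordLess_ordIso_trans[OF natLeq_UNIV ordIso_symmetric[OF D(2)]] by simp
 have "|{} :: 'a set| <o |U (D, d)|"
 proof -
  have "|{} :: 'a set| \<le>o natLeq" using countable_card_le_natLeq[of "{} :: 'a set"] by simp
  then show ?thesis using nU ordLeq_ordLess_trans by blast
 qed
 from F.basis_card[OF KI_F[OF D(1)] nU _ this, of V] have VD: "|V| =o |univ D|" using V by simp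
 have VU: "|UNIV :: 'a set| \<le>o |V|"
  by (rule ordIso_imp_ordLeq[OF ordIso_symmetric[OF ordIso_transitive[OF VD D(2)]]])
 have infU: "infinite (UNIV :: 'a set)" using unc countable_finite by blast
 have "infinite V" using card_of_ordLeq_infinite[OF VU infU] .
 then obtain V0 V1 where W: "V0 \<subseteq> V" "V1 \<subseteq> V" "V0 Int V1 = {}" "|V| \<le>o |V0|" "|V| \<le>o |V1|" using split_infinite[OF \<open>infinite V\<close>] by blast
 have WU: "V0 \<subseteq> univ D" "V1 \<subseteq> univ D" "V0 Un V1 \<subseteq> V" using W V(1) by auto
 have i: "indp d {} (V0 Un V1)" by (rule P.indp_subset[OF V(2) WU(3) _ V(1)]) simp
 have "indp d ({} Un V0) V1" by (rule P.indp_Un[OF i W(3) _ WU(1,2)]) simp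
 then have i1: "indp d (d V0) V1" using P.indp_cl[OF WU(1,2)] by simp
 have "indp d {} V0" by (rule P.indp_subset[OF V(2) W(1) _ V(1)]) simp
 then have "indp d (d {}) V0" using P.indp_cl[OF empty_subsetI WU(1)] by simp
 then show ?thesis using D WU(1,2) i1 ordLeq_transitive[OF VU W(4)] ordLeq_transitive[OF VU W(5)] by blast
qed

text \<open>A single member \<open>D\<close> of the size of the type witnesses all four statements.
  It is a monster model for each \<open>\<delta>\<close>, because isomorphisms between closed sets
  smaller than \<open>D\<close> extend by \<open>aut_ext\<close>. For amalgamation, \<open>A\<close>
  is sent into the closure of \<open>V0\<close>, and \<open>B\<close> and \<open>C\<close> are both
  extended over the image of \<open>A\<close> with values generated by \<open>V1\<close>; the images
  may overlap beyond \<open>A\<close>.\<close>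

lemma JEP: "JEP L KK le" and large: "arbitrarily_large KK"
 and monster_ex: "Card_order (\<delta> :: 'a rel) ==> \<exists>MM. monster L KK le \<delta> MM" and AP: "AP L KK le"
proof -
 obtain D d V0 V1 where D: "KI (D, d)" "|univ D| =o |UNIV :: 'a set|" "V0 \<subseteq> univ D" "V1 \<subseteq> univ D" "indp d (d {}) V0"
  "indp d (d V0) V1" "|UNIV :: 'a set| \<le>o |V0|" "|UNIV :: 'a set| \<le>o |V1|"
  using big_basis by blast
 have DK: "D \<in> KK" using D(1) KK_iff by blast
 have Dg: "fgood (D, d)" by (rule KI_fgood[OF D(1)])
 interpret P: pregeo "univ D" d using KI_pregeo[OF D(1)] by simp
 have into: "\<exists>h. F.ciso (A, c) (D, d) h \<and> Domain h = univ A \<and> Range h \<subseteq> d V0" if c: "KI (A, c)" for A c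
 proof -
  obtain G where G: "F.ciso (A, c) (D, d) G" "Range G = d {}" using start_ciso[OF KI_fgood[OF c] Dg] by auto
  have "\<exists>h. F.ciso (A, c) (D, d) h \<and> G \<subseteq> h \<and> Domain h = U (A, c) \<and> Range h \<subseteq> snd (D, d) (Range G Un V0)"
   by (rule ext_into[OF KI_fgood[OF c] Dg G(1)]) (use D(3,5,7) G(2) in simp_all)
  moreover have "d (d {} Un V0) = d V0" using P.cl_Un_cl[OF empty_subsetI D(3)] by simp
  ultimately show ?thesis using G(2) by auto
 qed
 have emb: "\<forall>A\<in>KK. \<exists>f. emb L le A D f"
 proof
  fix A assume A: "A \<in> KK"
  obtain c where c: "KI (A, c)" using A KK_iff by blast
  obtain h where "F.ciso (A, c) (D, d) h" "Domain h = univ A" using into[OF c] by blast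
  from embI[OF c D(1) this] show "\<exists>f. emb L le A D f" by blast
 qed
 then show "JEP L KK le" unfolding JEP_def using DK by blast
 show "arbitrarily_large KK"
  unfolding arbitrarily_large_def
 proof
  fix X :: "'a set"
  have "|X| \<le>o |UNIV :: 'a set|" by (rule card_of_mono1) simp
  then have "|X| \<le>o |univ D|" by (rule ordLeq_ordIso_trans[OF _ ordIso_symmetric[OF D(2)]])
  then show "\<exists>A\<in>KK. |X| \<le>o |univ A|" using DK by blast
 qed
 show "\<exists>MM. monster L KK le \<delta> MM" if \<delta>: "Card_order (\<delta> :: 'a rel)"
 proof -
  have "|Field \<delta>| \<le>o |UNIV :: 'a set|" by (rule card_of_mono1) simp
  then have "\<delta> \<le>o |UNIV :: 'a set|" by (rule ordIso_ordLeq_trans[OF ordIso_symmetric[OF card_of_Field_ordIso[OF \<delta>]]])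
  then have \<delta>D: "\<delta> \<le>o |univ D|" by (rule ordLeq_ordIso_trans[OF _ ordIso_symmetric[OF D(2)]])
  have nU: "natLeq <o |U (D, d)|" using ordLess_ordIso_trans[OF natLeq_UNIV ordIso_symmetric[OF D(2)]] by simp
  have "monster L KK le \<delta> D"
   unfolding monster_def
  proof (intro conjI allI impI ballI)
   show "D \<in> KK" by (rule DK)
   show "\<exists>f. emb L le A D f" if "A \<in> KK" for A using bspec[OF emb that] .
   fix A B g assume h: "le A D \<and> le B D \<and> |univ A| <o \<delta> \<and> |univ B| <o \<delta> \<and> iso L A B g"
   note a = leD[OF conjunct1[OF h] D(1)] and b = leD[OF conjunct1[OF conjunct2[OF h]] D(1)]
   have i: "iso L (restr D (univ A)) (restr D (univ B)) g" using h a(3) b(3) by metis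
   have s: "univ A \<subseteq> univ D" "univ B \<subseteq> univ D" using a(1) b(1) by (simp_all add: closed_set_def)
   note g = iso_restrD[OF i s]
   have ci: "F.ciso (D, d) (D, d) (gr g (univ A))" using g a(1) b(1) by (simp add: F.ciso_def)
   have "|univ A| <o |univ D|" using h \<delta>D ordLess_ordLeq_trans by blast
   then obtain f where f: "pel L D D f" "gr g (univ A) \<subseteq> f" "Domain f = univ D" "Range f = univ D"
    using F.aut_ext[OF KI_F[OF D(1)] nU ci] by auto
   obtain k where "f = gr k (Domain f)" by (rule pel_gr[OF f(1)])
   then have k: "f = gr k (univ D)" using f(3) by simp
   have kU: "k ` univ D = univ D" using f(4) by (subst (asm) k) simp
   have sD: "is_struct L D" using KI_struct[OF D(1)] by simp
   have "iso L D D k" by (rule pel_iso[OF sD sD _ kU]) (use f(1) k in simp)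
   moreover have "k x = g x" if "x \<in> univ A" for x
   proof -
    have "(x, g x) \<in> f" using f(2) that by (meson gr_simps(3) subsetD)
    then show ?thesis by (simp add: k)
   qed
   ultimately show "\<exists>h. iso L D D h \<and> (\<forall>x\<in>univ A. h x = g x)" by blast
  qed
  then show ?thesis by blast
 qed
 show "AP L KK le"
  unfolding AP_def
 proof (intro ballI allI impI)
  fix A B C f g assume K: "A \<in> KK" "B \<in> KK" "C \<in> KK" and fg: "emb L le A B f \<and> emb L le A C g"
  obtain a where a: "KI (A, a)" using K(1) KK_iff by blast
  obtain b where b: "KI (B, b)" using K(2) KK_iff by blast
  obtain c where c: "KI (C, c)" using K(3) KK_iff by blast
  obtain h where h: "F.ciso (A, a) (D, d) h" "Domain h = univ A" "Range h \<subseteq> d V0" using into[OF a] by blast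
  have ext: "\<exists>f'. emb L le B' D f' \<and> (\<forall>x\<in>univ A. (x, f' (f x)) \<in> h)"
   if e: "emb L le A B' f" and b: "KI (B', b)" for B' b f
  proof -
   note ce = embD[OF e a b]
   have "Range ((gr f (univ A))\<inverse>) = Domain h" using h(2) by simp
   note c3 = F.ciso_comp[OF F.ciso_converse[OF ce] h(1) this]
   have V0U: "d V0 \<subseteq> univ D" by (rule P.cl_in[OF D(3)])
   have "indp d (Range h) V1" by (rule P.indp_mono[OF D(6) h(3) V0U D(4)])
   then have ind: "indp (snd (D, d)) (Range ((gr f (univ A))\<inverse> O h)) V1" using c3(3) by simp
   have "\<exists>k. F.ciso (B', b) (D, d) k \<and> (gr f (univ A))\<inverse> O h \<subseteq> k \<and> Domain k = U (B', b) \<and>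
    Range k \<subseteq> snd (D, d) (Range ((gr f (univ A))\<inverse> O h) Un V1)"
    by (rule ext_into[OF KI_fgood[OF b] Dg c3(1) _ ind D(8)]) (use D(4) in simp)
   then obtain k where k: "F.ciso (B', b) (D, d) k" "(gr f (univ A))\<inverse> O h \<subseteq> k" "Domain k = univ B'" by auto
   obtain f' where f': "emb L le B' D f'" "k = gr f' (univ B')" using embI[OF b D(1) k(1,3)] by blast
   have "(x, f' (f x)) \<in> h" if x: "x \<in> univ A" for x
   proof -
    obtain y where y: "(x, y) \<in> h" using x h(2) by blast
    have "(x, f x) \<in> gr f (univ A)" using x by simp
    then have "(f x, y) \<in> k" using y k(2) by blast
    then have "y = f' (f x)" unfolding f'(2) by simp
    then show ?thesis using y by simp
   qed
   then show ?thesis using f'(1) by blast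
  qed
  obtain f' where f': "emb L le B D f'" "\<forall>x\<in>univ A. (x, f' (f x)) \<in> h" using ext[OF conjunct1[OF fg] b] by blast
  obtain g' where g': "emb L le C D g'" "\<forall>x\<in>univ A. (x, g' (g x)) \<in> h" using ext[OF conjunct2[OF fg] c] by blast
  have "f' (f x) = g' (g x)" if x: "x \<in> univ A" for x
   using pel_inj[OF F.ciso_el[OF h(1)], of x "f' (f x)" x "g' (g x)"] f'(2) g'(2) x by simp
  then show "\<exists>D\<in>KK. \<exists>f' g'. emb L le B D f' \<and> emb L le C D g' \<and> (\<forall>x\<in>univ A. f' (f x) = g' (g x))"
   using DK f'(1) g'(1) by blast
 qed
qed

text \<open>A smaller \<open>MM\<close> would itself be a model, isomorphic to a proper closed submodel, and homogeneity would
 extend the inverse isomorphism to an automorphism that is not injective.\<close>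

lemma monster_card:
 assumes \<delta>: "Card_order (\<delta> :: 'a rel)" and MM: "monster L KK le \<delta> MM"
 shows "\<exists>m. KI (MM, m) \<and> \<delta> \<le>o |univ MM|"
proof -
 obtain m where m: "KI (MM, m)" using MM KK_iff by (auto simp: monster_def)
 have "\<not> |univ MM| <o \<delta>"
 proof
  assume small: "|univ MM| <o \<delta>"
  obtain \<phi> b where b: "b \<in> univ MM" "b \<notin> \<phi> ` univ MM" and phi: "F.ciso (MM, m) (MM, m) (gr \<phi> (univ MM))" "inj_on \<phi> (univ MM)"
   using proper_copy[OF m] by auto
  define A where "A = \<phi> ` univ MM"
  have cA: "closed_set (univ MM) m A" using F.ciso_Range[OF phi(1)] by (simp add: A_def)
  have iA: "infd m A" using F.infd_image[OF KI_F[OF m] KI_F[OF m] phi(1)] KI_infd[OF m] by (simp add: A_def)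
  have leA: "le (restr MM A) MM" using KI_sub(3)[OF m, of A] cA iA by simp
  have sM: "is_struct L MM" using KI_struct[OF m] by simp
  have sA: "is_struct L (restr MM A)" using fgood_closed_struct[OF KI_fgood[OF m]] cA by simp
  have AU: "A \<subseteq> univ MM" using cA by (simp add: closed_set_def)
  let ?\<psi> = "inv_into (univ MM) \<phi>"
  have conv: "(gr \<phi> (univ MM))\<inverse> = gr ?\<psi> A"
  proof -
   have "gr ?\<psi> A = (\<lambda>x. (\<phi> x, ?\<psi> (\<phi> x))) ` univ MM" by (auto simp: gr_def A_def)
   also have "\<dots> = (\<lambda>x. (\<phi> x, x)) ` univ MM" by (rule image_cong) (use phi(2) in \<open>auto simp: inv_into_f_f\<close>)
   finally show ?thesis by (auto simp: gr_def)
  qed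
  have el: "pel L MM MM (gr ?\<psi> A)" using F.ciso_el[OF phi(1)] conv by (metis fst_conv pel_converse)
  have pA: "?\<psi> ` A = univ MM" unfolding A_def using phi(2) by (simp add: inv_into_image_cancel)
  have rM: "restr MM (univ MM) = MM" by (rule restr_univ[OF sM])
  have "iso L (restr MM A) (restr MM (?\<psi> ` A)) ?\<psi>"
   by (rule iso_restrI[OF sA AU _ _ el]) (use pA rM sM in simp_all)
  then have "iso L (restr MM A) MM ?\<psi>" using pA rM by simp
  moreover have "|univ (restr MM A)| <o \<delta>" using card_of_mono1[OF AU] small ordLeq_ordLess_trans by auto
  moreover have "\<forall>A B g. le A MM \<and> le B MM \<and> |univ A| <o \<delta> \<and> |univ B| <o \<delta> \<and> iso L A B g -->
    (\<exists>h. iso L MM MM h \<and> (\<forall>x\<in>univ A. h x = g x))" using MM unfolding monster_def by (elim conjE)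
  ultimately have "\<exists>h. iso L MM MM h \<and> (\<forall>x\<in>univ (restr MM A). h x = ?\<psi> x)"
   using leA le_refl[OF m] small by presburger
  then obtain h where h: "iso L MM MM h" "\<forall>x\<in>A. h x = ?\<psi> x" by auto
  have hi: "inj_on h (univ MM)" "h ` univ MM = univ MM" using h(1) by (simp_all add: iso_def bij_betw_def)
  have "h b \<in> univ MM" using hi(2) b(1) by blast
  then obtain x where x: "x \<in> A" "h b = ?\<psi> x" using pA by blast
  then have "h b = h x" using h(2) by simp
  then have "b = x" using inj_onD[OF hi(1)] b(1) x(1) AU by blast
  then show False using b(2) x(1) by (simp add: A_def)
 qed
 moreover have "Well_order \<delta>" using \<delta> by (simp add: card_order_on_def)
 ultimately have "\<delta> \<le>o |univ MM|" using not_ordLess_iff_ordLeq[OF \<open>Well_order \<delta>\<close> card_of_Well_order] by blast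
 then show ?thesis using m by blast
qed

end

section \<open>Weak types and independence in a monster model\<close>

context pregeo begin

text \<open>Take a minimal \<open>F\<close> in \<open>D\<close> that supports the dependence of
  \<open>y\<close> over \<open>A\<close> and \<open>S\<close>. By exchange each \<open>f\<close> in
  \<open>F\<close> depends on \<open>A\<close>, the rest of \<open>F\<close>, and \<open>Y\<close>.
  A minimal part of \<open>Y\<close> used for this is empty, since another exchange would make a
  point of \<open>Y\<close> depend on \<open>D\<close> and other points of \<open>Y\<close>. So
  \<open>f\<close> depends on \<open>A\<close> and the rest of \<open>F\<close>, against
  minimality.\<close>

lemma free_indep:
 assumes A: "A \<subseteq> D" "D \<subseteq> X" and Y: "Y \<subseteq> X" "indp cl D Y" and y: "y \<in> cl (A Un Y)" and S: "S \<subseteq> cl (A Un Y)"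
  and yD: "y \<in> cl (D Un S)"
 shows "y \<in> cl (A Un S)"
proof -
 have AY: "A Un Y \<subseteq> X" "A \<subseteq> X" using A Y by auto
 have SX: "S \<subseteq> X" "y \<in> X" using S y cl_in[OF AY(1)] by auto
 have AS: "A Un S \<subseteq> X" using AY SX by blast
 have "A Un S Un D = D Un S" using A(1) by blast
 then have "y \<in> cl (A Un S Un D)" using yD by simp
 then obtain F where F: "F \<subseteq> D" "finite F" "y \<in> cl (A Un S Un F)"
  "\<And>f. f \<in> F ==> y \<notin> cl (A Un S Un (F - {f}))" "\<And>f. f \<in> F ==> f \<in> cl (insert y (A Un S Un (F - {f})))"
  by (rule exch_min[OF AS A(2)]) blast
 have "F = {}"
 proof (rule ccontr)
  assume "F \<noteq> {}"
  then obtain f where f: "f \<in> F" by blast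
  let ?A = "A Un (F - {f})"
  have FX: "F \<subseteq> X" using F(1) A(2) by blast
  have AX: "?A \<subseteq> X" "?A Un Y \<subseteq> X" using FX AY Y(1) by auto
  have "cl (A Un Y) \<subseteq> cl (?A Un Y)" by (rule cl_mono[OF _ AX(2)]) blast
  moreover have "?A \<subseteq> cl (?A Un Y)" using cl_ext[OF AX(2)] by blast
  ultimately have "insert y (A Un S Un (F - {f})) \<subseteq> cl (?A Un Y)" using y S by blast
  then have "f \<in> cl (?A Un Y)" using cl_least[OF AX(2)] F(5)[OF f] by blast
  then obtain F2 where F2: "F2 \<subseteq> Y" "finite F2" "f \<in> cl (?A Un F2)"
   "\<And>g. g \<in> F2 ==> f \<notin> cl (?A Un (F2 - {g}))" "\<And>g. g \<in> F2 ==> g \<in> cl (insert f (?A Un (F2 - {g})))"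
   by (rule exch_min[OF AX(1) Y(1)]) blast
  have "F2 = {}"
  proof (rule ccontr)
   assume "F2 \<noteq> {}"
   then obtain g where g: "g \<in> F2" by blast
   have "insert f (?A Un (F2 - {g})) \<subseteq> D Un (F2 - {g})" using f F(1) A(1) by blast
   moreover have "D Un (F2 - {g}) \<subseteq> X" using A(2) F2(1) Y(1) by blast
   ultimately have "g \<in> cl (D Un (F2 - {g}))" using cl_mono F2(5)[OF g] by blast
   moreover have "g \<in> Y" "F2 - {g} \<subseteq> Y - {g}" using g F2(1) by auto
   ultimately show False using indp_notin'[OF Y(2) A(2) Y(1), of g "F2 - {g}"] by blast
  qed
  then have fA: "f \<in> cl ?A" using F2(3) by simp
  let ?B = "A Un S Un (F - {f})"
  have BX: "?B \<subseteq> X" using AS FX by blast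
  have "cl ?A \<subseteq> cl ?B" by (rule cl_mono[OF _ BX]) blast
  then have "A Un S Un F \<subseteq> cl ?B" using fA cl_ext[OF BX] by blast
  then have "y \<in> cl ?B" using cl_least[OF BX] F(3) by blast
  then show False using F(4)[OF f] by blast
 qed
 then show ?thesis using F(3) by simp
qed

lemma infd_super:
 assumes H: "infd cl H" "H \<subseteq> H'" and c: "closed_set X cl H'"
 shows "infd cl H'"
proof -
 have X: "H' \<subseteq> X" "H \<subseteq> X" using c H(2) by (auto simp: closed_set_def)
 obtain B where B: "B \<subseteq> H" "indp cl {} B" "H \<subseteq> cl ({} Un B)" by (rule basis_of[OF X(2) empty_subsetI])
 have inf: "infinite B" by (rule infd_infinite_basis[OF H(1) _ _ B(1), of "{}"]) (use B(3) in auto)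
 have "B \<subseteq> H'" using B(1) H(2) by blast
 then obtain B' where B': "B \<subseteq> B'" "B' \<subseteq> H'" "indp cl {} B'" "H' \<subseteq> cl ({} Un B')"
  by (rule max_indp[OF B(2) _ X(1) empty_subsetI])
 have "cl ({} Un B') = H'" using B'(4) cl_least'[OF c B'(2)] by auto
 moreover have "infinite B'" using inf B'(1) finite_subset by blast
 ultimately show ?thesis using infd_cl[OF _ B'(3) empty_subsetI, of ] B'(2) X(1) by auto
qed

end

lemma pel_Image_sub:
 assumes G: "pel L A B G" and K: "K \<subseteq> G" "S \<subseteq> Domain K"
 shows "G `` S = K `` S"
proof
 show "G `` S \<subseteq> K `` S"
 proof
  fix z assume "z \<in> G `` S"
  then obtain x where x: "x \<in> S" "(x, z) \<in> G" by blast
  then obtain w where w: "(x, w) \<in> K" using K(2) by blast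
  then have "(x, w) \<in> G" using K(1) by blast
  then have "w = z" using pel_inj[OF G, of x w x z] x(2) by simp
  then show "z \<in> K `` S" using x(1) w by blast
 qed
 show "K `` S \<subseteq> G `` S" using K(1) by blast
qed

lemma set_zip_same: "set (zip a a) = Id_on (set a)"
 by (induction a) auto

lemma Domain_zip: "length a = length b ==> Domain (set (zip a b)) = set a" and
 Range_zip: "length a = length b ==> Range (set (zip a b)) = set b"
 by (metis Domain_fst list.set_map map_fst_zip) (metis Range_snd list.set_map map_snd_zip)

lemma converse_zip: "length a = length b ==> (set (zip a b))\<inverse> = set (zip b a)"
 by (auto simp: set_zip_nth)

lemma rel_zip: "finite G ==> \<exists>b c. length b = length c \<and> set (zip b c) = G"
proof -
 assume "finite G"
 then obtain ps where ps: "set ps = G" using finite_list by blast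
 have "zip (map fst ps) (map snd ps) = ps" by (simp add: zip_map_fst_snd)
 then have "length (map fst ps) = length (map snd ps) \<and> set (zip (map fst ps) (map snd ps)) = G" using ps by simp
 then show ?thesis by (intro exI)
qed

text \<open>A monster model enters through its membership in the class and its size, both supplied
  by \<open>monster_card\<close>; its automorphisms are produced by \<open>aut_ext\<close>.\<close>

locale monK = qmK L M cl ty
 for L :: "('f, 'r) lang" and M :: "('f, 'r, 'm) struct" and cl :: "'m set \<Rightarrow> 'm set" and ty :: "'a itself" +
 fixes MM :: "('f, 'r, 'a) struct" and m :: "'a set \<Rightarrow> 'a set" and \<delta> :: "'a rel"
 assumes KIM: "KI (MM, m)" and \<delta>: "Card_order \<delta>" "natLeq <o \<delta>" "\<delta> \<le>o |univ MM|"
begin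

sublocale P: pregeo "univ MM" m
 using KI_pregeo[OF KIM] by simp

abbreviation (input) "E G \<equiv> pel L MM MM G"
abbreviation (input) "cls H \<equiv> closed_set (univ MM) m H"

lemma PF: "(MM, m) \<in> Collect fgood" by (rule KI_F[OF KIM])
lemma nU: "natLeq <o |univ MM|" by (rule ordLess_ordLeq_trans[OF \<delta>(2,3)])
lemma sM: "is_struct L MM" using KI_struct[OF KIM] by simp

lemma E_full:
 assumes f: "E f" "Domain f = univ MM" "Range f = univ MM"
 shows "\<exists>h. f = gr h (univ MM) \<and> iso L MM MM h"
proof -
 obtain h where "f = gr h (Domain f)" by (rule pel_gr[OF f(1)])
 then have h: "f = gr h (univ MM)" using f(2) by simp
 have "h ` univ MM = univ MM" using f(3) by (subst (asm) h) simp
 then have "iso L MM MM h" using pel_iso[OF sM sM] f(1) h by simp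
 then show ?thesis using h by blast
qed

text \<open>Weak types test finite parameter sets by automorphisms, \<open>pel\<close> tests finite
  tuples by formulas. The two meet because \<open>aut_ext_fin\<close> extends a finite elementary
  map to an automorphism.\<close>

lemma wtp_iff:
 assumes b: "set b \<subseteq> univ MM" "set c \<subseteq> univ MM" and A: "A \<subseteq> univ MM"
 shows "wtp_eq L MM b c A \<longleftrightarrow> length b = length c \<and> E (set (zip b c) Un Id_on A)"
proof
 assume w: "wtp_eq L MM b c A"
 have g: "\<exists>f. iso L MM MM f \<and> (\<forall>x\<in>B. f x = x) \<and> map f b = c" if "B \<subseteq> A" "finite B" for B
  using w that unfolding wtp_eq_def gtp_eq_def Aut_def by blast
 obtain f where "map f b = c" using g[of "{}"] by blast
 then have len: "length b = length c" by auto
 have "E (set (zip b c) Un Id_on A)"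
 proof (rule pel_finite)
  fix Q assume Q: "Q \<subseteq> set (zip b c) Un Id_on A" "finite Q"
  let ?B = "Domain Q Int A"
  have "finite ?B" using Q(2) by (simp add: finite_Domain)
  then obtain f where f: "iso L MM MM f" "\<forall>x\<in>?B. f x = x" "map f b = c" using g[of ?B] by blast
  have "Q \<subseteq> gr f (univ MM)"
  proof
   fix t assume t: "t \<in> Q"
   obtain x y where xy: "t = (x, y)" by force
   have "(x, y) \<in> set (zip b c) \<or> x = y \<and> x \<in> A" using Q(1) t xy by auto
   then show "t \<in> gr f (univ MM)"
   proof
    assume "(x, y) \<in> set (zip b c)"
    then have "x \<in> set b \<and> y = f x" unfolding f(3)[symmetric] by (auto simp: set_zip)
    then show ?thesis using b xy by auto
   next
    assume h: "x = y \<and> x \<in> A"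
    then have "x \<in> ?B" using t xy by blast
    then show ?thesis using f(2) h A xy by auto
   qed
  qed
  then show "E Q" by (rule pel_subset[OF iso_pel[OF f(1)]])
 qed
 then show "length b = length c \<and> E (set (zip b c) Un Id_on A)" using len by simp
next
 assume h: "length b = length c \<and> E (set (zip b c) Un Id_on A)"
 show "wtp_eq L MM b c A"
  unfolding wtp_eq_def
 proof (intro allI impI)
  fix B assume B: "B \<subseteq> A" "finite B"
  let ?G = "set (zip b c) Un Id_on B"
  have EG: "E ?G" by (rule pel_subset[OF conjunct2[OF h]]) (use B(1) in auto)
  have "Id_on B = (\<lambda>x. (x, x)) ` B" by auto
  then have "finite ?G" using B(2) by simp
  then obtain f where f: "E f" "?G \<subseteq> f" "Domain f = univ MM" "Range f = univ MM"
   using F.aut_ext_fin[OF PF, of ?G] nU EG by auto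
  obtain k where k: "f = gr k (univ MM)" "iso L MM MM k" using E_full[OF f(1,3,4)] by blast
  have "k x = x" if "x \<in> B" for x
  proof -
   have "(x, x) \<in> gr k (univ MM)" using that f(2) k(1) by blast
   then show ?thesis by simp
  qed
  moreover have "map k b = c"
  proof (rule nth_equalityI)
   show "length (map k b) = length c" using h by simp
   fix i assume i: "i < length (map k b)"
   then have "(b ! i, c ! i) \<in> set (zip b c)" using h by (auto simp: set_zip)
   then have "(b ! i, c ! i) \<in> gr k (univ MM)" using f(2) k(1) by blast
   then show "map k b ! i = c ! i" using i by simp
  qed
  ultimately show "gtp_eq L MM b c B" using k(2) unfolding gtp_eq_def Aut_def by blast
 qed
qed

lemma wtp_mono: "wtp_eq L MM b c A ==> B \<subseteq> A ==> wtp_eq L MM b c B"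
 unfolding wtp_eq_def by (meson subset_trans)

lemma wtp_len: "wtp_eq L MM b c A ==> length b = length c"
proof -
 assume "wtp_eq L MM b c A"
 then have "gtp_eq L MM b c {}" unfolding wtp_eq_def by (meson empty_subsetI finite.emptyI)
 then obtain f where "map f b = c" unfolding gtp_eq_def by blast
 then show ?thesis by auto
qed

lemma model_iff: "model le \<delta> MM A \<longleftrightarrow> cls A \<and> infd m A \<and> |A| <o \<delta>"
proof
 assume h: "model le \<delta> MM A"
 then have "le (restr MM A) MM" "|A| <o \<delta>" by (simp_all add: model_def)
 then show "cls A \<and> infd m A \<and> |A| <o \<delta>" using leD(1,2)[OF _ KIM, of "restr MM A"] by simp
next
 assume h: "cls A \<and> infd m A \<and> |A| <o \<delta>"
 then have "le (restr MM A) MM" using KI_sub(3)[OF KIM, of A] by simp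
 then show "model le \<delta> MM A" using h by (simp add: model_def closed_set_def)
qed

lemma modelD: "model le \<delta> MM A ==> cls A" "model le \<delta> MM A ==> infd m A" "model le \<delta> MM A ==> |A| <o \<delta>"
 "model le \<delta> MM A ==> A \<subseteq> univ MM"
 unfolding model_iff by (simp_all add: closed_set_def)

text \<open>A pair of tuples with the same type over \<open>A\<close> amounts to a finite elementary
  relation inside \<open>B \<union> C\<close> fixing \<open>A\<close>, so nonsplitting becomes
  extension by the identity on \<open>a\<close>. One direction is \<open>indep_dep\<close>. For the
  other, a basis \<open>Y\<close> of \<open>a\<close> over \<open>B \<union> C\<close> generates
  \<open>a\<close> already over \<open>B\<close> by the assumption on dependences, and
  \<open>indep_fin\<close> applies.\<close>

lemma indep_iff:
 assumes B: "cls B" "infd m B" and C: "C \<subseteq> univ MM" and a: "set a \<subseteq> univ MM"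
 shows "indep L MM a B C \<longleftrightarrow> (\<forall>y\<in>set a. \<forall>S\<subseteq>set a. y \<in> m (B Un C Un S) --> y \<in> m (B Un S))"
proof
 have BU: "B \<subseteq> univ MM" using B(1) by (simp add: closed_set_def)
 assume "indep L MM a B C"
 then obtain A where A: "A \<subseteq> B" "finite A" "\<not> splits L MM a (B Un C) A" unfolding indep_def by blast
 have AU: "A \<subseteq> univ MM" using A(1) BU by blast
 have ns: "\<forall>G. finite G --> E G --> Domain G \<subseteq> B Un C --> Range G \<subseteq> B Un C --> Id_on A \<subseteq> G --> E (G Un Id_on (set a))"
 proof (intro allI impI)
  fix G assume G: "finite G" "E G" "Domain G \<subseteq> B Un C" "Range G \<subseteq> B Un C" "Id_on A \<subseteq> G"
  obtain b c where bc: "length b = length c" "set (zip b c) = G" using rel_zip[OF G(1)] by blast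
  have sb: "set b \<subseteq> B Un C" "set c \<subseteq> B Un C" using Domain_zip[OF bc(1)] Range_zip[OF bc(1)] bc(2) G(3,4) by auto
  then have sU: "set b \<subseteq> univ MM" "set c \<subseteq> univ MM" using BU C by auto
  have GA: "G Un Id_on A = G" using G(5) by blast
  then have "wtp_eq L MM b c A" using wtp_iff[OF sU AU] bc G(2) by simp
  then have "wtp_eq L MM (a @ b) (a @ c) A" using A(3) sb unfolding splits_def by blast
  then have "E (set (zip (a @ b) (a @ c)) Un Id_on A)" using wtp_iff[of "a @ b" "a @ c" A] a sU AU by simp
  moreover have "set (zip (a @ b) (a @ c)) Un Id_on A = G Un Id_on (set a)"
   using bc G(5) by (auto simp: set_zip_same)
  ultimately show "E (G Un Id_on (set a))" by simp
 qed
 show "\<forall>y\<in>set a. \<forall>S\<subseteq>set a. y \<in> m (B Un C Un S) --> y \<in> m (B Un S)"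
 proof (intro ballI allI impI)
  fix y S assume y: "y \<in> set a" "S \<subseteq> set a" "y \<in> m (B Un C Un S)"
  show "y \<in> m (B Un S)"
   using F.indep_dep[OF PF _ _ _ finite_set _ A(1,2) _ y(1,2), of C] B C a ns y(3) by simp
 qed
next
 have BU: "B \<subseteq> univ MM" using B(1) by (simp add: closed_set_def)
 then have BC: "B Un C \<subseteq> univ MM" using C by blast
 assume d: "\<forall>y\<in>set a. \<forall>S\<subseteq>set a. y \<in> m (B Un C Un S) --> y \<in> m (B Un S)"
 obtain Y where Y: "Y \<subseteq> set a" "indp m (B Un C) Y" "set a \<subseteq> m (B Un C Un Y)" by (rule P.basis_of[OF a BC])
 have aY: "set a \<subseteq> m (B Un Y)" using d Y(1,3) by blast
 have fY: "finite Y" "Y \<subseteq> univ MM" using Y(1) a finite_subset[OF Y(1) finite_set] by auto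
 have "\<exists>b\<subseteq>B. finite b \<and> (\<forall>G. E G --> Domain G \<subseteq> B Un C --> Range G \<subseteq> B Un C --> Id_on b \<subseteq> G --> E (G Un Id_on (set a)))"
  using F.indep_fin[OF PF, of B C Y "set a"] B C fY Y(2) aY by simp
 then obtain k where k: "k \<subseteq> B" "finite k"
  "\<forall>G. E G --> Domain G \<subseteq> B Un C --> Range G \<subseteq> B Un C --> Id_on k \<subseteq> G --> E (G Un Id_on (set a))" by blast
 have kU: "k \<subseteq> univ MM" using k(1) BU by blast
 have "\<not> splits L MM a (B Un C) k"
 proof
  assume "splits L MM a (B Un C) k"
  then obtain b c where bc: "set b \<subseteq> B Un C" "set c \<subseteq> B Un C" "wtp_eq L MM b c k" "\<not> wtp_eq L MM (a @ b) (a @ c) k"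
   unfolding splits_def by blast
  have sU: "set b \<subseteq> univ MM" "set c \<subseteq> univ MM" using bc(1,2) BC by auto
  let ?G = "set (zip b c) Un Id_on k"
  have G: "length b = length c" "E ?G" using wtp_iff[OF sU kU] bc(3) by simp_all
  have "Domain ?G \<subseteq> B Un C" "Range ?G \<subseteq> B Un C"
   using Domain_zip[OF G(1)] Range_zip[OF G(1)] bc(1,2) k(1) by auto
  then have "E (?G Un Id_on (set a))" using k(3)[rule_format, OF G(2)] by blast
  moreover have "set (zip (a @ b) (a @ c)) Un Id_on k = ?G Un Id_on (set a)"
   using G(1) by (auto simp: set_zip_same)
  ultimately have "wtp_eq L MM (a @ b) (a @ c) k" using wtp_iff[of "a @ b" "a @ c" k] a sU kU G(1) by simp
  then show False using bc(4) by blast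
 qed
 then show "indep L MM a B C" unfolding indep_def using k(1,2) by blast
qed

lemma model_cl:
 assumes A: "model le \<delta> MM A" "A \<subseteq> Z" "Z \<subseteq> univ MM" "|Z| <o \<delta>"
 shows "model le \<delta> MM (m Z)"
proof -
 have c: "cls (m Z)" by (rule P.closed_cl[OF A(3)])
 have "A \<subseteq> m Z" using A(2) P.cl_ext[OF A(3)] by blast
 then have "infd m (m Z)" by (rule P.infd_super[OF modelD(2)[OF A(1)] _ c])
 moreover have "|m Z| <o \<delta>" using F.card_cl_less[OF PF _ \<delta>(1,2) A(4)] A(3) by simp
 ultimately show ?thesis using c model_iff by blast
qed

section \<open>The axioms of a FUR-class\<close>

lemma AI_MM: "AI L le \<delta> MM"
 unfolding AI_def
proof (intro allI impI)
 fix \<A> b A assume h: "model le \<delta> MM \<A> \<and> countable \<A>" "set b \<subseteq> univ MM \<and> A \<subseteq> \<A> \<and> finite A"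
 note md = modelD[OF conjunct1[OF h(1)]]
 have "\<exists>G. E G \<and> Id_on A \<subseteq> G \<and> set b \<subseteq> Domain G \<and> Range G \<subseteq> \<A>"
  using F.saturated[OF PF, of \<A> A "set b"] md h(2) by simp
 then obtain G where G: "E G" "Id_on A \<subseteq> G" "set b \<subseteq> Domain G" "Range G \<subseteq> \<A>" by blast
 obtain g where g: "G = gr g (Domain G)" by (rule pel_gr[OF G(1)])
 have zip: "set (zip b (map g b)) \<subseteq> G"
 proof
  fix t assume "t \<in> set (zip b (map g b))"
  then obtain x where x: "x \<in> set b" "t = (x, g x)" by (auto simp: set_zip)
  then have "t \<in> gr g (Domain G)" using G(3) by auto
  then show "t \<in> G" using g by simp
 qed
 have "set (map g b) \<subseteq> Range G" using zip Range_zip[of b "map g b"] by (metis Range_mono length_map)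
 then have a: "set (map g b) \<subseteq> \<A>" "set (map g b) \<subseteq> univ MM" using G(4) md(4) by auto
 have "E (set (zip b (map g b)) Un Id_on A)" by (rule pel_subset[OF G(1)]) (use zip G(2) in blast)
 then have "E ((set (zip b (map g b)) Un Id_on A)\<inverse>)" by simp
 moreover have "(set (zip b (map g b)) Un Id_on A)\<inverse> = set (zip (map g b) b) Un Id_on A"
  using converse_zip[of b "map g b"] by (auto simp: converse_Un)
 ultimately have "wtp_eq L MM (map g b) b A" using wtp_iff[OF a(2), of b A] h(2) md(4) by auto
 then show "\<exists>a. set a \<subseteq> \<A> \<and> wtp_eq L MM a b A" using a(1) by blast
qed

text \<open>Prepares the use of \<open>isol_generic\<close>: as \<open>a\<close> and
  \<open>a'\<close> have the same type over \<open>H\<close>, the image of \<open>Y\<close> is again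
  independent over \<open>H\<close>.\<close>

lemma zip_transfer:
 assumes "length a = length a'" "length s = length s'" and k: "finite k" "k \<subseteq> H" and H: "cls H"
  and Y: "Y \<subseteq> set a" "indp m H Y"
  and 1: "E (set (zip a' a) Un Id_on H)" and 2: "E (set (zip (a' @ s') (a @ s)) Un Id_on k)"
 shows "\<exists>G. G = set (zip (a @ s) (a' @ s')) Un Id_on k \<and> E G \<and> Domain G = k Un set (a @ s) \<and> indp m H (G `` Y)"
proof -
 define G where "G = set (zip (a @ s) (a' @ s')) Un Id_on k"
 have len: "length (a @ s) = length (a' @ s')" using assms(1,2) by simp
 have HU: "H \<subseteq> univ MM" using H by (simp add: closed_set_def)
 have "G = (set (zip (a' @ s') (a @ s)) Un Id_on k)\<inverse>"
  unfolding G_def converse_Un using converse_zip[OF len[symmetric]] by simp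
 then have EG: "E G" using 2 by simp
 let ?K = "set (zip a a')"
 let ?G0 = "?K Un Id_on H"
 have "?G0 = (set (zip a' a) Un Id_on H)\<inverse>" unfolding converse_Un using converse_zip[OF assms(1)[symmetric]] by simp
 then have E0: "E ?G0" using 1 by simp
 have DK: "Y \<subseteq> Domain ?K" using Y(1) Domain_zip[OF assms(1)] by simp
 have KG: "?K \<subseteq> G" unfolding G_def using assms(1) by auto
 have eq: "G `` Y = ?G0 `` Y" using pel_Image_sub[OF EG KG DK] pel_Image_sub[OF E0 _ DK] by simp
 have "?G0 `` H = H" by (rule pel_Image_Id[OF E0]) simp
 moreover have "H \<subseteq> Domain ?G0" "Y \<subseteq> Domain ?G0" using DK by blast+
 ultimately have "indp m H (?G0 `` Y)"
  using F.indp_image[OF PF PF, of ?G0 H Y] E0 Y(2) by simp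
 moreover have "Domain G = k Un set (a @ s)" unfolding G_def using Domain_zip[OF len] by auto
 ultimately show ?thesis using EG eq G_def by auto
qed

text \<open>The model is the closure of \<open>\<A>\<close> and \<open>a\<close>, enumerated in any
  way. For each initial segment, \<open>isol_generic\<close> with a basis \<open>Y\<close> of
  \<open>a\<close> over \<open>\<A>\<close> yields the required finite part of
  \<open>\<A>\<close>.\<close>

lemma AII_MM: "AII L le \<delta> MM"
 unfolding AII_def
proof (intro allI impI)
 fix a \<A> assume h: "set a \<subseteq> univ MM \<and> model le \<delta> MM \<A> \<and> countable \<A>"
 then have a: "set a \<subseteq> univ MM" and mA: "model le \<delta> MM \<A>" and cA: "countable \<A>" by simp_all
 note md = modelD[OF mA]
 have Z: "\<A> Un set a \<subseteq> univ MM" "countable (\<A> Un set a)" using md(4) a cA by (auto simp: countable_finite)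
 have "|\<A> Un set a| <o \<delta>"
  using Z(2) countable_card_le_natLeq[of "\<A> Un set a"] ordLeq_ordLess_trans[OF _ \<delta>(2)] by blast
 then have mB: "model le \<delta> MM (m (\<A> Un set a))" using model_cl[OF mA _ Z(1)] by blast
 let ?B = "m (\<A> Un set a)"
 have cB: "countable ?B" using F.countable_closure[OF PF Z(2)] Z(1) by simp
 have sub: "\<A> Un set a \<subseteq> ?B" by (rule P.cl_ext[OF Z(1)])
 have BU: "?B \<subseteq> univ MM" by (rule P.cl_in[OF Z(1)])
 have "infinite \<A>" using md(2) P.cl_ext[OF md(4)] unfolding infd_def by blast
 then have ne: "?B \<noteq> {}" using sub by auto
 define s where "s = from_nat_into ?B"
 have rs: "range s = ?B" unfolding s_def by (rule range_from_nat_into[OF ne cB])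
 obtain Y where Y: "Y \<subseteq> set a" "indp m \<A> Y" "set a \<subseteq> m (\<A> Un Y)" by (rule P.basis_of[OF a md(4)])
 have YU: "finite Y" "Y \<subseteq> univ MM" "\<A> Un Y \<subseteq> univ MM" using Y(1) a md(4) finite_subset[OF Y(1) finite_set] by auto
 have BY: "?B \<subseteq> m (\<A> Un Y)" by (rule P.cl_least[OF YU(3)]) (use Y(3) P.cl_ext[OF YU(3)] in blast)
 have "\<exists>A\<subseteq>\<A>. finite A \<and> (\<forall>a' s'. set a' \<subseteq> univ MM \<and> set s' \<subseteq> univ MM \<and> length s' = Suc n \<and> wtp_eq L MM a' a \<A> \<and>
   wtp_eq L MM (a' @ s') (a @ map s [0..<Suc n]) A --> wtp_eq L MM (a' @ s') (a @ map s [0..<Suc n]) \<A>)" for n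
 proof -
  define t where "t = map s [0..<Suc n]"
  have tB: "set t \<subseteq> ?B" using rs by (auto simp: t_def)
  let ?e = "set (a @ t)"
  have eY: "?e \<subseteq> snd (MM, m) (\<A> Un Y)" using sub tB BY by auto
  have eU: "?e \<subseteq> univ MM" using a tB BU by auto
  obtain k where k: "k \<subseteq> \<A>" "finite k" "?e \<subseteq> snd (MM, m) (k Un Y)"
   "\<forall>G. F.el (MM, m) (MM, m) G --> Domain G = k Un Y Un ?e --> Id_on k \<subseteq> G --> indp (snd (MM, m)) \<A> (G `` Y) --> F.el (MM, m) (MM, m) (G Un Id_on \<A>)"
   by (rule F.isol_generic[OF PF _ cA YU(1) _ _ finite_set eY]) (use md(1) YU(2) Y(2) in simp_all)
  have kU: "k \<subseteq> univ MM" using k(1) md(4) by blast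
  have "wtp_eq L MM (a' @ s') (a @ t) \<A>"
   if h: "set a' \<subseteq> univ MM" "set s' \<subseteq> univ MM" "length s' = Suc n" "wtp_eq L MM a' a \<A>" "wtp_eq L MM (a' @ s') (a @ t) k" for a' s'
  proof -
   have len: "length a = length a'" "length t = length s'" using wtp_len[OF h(4)] h(3) by (simp_all add: t_def)
   have e1: "E (set (zip a' a) Un Id_on \<A>)" using wtp_iff[OF h(1) a md(4)] h(4) by simp
   have as: "set (a' @ s') \<subseteq> univ MM" using h(1,2) by simp
   have e2: "E (set (zip (a' @ s') (a @ t)) Un Id_on k)" using wtp_iff[OF as eU kU] h(5) by simp
   obtain G where G: "G = set (zip (a @ t) (a' @ s')) Un Id_on k" "E G" "Domain G = k Un ?e" "indp m \<A> (G `` Y)"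
    using zip_transfer[OF len k(2,1) md(1) Y(1,2) e1 e2] by blast
   have "Domain G = k Un Y Un ?e" using G(3) Y(1) by auto
   moreover have "Id_on k \<subseteq> G" unfolding G(1) by blast
   ultimately have "E (G Un Id_on \<A>)" using k(4) G(2,4) by simp
   then have "E ((G Un Id_on \<A>)\<inverse>)" by simp
   moreover have "(G Un Id_on \<A>)\<inverse> = set (zip (a' @ s') (a @ t)) Un Id_on \<A>"
    unfolding G(1) converse_Un using converse_zip[of "a @ t" "a' @ s'"] len k(1) by auto
   ultimately show ?thesis using wtp_iff[OF as eU md(4)] len by simp
  qed
  then show ?thesis using k(1,2) unfolding t_def by blast
 qed
 moreover have "?B = \<A> Un set a Un range s" using rs sub by blast
 ultimately have "s_primary L le \<delta> MM ?B \<A> a" unfolding s_primary_def using mB by blast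
 then show "\<exists>\<B>. s_primary L le \<delta> MM \<B> \<A> a" by blast
qed

text \<open>From a minimal set \<open>F\<close> of elements of \<open>\<B>\<close> on which
  \<open>y\<close> depends, exchange produces an element of \<open>F\<close> depending on
  \<open>\<A>\<close>, \<open>a\<close> and the rest of \<open>F\<close>. Independence of
  \<open>\<B>\<close> from \<open>a\<close> removes \<open>a\<close> from this dependence, which
  contradicts minimality.\<close>

lemma AV_MM: "AV L le \<delta> MM"
 unfolding AV_def
proof (intro allI impI)
 fix \<A> \<B> a assume h: "model le \<delta> MM \<A> \<and> countable \<A> \<and> model le \<delta> MM \<B> \<and> countable \<B> \<and> \<A> \<subseteq> \<B> \<and>
  set a \<subseteq> univ MM \<and> set_indep L MM \<B> \<A> (set a)"
 then have A: "model le \<delta> MM \<A>" and B: "model le \<delta> MM \<B>" and AB: "\<A> \<subseteq> \<B>" and a: "set a \<subseteq> univ MM"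
  and si: "set_indep L MM \<B> \<A> (set a)" by simp_all
 note mA = modelD[OF A] and mB = modelD[OF B]
 have "y \<in> m (\<A> Un S)" if y: "y \<in> set a" "S \<subseteq> set a" "y \<in> m (\<A> Un \<B> Un S)" for y S
 proof -
  have AS: "\<A> Un S \<subseteq> univ MM" using mA(4) y(2) a by blast
  have "y \<in> m (\<A> Un S Un \<B>)" using y(3) by (simp add: Un_ac)
  then obtain F where F: "F \<subseteq> \<B>" "finite F" "y \<in> m (\<A> Un S Un F)"
   "\<And>f. f \<in> F ==> y \<notin> m (\<A> Un S Un (F - {f}))" "\<And>f. f \<in> F ==> f \<in> m (insert y (\<A> Un S Un (F - {f})))"
   by (rule P.exch_min[OF AS mB(4)]) blast
  have "F = {}"
  proof (rule ccontr)
   assume "F \<noteq> {}"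
   then obtain f where f: "f \<in> F" by blast
   obtain l where l: "set l = F" using finite_list[OF F(2)] by blast
   have FU: "F \<subseteq> univ MM" using F(1) mB(4) by blast
   have "indep L MM l \<A> (set a)" using si l F(1) by (simp add: set_indep_def)
   then have d: "\<forall>y\<in>F. \<forall>S\<subseteq>F. y \<in> m (\<A> Un set a Un S) --> y \<in> m (\<A> Un S)"
    using indep_iff[OF mA(1,2) a, of l] l FU by simp
   have "insert y (\<A> Un S Un (F - {f})) \<subseteq> \<A> Un set a Un (F - {f})" using y(1,2) by blast
   moreover have "\<A> Un set a Un (F - {f}) \<subseteq> univ MM" using mA(4) a FU by blast
   ultimately have "f \<in> m (\<A> Un set a Un (F - {f}))" using P.cl_mono F(5)[OF f] by blast
   then have fA: "f \<in> m (\<A> Un (F - {f}))" using d f by blast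
   let ?B = "\<A> Un S Un (F - {f})"
   have BX: "?B \<subseteq> univ MM" using AS FU by blast
   have "m (\<A> Un (F - {f})) \<subseteq> m ?B" by (rule P.cl_mono[OF _ BX]) blast
   then have "\<A> Un S Un F \<subseteq> m ?B" using fA P.cl_ext[OF BX] by blast
   then have "y \<in> m ?B" using P.cl_least[OF BX] F(3) by blast
   then show False using F(4)[OF f] by blast
  qed
  then show ?thesis using F(3) by simp
 qed
 then have "\<forall>y\<in>set a. \<forall>S\<subseteq>set a. y \<in> m (\<A> Un \<B> Un S) --> y \<in> m (\<A> Un S)" by blast
 then show "indep L MM a \<A> \<B>" using indep_iff[OF mA(1,2) mB(4) a] by blast
qed

text \<open>Together with \<open>set_indep_indp\<close> this reduces independence of generated sets,
  which speaks of all tuples, to independence of a generating set; \<open>free_indep\<close> makes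
  the transition.\<close>

lemma set_indep_free:
 assumes B: "model le \<delta> MM B" and C: "B \<subseteq> C" "C \<subseteq> univ MM" and Y: "Y \<subseteq> univ MM" "indp m C Y" and A: "A \<subseteq> m (B Un Y)"
 shows "set_indep L MM A B C"
 unfolding set_indep_def
proof (intro allI impI)
 fix a assume a: "set a \<subseteq> A"
 note mB = modelD[OF B]
 have "B Un Y \<subseteq> univ MM" using mB(4) Y(1) by blast
 then have aU: "set a \<subseteq> univ MM" using a A P.cl_in by blast
 have BC: "B Un C = C" using C(1) by blast
 have "\<forall>y\<in>set a. \<forall>S\<subseteq>set a. y \<in> m (B Un C Un S) --> y \<in> m (B Un S)"
  unfolding BC
 proof (intro ballI allI impI)
  fix y S assume h: "y \<in> set a" "S \<subseteq> set a" "y \<in> m (C Un S)"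
  show "y \<in> m (B Un S)" by (rule P.free_indep[OF C Y _ _ h(3)]) (use h(1,2) a A in auto)
 qed
 then show "indep L MM a B C" using indep_iff[OF mB(1,2) C(2) aU] by blast
qed

text \<open>A dependence inside \<open>X\<close> involves finitely many elements. Applied to a tuple
  listing them, \<open>indep_iff\<close> moves the dependence from \<open>B \<union> C\<close> down
  to \<open>B\<close>.\<close>

lemma set_indep_indp:
 assumes B: "model le \<delta> MM B" and C: "C \<subseteq> univ MM" and X: "X \<subseteq> univ MM" "indp m B X" and i: "set_indep L MM A B C" "X \<subseteq> A"
 shows "indp m (B Un C) X"
 unfolding indp_def
proof (intro ballI notI)
 note mB = modelD[OF B]
 fix x assume x: "x \<in> X" "x \<in> m (B Un C Un (X - {x}))"
 have u: "B Un C \<subseteq> univ MM" "X - {x} \<subseteq> univ MM" using mB(4) C X(1) by auto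
 have "{x} \<subseteq> m ((X - {x}) Un (B Un C))" using x(2) by (simp add: Un_commute)
 then obtain S where S: "S \<subseteq> X - {x}" "finite S" "{x} \<subseteq> m (S Un (B Un C))"
  using P.cl_fin_Un[OF u(2,1), of "{x}"] by blast
 obtain l where l: "set l = insert x S" using finite_list[of "insert x S"] S(2) by blast
 have lX: "set l \<subseteq> X" unfolding l using S(1) x(1) by auto
 then have lA: "set l \<subseteq> A" "set l \<subseteq> univ MM" using i(2) X(1) by auto
 have "indep L MM l B C" using i(1) lA(1) by (simp add: set_indep_def)
 then have "\<forall>y\<in>insert x S. \<forall>T\<subseteq>insert x S. y \<in> m (B Un C Un T) --> y \<in> m (B Un T)"
  using indep_iff[OF mB(1,2) C lA(2)] l by simp
 then have "x \<in> m (B Un C Un S) --> x \<in> m (B Un S)" by blast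
 moreover have "x \<in> m (B Un C Un S)" using S(3) by (simp add: Un_commute)
 moreover have "x \<notin> m (B Un S)" by (rule P.indp_notin'[OF X(2) mB(4) X(1) x(1) S(1)])
 ultimately show False by blast
qed

text \<open>A basis \<open>Y\<close> of \<open>\<B>\<close> over \<open>\<A>\<close> is mapped into
  a basis of \<open>MM\<close> over \<open>\<D>\<close>, which has full size because
  \<open>\<D>\<close> is small. The isomorphism fixing \<open>\<A>\<close> that follows this map
  gives \<open>\<C>\<close>, and an automorphism extending it serves for every finite part of
  \<open>\<A>\<close>.\<close>

lemma AVI_MM: "AVI L le \<delta> MM"
 unfolding AVI_def
proof (intro allI impI)
 fix \<A> \<B> \<D> assume h: "model le \<delta> MM \<A> \<and> model le \<delta> MM \<B> \<and> model le \<delta> MM \<D> \<and> \<A> \<subseteq> \<B> Int \<D>"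
 then have A: "model le \<delta> MM \<A>" and B: "model le \<delta> MM \<B>" and D: "model le \<delta> MM \<D>" and sub: "\<A> \<subseteq> \<B>" "\<A> \<subseteq> \<D>" by auto
 note mA = modelD[OF A] and mB = modelD[OF B] and mD = modelD[OF D]
 obtain Y where Y: "Y \<subseteq> \<B>" "indp m \<A> Y" "\<B> \<subseteq> m (\<A> Un Y)" by (rule P.basis_of[OF mB(4) mA(4)])
 have YU: "Y \<subseteq> univ MM" using Y(1) mB(4) by blast
 have eqB: "m (\<A> Un Y) = \<B>" using Y(3) P.cl_least'[OF mB(1)] sub(1) Y(1) by (meson Un_least subset_antisym)
 obtain V where V: "V \<subseteq> univ MM" "indp m \<D> V" "univ MM \<subseteq> m (\<D> Un V)" by (rule P.basis_of[OF subset_refl mD(4)])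
 have lt: "|\<B>| <o |univ MM|" "|\<D>| <o |univ MM|" by (rule ordLess_ordLeq_trans[OF mB(3) \<delta>(3)], rule ordLess_ordLeq_trans[OF mD(3) \<delta>(3)])
 have "|V| =o |univ MM|" using F.basis_card[OF PF, of \<D> V] nU mD(4) lt(2) V(1,3) by simp
 moreover have "|Y| \<le>o |univ MM|" by (rule card_of_mono1[OF YU])
 ultimately have "|Y| \<le>o |V|" using ordIso_symmetric ordLeq_ordIso_trans by blast
 then have "\<exists>j. inj_on j Y \<and> j ` Y \<subseteq> V" unfolding card_of_ordLeq .
 then obtain j where j: "inj_on j Y" "j ` Y \<subseteq> V" by blast
 have jU: "j ` Y \<subseteq> univ MM" using j(2) V(1) by blast
 have iD: "indp m \<D> (j ` Y)" by (rule P.indp_subset[OF V(2) j(2) mD(4) V(1)])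
 have iA: "indp m \<A> (j ` Y)" by (rule P.indp_mono[OF iD sub(2) mD(4) jU])
 have I: "F.ciso (MM, m) (MM, m) (Id_on \<A>)" by (rule F.ciso_Id_on) (use mA(1) in simp)
 have DI: "Domain (Id_on \<A>) = \<A>" "Range (Id_on \<A>) = \<A>" by auto
 have bj: "bij_betw j Y (j ` Y)" using j(1) by (simp add: bij_betw_def)
 obtain f where f: "F.ciso (MM, m) (MM, m) f" "Id_on \<A> \<subseteq> f" "Domain f = \<B>" "Range f = m (\<A> Un j ` Y)"
  using F.gext1[OF PF PF I _ _ _ _ bj] YU Y(2) jU iA eqB by (auto simp: DI)
 have Ef: "E f" using F.ciso_el[OF f(1)] by simp
 obtain g where "f = gr g (Domain f)" by (rule pel_gr[OF Ef])
 then have g: "f = gr g \<B>" using f(3) by simp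
 have RC: "g ` \<B> = m (\<A> Un j ` Y)" using f(4) by (subst (asm) g) simp
 let ?C = "m (\<A> Un j ` Y)"
 have C: "model le \<delta> MM ?C"
  unfolding model_iff
 proof (intro conjI)
  show "cls ?C" using F.ciso_Range[OF f(1)] f(4) by simp
  show "infd m ?C" using F.infd_image[OF PF PF f(1)] f(3,4) mB(2) by simp
  have "|g ` \<B>| \<le>o |\<B>|" by (rule card_of_image)
  then show "|?C| <o \<delta>" using RC ordLeq_ordLess_trans[OF _ mB(3)] by simp
 qed
 have "set_wtp_eq L MM \<B> ?C \<A>"
  unfolding set_wtp_eq_def
 proof (intro exI[of _ g] conjI allI impI)
  show "g ` \<B> = ?C" by (rule RC)
  fix A0 assume A0: "A0 \<subseteq> \<A>" "finite A0"
  obtain f' where f': "E f'" "f \<subseteq> f'" "Domain f' = univ MM" "Range f' = univ MM"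
   using F.aut_ext[OF PF _ f(1)] nU lt(1) f(3) by auto
  obtain k where k: "f' = gr k (univ MM)" "iso L MM MM k" using E_full[OF f'(1,3,4)] by blast
  have kf: "k x = y" if "(x, y) \<in> f" for x y
  proof -
   have "(x, y) \<in> gr k (univ MM)" using that f'(2) k(1) by blast
   then show ?thesis by simp
  qed
  have "k x = x" if "x \<in> A0" for x by (rule kf) (use that A0(1) f(2) in blast)
  moreover have "k x = g x" if "x \<in> \<B>" for x by (rule kf) (use that g in simp)
  ultimately show "\<exists>f\<in>Aut L MM A0. \<forall>x\<in>\<B>. f x = g x" using k(2) unfolding Aut_def by blast
 qed
 moreover have "set_indep L MM ?C \<A> \<D>" by (rule set_indep_free[OF A sub(2) mD(4) jU iD subset_refl])
 ultimately show "\<exists>\<C>. model le \<delta> MM \<C> \<and> set_wtp_eq L MM \<B> \<C> \<A> \<and> set_indep L MM \<C> \<A> \<D>" using C by blast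
qed

lemma model_KI: "model le \<delta> MM A ==> KI (restr MM A, m)"
 using KI_sub(1)[OF KIM, of A] modelD by simp

lemma model_struct: "model le \<delta> MM A ==> is_struct L (restr MM A)"
 using KI_struct[OF model_KI] by simp

lemma model_embI:
 assumes D: "model le \<delta> MM D" and B: "model le \<delta> MM B" and f: "E f" "Domain f = D" "cls (Range f)" "Range f \<subseteq> B"
 shows "\<exists>g. emb L le (restr MM D) (restr MM B) g \<and> f = gr g D"
proof -
 have "f \<subseteq> Domain f \<times> Range f" by auto
 then have "f \<subseteq> D \<times> B" using f(2,4) by blast
 then have "pel L (restr MM D) (restr MM B) f"
  using pel_restr_iff[OF model_struct[OF D] modelD(4)[OF D] model_struct[OF B] modelD(4)[OF B]] f(1) by blast
 then have "F.ciso (restr MM D, m) (restr MM B, m) f"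
  using f(2-4) modelD(1)[OF D] by (simp add: F.ciso_def closed_set_def)
 from embI[OF model_KI[OF D] model_KI[OF B] this] show ?thesis using f(2) by simp
qed

lemma model_embD:
 assumes D: "model le \<delta> MM D" and B: "model le \<delta> MM B" and g: "emb L le (restr MM D) (restr MM B) g"
 shows "E (gr g D)" "g ` D \<subseteq> B"
proof -
 have c: "F.ciso (restr MM D, m) (restr MM B, m) (gr g D)" using embD[OF g model_KI[OF D] model_KI[OF B]] by simp
 show gB: "g ` D \<subseteq> B" using F.ciso_Range[OF c] by (simp add: closed_set_def)
 have "gr g D \<subseteq> D \<times> B" using gB by (auto simp: gr_def)
 then show "E (gr g D)"
  using pel_restr_iff[OF model_struct[OF D] modelD(4)[OF D] model_struct[OF B] modelD(4)[OF B]] F.ciso_el[OF c] by simp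
qed

text \<open>The model is the closure \<open>D\<close> of \<open>\<A> \<union> \<C>\<close>, and
  weakly elementary maps extend to it by \<open>gext2\<close>. For uniqueness, an embedding over
  \<open>\<A> \<union> \<C>\<close> of another s-prime model into \<open>D\<close> preserves
  closures in both directions, so that model contains nothing outside \<open>D\<close>. The final
  clause holds because a basis \<open>X\<close> of \<open>\<A>\<close> over \<open>\<B>\<close>
  generates \<open>D\<close> over \<open>\<C>\<close> and stays independent over
  \<open>\<C>'\<close>.\<close>

lemma AIII_MM: "AIII L le \<delta> MM"
 unfolding AIII_def
proof (intro allI impI)
 fix \<A> \<B> \<C> assume h: "model le \<delta> MM \<A> \<and> model le \<delta> MM \<B> \<and> model le \<delta> MM \<C> \<and> set_indep L MM \<A> \<B> \<C> \<and> \<B> = \<A> Int \<C>"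
 then have A: "model le \<delta> MM \<A>" and B: "model le \<delta> MM \<B>" and C: "model le \<delta> MM \<C>" and i: "set_indep L MM \<A> \<B> \<C>"
  and BAC: "\<B> = \<A> Int \<C>" by blast+
 note mA = modelD[OF A] and mB = modelD[OF B] and mC = modelD[OF C]
 have BC: "\<B> \<subseteq> \<A>" "\<B> \<subseteq> \<C>" using BAC by auto
 have U: "\<A> Un \<C> \<subseteq> univ MM" using mA(4) mC(4) by blast
 obtain X where X: "X \<subseteq> \<A>" "indp m \<B> X" "\<A> \<subseteq> m (\<B> Un X)" by (rule P.basis_of[OF mA(4) mB(4)])
 have XU: "X \<subseteq> univ MM" using X(1) mA(4) by blast
 have eqA: "\<A> = m (\<B> Un X)" using X(3) P.cl_least'[OF mA(1)] BC(1) X(1) by (meson Un_least subset_antisym)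
 have gen: "indp m \<C>' X" if C': "model le \<delta> MM \<C>'" "\<C> \<subseteq> \<C>'" "set_indep L MM \<A> \<B> \<C>'" for \<C>'
 proof -
  have "\<B> Un \<C>' = \<C>'" using BC(2) C'(2) by blast
  then show ?thesis using set_indep_indp[OF B modelD(4)[OF C'(1)] XU X(2) C'(3) X(1)] by simp
 qed
 have XC: "indp m \<C> X" by (rule gen[OF C subset_refl i])
 define D where "D = m (\<A> Un \<C>)"
 have inf: "\<not> finite (Field \<delta>)"
 proof
  assume "finite (Field \<delta>)"
  then have "|Field \<delta>| <o natLeq" by (simp add: finite_iff_ordLess_natLeq)
  then have "\<delta> <o natLeq" by (rule ordIso_ordLess_trans[OF ordIso_symmetric[OF card_of_Field_ordIso[OF \<delta>(1)]]])
  then show False using \<delta>(2) ordLess_transitive ordLess_irreflexive by blast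
 qed
 have "|\<A> Un \<C>| <o \<delta>" by (rule card_of_Un_ordLess_infinite_Field[OF inf \<delta>(1) mA(3) mC(3)])
 then have D: "model le \<delta> MM D" unfolding D_def using model_cl[OF A _ U] by blast
 have subD: "\<A> Un \<C> \<subseteq> D" unfolding D_def by (rule P.cl_ext[OF U])
 have un: "\<Union>{\<A>, \<C>} = \<A> Un \<C>" by simp
 have sp: "s_prime L le \<delta> MM {\<A>, \<C>} D"
  unfolding s_prime_def un
 proof (intro conjI allI impI)
  show "model le \<delta> MM D" by (rule D)
  show "\<A> Un \<C> \<subseteq> D" by (rule subD)
  fix B' f assume hf: "model le \<delta> MM B' \<and> f ` (\<A> Un \<C>) \<subseteq> B' \<and> weakly_elementary L le MM {\<A>, \<C>} f"
  then have B': "model le \<delta> MM B'" and fB: "f ` (\<A> Un \<C>) \<subseteq> B'"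
   and w: "\<And>a. set a \<subseteq> \<A> Un \<C> ==> wtp_eq L MM a (map f a) {}" "le (restr MM (f ` \<A>)) MM" "le (restr MM (f ` \<C>)) MM"
   by (simp_all add: weakly_elementary_def)
  have fU: "f ` (\<A> Un \<C>) \<subseteq> univ MM" using fB modelD(4)[OF B'] by blast
  let ?f = "gr f (\<A> Un \<C>)"
  have Ef: "E ?f"
  proof (rule pel_finite)
   fix Q assume Q: "Q \<subseteq> ?f" "finite Q"
   have "finite (Domain Q)" using Q(2) by (rule finite_Domain)
   from finite_list[OF this] obtain a where a: "set a = Domain Q" by blast
   have "Domain Q \<subseteq> Domain ?f" by (rule Domain_mono[OF Q(1)])
   then have aD: "set a \<subseteq> \<A> Un \<C>" using a by simp
   have aU: "set a \<subseteq> univ MM" "set (map f a) \<subseteq> univ MM" using aD U fU by auto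
   have "E (set (zip a (map f a)) Un Id_on {})" using wtp_iff[OF aU, of "{}"] w(1)[OF aD] by simp
   moreover have "Q \<subseteq> set (zip a (map f a)) Un Id_on {}"
   proof
    fix t assume t: "t \<in> Q"
    then have "t \<in> ?f" using Q(1) by blast
    then obtain x where x: "t = (x, f x)" by (auto simp: gr_def)
    then have "x \<in> Domain Q" using t by blast
    then have "x \<in> set a" using a by simp
    then show "t \<in> set (zip a (map f a)) Un Id_on {}" using x by (auto simp: set_zip in_set_conv_nth)
   qed
   ultimately show "E Q" by (rule pel_subset)
  qed
  have cA: "cls (f ` \<A>)" "cls (f ` \<C>)" using leD(1)[OF w(2) KIM] leD(1)[OF w(3) KIM] by simp_all
  have im: "?f `` \<A> = f ` \<A>" "?f `` \<C> = f ` \<C>" "?f `` (\<A> Un \<C>) = f ` (\<A> Un \<C>)" by (simp_all add: gr_Image)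
  have gE: "F.el (MM, m) (MM, m) ?f" and g1: "Domain ?f = \<A> Un \<C>" using Ef by simp_all
  have g2: "F.clo (MM, m) \<A>" and g4: "F.clo (MM, m) \<C>" and g6: "F.clo (MM, m) \<B>" and g7: "infd (snd (MM, m)) \<B>"
   and g8: "indp (snd (MM, m)) \<C> X" and g9: "\<A> = snd (MM, m) (\<B> Un X)"
   by (simp_all only: fst_conv snd_conv) (rule mA(1) mC(1) mB(1) mB(2) XC eqA)+
  have g3: "F.clo (MM, m) (?f `` \<A>)" and g5: "F.clo (MM, m) (?f `` \<C>)" unfolding im fst_conv snd_conv by (rule cA)+
  have "\<exists>f'. F.ciso (MM, m) (MM, m) f' \<and> ?f \<subseteq> f' \<and> Domain f' = snd (MM, m) (\<A> Un \<C>) \<and> Range f' = snd (MM, m) (?f `` (\<A> Un \<C>))"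
   using F.gext2[OF PF PF gE g1 g2 g3 g4 g5 BAC g6 g7 X(1) g8 g9] .
  then obtain f' where f0: "F.ciso (MM, m) (MM, m) f'" "?f \<subseteq> f'" "Domain f' = snd (MM, m) (\<A> Un \<C>)"
   "Range f' = snd (MM, m) (?f `` (\<A> Un \<C>))" by blast
  have "Domain f' = D" "Range f' = m (f ` (\<A> Un \<C>))" using f0(3,4) unfolding im D_def by simp_all
  note f' = f0(1,2) this
  have Ef': "E f'" using F.ciso_el[OF f'(1)] by simp
  have cf': "cls (Range f')" using F.ciso_Range[OF f'(1)] by simp
  have rB: "Range f' \<subseteq> B'" unfolding f'(4) by (rule P.cl_least'[OF modelD(1)[OF B'] fB])
  obtain g where g: "emb L le (restr MM D) (restr MM B') g" "f' = gr g D" using model_embI[OF D B' Ef' f'(3) cf' rB] by blast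
  have "g x = f x" if "x \<in> \<A> Un \<C>" for x
  proof -
   have "(x, f x) \<in> ?f" using that by simp
   then have "(x, f x) \<in> gr g D" using f'(2) g(2) by blast
   then show ?thesis by simp
  qed
  then show "\<exists>g. emb L le (restr MM D) (restr MM B') g \<and> (\<forall>x\<in>\<A> Un \<C>. g x = f x)" using g(1) by blast
 qed
 have uniq: "D' = D" if D': "s_prime L le \<delta> MM {\<A>, \<C>} D'" for D'
 proof -
  have d: "model le \<delta> MM D'" "\<A> Un \<C> \<subseteq> D'"
   and e: "\<forall>B f. model le \<delta> MM B \<and> f ` (\<A> Un \<C>) \<subseteq> B \<and> weakly_elementary L le MM {\<A>, \<C>} f -->
    (\<exists>g. emb L le (restr MM D') (restr MM B) g \<and> (\<forall>x\<in>\<A> Un \<C>. g x = f x))"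
   using D' unfolding s_prime_def un by blast+
  have we: "weakly_elementary L le MM {\<A>, \<C>} id"
   unfolding weakly_elementary_def un
  proof (intro conjI allI impI ballI)
   show "id ` (\<A> Un \<C>) \<subseteq> univ MM" using U by simp
   fix a assume a: "set a \<subseteq> \<A> Un \<C>"
   have "E (Id_on (set a))" by (rule pel_Id_on) (use a U in auto)
   moreover have aU: "set a \<subseteq> univ MM" using a U by (rule subset_trans)
   ultimately show "wtp_eq L MM a (map id a) {}" using wtp_iff[OF aU aU, of "{}"] by (simp add: set_zip_same)
  next
   fix H assume "H \<in> {\<A>, \<C>}"
   then have "model le \<delta> MM H" using A C by blast
   then show "le (restr MM (id ` H)) MM" by (simp add: model_def)
  qed
  have "id ` (\<A> Un \<C>) \<subseteq> D" using subD by simp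
  with e[rule_format, of D id] D we obtain g where g0: "emb L le (restr MM D') (restr MM D) g" "\<forall>x\<in>\<A> Un \<C>. g x = id x" by blast
  then have g: "emb L le (restr MM D') (restr MM D) g" "\<forall>x\<in>\<A> Un \<C>. g x = x" by simp_all
  note eg = model_embD[OF d(1) D g(1)]
  have Id: "Id_on (\<A> Un \<C>) \<subseteq> gr g D'" using g(2) d(2) by auto
  have "x \<in> D" if x: "x \<in> D'" for x
  proof -
   have "g x \<in> m (\<A> Un \<C>)" using eg(2) x unfolding D_def by blast
   moreover have "(x, g x) \<in> gr g D'" using x by simp
   ultimately show ?thesis using F.cl_iff_Id[OF PF, of "gr g D'" x "g x" "\<A> Un \<C>"] eg(1) Id by (simp add: D_def)
  qed
  moreover have "D \<subseteq> D'" unfolding D_def by (rule P.cl_least'[OF modelD(1)[OF d(1)] d(2)])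
  ultimately show ?thesis by blast
 qed
 have fur: "set_indep L MM D \<C> \<C>'" if C': "model le \<delta> MM \<C>' \<and> \<C> \<subseteq> \<C>' \<and> set_indep L MM \<A> \<B> \<C>'" for \<C>'
 proof -
  have c: "model le \<delta> MM \<C>'" "\<C> \<subseteq> \<C>'" "set_indep L MM \<A> \<B> \<C>'" using C' by simp_all
  have CX: "\<C> Un X \<subseteq> univ MM" using mC(4) XU by blast
  have "m (\<B> Un X) \<subseteq> m (\<C> Un X)" by (rule P.cl_mono[OF _ CX]) (use BC(2) in blast)
  then have "\<A> Un \<C> \<subseteq> m (\<C> Un X)" using eqA P.cl_ext[OF CX] by blast
  then have "D \<subseteq> m (\<C> Un X)" unfolding D_def by (rule P.cl_least[OF CX])
  then show ?thesis by (rule set_indep_free[OF C c(2) modelD(4)[OF c(1)] XU gen[OF c]])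
 qed
 show "\<exists>\<D>. s_prime L le \<delta> MM {\<A>, \<C>} \<D> \<and> (\<forall>\<D>'. s_prime L le \<delta> MM {\<A>, \<C>} \<D>' --> \<D>' = \<D>) \<and>
  (\<forall>\<C>'. model le \<delta> MM \<C>' \<and> \<C> \<subseteq> \<C>' \<and> set_indep L MM \<A> \<B> \<C>' --> set_indep L MM \<D> \<C> \<C>')"
 proof (intro exI[of _ D] conjI allI impI)
  show "s_prime L le \<delta> MM {\<A>, \<C>} D" by (rule sp)
  show "D' = D" if "s_prime L le \<delta> MM {\<A>, \<C>} D'" for D' by (rule uniq[OF that])
  show "set_indep L MM D \<C> \<C>'" if "model le \<delta> MM \<C>' \<and> \<C> \<subseteq> \<C>' \<and> set_indep L MM \<A> \<B> \<C>'" for \<C>' by (rule fur[OF that])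
 qed
qed

text \<open>The rank of \<open>b\<close> over \<open>\<A>\<close> is the least size of a part of \<open>b\<close> that generates \<open>b\<close> over \<open>\<A>\<close>. If
 player II answers with \<open>k\<close>, the next move of player I must lower the rank.\<close>

lemma isolating_set:
 assumes A: "model le \<delta> MM \<A>" "countable \<A>" and b: "set b \<subseteq> univ MM"
  and Y: "Y \<subseteq> set b" "set b \<subseteq> m (\<A> Un Y)" and min: "\<forall>Z\<subseteq>set b. set b \<subseteq> m (\<A> Un Z) --> card Y \<le> card Z"
 shows "\<exists>k\<subseteq>\<A>. finite k \<and> (\<forall>b'. set b' \<subseteq> univ MM --> wtp_eq L MM b' b k --> \<not> wtp_eq L MM b' b \<A> -->
  (\<exists>Z\<subseteq>set b'. set b' \<subseteq> m (\<A> Un Z) \<and> card Z < card Y))"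
proof -
 note mA = modelD[OF A(1)]
 have YU: "finite Y" "Y \<subseteq> univ MM" "\<A> Un Y \<subseteq> univ MM" using Y(1) b mA(4) finite_subset[OF Y(1) finite_set] by auto
 have drop: "\<exists>z\<in>Z. W \<subseteq> m (\<A> Un (Z - {z}))"
  if Z: "\<not> indp m \<A> Z" "W \<subseteq> m (\<A> Un Z)" "Z \<subseteq> univ MM" for Z W
 proof -
  obtain z where z: "z \<in> Z" "z \<in> m (\<A> Un (Z - {z}))" using Z(1) unfolding indp_def by blast
  have u: "\<A> Un (Z - {z}) \<subseteq> univ MM" using mA(4) Z(3) by blast
  have "\<A> Un Z \<subseteq> m (\<A> Un (Z - {z}))" using z(2) P.cl_ext[OF u] by blast
  then show ?thesis using P.cl_least[OF u] Z(2) z(1) by blast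
 qed
 have iY: "indp m \<A> Y"
 proof (rule ccontr)
  assume "\<not> indp m \<A> Y"
  then obtain z where z: "z \<in> Y" "set b \<subseteq> m (\<A> Un (Y - {z}))" using drop[OF _ Y(2) YU(2)] by blast
  have "card Y \<le> card (Y - {z})" using min[rule_format, of "Y - {z}"] z(2) Y(1) by blast
  moreover have "card (Y - {z}) < card Y" using z(1) YU(1) by (rule card_Diff1_less[rotated])
  ultimately show False by simp
 qed
 have bY: "set b \<subseteq> snd (MM, m) (\<A> Un Y)" using Y(2) by simp
 obtain k where k: "k \<subseteq> \<A>" "finite k" "set b \<subseteq> snd (MM, m) (k Un Y)"
  "\<forall>G. F.el (MM, m) (MM, m) G --> Domain G = k Un Y Un set b --> Id_on k \<subseteq> G --> indp (snd (MM, m)) \<A> (G `` Y) --> F.el (MM, m) (MM, m) (G Un Id_on \<A>)"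
  by (rule F.isol_generic[OF PF _ A(2) YU(1) _ _ finite_set bY]) (use mA(1) YU(2) iY in simp_all)
 have kU: "k \<subseteq> univ MM" using k(1) mA(4) by blast
 have "\<exists>Z\<subseteq>set b'. set b' \<subseteq> m (\<A> Un Z) \<and> card Z < card Y"
  if h: "set b' \<subseteq> univ MM" "wtp_eq L MM b' b k" "\<not> wtp_eq L MM b' b \<A>" for b'
 proof -
  have len: "length b = length b'" "E (set (zip b' b) Un Id_on k)" using wtp_iff[OF h(1) b kU] h(2) by simp_all
  define G where "G = set (zip b b') Un Id_on k"
  have Gc: "G = (set (zip b' b) Un Id_on k)\<inverse>" unfolding G_def converse_Un using converse_zip[OF len(1)[symmetric]] by simp
  then have EG: "E G" using len(2) by simp
  have DG: "Domain G = k Un Y Un set b" unfolding G_def using Domain_zip[OF len(1)] Y(1) by auto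
  have IG: "Id_on k \<subseteq> G" unfolding G_def by blast
  let ?Z = "G `` Y"
  have "\<not> indp m \<A> ?Z"
  proof
   assume "indp m \<A> ?Z"
   then have "E (G Un Id_on \<A>)" using k(4) EG DG IG by simp
   then have "E ((G Un Id_on \<A>)\<inverse>)" by simp
   moreover have "(G Un Id_on \<A>)\<inverse> = set (zip b' b) Un Id_on \<A>"
    unfolding G_def converse_Un using converse_zip[OF len(1)] k(1) by auto
   ultimately show False using wtp_iff[OF h(1) b mA(4)] h(3) len(1) by simp
  qed
  moreover have Zb: "?Z \<subseteq> set b'"
  proof -
   have "G `` Y = set (zip b b') `` Y"
    by (rule pel_Image_sub[OF EG]) (use G_def Domain_zip[OF len(1)] Y(1) in auto)
   also have "\<dots> \<subseteq> Range (set (zip b b'))" by blast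
   finally show ?thesis using Range_zip[OF len(1)] by simp
  qed
  moreover have "set b' \<subseteq> m (\<A> Un ?Z)"
  proof
   fix y assume "y \<in> set b'"
   then obtain x where x: "(x, y) \<in> set (zip b b')" using Range_zip[OF len(1)] by blast
   then have xb: "x \<in> set b" using Domain_zip[OF len(1)] by blast
   have "(x, y) \<in> G" using x by (simp add: G_def)
   moreover have "k Un Y \<subseteq> Domain G" using DG by blast
   ultimately have "y \<in> m (G `` (k Un Y))"
    using F.cl_iff_Image[OF PF PF, of G x y "k Un Y"] EG k(3) xb by auto
   moreover have "G `` (k Un Y) \<subseteq> \<A> Un ?Z" using pel_Image_Id[OF EG IG] k(1) by blast
   moreover have "\<A> Un ?Z \<subseteq> univ MM" using mA(4) Zb h(1) by blast
   ultimately show "y \<in> m (\<A> Un ?Z)" using P.cl_mono by blast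
  qed
  moreover have "?Z \<subseteq> univ MM" using Zb h(1) by blast
  ultimately obtain z where z: "z \<in> ?Z" "set b' \<subseteq> m (\<A> Un (?Z - {z}))" using drop by blast
  have "finite ?Z" using Zb finite_subset by blast
  then have "card (?Z - {z}) < card ?Z" using z(1) by (rule card_Diff1_less)
  also have "card ?Z \<le> card Y"
  proof -
   obtain g where "G = gr g (Domain G)" by (rule pel_gr[OF EG])
   then have "?Z = g ` Y" using gr_Image[of Y "Domain G" g] DG by (metis Un_upper1 Un_upper2 subset_trans)
   then show ?thesis using card_image_le[OF YU(1)] by simp
  qed
  finally show ?thesis using z(2) Zb by (intro exI[of _ "?Z - {z}"]) auto
 qed
 then show ?thesis using k(1,2) by blast
qed

lemma AIV_MM: "AIV L le \<delta> MM"
 unfolding AIV_def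
proof (intro allI impI)
 fix a assume a: "set a \<subseteq> univ MM"
 show "\<exists>n. \<forall>\<A> A. model le \<delta> MM \<A> \<and> countable \<A> \<and> A \<subseteq> \<A> \<and> finite A --> (\<exists>\<sigma>. gi_winning L MM \<A> a A n \<sigma>)"
 \<comment> \<open>One more than the length of \<open>a\<close>: the first move is made against the
   given set \<open>A\<close>, before player II has answered, and need not lower the rank. After it
   the rank is at most the length, and each further move lowers it.\<close>
 proof (intro exI[of _ "Suc (length a)"] allI impI)
  fix \<A> A assume h: "model le \<delta> MM \<A> \<and> countable \<A> \<and> A \<subseteq> \<A> \<and> finite A"
  then have mA: "model le \<delta> MM \<A>" and cA: "countable \<A>" and A: "A \<subseteq> \<A>" "finite A" by simp_all
  define sp where "sp b n \<longleftrightarrow> (\<exists>Z\<subseteq>set b. set b \<subseteq> m (\<A> Un Z) \<and> card Z = n)" for b n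
  define \<mu> where "\<mu> b = (LEAST n. sp b n)" for b
  have sp0: "sp b (card (set b))" if "set b \<subseteq> univ MM" for b
  proof -
   have "\<A> Un set b \<subseteq> univ MM" using that modelD(4)[OF mA] by blast
   then have "set b \<subseteq> m (\<A> Un set b)" using P.cl_ext by blast
   then show ?thesis unfolding sp_def by blast
  qed
  have \<mu>le: "\<mu> b \<le> n" if "sp b n" for b n unfolding \<mu>_def by (rule Least_le[of "sp b", OF that])
  have ex: "\<exists>k\<subseteq>\<A>. finite k \<and> (\<forall>b'. set b' \<subseteq> univ MM --> wtp_eq L MM b' b k --> \<not> wtp_eq L MM b' b \<A> --> \<mu> b' < \<mu> b)"
   if b: "set b \<subseteq> univ MM" for b
  proof -
   have "sp b (\<mu> b)" unfolding \<mu>_def by (rule LeastI[of "sp b", OF sp0[OF b]])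
   then obtain Y where Y: "Y \<subseteq> set b" "set b \<subseteq> m (\<A> Un Y)" "card Y = \<mu> b" unfolding sp_def by blast
   have min: "\<forall>Z\<subseteq>set b. set b \<subseteq> m (\<A> Un Z) --> card Y \<le> card Z"
   proof (intro allI impI)
    fix Z assume "Z \<subseteq> set b" "set b \<subseteq> m (\<A> Un Z)"
    then have "sp b (card Z)" unfolding sp_def by blast
    then show "card Y \<le> card Z" unfolding Y(3) by (rule \<mu>le)
   qed
   obtain k where k: "k \<subseteq> \<A>" "finite k" "\<forall>b'. set b' \<subseteq> univ MM --> wtp_eq L MM b' b k --> \<not> wtp_eq L MM b' b \<A> -->
    (\<exists>Z\<subseteq>set b'. set b' \<subseteq> m (\<A> Un Z) \<and> card Z < card Y)"
    using isolating_set[OF mA cA b Y(1,2) min] by blast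
   have "\<mu> b' < \<mu> b" if h: "set b' \<subseteq> univ MM" "wtp_eq L MM b' b k" "\<not> wtp_eq L MM b' b \<A>" for b'
   proof -
    obtain Z where Z: "Z \<subseteq> set b'" "set b' \<subseteq> m (\<A> Un Z)" "card Z < card Y" using k(3)[rule_format, OF h] by blast
    have "sp b' (card Z)" unfolding sp_def using Z(1,2) by blast
    from \<mu>le[OF this] show ?thesis using Z(3) Y(3) by simp
   qed
   then show ?thesis using k(1,2) by blast
  qed
  define k where "k b = (SOME k. k \<subseteq> \<A> \<and> finite k \<and>
   (\<forall>b'. set b' \<subseteq> univ MM --> wtp_eq L MM b' b k --> \<not> wtp_eq L MM b' b \<A> --> \<mu> b' < \<mu> b))" for b
  have k: "k b \<subseteq> \<A> \<and> finite (k b) \<and>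
   (\<forall>b'. set b' \<subseteq> univ MM --> wtp_eq L MM b' b (k b) --> \<not> wtp_eq L MM b' b \<A> --> \<mu> b' < \<mu> b)" if "set b \<subseteq> univ MM" for b
   unfolding k_def by (rule someI_ex) (rule ex[OF that])
  \<comment> \<open>Player II adds to the set just played an isolating set of the tuple just played;
    earlier moves do not matter.\<close>
  define \<sigma> where "\<sigma> ms = k (fst (last ms)) Un snd (last ms)" for ms :: "('a list \<times> 'a set) list"
  have inv: "set b \<subseteq> univ MM \<and> finite B \<and> B \<subseteq> \<A> \<and> length b = length a \<and>
   (ms \<noteq> [] --> k b \<subseteq> B \<and> snd (last ms) \<subseteq> B \<and> length ms + \<mu> b \<le> Suc (length a))"
   if "gi_play L MM \<A> \<sigma> a A ms b B" for ms b B
   using that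
  proof (induction rule: gi_play.induct)
   case start
   then show ?case using a A by simp
  next
   case (move ms b B b' B')
   have IH: "set b \<subseteq> univ MM" "length b = length a"
    "ms \<noteq> [] ==> k b \<subseteq> B \<and> snd (last ms) \<subseteq> B \<and> length ms + \<mu> b \<le> Suc (length a)" using move.IH by simp_all
   have l: "set b' \<subseteq> univ MM" "finite B'" "B' \<subseteq> \<A>" "wtp_eq L MM b' b B" "\<not> wtp_eq L MM b' b B'"
    using move.hyps(2) by (simp_all add: gi_legal_def)
   have len: "length b' = length a" using wtp_len[OF l(4)] IH(2) by simp
   have \<sigma>: "\<sigma> (ms @ [(b', B')]) = k b' Un B'" by (simp add: \<sigma>_def)
   have k': "k b' \<subseteq> \<A>" "finite (k b')" using k[OF l(1)] by simp_all
   have "length (ms @ [(b', B')]) + \<mu> b' \<le> Suc (length a)"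
   proof (cases "ms = []")
    case True
    have "\<mu> b' \<le> card (set b')" by (rule \<mu>le[OF sp0[OF l(1)]])
    also have "\<dots> \<le> length a" using card_length[of b'] len by simp
    finally show ?thesis using True by simp
   next
    case False
    have "wtp_eq L MM b' b (k b)" using wtp_mono[OF l(4)] IH(3)[OF False] by blast
    moreover have "\<not> wtp_eq L MM b' b \<A>" using wtp_mono[of b' b \<A> B'] l(3,5) by blast
    ultimately have "\<mu> b' < \<mu> b" using k[OF IH(1)] l(1) by blast
    then show ?thesis using IH(3)[OF False] by simp
   qed
   then show ?case unfolding \<sigma> using l(1-3) len k' by simp
  qed
  have "gi_winning L MM \<A> a A (Suc (length a)) \<sigma>"
   unfolding gi_winning_def
  proof (intro allI impI)
   fix ms b B assume "gi_play L MM \<A> \<sigma> a A ms b B"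
   from inv[OF this] show "length ms \<le> Suc (length a) \<and> (ms \<noteq> [] --> finite B \<and> B \<subseteq> \<A> \<and> snd (last ms) \<subseteq> B)"
    by (cases "ms = []") auto
  qed
  then show "\<exists>\<sigma>. gi_winning L MM \<A> a A (Suc (length a)) \<sigma>" by blast
 qed
qed

end

text \<open>Uncountability of \<open>'a\<close> enters in finding a member with carrier in
  \<open>'a\<close>, and in counting a basis of a largest member, which leaves room for joint
  embedding, amalgamation and monster models. The axioms are then verified in any monster model,
  which \<open>monster_card\<close> shows to be large enough.\<close>

theorem lemma2p87:
  fixes L :: "('f, 'r) lang"
    and M :: "('f, 'r, 'm) struct"
    and cl :: "'m set \<Rightarrow> 'm set"
  assumes "countable_lang L"
    and "qm_structure L M cl"
    and "uncountable (UNIV :: 'a set)"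
  shows "FUR_class L (qm_class L M cl :: ('f, 'r, 'a) struct set) (qm_le L M cl)"
proof -
  interpret qmK L M cl "TYPE('a)"
    by unfold_locales (use assms in simp_all)
  have inf: "\<forall>A\<in>KK. infinite (univ A)"
  proof
    fix A assume "A \<in> KK"
    then obtain c where "KI (A, c)" using KK_iff by blast
    then show "infinite (univ A)" using KI_infinite[of "(A, c)"] by simp
  qed
  have ax: "AI L le \<delta> MM \<and> AII L le \<delta> MM \<and> AIII L le \<delta> MM \<and> AIV L le \<delta> MM \<and> AV L le \<delta> MM \<and> AVI L le \<delta> MM"
    if \<delta>: "Card_order \<delta>" "natLeq <o \<delta>" and MM: "monster L KK le \<delta> MM" for \<delta> :: "'a rel" and MM
  proof -
    obtain m where m: "KI (MM, m)" "\<delta> \<le>o |univ MM|" using monster_card[OF \<delta>(1) MM] by blast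
    interpret monK L M cl "TYPE('a)" MM m \<delta>
      by unfold_locales (rule m \<delta>)+
    show ?thesis using AI_MM AII_MM AIII_MM AIV_MM AV_MM AVI_MM by simp
  qed
  show ?thesis
    unfolding FUR_class_def
  proof (intro conjI allI impI)
    show "\<exists>MM. monster L KK le \<delta> MM" if "Card_order \<delta> \<and> natLeq <o \<delta>" for \<delta> :: "'a rel"
      using monster_ex[of \<delta>] that by blast
  qed (use aec LS AP JEP large inf ax in \<open>simp_all\<close>)
qed

end
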